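(* In the single-sample semiparametric density model described in the context, suppose Assumptions 1 to 8 (written out in the context) hold, and let $(\hat\theta,\hat h)$ be the penalized likelihood estimator. Then, as $n\to\infty$, $\lambda\to0$ and $n\lambda^{1/r}\to\infty$, $$\|\hat\theta-\theta_0\|_{l^2}\sim\|\hat\theta-\theta_0\|_{\mathbb R^p}=V_{\tau_0}^{1/2}\big[L_\theta(\hat\theta-\theta_0)\big]=O_p\big(n^{-1/2}\lambda^{-1/(2r)}+\lambda^{1/2}\big),$$ where $\|\cdot\|_{l^2}$ is the Euclidean norm, $\|\zeta\|_{\mathbb R^p}=V_{\tau_0}(L_\theta\zeta)^{1/2}$, and $A\sim B$ means $c_1A\le B\le c_2A$ for some positive constants $c_1,c_2$.
   Context: Setting. $p\ge1$; $\mathcal X$ is a sample space (integrals are with respect to a reference measure $dx$); $\mathcal H$ is a real Hilbert space of functions with norm $\|\cdot\|$; $\mathcal Q=\mathbb R^p\times\mathcal H$. Write $\tau=(\theta,h)\in\mathcal Q$. $\eta:\mathcal Q\to L^2_0(\mathcal X)$ is a known map, with values written $\eta(x;\tau)=\eta(x;\theta,h)$, and $f_\tau(x)=e^{\eta(x;\tau)}/\int_{\mathcal X}e^{\eta(t;\tau)}dt$. The true parameter is $\tau_0=(\theta_0,h_0)$; $L^2_{\tau_0}(\mathcal X)$ is the space of functions with finite second moment under $f_{\tau_0}$ and $L^2_0(\mathcal X)=L^2_{\tau_0}(\mathcal X)\ominus\{1\}$ (constants removed). $X_1,\dots,X_n$ are iid from $f_{\tau_0}$; $\lambda>0$ is a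 smoothing parameter. $D_\theta,D_h$ are Fréchet partial derivatives. Put $\mu_\tau(\varphi)=\int\varphi f_\tau$, $V_\tau(\varphi_1,\varphi_2)=\mu_\tau(\varphi_1\varphi_2)-\mu_\tau(\varphi_1)\mu_\tau(\varphi_2)$, $V_\tau(\varphi)=V_\tau(\varphi,\varphi)$. $O_p$ statements are along arbitrary deterministic sequences $\lambda=\lambda_n$ with the stated limits. Criteria. $\mathfrak L_n(\theta,h)=-\frac1n\sum_{i=1}^n\eta(X_i;\theta,h)+\log\int_{\mathcal X}e^{\eta(x;\theta,h)}dx$ and $\mathfrak L_{n,\lambda}=\mathfrak L_n+\frac\lambda2J(h)$. It is assumed that $\mathfrak L_n$ is convex and that $\mathfrak L_{n,\lambda}$ has a unique local minimum $\hat\tau=(\hat\theta,\hat h)$ in $\mathcal N_{\theta_0}\times\mathcal N_{h_0}$, which is the unique solution there of $D_\theta\mathfrak L_{n,\lambda}=0$, $D_h\mathfrak L_{n,\lambda}=0$. It is also assumed that the minimizer $\tilde\tau$ of the quadratic criterion $$\tilde{\mathfrak L}_{n,\lambda}(\theta,h)=-\tfrac1n\sum_{i}[D_\theta\eta(X_i;\tau_0)\theta+D_h\eta(X_i;\tau_0)h]+\mu_{\tau_0}[D_\theta\eta(\tau_0)\theta+D_h\eta(\tau_0)h]+\tfrac12V_{\tau_0}[D_\theta\eta(\tau_0)(\theta-\theta_0)+D_h\eta(\tau_0)(h-h_0)]+\tfrac\lambda2J(h)$$ lies in $\mathcal N_{\theta_0}\times\mathcal N_{h_0}$. Assumption 1.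 $J$ is a square seminorm on $\mathcal H$ with finite-dimensional null space and semi-inner product $J(\cdot,\cdot)$; $J(h_0)<\infty$. Assumption 2. There are bounded linear operators $L_\theta:\mathbb R^p\to L^2_0(\mathcal X)$, $L_h:\mathcal H\to L^2_0(\mathcal X)$ with zero null spaces such that (i) there are positive constants $M_1,M_2$ (possibly depending on $\lambda$) with $M_1\|g\|^2\le V_{\tau_0}(L_hg)+\lambda J(g)\le M_2\|g\|^2$ for all $g\in\mathcal H$; (ii) there is $c_\delta>0$ with $V_{\tau_0}(L_\theta\zeta-L_hg)>c_\delta$ for all $\zeta\in\mathbb R^p$ with $\|\zeta\|_{l^2}=1$ and all $g\in\mathcal H$. There are neighborhoods $\mathcal N_{\theta_0}\subset\mathbb R^p$ of $\theta_0$ and $\mathcal N_{h_0}\subset\mathcal H$ of $h_0$ for which Assumptions 3–6 hold. Assumption 3. $\eta$ is one-to-one and three times continuously Fréchet differentiable on $\mathcal N_{\theta_0}\times\mathcal N_{h_0}$, and $\tau_0$ is the unique root there of $E[D_\theta\mathfrak L_n(\theta,h)]=0$, $E[D_h\mathfrak L_n(\theta,h)]=0$. Assumption 4. For all $(\theta_*,h_* )\in\mathcal N_{\theta_0}\times\mathcal N_{h_0}$, $D_\theta\eta(\theta_*,h_* ):\mathbb R^p\to L_0^2(\mathcal X)$ and $D_h\eta(\theta_*,h_* ):\mathcal H\to L_0^2(\mathcal X)$ are bounded linear, and there are constants $C_1,C_2>0$ with $C_1V_{\tau_0}(L_\theta\zeta+L_hg)\le V_{\tau_0}(D_\theta\eta(\theta_*,h_*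 )\zeta+D_h\eta(\theta_*,h_* )g)\le C_2V_{\tau_0}(L_\theta\zeta+L_hg)$ for all $(\zeta,g)\in\mathcal Q$. Assumption 5. There is a positive constant $C_d<2C_1$ such that for all $(\theta_1,h_1),(\theta_2,h_2)$ and $(\zeta,g)$ in $\mathcal N_{\theta_0}\times\mathcal N_{h_0}$, $V_{\tau_0}[(D_\theta\eta(\theta_1,h_1)-D_\theta\eta(\theta_2,h_2))\zeta+(D_h\eta(\theta_1,h_1)-D_h\eta(\theta_2,h_2))g]\le C_dV_{\tau_0}(L_\theta\zeta+L_hg)$. Assumption 6. $\mathcal N_{\theta_0}\times\mathcal N_{h_0}$ is convex and contains $\hat\tau$, and there are $C_3,C_4>0$ with $C_3V_{\tau_0}(f)\le V_\tau(f)\le C_4V_{\tau_0}(f)$ for all $\tau\in\mathcal N_{\theta_0}\times\mathcal N_{h_0}$ and $f\in L_0^2(\mathcal X)$. Assumption 7. The quadratic functional $g\mapsto V_{\tau_0}(L_hg)$ is completely continuous with respect to $J$ (for every $\epsilon>0$ there are finitely many continuous linear functionals $\ell_1,\dots,\ell_k$ such that $\ell_1(g)=\dots=\ell_k(g)=0$ implies $V_{\tau_0}(L_hg)\le\epsilon J(g)$). This yields eigenfunctions $\phi_\nu$ and eigenvalues $0\le\rho_\nu\to\infty$, $\nu=1,2,\dots$, with $V_{\tau_0}(L_h\phi_\nu,L_h\phi_\mu)=\delta_{\nu\mu}$, $J(\phi_\nu,\phi_\mu)=\rho_\nu\delta_{\nu\mu}$. Assumption 8. $\rho_\nu=\kappa_\nu\nu^r$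 with $r>1$ and $\kappa_\nu\in(\beta_1,\beta_2)\subset(0,\infty)$. *)

theory Defs
  imports "HOL-Probability.Probability"
begin

text \<open>
  \<open>M\<close> is the reference measure and \<open>\<eta> \<tau>\<close> a chosen representative of the L2 class attached to
  the parameter \<open>\<tau>\<close>.
\<close>

definition dens :: "'x measure \<Rightarrow> ('q \<Rightarrow> 'x \<Rightarrow> real) \<Rightarrow> 'q \<Rightarrow> 'x \<Rightarrow> real" where
  "dens M \<eta> \<tau> x = exp (\<eta> \<tau> x) / (\<integral>t. exp (\<eta> \<tau> t) \<partial>M)"

definition mean :: "'x measure \<Rightarrow> ('q \<Rightarrow> 'x \<Rightarrow> real) \<Rightarrow> 'q \<Rightarrow> ('x \<Rightarrow> real) \<Rightarrow> real" where
  "mean M \<eta> \<tau> \<phi> = (\<integral>x. \<phi> x * dens M \<eta> \<tau> x \<partial>M)"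

definition Cov ::
  "'x measure \<Rightarrow> ('q \<Rightarrow> 'x \<Rightarrow> real) \<Rightarrow> 'q \<Rightarrow> ('x \<Rightarrow> real) \<Rightarrow> ('x \<Rightarrow> real) \<Rightarrow> real" where
  "Cov M \<eta> \<tau> \<phi> \<psi> = mean M \<eta> \<tau> (\<lambda>x. \<phi> x * \<psi> x) - mean M \<eta> \<tau> \<phi> * mean M \<eta> \<tau> \<psi>"

definition Var :: "'x measure \<Rightarrow> ('q \<Rightarrow> 'x \<Rightarrow> real) \<Rightarrow> 'q \<Rightarrow> ('x \<Rightarrow> real) \<Rightarrow> real" where
  "Var M \<eta> \<tau> \<phi> = Cov M \<eta> \<tau> \<phi> \<phi>"

definition L2_space :: "'x measure \<Rightarrow> ('q \<Rightarrow> 'x \<Rightarrow> real) \<Rightarrow> 'q \<Rightarrow> ('x \<Rightarrow> real) set" where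
  "L2_space M \<eta> \<tau> =
     {\<phi> \<in> borel_measurable M. integrable M (\<lambda>x. (\<phi> x)\<^sup>2 * dens M \<eta> \<tau> x)}"

definition L20_space :: "'x measure \<Rightarrow> ('q \<Rightarrow> 'x \<Rightarrow> real) \<Rightarrow> 'q \<Rightarrow> ('x \<Rightarrow> real) set" where
  "L20_space M \<eta> \<tau> = {\<phi> \<in> L2_space M \<eta> \<tau>. mean M \<eta> \<tau> \<phi> = 0}"

definition L2_norm :: "'x measure \<Rightarrow> ('q \<Rightarrow> 'x \<Rightarrow> real) \<Rightarrow> 'q \<Rightarrow> ('x \<Rightarrow> real) \<Rightarrow> real" where
  "L2_norm M \<eta> \<tau> \<phi> = sqrt (mean M \<eta> \<tau> (\<lambda>x. (\<phi> x)\<^sup>2))"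

text \<open>
  Elements of the L2 space are functions up to almost everywhere equality, and the measure is not
  part of a type, so the space is not a type of class \<open>real_normed_vector\<close>.  Linearity and
  Frechet differentiability of maps into it are therefore stated for representatives, with
  equality almost everywhere and with the L2 seminorm.
\<close>

definition L20_bounded_linear ::
  "'x measure \<Rightarrow> ('q \<Rightarrow> 'x \<Rightarrow> real) \<Rightarrow> 'q \<Rightarrow> ('a::real_normed_vector \<Rightarrow> 'x \<Rightarrow> real) \<Rightarrow> bool" where
  "L20_bounded_linear M \<eta> \<tau>\<^sub>0 T \<longleftrightarrow>
     (\<forall>u. T u \<in> L20_space M \<eta> \<tau>\<^sub>0) \<and>
     (\<forall>u v. AE x in M. T (u + v) x = T u x + T v x) \<and>
     (\<forall>c u. AE x in M. T (c *\<^sub>R u) x = c * T u x) \<and>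
     (\<exists>K. \<forall>u. L2_norm M \<eta> \<tau>\<^sub>0 (T u) \<le> K * norm u)"

definition L20_bounded_bilinear ::
  "'x measure \<Rightarrow> ('q \<Rightarrow> 'x \<Rightarrow> real) \<Rightarrow> 'q \<Rightarrow>
    ('a::real_normed_vector \<Rightarrow> 'a \<Rightarrow> 'x \<Rightarrow> real) \<Rightarrow> bool" where
  "L20_bounded_bilinear M \<eta> \<tau>\<^sub>0 T \<longleftrightarrow>
     (\<forall>a. L20_bounded_linear M \<eta> \<tau>\<^sub>0 (\<lambda>u. T u a)) \<and>
     (\<forall>a. L20_bounded_linear M \<eta> \<tau>\<^sub>0 (\<lambda>u. T a u)) \<and>
     (\<exists>K. \<forall>a b. L2_norm M \<eta> \<tau>\<^sub>0 (T a b) \<le> K * norm a * norm b)"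

definition L20_bounded_trilinear ::
  "'x measure \<Rightarrow> ('q \<Rightarrow> 'x \<Rightarrow> real) \<Rightarrow> 'q \<Rightarrow>
    ('a::real_normed_vector \<Rightarrow> 'a \<Rightarrow> 'a \<Rightarrow> 'x \<Rightarrow> real) \<Rightarrow> bool" where
  "L20_bounded_trilinear M \<eta> \<tau>\<^sub>0 T \<longleftrightarrow>
     (\<forall>a b. L20_bounded_linear M \<eta> \<tau>\<^sub>0 (\<lambda>u. T u a b)) \<and>
     (\<forall>a b. L20_bounded_linear M \<eta> \<tau>\<^sub>0 (\<lambda>u. T a u b)) \<and>
     (\<forall>a b. L20_bounded_linear M \<eta> \<tau>\<^sub>0 (\<lambda>u. T a b u)) \<and>
     (\<exists>K. \<forall>a b c. L2_norm M \<eta> \<tau>\<^sub>0 (T a b c) \<le> K * norm a * norm b * norm c)"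

text \<open>
  \<open>\<eta>\<close> is three times continuously Frechet differentiable on the open set \<open>S\<close> as a map into the L2
  space: \<open>D1\<close>, \<open>D2\<close>, \<open>D3\<close> are its successive derivatives, the k-th one being a k-linear map, and
  the remainders are small in the operator norm of k-linear maps.
\<close>

definition L20_C3_on ::
  "'x measure \<Rightarrow> ('q::real_normed_vector \<Rightarrow> 'x \<Rightarrow> real) \<Rightarrow> 'q \<Rightarrow> 'q set \<Rightarrow> bool" where
  "L20_C3_on M \<eta> \<tau>\<^sub>0 S \<longleftrightarrow>
    (\<exists>D1 D2 D3. \<forall>\<tau>\<in>S.
       L20_bounded_linear M \<eta> \<tau>\<^sub>0 (D1 \<tau>) \<and>
       L20_bounded_bilinear M \<eta> \<tau>\<^sub>0 (D2 \<tau>) \<and>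
       L20_bounded_trilinear M \<eta> \<tau>\<^sub>0 (D3 \<tau>) \<and>
       (\<forall>\<epsilon>>0. \<forall>\<^sub>F k in nhds 0.
          L2_norm M \<eta> \<tau>\<^sub>0 (\<lambda>x. \<eta> (\<tau> + k) x - \<eta> \<tau> x - D1 \<tau> k x) \<le> \<epsilon> * norm k) \<and>
       (\<forall>\<epsilon>>0. \<forall>\<^sub>F k in nhds 0. \<forall>a.
          L2_norm M \<eta> \<tau>\<^sub>0 (\<lambda>x. D1 (\<tau> + k) a x - D1 \<tau> a x - D2 \<tau> k a x)
            \<le> \<epsilon> * norm k * norm a) \<and>
       (\<forall>\<epsilon>>0. \<forall>\<^sub>F k in nhds 0. \<forall>a b.
          L2_norm M \<eta> \<tau>\<^sub>0 (\<lambda>x. D2 (\<tau> + k) a b x - D2 \<tau> a b x - D3 \<tau> k a b x)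
            \<le> \<epsilon> * norm k * norm a * norm b) \<and>
       (\<forall>\<epsilon>>0. \<forall>\<^sub>F k in nhds 0. \<forall>a b c.
          L2_norm M \<eta> \<tau>\<^sub>0 (\<lambda>x. D3 (\<tau> + k) a b c x - D3 \<tau> a b c x)
            \<le> \<epsilon> * norm a * norm b * norm c))"

definition D_fst ::
  "('a::real_normed_vector \<times> 'b::real_normed_vector \<Rightarrow> real) \<Rightarrow> 'a \<times> 'b \<Rightarrow> 'a \<Rightarrow> real" where
  "D_fst F \<tau> = frechet_derivative (\<lambda>\<theta>. F (\<theta>, snd \<tau>)) (at (fst \<tau>))"

definition D_snd ::
  "('a::real_normed_vector \<times> 'b::real_normed_vector \<Rightarrow> real) \<Rightarrow> 'a \<times> 'b \<Rightarrow> 'b \<Rightarrow> real" where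
  "D_snd F \<tau> = frechet_derivative (\<lambda>h. F (fst \<tau>, h)) (at (snd \<tau>))"

text \<open>
  \<open>D_theta \<eta> \<tau> \<zeta> x\<close> and \<open>D_h \<eta> \<tau> g x\<close> are the partial derivatives of \<open>\<tau> \<mapsto> \<eta>(x;\<tau>)\<close> at a fixed
  point \<open>x\<close>, as needed for the values at the observations.  Where both exist, they are
  representatives of the partial derivatives of \<open>\<eta>\<close> as a map into the L2 space.
\<close>

definition D_theta ::
  "('a::real_normed_vector \<times> 'b::real_normed_vector \<Rightarrow> 'x \<Rightarrow> real) \<Rightarrow> 'a \<times> 'b \<Rightarrow> 'a \<Rightarrow> 'x \<Rightarrow> real" where
  "D_theta \<eta> \<tau> \<zeta> x = D_fst (\<lambda>\<sigma>. \<eta> \<sigma> x) \<tau> \<zeta>"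

definition D_h ::
  "('a::real_normed_vector \<times> 'b::real_normed_vector \<Rightarrow> 'x \<Rightarrow> real) \<Rightarrow> 'a \<times> 'b \<Rightarrow> 'b \<Rightarrow> 'x \<Rightarrow> real" where
  "D_h \<eta> \<tau> g x = D_snd (\<lambda>\<sigma>. \<eta> \<sigma> x) \<tau> g"

definition D_tot ::
  "('a::real_normed_vector \<times> 'b::real_normed_vector \<Rightarrow> 'x \<Rightarrow> real) \<Rightarrow> 'a \<times> 'b \<Rightarrow> 'a \<times> 'b \<Rightarrow> 'x \<Rightarrow> real" where
  "D_tot \<eta> \<tau> u x = D_theta \<eta> \<tau> (fst u) x + D_h \<eta> \<tau> (snd u) x"

text \<open>The observations are \<open>xs 0, \<dots>, xs (n - 1)\<close>.\<close>

definition crit ::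
  "'x measure \<Rightarrow> ('q \<Rightarrow> 'x \<Rightarrow> real) \<Rightarrow> nat \<Rightarrow> (nat \<Rightarrow> 'x) \<Rightarrow> 'q \<Rightarrow> real" where
  "crit M \<eta> n xs \<tau> = - (\<Sum>i<n. \<eta> \<tau> (xs i)) / real n + ln (\<integral>x. exp (\<eta> \<tau> x) \<partial>M)"

definition pen_crit ::
  "'x measure \<Rightarrow> ('a \<times> 'b \<Rightarrow> 'x \<Rightarrow> real) \<Rightarrow> ('b \<Rightarrow> 'b \<Rightarrow> real) \<Rightarrow> real \<Rightarrow> nat \<Rightarrow>
    (nat \<Rightarrow> 'x) \<Rightarrow> 'a \<times> 'b \<Rightarrow> real" where
  "pen_crit M \<eta> J lam n xs \<tau> = crit M \<eta> n xs \<tau> + lam / 2 * J (snd \<tau>) (snd \<tau>)"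

definition quad_crit ::
  "'x measure \<Rightarrow> ('a::real_normed_vector \<times> 'b::real_normed_vector \<Rightarrow> 'x \<Rightarrow> real) \<Rightarrow> 'a \<times> 'b \<Rightarrow>
    ('b \<Rightarrow> 'b \<Rightarrow> real) \<Rightarrow> real \<Rightarrow> nat \<Rightarrow> (nat \<Rightarrow> 'x) \<Rightarrow> 'a \<times> 'b \<Rightarrow> real" where
  "quad_crit M \<eta> \<tau>\<^sub>0 J lam n xs \<tau> =
     - (\<Sum>i<n. D_tot \<eta> \<tau>\<^sub>0 \<tau> (xs i)) / real n
     + mean M \<eta> \<tau>\<^sub>0 (D_tot \<eta> \<tau>\<^sub>0 \<tau>)
     + 1 / 2 * Var M \<eta> \<tau>\<^sub>0 (D_tot \<eta> \<tau>\<^sub>0 (\<tau> - \<tau>\<^sub>0))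
     + lam / 2 * J (snd \<tau>) (snd \<tau>)"

definition local_min :: "('a::topological_space \<Rightarrow> real) \<Rightarrow> 'a \<Rightarrow> bool" where
  "local_min F \<tau> \<longleftrightarrow> (\<forall>\<^sub>F \<sigma> in nhds \<tau>. F \<tau> \<le> F \<sigma>)"

text \<open>
  \<open>has_derivative\<close> rather than \<open>frechet_derivative\<close>, so that stationarity includes
  differentiability.
\<close>

definition stationary ::
  "('a::real_normed_vector \<times> 'b::real_normed_vector \<Rightarrow> real) \<Rightarrow> 'a \<times> 'b \<Rightarrow> bool" where
  "stationary F \<tau> \<longleftrightarrow>
     ((\<lambda>\<theta>. F (\<theta>, snd \<tau>)) has_derivative (\<lambda>_. 0)) (at (fst \<tau>)) \<and>
     ((\<lambda>h. F (fst \<tau>, h)) has_derivative (\<lambda>_. 0)) (at (snd \<tau>))"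

definition unique_local_min ::
  "('a::real_normed_vector \<times> 'b::real_normed_vector \<Rightarrow> real) \<Rightarrow> ('a \<times> 'b) set \<Rightarrow> 'a \<times> 'b \<Rightarrow> bool" where
  "unique_local_min F S \<tau> \<longleftrightarrow>
     \<tau> \<in> S \<and> (\<forall>\<sigma>\<in>S. local_min F \<sigma> \<longleftrightarrow> \<sigma> = \<tau>) \<and> (\<forall>\<sigma>\<in>S. stationary F \<sigma> \<longleftrightarrow> \<sigma> = \<tau>)"

definition norm_Rp ::
  "'x measure \<Rightarrow> ('q \<Rightarrow> 'x \<Rightarrow> real) \<Rightarrow> 'q \<Rightarrow> ('a \<Rightarrow> 'x \<Rightarrow> real) \<Rightarrow> 'a \<Rightarrow> real" where
  "norm_Rp M \<eta> \<tau>\<^sub>0 L\<^sub>\<theta> \<zeta> = sqrt (Var M \<eta> \<tau>\<^sub>0 (L\<^sub>\<theta> \<zeta>))"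

text \<open>
  Both notions ask for a measurable event of large probability on which the property holds.  For
  measurable properties this is the usual definition; for others it is the one by outer
  probability (whereas \<open>measure\<close> of a non-measurable set would be 0), so no measurability of the
  estimators has to be assumed.
\<close>

definition whp :: "'w measure \<Rightarrow> (nat \<Rightarrow> 'w \<Rightarrow> bool) \<Rightarrow> bool" where
  "whp P E \<longleftrightarrow>
     (\<forall>\<epsilon>>0. \<forall>\<^sub>F n in sequentially. \<exists>A\<in>sets P. measure P A \<ge> 1 - \<epsilon> \<and> (\<forall>\<omega>\<in>A. E n \<omega>))"

definition big_Op :: "'w measure \<Rightarrow> (nat \<Rightarrow> 'w \<Rightarrow> real) \<Rightarrow> (nat \<Rightarrow> real) \<Rightarrow> bool" where
  "big_Op P Y a \<longleftrightarrow>
     (\<forall>\<epsilon>>0. \<exists>K. \<forall>\<^sub>F n in sequentially.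
        \<exists>A\<in>sets P. measure P A \<ge> 1 - \<epsilon> \<and> (\<forall>\<omega>\<in>A. \<bar>Y n \<omega>\<bar> \<le> K * a n))"

end

theory Submission
  imports Defs
begin

text \<open>The penalized criterion is convex, so it suffices to show that with high probability it exceeds
  its value at \<open>\<tau>\<^sub>0\<close> everywhere on an ellipsoid around \<open>\<tau>\<^sub>0\<close> of squared radius
  \<open>K\<^sup>2 * (\<lambda> powr (- 1 / r) / n + \<lambda>)\<close> in the norm given by \<open>V (L\<^sub>\<theta> \<zeta> + L\<^sub>h g) + \<lambda> * J g\<close>.

  In the population, Assumption 6 bounds the density ratios, and then log-concavity bounds the
  Kullback-Leibler loss from below by a multiple of the variance of the displacement.

  For the sample, a displacement is rounded to one of \<open>exp (C * \<lambda> powr (- 1 / r))\<close> net points. The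
  log-likelihood ratio lies below its tangent at the net point by concavity, and the resulting linear
  process is controlled by a PAC-Bayes argument, in which the rounding error is the mean of tilted
  random signs and clipping makes the exponential moments finite. Fatou's lemma passes from finitely
  many eigendirections to the Hilbert space.\<close>

subsection \<open>Tilted random signs\<close>

text \<open>The obstacle is integrability: scores are only square integrable under the true density,
  with no sup-norm or exponential moment bound on the eigenfunctions, so no Bernstein-type
  inequality applies to the linearized criterion. But only an upper bound on the empirical
  log-likelihood ratio is wanted, and that ratio is bounded above near
  \<open>\<tau>\<^sub>0\<close>; hence a tangent may be replaced by its minimum with a constant
  \<open>B\<close>, and large positive scores do no harm. Truncation destroys the linearity that
  makes a supremum over a Hilbert ball tractable. Random signs restore it: a uniform prior on signs
  is tilted into a posterior with the prescribed mean \<open>q\<close>, at entropy cost at most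
  \<open>\<Sum> q\<^sup>2\<close>. Two counts must both be of order
  \<open>\<lambda> powr (- 1 / r)\<close>: the log-cardinality of the net, that is, the number of
  eigendirections resolved by it, and the variance added by the randomization, governed by the
  effective dimension \<open>\<Sum> 1 / (1 + \<lambda> * \<rho> \<nu>)\<close>. Divided by
  \<open>n\<close> they give the variance term of the rate; the bias term comes from the penalty at
  \<open>h\<^sub>0\<close>.\<close>

definition signs :: "'i set \<Rightarrow> ('i \<Rightarrow> real) set" where
  "signs I = PiE I (\<lambda>_. {-1, 1})"

text \<open>The law of independent signs with means \<open>q i\<close>: the value \<open>e\<close>
  has probability \<open>(1 + e * q i) / 2\<close> when \<open>e\<close> is 1 or -1. The uniform law
  is the case \<open>q = 0\<close>.\<close>

definition tilt :: "'i set \<Rightarrow> ('i \<Rightarrow> real) \<Rightarrow> ('i \<Rightarrow> real) \<Rightarrow> real" where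
  "tilt I q \<epsilon> = (\<Prod>i\<in>I. (1 + \<epsilon> i * q i) / 2)"

lemma card_signs: "finite I \<Longrightarrow> card (signs I) = 2 ^ card I"
  by (simp add: signs_def card_PiE numeral_2_eq_2)

text \<open>Independence under the tilted law. The first and second moments below come from it by
  inserting factors that are 1 off one or two coordinates.\<close>

lemma sum_tilt_prod:
  assumes "finite I"
  shows "(\<Sum>\<epsilon>\<in>signs I. tilt I q \<epsilon> * (\<Prod>i\<in>I. g i (\<epsilon> i)))
       = (\<Prod>i\<in>I. ((1 - q i) * g i (-1) + (1 + q i) * g i 1) / 2)"
proof -
  have "(\<Prod>i\<in>I. ((1 - q i) * g i (-1) + (1 + q i) * g i 1) / 2)
      = (\<Prod>i\<in>I. \<Sum>e\<in>{-1, 1}. (1 + e * q i) / 2 * g i e)"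
    by (intro prod.cong) (auto simp: field_simps)
  also have "\<dots> = (\<Sum>\<epsilon>\<in>signs I. \<Prod>i\<in>I. (1 + \<epsilon> i * q i) / 2 * g i (\<epsilon> i))"
    unfolding signs_def by (rule prod_sum_PiE) (use assms in auto)
  also have "\<dots> = (\<Sum>\<epsilon>\<in>signs I. tilt I q \<epsilon> * (\<Prod>i\<in>I. g i (\<epsilon> i)))"
    unfolding tilt_def by (intro sum.cong refl) (rule prod.distrib)
  finally show ?thesis by (rule sym)
qed

lemma sum_tilt: "finite I \<Longrightarrow> (\<Sum>\<epsilon>\<in>signs I. tilt I q \<epsilon>) = 1"
  using sum_tilt_prod[of I q "\<lambda>_ _. 1"] by simp

lemma tilt_mean:
  assumes "finite I" "j \<in> I"
  shows "(\<Sum>\<epsilon>\<in>signs I. tilt I q \<epsilon> * \<epsilon> j) = q j"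
proof -
  have "(\<Sum>\<epsilon>\<in>signs I. tilt I q \<epsilon> * \<epsilon> j)
      = (\<Sum>\<epsilon>\<in>signs I. tilt I q \<epsilon> * (\<Prod>i\<in>I. if i = j then \<epsilon> i else 1))"
    using assms by (simp add: prod.delta)
  also have "\<dots> = (\<Prod>i\<in>I. ((1 - q i) * (if i = j then -1 else 1) + (1 + q i) * (if i = j then 1 else 1)) / 2)"
    by (rule sum_tilt_prod[OF assms(1), of q "\<lambda>i e. if i = j then e else 1"])
  also have "\<dots> = (\<Prod>i\<in>I. if i = j then q i else 1)"
    by (intro prod.cong) (auto simp: field_simps)
  finally show ?thesis using assms by (simp add: prod.delta)
qed

lemma tilt_cov:
  assumes "finite I" "j \<in> I" "k \<in> I"
  shows "(\<Sum>\<epsilon>\<in>signs I. tilt I q \<epsilon> * (\<epsilon> j * \<epsilon> k)) = (if j = k then 1 else q j * q k)"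
proof (cases "j = k")
  case True
  have "\<epsilon> j * \<epsilon> j = 1" if "\<epsilon> \<in> signs I" for \<epsilon>
    using that assms unfolding signs_def by (auto simp: PiE_iff dest!: bspec[of I _ j])
  then have "(\<Sum>\<epsilon>\<in>signs I. tilt I q \<epsilon> * (\<epsilon> j * \<epsilon> k)) = (\<Sum>\<epsilon>\<in>signs I. tilt I q \<epsilon>)"
    using True by (intro sum.cong) auto
  then show ?thesis using True sum_tilt[OF assms(1)] by simp
next
  case False
  \<comment> \<open>Evaluates a product with two distinguished factors; it serves both the integrand
    and the outcome of \<open>sum_tilt_prod\<close>.\<close>
  have d: "(\<Prod>i\<in>I. if i = j then f i else if i = k then f i else 1) = f j * f k" for f :: "_ \<Rightarrow> real"
  proof -
    have "(\<Prod>i\<in>I. if i = j then f i else if i = k then f i else 1)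
       = (\<Prod>i\<in>I. (if i = j then f i else 1) * (if i = k then f i else 1))"
      using False by (intro prod.cong) auto
    then show ?thesis using assms by (simp add: prod.distrib prod.delta)
  qed
  have "(\<Sum>\<epsilon>\<in>signs I. tilt I q \<epsilon> * (\<epsilon> j * \<epsilon> k))
      = (\<Sum>\<epsilon>\<in>signs I. tilt I q \<epsilon> * (\<Prod>i\<in>I. if i = j then \<epsilon> i else if i = k then \<epsilon> i else 1))"
    by (simp add: d)
  also have "\<dots> = (\<Prod>i\<in>I. ((1 - q i) * (if i = j then -1 else if i = k then -1 else 1)
                   + (1 + q i) * (if i = j then 1 else if i = k then 1 else 1)) / 2)"
    by (rule sum_tilt_prod[OF assms(1), of q "\<lambda>i e. if i = j then e else if i = k then e else 1"])
  also have "\<dots> = (\<Prod>i\<in>I. if i = j then q i else if i = k then q i else 1)"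
    by (intro prod.cong) (auto simp: field_simps)
  finally show ?thesis using False by (simp add: d)
qed

lemma tilt_linear:
  assumes "finite I"
  shows "(\<Sum>\<epsilon>\<in>signs I. tilt I q \<epsilon> * (\<Sum>i\<in>I. \<epsilon> i * b i)) = (\<Sum>i\<in>I. q i * b i)"
proof -
  have "(\<Sum>\<epsilon>\<in>signs I. tilt I q \<epsilon> * (\<Sum>i\<in>I. \<epsilon> i * b i))
      = (\<Sum>i\<in>I. (\<Sum>\<epsilon>\<in>signs I. tilt I q \<epsilon> * \<epsilon> i) * b i)"
    unfolding sum_distrib_left sum_distrib_right by (subst sum.swap) (simp add: mult.assoc)
  then show ?thesis using tilt_mean[OF assms] by simp
qed

text \<open>Squared mean plus variance: a sign of mean \<open>q i\<close> has variance
  \<open>1 - (q i)\<^sup>2\<close>, and distinct signs are uncorrelated.\<close>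

lemma tilt_square:
  assumes "finite I"
  shows "(\<Sum>\<epsilon>\<in>signs I. tilt I q \<epsilon> * (\<Sum>i\<in>I. \<epsilon> i * b i)\<^sup>2)
       = (\<Sum>i\<in>I. q i * b i)\<^sup>2 + (\<Sum>i\<in>I. (1 - (q i)\<^sup>2) * (b i)\<^sup>2)"
proof -
  have "(\<Sum>\<epsilon>\<in>signs I. tilt I q \<epsilon> * (\<Sum>i\<in>I. \<epsilon> i * b i)\<^sup>2)
      = (\<Sum>\<epsilon>\<in>signs I. \<Sum>i\<in>I. \<Sum>j\<in>I. tilt I q \<epsilon> * (\<epsilon> i * \<epsilon> j) * (b i * b j))"
    by (simp add: power2_eq_square sum_product sum_distrib_left mult_ac)
  also have "\<dots> = (\<Sum>i\<in>I. \<Sum>j\<in>I. \<Sum>\<epsilon>\<in>signs I. tilt I q \<epsilon> * (\<epsilon> i * \<epsilon> j) * (b i * b j))"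
    by (subst sum.swap, rule sum.cong[OF refl], rule sum.swap)
  also have "\<dots> = (\<Sum>i\<in>I. \<Sum>j\<in>I. (if i = j then 1 else q i * q j) * (b i * b j))"
    by (intro sum.cong refl) (simp add: sum_distrib_right[symmetric] tilt_cov[OF assms])
  also have "\<dots> = (\<Sum>i\<in>I. \<Sum>j\<in>I. q i * b i * (q j * b j) + (if i = j then (1 - (q i)\<^sup>2) * (b i)\<^sup>2 else 0))"
    by (intro sum.cong refl) (auto simp: power2_eq_square algebra_simps)
  also have "\<dots> = (\<Sum>i\<in>I. q i * b i)\<^sup>2 + (\<Sum>i\<in>I. (1 - (q i)\<^sup>2) * (b i)\<^sup>2)"
    using assms by (simp add: sum.distrib power2_eq_square sum_product)
  finally show ?thesis .
qed

lemma tilt_affine_square: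
  assumes "finite I"
  shows "(\<Sum>\<epsilon>\<in>signs I. tilt I q \<epsilon> * (a + (\<Sum>i\<in>I. \<epsilon> i * b i))\<^sup>2)
       = (a + (\<Sum>i\<in>I. q i * b i))\<^sup>2 + (\<Sum>i\<in>I. (1 - (q i)\<^sup>2) * (b i)\<^sup>2)"
proof -
  have "(\<Sum>\<epsilon>\<in>signs I. tilt I q \<epsilon> * (a + (\<Sum>i\<in>I. \<epsilon> i * b i))\<^sup>2)
     = (\<Sum>\<epsilon>\<in>signs I. a\<^sup>2 * tilt I q \<epsilon> + 2 * a * (tilt I q \<epsilon> * (\<Sum>i\<in>I. \<epsilon> i * b i))
           + tilt I q \<epsilon> * (\<Sum>i\<in>I. \<epsilon> i * b i)\<^sup>2)"
    by (intro sum.cong refl) (simp add: power2_sum algebra_simps)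
  also have "\<dots> = a\<^sup>2 + 2 * a * (\<Sum>i\<in>I. q i * b i) +
       ((\<Sum>i\<in>I. q i * b i)\<^sup>2 + (\<Sum>i\<in>I. (1 - (q i)\<^sup>2) * (b i)\<^sup>2))"
    by (simp add: sum.distrib sum_distrib_left[symmetric] sum_tilt tilt_linear tilt_square assms)
  finally show ?thesis by (simp add: power2_sum algebra_simps)
qed

lemma tilt_nonneg:
  assumes "\<And>i. i \<in> I \<Longrightarrow> \<bar>q i\<bar> \<le> 1" "\<epsilon> \<in> signs I"
  shows "tilt I q \<epsilon> \<ge> 0"
  unfolding tilt_def
proof (rule prod_nonneg)
  fix i assume "i \<in> I"
  then have "\<epsilon> i = -1 \<or> \<epsilon> i = 1" using assms(2) by (auto simp: signs_def)
  then show "0 \<le> (1 + \<epsilon> i * q i) / 2" using assms(1)[OF \<open>i \<in> I\<close>] by auto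
qed

text \<open>The Gibbs variational inequality with the uniform law as prior and the tilted law as
  posterior. The relative entropy is the mean of \<open>\<Sum> ln (1 + \<epsilon> i * q i)\<close>,
  hence at most \<open>\<Sum> (q i)\<^sup>2\<close> because
  \<open>ln (1 + x) \<le> x\<close>.\<close>

lemma tilt_change_of_measure:
  assumes I: "finite I" and q: "\<And>i. i \<in> I \<Longrightarrow> \<bar>q i\<bar> < 1"
  shows "exp ((\<Sum>\<epsilon>\<in>signs I. tilt I q \<epsilon> * g \<epsilon>) - (\<Sum>i\<in>I. (q i)\<^sup>2))
       \<le> (\<Sum>\<epsilon>\<in>signs I. exp (g \<epsilon>)) / 2 ^ card I"
proof -
  define m where "m = (\<Sum>\<epsilon>\<in>signs I. tilt I q \<epsilon> * g \<epsilon>) - (\<Sum>i\<in>I. (q i)\<^sup>2)"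
  have pos: "1 + \<epsilon> i * q i > 0" if "\<epsilon> \<in> signs I" "i \<in> I" for \<epsilon> i
  proof -
    have "\<epsilon> i = -1 \<or> \<epsilon> i = 1" using that by (auto simp: signs_def)
    then show ?thesis using q[OF that(2)] by auto
  qed
  have tpos: "tilt I q \<epsilon> \<ge> 0" if "\<epsilon> \<in> signs I" for \<epsilon>
    using that q by (intro tilt_nonneg) (auto intro: less_imp_le)
  \<comment> \<open>A majorant of the log-density of the tilted law against the uniform one; working
    with it avoids logarithms.\<close>
  define u where "u \<epsilon> = (\<Sum>i\<in>I. \<epsilon> i * q i)" for \<epsilon> :: "'a \<Rightarrow> real"
  have le: "tilt I q \<epsilon> \<le> exp (u \<epsilon>) / 2 ^ card I" if "\<epsilon> \<in> signs I" for \<epsilon>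
  proof -
    have "tilt I q \<epsilon> = (\<Prod>i\<in>I. 1 + \<epsilon> i * q i) / 2 ^ card I"
      by (simp add: tilt_def prod_dividef)
    also have "(\<Prod>i\<in>I. 1 + \<epsilon> i * q i) \<le> (\<Prod>i\<in>I. exp (\<epsilon> i * q i))"
      using pos[OF that] by (intro prod_mono) (auto intro: less_imp_le)
    finally show ?thesis by (simp add: u_def exp_sum[OF I] divide_right_mono)
  qed
  \<comment> \<open>The number \<open>m\<close> centres the exponent, so Jensen's inequality for
    \<open>exp\<close> reduces to \<open>1 + x \<le> exp x\<close> at each point.\<close>
  have "(\<Sum>\<epsilon>\<in>signs I. tilt I q \<epsilon> * (g \<epsilon> - u \<epsilon> - m))
     = (\<Sum>\<epsilon>\<in>signs I. tilt I q \<epsilon> * g \<epsilon>) - (\<Sum>\<epsilon>\<in>signs I. tilt I q \<epsilon> * u \<epsilon>) - (\<Sum>\<epsilon>\<in>signs I. tilt I q \<epsilon>) * m"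
    by (simp add: right_diff_distrib sum_subtractf sum_distrib_right)
  also have "\<dots> = 0"
    unfolding u_def by (simp add: tilt_linear[OF I] sum_tilt[OF I] m_def power2_eq_square)
  finally have z: "(\<Sum>\<epsilon>\<in>signs I. tilt I q \<epsilon> * (g \<epsilon> - u \<epsilon> - m)) = 0" .
  have "exp m = (\<Sum>\<epsilon>\<in>signs I. tilt I q \<epsilon> * (exp m * (1 + (g \<epsilon> - u \<epsilon> - m))))"
  proof -
    have "(\<Sum>\<epsilon>\<in>signs I. tilt I q \<epsilon> * (exp m * (1 + (g \<epsilon> - u \<epsilon> - m))))
      = exp m * ((\<Sum>\<epsilon>\<in>signs I. tilt I q \<epsilon>) + (\<Sum>\<epsilon>\<in>signs I. tilt I q \<epsilon> * (g \<epsilon> - u \<epsilon> - m)))"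
      by (simp add: sum.distrib[symmetric] sum_distrib_left) (simp add: algebra_simps)
    then show ?thesis using z sum_tilt[OF I] by simp
  qed
  also have "\<dots> \<le> (\<Sum>\<epsilon>\<in>signs I. exp (g \<epsilon>) / 2 ^ card I)"
  proof (rule sum_mono)
    fix \<epsilon> assume e: "\<epsilon> \<in> signs I"
    have "exp m * (1 + (g \<epsilon> - u \<epsilon> - m)) \<le> exp m * exp (g \<epsilon> - u \<epsilon> - m)"
      by (intro mult_left_mono) (simp_all add: exp_ge_add_one_self)
    also have "\<dots> = exp (g \<epsilon> - u \<epsilon>)" by (simp add: exp_add[symmetric])
    finally have "tilt I q \<epsilon> * (exp m * (1 + (g \<epsilon> - u \<epsilon> - m))) \<le> tilt I q \<epsilon> * exp (g \<epsilon> - u \<epsilon>)"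
      using tpos[OF e] by (intro mult_left_mono)
    also have "\<dots> \<le> exp (u \<epsilon>) / 2 ^ card I * exp (g \<epsilon> - u \<epsilon>)"
      using le[OF e] by (intro mult_right_mono) auto
    also have "\<dots> = exp (g \<epsilon>) / 2 ^ card I"
      by (simp add: exp_add[symmetric])
    finally show "tilt I q \<epsilon> * (exp m * (1 + (g \<epsilon> - u \<epsilon> - m))) \<le> exp (g \<epsilon>) / 2 ^ card I" .
  qed
  finally show ?thesis by (simp add: m_def sum_divide_distrib)
qed

subsection \<open>Smoothing of truncated linear forms\<close>

definition clip :: "real \<Rightarrow> real \<Rightarrow> real" where
  "clip c w = max (- c) (min c w)"

text \<open>A bounded substitute for a linear form in random signs. The added term makes up for what
  clipping can lose in the mean. Its cap \<open>3 * B\<close> is harmless, because the clipped form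
  is at least \<open>- 2 * B\<close> while the truncated target in \<open>min_le_smooth\<close> is
  at most \<open>B\<close>.\<close>

definition smooth :: "real \<Rightarrow> 'i set \<Rightarrow> real \<Rightarrow> ('i \<Rightarrow> real) \<Rightarrow> ('i \<Rightarrow> real) \<Rightarrow> real" where
  "smooth B I a b \<epsilon> = clip (2 * B) (a + (\<Sum>i\<in>I. \<epsilon> i * b i)) + min ((\<Sum>i\<in>I. (b i)\<^sup>2) / (4 * B)) (3 * B)"

text \<open>Clipping a random sign sum costs at most its variance divided by \<open>4 * B\<close>, which bounds a
  truncated linear form by a mean of bounded functions.\<close>

lemma min_le_smooth:
  assumes I: "finite I" and q: "\<And>i. i \<in> I \<Longrightarrow> \<bar>q i\<bar> < 1" and B: "B > 0"
  shows "min (a + (\<Sum>i\<in>I. q i * b i)) B \<le> (\<Sum>\<epsilon>\<in>signs I. tilt I q \<epsilon> * smooth B I a b \<epsilon>)"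
proof -
  define x where "x = min (a + (\<Sum>i\<in>I. q i * b i)) B"
  define s where "s = (\<Sum>i\<in>I. (b i)\<^sup>2)"
  have tpos: "tilt I q \<epsilon> \<ge> 0" if "\<epsilon> \<in> signs I" for \<epsilon>
    using that q by (intro tilt_nonneg) (auto intro: less_imp_le)
  define E where "E h = (\<Sum>\<epsilon>\<in>signs I. tilt I q \<epsilon> * h \<epsilon>)" for h :: "('a \<Rightarrow> real) \<Rightarrow> real"
  define c where "c \<epsilon> = clip (2 * B) (a + (\<Sum>i\<in>I. \<epsilon> i * b i))" for \<epsilon>
  have Em: "E h \<le> E h'" if "\<And>\<epsilon>. h \<epsilon> \<le> h' \<epsilon>" for h h'
    unfolding E_def using that tpos by (intro sum_mono mult_left_mono) auto
  have Ec: "E (\<lambda>_. t) = t" for t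
    unfolding E_def by (simp add: sum_distrib_right[symmetric] sum_tilt[OF I])
  have 1: "x \<le> E c + 3 * B"
  proof -
    have "E (\<lambda>_. - 2 * B) \<le> E c" by (rule Em) (auto simp: c_def clip_def)
    then show ?thesis using Ec[of "- 2 * B"] by (simp add: x_def)
  qed
  have 2: "x \<le> E c + s / (4 * B)"
  proof -
    define G where "G \<epsilon> = (\<Sum>i\<in>I. \<epsilon> i * b i) - (\<Sum>i\<in>I. q i * b i)" for \<epsilon> :: "'a \<Rightarrow> real"
    \<comment> \<open>If the upper clip is active, the loss is absorbed by
      \<open>G - B \<le> G\<^sup>2 / (4 * B)\<close>, an instance of the inequality of arithmetic
      and geometric means; the lower clip can only help.\<close>
    have lb: "x + G \<epsilon> - (G \<epsilon>)\<^sup>2 / (4 * B) \<le> c \<epsilon>" for \<epsilon>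
    proof -
      have "G \<epsilon> - B \<le> (G \<epsilon>)\<^sup>2 / (4 * B)"
      proof -
        have "0 \<le> (G \<epsilon> - 2 * B)\<^sup>2" by simp
        then have "(G \<epsilon> - B) * (4 * B) \<le> (G \<epsilon>)\<^sup>2"
          by (simp add: power2_eq_square algebra_simps)
        then show ?thesis using B by (simp add: field_simps)
      qed
      moreover have "0 \<le> (G \<epsilon>)\<^sup>2 / (4 * B)" using B by simp
      moreover have "x + G \<epsilon> \<le> a + (\<Sum>i\<in>I. \<epsilon> i * b i)" by (simp add: x_def G_def)
      moreover have "x \<le> B" by (simp add: x_def)
      ultimately show ?thesis unfolding c_def clip_def by linarith
    qed
    have "E (\<lambda>\<epsilon>. x + G \<epsilon> - (G \<epsilon>)\<^sup>2 / (4 * B)) \<le> E c"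
      using lb by (rule Em)
    moreover have "E (\<lambda>\<epsilon>. x + G \<epsilon> - (G \<epsilon>)\<^sup>2 / (4 * B)) = x + E G - E (\<lambda>\<epsilon>. (G \<epsilon>)\<^sup>2) / (4 * B)"
    proof -
      have "E (\<lambda>\<epsilon>. x + G \<epsilon> - (G \<epsilon>)\<^sup>2 / (4 * B)) = E (\<lambda>_. x) + E G - E (\<lambda>\<epsilon>. (G \<epsilon>)\<^sup>2) / (4 * B)"
        unfolding E_def by (simp add: algebra_simps sum.distrib sum_subtractf sum_divide_distrib)
      then show ?thesis by (simp only: Ec)
    qed
    moreover have "E G = 0"
    proof -
      have "E G = E (\<lambda>\<epsilon>. (\<Sum>i\<in>I. \<epsilon> i * b i)) - E (\<lambda>_. (\<Sum>i\<in>I. q i * b i))"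
        unfolding E_def G_def by (simp add: right_diff_distrib sum_subtractf)
      then show ?thesis unfolding Ec by (simp add: E_def tilt_linear[OF I])
    qed
    moreover have "E (\<lambda>\<epsilon>. (G \<epsilon>)\<^sup>2) \<le> s"
    proof -
      have "E (\<lambda>\<epsilon>. (G \<epsilon>)\<^sup>2) = (\<Sum>i\<in>I. (1 - (q i)\<^sup>2) * (b i)\<^sup>2)"
        using tilt_affine_square[OF I, of q "- (\<Sum>i\<in>I. q i * b i)" b]
        unfolding E_def G_def by simp
      also have "\<dots> \<le> s" unfolding s_def
        by (intro sum_mono) (simp add: left_diff_distrib)
      finally show ?thesis .
    qed
    ultimately show ?thesis using B by (smt (verit) divide_right_mono)
  qed
  have "x \<le> E c + min (s / (4 * B)) (3 * B)" using 1 2 by linarith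
  also have "\<dots> = E c + E (\<lambda>_. min (s / (4 * B)) (3 * B))" by (simp only: Ec)
  also have "\<dots> = E (smooth B I a b)"
    unfolding E_def c_def smooth_def s_def by (simp add: distrib_left sum.distrib)
  finally show ?thesis by (simp add: x_def E_def)
qed

text \<open>The ingredients of an exponential moment bound: a range of order \<open>B\<close>, and
  control of first and second moments by those of the unclipped form. Clipping from below raises a
  value \<open>z < - 2 * B\<close> by \<open>- 2 * B - z\<close>, which is at most
  \<open>z\<^sup>2 / (8 * B)\<close>.\<close>

lemma smooth_bounds:
  assumes "B > 0"
  shows "- 2 * B \<le> smooth B I a b \<epsilon>" "smooth B I a b \<epsilon> \<le> 5 * B"
    "smooth B I a b \<epsilon> \<le> (a + (\<Sum>i\<in>I. \<epsilon> i * b i)) + (a + (\<Sum>i\<in>I. \<epsilon> i * b i))\<^sup>2 / (8 * B)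
         + (\<Sum>i\<in>I. (b i)\<^sup>2) / (4 * B)"
    "(smooth B I a b \<epsilon>)\<^sup>2 \<le> 2 * (a + (\<Sum>i\<in>I. \<epsilon> i * b i))\<^sup>2 + 3 / 2 * (\<Sum>i\<in>I. (b i)\<^sup>2)"
proof -
  define z where "z = a + (\<Sum>i\<in>I. \<epsilon> i * b i)"
  define s where "s = (\<Sum>i\<in>I. (b i)\<^sup>2)"
  define g where "g = min (s / (4 * B)) (3 * B)"
  have s0: "s \<ge> 0" by (simp add: s_def sum_nonneg)
  have g0: "0 \<le> g" "g \<le> 3 * B" "g \<le> s / (4 * B)" using s0 assms by (auto simp: g_def)
  have sm: "smooth B I a b \<epsilon> = clip (2 * B) z + g" by (simp add: smooth_def z_def g_def s_def)
  show "- 2 * B \<le> smooth B I a b \<epsilon>" unfolding sm using g0 by (auto simp: clip_def)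
  show "smooth B I a b \<epsilon> \<le> 5 * B" unfolding sm using g0 assms by (auto simp: clip_def)
  have "- 2 * B - z \<le> z\<^sup>2 / (8 * B)"
  proof -
    have "0 \<le> (z + 4 * B)\<^sup>2" by simp
    then have "(- 2 * B - z) * (8 * B) \<le> z\<^sup>2" by (simp add: power2_eq_square algebra_simps)
    then show ?thesis using assms by (simp add: field_simps)
  qed
  moreover have "0 \<le> z\<^sup>2 / (8 * B)" using assms by simp
  ultimately have "clip (2 * B) z \<le> z + z\<^sup>2 / (8 * B)" unfolding clip_def by linarith
  then show "smooth B I a b \<epsilon> \<le> (a + (\<Sum>i\<in>I. \<epsilon> i * b i)) + (a + (\<Sum>i\<in>I. \<epsilon> i * b i))\<^sup>2 / (8 * B)
         + (\<Sum>i\<in>I. (b i)\<^sup>2) / (4 * B)"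
    unfolding sm using g0(3) by (simp add: z_def s_def)
  have "\<bar>clip (2 * B) z\<bar> \<le> \<bar>z\<bar>" using assms by (auto simp: clip_def)
  then have c2: "(clip (2 * B) z)\<^sup>2 \<le> z\<^sup>2" by (simp add: abs_le_square_iff)
  \<comment> \<open>One factor \<open>g\<close> is bounded by each of the two arguments of its
    \<open>min\<close>, so \<open>B\<close> cancels.\<close>
  have "g\<^sup>2 \<le> 3 * B * (s / (4 * B))"
    unfolding power2_eq_square using g0 assms by (intro mult_mono) auto
  also have "\<dots> = 3 / 4 * s" using assms by simp
  finally have "(clip (2 * B) z + g)\<^sup>2 \<le> 2 * z\<^sup>2 + 3 / 2 * s"
    using c2 sum_squares_bound[of "clip (2 * B) z" g] by (simp add: power2_sum)
  then show "(smooth B I a b \<epsilon>)\<^sup>2 \<le> 2 * (a + (\<Sum>i\<in>I. \<epsilon> i * b i))\<^sup>2 + 3 / 2 * (\<Sum>i\<in>I. (b i)\<^sup>2)"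
    unfolding sm by (simp add: z_def s_def)
qed

lemma exp_le_quadratic:
  fixes w :: real assumes "w \<le> 1" shows "exp w \<le> 1 + w + w\<^sup>2"
proof (cases "w \<ge> 0")
  case True then show ?thesis using exp_bound assms by blast
next
  case False

  show ?thesis
  proof (cases "w \<ge> - 1")
    case True

    have "exp w * (1 - w) \<le> exp w * exp (- w)" by (intro mult_left_mono) (use exp_ge_add_one_self[of "- w"] in auto)
    then have 1: "exp w * (1 - w) \<le> 1" by (simp add: exp_minus)
    have "(1 + w + w\<^sup>2) * (1 - w) = 1 - w ^ 3" by (simp add: power2_eq_square power3_eq_cube algebra_simps)
    moreover have "w ^ 3 \<le> 0"
      using False mult_nonpos_nonneg[of w "w * w"] by (simp add: power3_eq_cube mult.assoc)
    ultimately have "exp w * (1 - w) \<le> (1 + w + w\<^sup>2) * (1 - w)" using 1 by linarith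
    then show ?thesis using False by (simp add: mult_le_cancel_right)
  next
    case nw: False
    then have "0 \<le> w * (1 + w)" by (intro mult_nonpos_nonpos) auto
    then have "0 \<le> w + w * w" by (simp add: distrib_left)
    moreover have "exp w \<le> 1" using False by simp
    ultimately show ?thesis unfolding power2_eq_square by linarith
  qed
qed

subsection \<open>Square integrable functions\<close>

definition sqint :: "'x measure \<Rightarrow> ('x \<Rightarrow> real) \<Rightarrow> bool" where
  "sqint Q \<phi> \<longleftrightarrow> \<phi> \<in> borel_measurable Q \<and> integrable Q (\<lambda>x. (\<phi> x)\<^sup>2)"

lemma sqint_measurable: "sqint Q \<phi> \<Longrightarrow> \<phi> \<in> borel_measurable Q"
  and sqint_integrable_square: "sqint Q \<phi> \<Longrightarrow> integrable Q (\<lambda>x. (\<phi> x)\<^sup>2)"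
  by (simp_all add: sqint_def)

lemma sqint_mult:
  assumes "sqint Q \<phi>" "sqint Q \<psi>"
  shows "integrable Q (\<lambda>x. \<phi> x * \<psi> x)"
proof (rule Bochner_Integration.integrable_bound)
  show "integrable Q (\<lambda>x. (\<phi> x)\<^sup>2 + (\<psi> x)\<^sup>2)"
    using assms by (auto simp: sqint_def)
  show "(\<lambda>x. \<phi> x * \<psi> x) \<in> borel_measurable Q"
    using assms by (auto simp: sqint_def)
  have "\<bar>u * v\<bar> \<le> u\<^sup>2 + v\<^sup>2" for u v :: real
  proof -
    have "2 * (\<bar>u\<bar> * \<bar>v\<bar>) \<le> u\<^sup>2 + v\<^sup>2" using sum_squares_bound[of "\<bar>u\<bar>" "\<bar>v\<bar>"] by simp
    moreover have "0 \<le> \<bar>u\<bar> * \<bar>v\<bar>" by simp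
    ultimately show ?thesis unfolding abs_mult by linarith
  qed
  then show "AE x in Q. norm (\<phi> x * \<psi> x) \<le> norm ((\<phi> x)\<^sup>2 + (\<psi> x)\<^sup>2)"
    by (simp add: abs_of_nonneg)
qed

lemma sqint_add:
  assumes "sqint Q \<phi>" "sqint Q \<psi>"
  shows "sqint Q (\<lambda>x. \<phi> x + \<psi> x)"
  unfolding sqint_def power2_sum
  using assms sqint_mult[OF assms] by (auto simp: sqint_def mult.assoc)

lemma sqint_cmult: "sqint Q \<phi> \<Longrightarrow> sqint Q (\<lambda>x. c * \<phi> x)"
  by (auto simp: sqint_def power_mult_distrib)

lemma sqint_uminus: "sqint Q \<phi> \<Longrightarrow> sqint Q (\<lambda>x. - \<phi> x)"
  using sqint_cmult[of Q \<phi> "-1"] by simp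

lemma sqint_diff: "sqint Q \<phi> \<Longrightarrow> sqint Q \<psi> \<Longrightarrow> sqint Q (\<lambda>x. \<phi> x - \<psi> x)"
  using sqint_add[OF _ sqint_uminus, of Q \<phi> \<psi>] by simp

lemma sqint_zero: "sqint Q (\<lambda>_. 0)"
  by (simp add: sqint_def)

lemma sqint_sum: "(\<And>i. i \<in> I \<Longrightarrow> sqint Q (\<phi> i)) \<Longrightarrow> sqint Q (\<lambda>x. \<Sum>i\<in>I. \<phi> i x)"
  by (induction I rule: infinite_finite_induct) (auto intro: sqint_add sqint_zero)

lemma sqint_bound:
  assumes "sqint Q \<phi>" "\<psi> \<in> borel_measurable Q" "AE x in Q. \<bar>\<psi> x\<bar> \<le> C * \<bar>\<phi> x\<bar>"
  shows "sqint Q \<psi>"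
  unfolding sqint_def
proof
  show "integrable Q (\<lambda>x. (\<psi> x)\<^sup>2)"
  proof (rule Bochner_Integration.integrable_bound)
    show "integrable Q (\<lambda>x. C\<^sup>2 * (\<phi> x)\<^sup>2)" using assms by (auto simp: sqint_def)
    show "(\<lambda>x. (\<psi> x)\<^sup>2) \<in> borel_measurable Q" using assms by auto
    show "AE x in Q. norm ((\<psi> x)\<^sup>2) \<le> norm (C\<^sup>2 * (\<phi> x)\<^sup>2)"
      using assms(3)
    proof eventually_elim
      case (elim x)
      then have "\<bar>\<psi> x\<bar>\<^sup>2 \<le> (C * \<bar>\<phi> x\<bar>)\<^sup>2" by (intro power_mono) auto
      then show ?case by (simp add: power_mult_distrib)
    qed
  qed
qed (use assms in auto)

text \<open>The discriminant argument: expand the integral of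
  \<open>(a * \<phi> - b * \<psi>)\<^sup>2\<close>. In the degenerate case \<psi> vanishes almost
  everywhere.\<close>

lemma Cauchy_Schwarz_integral:
  assumes "sqint Q \<phi>" "sqint Q \<psi>"
  shows "(\<integral>x. \<phi> x * \<psi> x \<partial>Q)\<^sup>2 \<le> (\<integral>x. (\<phi> x)\<^sup>2 \<partial>Q) * (\<integral>x. (\<psi> x)\<^sup>2 \<partial>Q)"
proof -
  define a where "a = (\<integral>x. (\<psi> x)\<^sup>2 \<partial>Q)"
  define b where "b = (\<integral>x. \<phi> x * \<psi> x \<partial>Q)"
  define c where "c = (\<integral>x. (\<phi> x)\<^sup>2 \<partial>Q)"
  have a0: "a \<ge> 0" by (simp add: a_def)
  have int: "integrable Q (\<lambda>x. (\<phi> x)\<^sup>2)" "integrable Q (\<lambda>x. (\<psi> x)\<^sup>2)" "integrable Q (\<lambda>x. \<phi> x * \<psi> x)"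
    using assms sqint_mult[OF assms] by (auto simp: sqint_def)
  have "0 \<le> (\<integral>x. (a * \<phi> x - b * \<psi> x)\<^sup>2 \<partial>Q)" by simp
  also have "(\<lambda>x. (a * \<phi> x - b * \<psi> x)\<^sup>2) = (\<lambda>x. a\<^sup>2 * (\<phi> x)\<^sup>2 - 2 * a * b * (\<phi> x * \<psi> x) + b\<^sup>2 * (\<psi> x)\<^sup>2)"
    by (auto simp: power2_eq_square algebra_simps)
  also have "(\<integral>x. a\<^sup>2 * (\<phi> x)\<^sup>2 - 2 * a * b * (\<phi> x * \<psi> x) + b\<^sup>2 * (\<psi> x)\<^sup>2 \<partial>Q)
     = a\<^sup>2 * c - 2 * a * b * b + b\<^sup>2 * a"
    using int by (simp add: a_def b_def c_def)
  also have "\<dots> = a * (c * a - b\<^sup>2)" by (simp add: power2_eq_square algebra_simps)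
  finally have ineq: "0 \<le> a * (c * a - b\<^sup>2)" .
  show ?thesis
  proof (cases "a = 0")
    case False
    then have "a > 0" using a0 by simp
    then have "0 \<le> c * a - b\<^sup>2" using ineq by (simp only: zero_le_mult_iff) linarith
    then show ?thesis by (simp add: a_def b_def c_def)
  next
    case True
    then have "AE x in Q. (\<psi> x)\<^sup>2 = 0"
      using integral_nonneg_eq_0_iff_AE[OF int(2)] by (simp add: a_def)
    then have "b = (\<integral>x. 0 \<partial>Q)" unfolding b_def
      using int(3) by (intro integral_cong_AE) auto
    then show ?thesis by (simp add: b_def)
  qed
qed

lemma abs_integral_mult_le:
  assumes "sqint Q \<phi>" "sqint Q \<psi>"
  shows "\<bar>\<integral>x. \<phi> x * \<psi> x \<partial>Q\<bar> \<le> sqrt (\<integral>x. (\<phi> x)\<^sup>2 \<partial>Q) * sqrt (\<integral>x. (\<psi> x)\<^sup>2 \<partial>Q)"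
  using real_sqrt_le_mono[OF Cauchy_Schwarz_integral[OF assms]] by (simp add: real_sqrt_mult)

context prob_space
begin

lemma sqint_const: "sqint M (\<lambda>_. c)"
  by (simp add: sqint_def)

lemma sqint_integrable: "sqint M \<phi> \<Longrightarrow> integrable M \<phi>"
  using sqint_mult[OF _ sqint_const[of 1]] by simp

lemma square_integral_le:
  assumes "sqint M \<phi>"
  shows "(\<integral>x. \<phi> x \<partial>M)\<^sup>2 \<le> (\<integral>x. (\<phi> x)\<^sup>2 \<partial>M)"
  using Cauchy_Schwarz_integral[OF assms sqint_const[of 1]] by (simp add: prob_space)

text \<open>Clipping is what gives forms that are merely square integrable an exponential moment. On
  the scale \<open>5 * B\<close> the exponent is at most 1, where
  \<open>exp w \<le> 1 + w + w\<^sup>2\<close>; \<open>\<Theta>\<close> collects the mean of the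
  unclipped form, the clipping error and the quadratic term.\<close>

lemma smooth_mgf:
  assumes I: "finite I" and B: "B > 0" and a: "sqint M a" and b: "\<And>i. i \<in> I \<Longrightarrow> sqint M (b i)"
  defines "\<zeta> \<equiv> \<lambda>\<epsilon> x. a x + (\<Sum>i\<in>I. \<epsilon> i * b i x)"
  defines "\<Theta> \<equiv> \<lambda>\<epsilon>. (\<integral>x. \<zeta> \<epsilon> x \<partial>M) + ((\<integral>x. (\<zeta> \<epsilon> x)\<^sup>2 \<partial>M) + (\<Sum>i\<in>I. \<integral>x. (b i x)\<^sup>2 \<partial>M)) / B"
  shows "(\<lambda>x. smooth B I (a x) (\<lambda>i. b i x) \<epsilon>) \<in> borel_measurable M"
    and "(\<integral>\<^sup>+x. ennreal (exp ((smooth B I (a x) (\<lambda>i. b i x) \<epsilon> - \<Theta> \<epsilon>) / (5 * B))) \<partial>M) \<le> 1"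
proof -
  have [measurable]: "a \<in> borel_measurable M" "\<And>i. i \<in> I \<Longrightarrow> b i \<in> borel_measurable M"
    using a b by (auto simp: sqint_def)
  show meas[measurable]: "(\<lambda>x. smooth B I (a x) (\<lambda>i. b i x) \<epsilon>) \<in> borel_measurable M"
    unfolding smooth_def clip_def using I by measurable
  have z: "sqint M (\<zeta> \<epsilon>)" unfolding \<zeta>_def
    by (intro sqint_add sqint_sum sqint_cmult a b)
  define \<sigma> where "\<sigma> x = (\<Sum>i\<in>I. (b i x)\<^sup>2)" for x
  have \<sigma>: "integrable M \<sigma>" "(\<integral>x. \<sigma> x \<partial>M) = (\<Sum>i\<in>I. \<integral>x. (b i x)\<^sup>2 \<partial>M)"
    unfolding \<sigma>_def using b by (auto simp: sqint_def)
  have \<sigma>0: "\<sigma> x \<ge> 0" for x by (simp add: \<sigma>_def sum_nonneg)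
  define h where "h x = 1 + (\<zeta> \<epsilon> x + ((\<zeta> \<epsilon> x)\<^sup>2 + \<sigma> x) / B) / (5 * B)" for x
  have le: "exp (smooth B I (a x) (\<lambda>i. b i x) \<epsilon> / (5 * B)) \<le> h x" for x
  proof -
    define S where "S = smooth B I (a x) (\<lambda>i. b i x) \<epsilon>"
    have "S / (5 * B) \<le> 1" using smooth_bounds(2)[OF B] B by (simp add: S_def)
    then have "exp (S / (5 * B)) \<le> 1 + S / (5 * B) + (S / (5 * B))\<^sup>2" by (rule exp_le_quadratic)
    also have "(S / (5 * B))\<^sup>2 = S\<^sup>2 / (5 * B) / (5 * B)" by (simp add: power2_eq_square)
    also have "1 + S / (5 * B) + S\<^sup>2 / (5 * B) / (5 * B) = 1 + (S + S\<^sup>2 / (5 * B)) / (5 * B)"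
      by (simp add: add_divide_distrib)
    also have "\<dots> \<le> h x"
    proof -
      have "S \<le> \<zeta> \<epsilon> x + (\<zeta> \<epsilon> x)\<^sup>2 / (8 * B) + \<sigma> x / (4 * B)"
        using smooth_bounds(3)[OF B] by (simp add: S_def \<zeta>_def \<sigma>_def)
      moreover have "S\<^sup>2 / (5 * B) \<le> (2 * (\<zeta> \<epsilon> x)\<^sup>2 + 3 / 2 * \<sigma> x) / (5 * B)"
        using smooth_bounds(4)[OF B] B by (intro divide_right_mono) (auto simp: S_def \<zeta>_def \<sigma>_def)
      ultimately have "S + S\<^sup>2 / (5 * B) \<le> \<zeta> \<epsilon> x + (\<zeta> \<epsilon> x)\<^sup>2 / (8 * B) + \<sigma> x / (4 * B)
           + (2 * (\<zeta> \<epsilon> x)\<^sup>2 + 3 / 2 * \<sigma> x) / (5 * B)" by linarith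
      \<comment> \<open>\<open>1 / 8 + 2 / 5 = 21 / 40\<close> and
        \<open>1 / 4 + 3 / 10 = 11 / 20\<close>; both are then rounded up to 1.\<close>
      also have "\<dots> = \<zeta> \<epsilon> x + (21 / 40 * (\<zeta> \<epsilon> x)\<^sup>2 + 11 / 20 * \<sigma> x) / B"
        using B by (simp add: field_simps)
      also have "\<dots> \<le> \<zeta> \<epsilon> x + ((\<zeta> \<epsilon> x)\<^sup>2 + \<sigma> x) / B"
        using B \<sigma>0[of x] zero_le_power2[of "\<zeta> \<epsilon> x"]
        by (intro add_left_mono divide_right_mono add_mono) linarith+
      finally show ?thesis unfolding h_def
        using B by (intro add_left_mono divide_right_mono) auto
    qed
    finally show ?thesis by (simp add: S_def)
  qed
  have ih: "integrable M h" unfolding h_def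
    using z \<sigma> sqint_integrable[OF z] by (auto simp: sqint_def)
  have "(\<integral>x. h x \<partial>M) = 1 + \<Theta> \<epsilon> / (5 * B)"
    unfolding h_def \<Theta>_def using z \<sigma> sqint_integrable[OF z] by (simp add: prob_space sqint_def)
  also have "\<dots> \<le> exp (\<Theta> \<epsilon> / (5 * B))" by (rule exp_ge_add_one_self)
  finally have hle: "(\<integral>x. h x \<partial>M) \<le> exp (\<Theta> \<epsilon> / (5 * B))" .
  have "(\<integral>\<^sup>+x. ennreal (exp ((smooth B I (a x) (\<lambda>i. b i x) \<epsilon> - \<Theta> \<epsilon>) / (5 * B))) \<partial>M)
     \<le> (\<integral>\<^sup>+x. ennreal (exp (- \<Theta> \<epsilon> / (5 * B)) * h x) \<partial>M)"
  proof (intro nn_integral_mono ennreal_leI)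
    fix x
    have "exp ((smooth B I (a x) (\<lambda>i. b i x) \<epsilon> - \<Theta> \<epsilon>) / (5 * B))
       = exp (- \<Theta> \<epsilon> / (5 * B)) * exp (smooth B I (a x) (\<lambda>i. b i x) \<epsilon> / (5 * B))"
      by (simp add: exp_add[symmetric] diff_divide_distrib)
    then show "exp ((smooth B I (a x) (\<lambda>i. b i x) \<epsilon> - \<Theta> \<epsilon>) / (5 * B)) \<le> exp (- \<Theta> \<epsilon> / (5 * B)) * h x"
      using le[of x] by simp
  qed
  also have "\<dots> = ennreal (\<integral>x. exp (- \<Theta> \<epsilon> / (5 * B)) * h x \<partial>M)"
  proof (rule nn_integral_eq_integral)
    have "0 \<le> h x" for x using le[of x] exp_gt_zero[of "smooth B I (a x) (\<lambda>i. b i x) \<epsilon> / (5 * B)"] by linarith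
    then show "AE x in M. 0 \<le> exp (- \<Theta> \<epsilon> / (5 * B)) * h x" by simp
  qed (use ih in auto)
  also have "\<dots> \<le> ennreal 1"
  proof (rule ennreal_leI)
    have "exp (- \<Theta> \<epsilon> / (5 * B)) * (\<integral>x. h x \<partial>M) \<le> exp (- \<Theta> \<epsilon> / (5 * B)) * exp (\<Theta> \<epsilon> / (5 * B))"
      using hle by (intro mult_left_mono) auto
    then show "(\<integral>x. exp (- \<Theta> \<epsilon> / (5 * B)) * h x \<partial>M) \<le> 1" by (simp add: exp_add[symmetric])
  qed
  finally show "(\<integral>\<^sup>+x. ennreal (exp ((smooth B I (a x) (\<lambda>i. b i x) \<epsilon> - \<Theta> \<epsilon>) / (5 * B))) \<partial>M) \<le> 1" by simp
qed

end

subsection \<open>The deviation inequality\<close>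

text \<open>The sample is one infinite sequence, so that a single probability space serves all
  sample sizes.\<close>

locale iid_sample = prob_space P + Q: prob_space Q
  for P :: "'w measure" and Q :: "'x measure" +
  fixes X :: "nat \<Rightarrow> 'w \<Rightarrow> 'x"
  assumes indep: "indep_vars (\<lambda>_. Q) X UNIV"
    and dist: "\<And>i. distr P Q (X i) = Q"
begin

lemma X_measurable [measurable]: "X i \<in> P \<rightarrow>\<^sub>M Q"
  using indep by (auto simp: indep_vars_def)

lemma AE_sample:
  assumes "AE x in Q. R x"
  shows "AE \<omega> in P. \<forall>i. R (X i \<omega>)"
proof -
  have "AE \<omega> in P. R (X i \<omega>)" for i
  proof (rule AE_distrD[of _ P Q])
    show "AE x in distr P Q (X i). R x" unfolding dist by (rule assms)
  qed measurable
  then show ?thesis by (simp add: AE_all_countable)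
qed

lemma nn_integral_sample_prod:
  fixes F :: "'x \<Rightarrow> ennreal"
  assumes [measurable]: "F \<in> borel_measurable Q"
  shows "(\<integral>\<^sup>+\<omega>. (\<Prod>k<n. F (X k \<omega>)) \<partial>P) = (\<integral>\<^sup>+x. F x \<partial>Q) ^ n"
proof -
  have "indep_vars (\<lambda>_. borel) (\<lambda>k \<omega>. F (X k \<omega>)) {..<n}"
    by (rule indep_vars_compose2[OF indep_vars_subset[OF indep]]) auto
  then have "(\<integral>\<^sup>+\<omega>. (\<Prod>k<n. F (X k \<omega>)) \<partial>P) = (\<Prod>k<n. \<integral>\<^sup>+\<omega>. F (X k \<omega>) \<partial>P)"
    by (intro indep_vars_nn_integral) auto
  also have "\<dots> = (\<Prod>k<n. \<integral>\<^sup>+x. F x \<partial>Q)"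
    by (intro prod.cong refl) (simp add: nn_integral_distr[of "X _" P Q F, symmetric] dist)
  finally show ?thesis by simp
qed

text \<open>The majorant \<open>W\<close> does not depend on \<open>q\<close>: it is the average
  over all sign vectors of exponentials with mean at most 1, and
  \<open>tilt_change_of_measure\<close> bounds the exponential at any \<open>q\<close> by it. An
  infinite family is thus controlled by one random variable of mean at most 1, at the price
  \<open>\<Sum> (q i)\<^sup>2\<close>.\<close>

lemma pac_bayes:
  fixes I :: "'i set"
  assumes I: "finite I" and B: "B > 0" and a: "sqint Q a" and b: "\<And>i. i \<in> I \<Longrightarrow> sqint Q (b i)"
  defines "\<zeta> \<equiv> \<lambda>q x. a x + (\<Sum>i\<in>I. q i * b i x)"
  obtains W where "W \<in> borel_measurable P" "\<And>\<omega>. W \<omega> \<ge> 0" "(\<integral>\<^sup>+\<omega>. ennreal (W \<omega>) \<partial>P) \<le> 1"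
    "\<And>\<omega> q. (\<And>i. i \<in> I \<Longrightarrow> \<bar>q i\<bar> < 1) \<Longrightarrow>
       exp (((\<Sum>k<n. min (\<zeta> q (X k \<omega>)) B)
           - real n * ((\<integral>x. \<zeta> q x \<partial>Q)
               + ((\<integral>x. (\<zeta> q x)\<^sup>2 \<partial>Q) + 2 * (\<Sum>i\<in>I. \<integral>x. (b i x)\<^sup>2 \<partial>Q)) / B)) / (5 * B)
          - (\<Sum>i\<in>I. (q i)\<^sup>2)) \<le> W \<omega>"
proof -
  define \<Theta> where "\<Theta> \<epsilon> = (\<integral>x. \<zeta> \<epsilon> x \<partial>Q) + ((\<integral>x. (\<zeta> \<epsilon> x)\<^sup>2 \<partial>Q) + (\<Sum>i\<in>I. \<integral>x. (b i x)\<^sup>2 \<partial>Q)) / B" for \<epsilon>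
  define H where "H \<epsilon> x = smooth B I (a x) (\<lambda>i. b i x) \<epsilon>" for \<epsilon> x
  have Hm[measurable]: "H \<epsilon> \<in> borel_measurable Q" for \<epsilon>
    unfolding H_def by (rule Q.smooth_mgf(1)[OF I B a b])
  have mgf: "(\<integral>\<^sup>+x. ennreal (exp ((H \<epsilon> x - \<Theta> \<epsilon>) / (5 * B))) \<partial>Q) \<le> 1" for \<epsilon>
    unfolding H_def \<Theta>_def \<zeta>_def by (rule Q.smooth_mgf(2)[OF I B a b])
  define g where "g \<epsilon> \<omega> = (\<Sum>k<n. (H \<epsilon> (X k \<omega>) - \<Theta> \<epsilon>) / (5 * B))" for \<epsilon> \<omega>
  have [measurable]: "g \<epsilon> \<in> borel_measurable P" for \<epsilon> unfolding g_def by measurable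
  define W where "W \<omega> = (\<Sum>\<epsilon>\<in>signs I. exp (g \<epsilon> \<omega>)) / 2 ^ card I" for \<omega>
  show thesis
  proof (rule that[of W])
    show "W \<in> borel_measurable P" unfolding W_def by measurable
    show "W \<omega> \<ge> 0" for \<omega> by (auto simp: W_def intro!: divide_nonneg_nonneg sum_nonneg)
    have one: "(\<integral>\<^sup>+\<omega>. ennreal (exp (g \<epsilon> \<omega>)) \<partial>P) \<le> 1" for \<epsilon>
    proof -
      have "(\<integral>\<^sup>+\<omega>. ennreal (exp (g \<epsilon> \<omega>)) \<partial>P)
          = (\<integral>\<^sup>+\<omega>. (\<Prod>k<n. ennreal (exp ((H \<epsilon> (X k \<omega>) - \<Theta> \<epsilon>) / (5 * B)))) \<partial>P)"
        unfolding g_def by (simp add: exp_sum prod_ennreal)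
      also have "\<dots> = (\<integral>\<^sup>+x. ennreal (exp ((H \<epsilon> x - \<Theta> \<epsilon>) / (5 * B))) \<partial>Q) ^ n"
        by (rule nn_integral_sample_prod) measurable
      also have "\<dots> \<le> 1 ^ n" using mgf by (intro power_mono) auto
      finally show ?thesis by simp
    qed
    have "(\<integral>\<^sup>+\<omega>. ennreal (W \<omega>) \<partial>P) = (\<integral>\<^sup>+\<omega>. (\<Sum>\<epsilon>\<in>signs I. ennreal (1 / 2 ^ card I) * ennreal (exp (g \<epsilon> \<omega>))) \<partial>P)"
      by (intro nn_integral_cong)
        (simp add: W_def sum_divide_distrib ennreal_mult[symmetric] sum_ennreal)
    also have "\<dots> = (\<Sum>\<epsilon>\<in>signs I. ennreal (1 / 2 ^ card I) * (\<integral>\<^sup>+\<omega>. ennreal (exp (g \<epsilon> \<omega>)) \<partial>P))"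
      by (simp add: nn_integral_sum nn_integral_cmult)
    also have "\<dots> \<le> (\<Sum>\<epsilon>\<in>signs I. ennreal (1 / 2 ^ card I) * 1)"
      using one by (intro sum_mono mult_left_mono) auto
    also have "\<dots> = ennreal (\<Sum>\<epsilon>\<in>signs I. 1 / 2 ^ card I)"
      unfolding mult_1_right by (rule sum_ennreal) simp
    also have "\<dots> = 1" by (simp add: card_signs[OF I])
    finally show "(\<integral>\<^sup>+\<omega>. ennreal (W \<omega>) \<partial>P) \<le> 1" .
    fix \<omega> and q :: "'i \<Rightarrow> real" assume q: "\<And>i. i \<in> I \<Longrightarrow> \<bar>q i\<bar> < 1"
    have tpos: "tilt I q \<epsilon> \<ge> 0" if "\<epsilon> \<in> signs I" for \<epsilon>
      using that q by (intro tilt_nonneg) (auto intro: less_imp_le)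
    have int: "integrable Q a" "integrable Q (\<lambda>x. (a x)\<^sup>2)" using Q.sqint_integrable[OF a] sqint_integrable_square[OF a] by auto
    have intb: "integrable Q (b i)" "integrable Q (\<lambda>x. (b i x)\<^sup>2)" if "i \<in> I" for i
      using Q.sqint_integrable[OF b[OF that]] sqint_integrable_square[OF b[OF that]] by auto
    have z: "sqint Q (\<zeta> \<epsilon>)" for \<epsilon> unfolding \<zeta>_def by (intro sqint_add sqint_sum sqint_cmult a b)
    have E1: "(\<Sum>\<epsilon>\<in>signs I. tilt I q \<epsilon> * (\<integral>x. \<zeta> \<epsilon> x \<partial>Q)) = (\<integral>x. \<zeta> q x \<partial>Q)"
    proof -
      have "(\<Sum>\<epsilon>\<in>signs I. tilt I q \<epsilon> * (\<integral>x. \<zeta> \<epsilon> x \<partial>Q)) = (\<integral>x. (\<Sum>\<epsilon>\<in>signs I. tilt I q \<epsilon> * \<zeta> \<epsilon> x) \<partial>Q)"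
        using Q.sqint_integrable[OF z] by simp
      also have "(\<lambda>x. (\<Sum>\<epsilon>\<in>signs I. tilt I q \<epsilon> * \<zeta> \<epsilon> x)) = \<zeta> q"
        unfolding \<zeta>_def
        by (auto simp: distrib_left sum.distrib tilt_linear[OF I] sum_distrib_right[symmetric] sum_tilt[OF I])
      finally show ?thesis .
    qed
    \<comment> \<open>The sign noise adds one more copy of the energies of the \<open>b i\<close>,
      which is where the factor 2 in the statement comes from.\<close>
    have E2: "(\<Sum>\<epsilon>\<in>signs I. tilt I q \<epsilon> * (\<integral>x. (\<zeta> \<epsilon> x)\<^sup>2 \<partial>Q))
        \<le> (\<integral>x. (\<zeta> q x)\<^sup>2 \<partial>Q) + (\<Sum>i\<in>I. \<integral>x. (b i x)\<^sup>2 \<partial>Q)"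
    proof -
      have "(\<Sum>\<epsilon>\<in>signs I. tilt I q \<epsilon> * (\<integral>x. (\<zeta> \<epsilon> x)\<^sup>2 \<partial>Q)) = (\<integral>x. (\<Sum>\<epsilon>\<in>signs I. tilt I q \<epsilon> * (\<zeta> \<epsilon> x)\<^sup>2) \<partial>Q)"
        using z by (simp add: sqint_def)
      also have "(\<lambda>x. (\<Sum>\<epsilon>\<in>signs I. tilt I q \<epsilon> * (\<zeta> \<epsilon> x)\<^sup>2)) = (\<lambda>x. (\<zeta> q x)\<^sup>2 + (\<Sum>i\<in>I. (1 - (q i)\<^sup>2) * (b i x)\<^sup>2))"
        unfolding \<zeta>_def by (simp add: tilt_affine_square[OF I])
      also have "(\<integral>x. (\<zeta> q x)\<^sup>2 + (\<Sum>i\<in>I. (1 - (q i)\<^sup>2) * (b i x)\<^sup>2) \<partial>Q)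
        = (\<integral>x. (\<zeta> q x)\<^sup>2 \<partial>Q) + (\<Sum>i\<in>I. (1 - (q i)\<^sup>2) * (\<integral>x. (b i x)\<^sup>2 \<partial>Q))"
        using z[of q] intb by (simp add: sqint_def)
      also have "\<dots> \<le> (\<integral>x. (\<zeta> q x)\<^sup>2 \<partial>Q) + (\<Sum>i\<in>I. \<integral>x. (b i x)\<^sup>2 \<partial>Q)"
        by (intro add_left_mono sum_mono) (simp add: left_diff_distrib)
      finally show ?thesis .
    qed
    have E3: "(\<Sum>\<epsilon>\<in>signs I. tilt I q \<epsilon> * \<Theta> \<epsilon>) \<le> (\<integral>x. \<zeta> q x \<partial>Q)
               + ((\<integral>x. (\<zeta> q x)\<^sup>2 \<partial>Q) + 2 * (\<Sum>i\<in>I. \<integral>x. (b i x)\<^sup>2 \<partial>Q)) / B"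
    proof -
      have "(\<Sum>\<epsilon>\<in>signs I. tilt I q \<epsilon> * \<Theta> \<epsilon>) = (\<Sum>\<epsilon>\<in>signs I. tilt I q \<epsilon> * (\<integral>x. \<zeta> \<epsilon> x \<partial>Q))
         + ((\<Sum>\<epsilon>\<in>signs I. tilt I q \<epsilon> * (\<integral>x. (\<zeta> \<epsilon> x)\<^sup>2 \<partial>Q)) + (\<Sum>\<epsilon>\<in>signs I. tilt I q \<epsilon>) * (\<Sum>i\<in>I. \<integral>x. (b i x)\<^sup>2 \<partial>Q)) / B"
      proof -
        have "(\<Sum>\<epsilon>\<in>signs I. tilt I q \<epsilon> * (f \<epsilon> + (h \<epsilon> + c) / B)) = (\<Sum>\<epsilon>\<in>signs I. tilt I q \<epsilon> * f \<epsilon>)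
           + ((\<Sum>\<epsilon>\<in>signs I. tilt I q \<epsilon> * h \<epsilon>) + (\<Sum>\<epsilon>\<in>signs I. tilt I q \<epsilon>) * c) / B" for f h c
          by (simp add: distrib_left sum.distrib sum_distrib_right add_divide_distrib sum_divide_distrib)
        then show ?thesis unfolding \<Theta>_def .
      qed
      also have "\<dots> \<le> (\<integral>x. \<zeta> q x \<partial>Q)
               + ((\<integral>x. (\<zeta> q x)\<^sup>2 \<partial>Q) + 2 * (\<Sum>i\<in>I. \<integral>x. (b i x)\<^sup>2 \<partial>Q)) / B"
        unfolding E1 sum_tilt[OF I] using E2 B by (intro add_left_mono divide_right_mono) auto
      finally show ?thesis .
    qed
    have E4: "(\<Sum>k<n. min (\<zeta> q (X k \<omega>)) B) \<le> (\<Sum>\<epsilon>\<in>signs I. tilt I q \<epsilon> * (\<Sum>k<n. H \<epsilon> (X k \<omega>)))"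
    proof -
      have "(\<Sum>k<n. min (\<zeta> q (X k \<omega>)) B) \<le> (\<Sum>k<n. \<Sum>\<epsilon>\<in>signs I. tilt I q \<epsilon> * H \<epsilon> (X k \<omega>))"
        unfolding \<zeta>_def H_def by (intro sum_mono min_le_smooth I q B)
      also have "\<dots> = (\<Sum>\<epsilon>\<in>signs I. tilt I q \<epsilon> * (\<Sum>k<n. H \<epsilon> (X k \<omega>)))"
        by (subst sum.swap) (simp add: sum_distrib_left)
      finally show ?thesis .
    qed
    define T where "T = (\<integral>x. \<zeta> q x \<partial>Q) + ((\<integral>x. (\<zeta> q x)\<^sup>2 \<partial>Q) + 2 * (\<Sum>i\<in>I. \<integral>x. (b i x)\<^sup>2 \<partial>Q)) / B"
    have E5: "(\<Sum>\<epsilon>\<in>signs I. tilt I q \<epsilon> * g \<epsilon> \<omega>)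
       = ((\<Sum>\<epsilon>\<in>signs I. tilt I q \<epsilon> * (\<Sum>k<n. H \<epsilon> (X k \<omega>))) - real n * (\<Sum>\<epsilon>\<in>signs I. tilt I q \<epsilon> * \<Theta> \<epsilon>)) / (5 * B)"
    proof -
      have "g \<epsilon> \<omega> = ((\<Sum>k<n. H \<epsilon> (X k \<omega>)) - real n * \<Theta> \<epsilon>) / (5 * B)" for \<epsilon>
        unfolding g_def sum_divide_distrib[symmetric] by (simp add: sum_subtractf)
      then show ?thesis
        by (simp add: right_diff_distrib sum_subtractf sum_divide_distrib[symmetric] sum_distrib_left mult.left_commute)
    qed
    have "((\<Sum>k<n. min (\<zeta> q (X k \<omega>)) B) - real n * T) / (5 * B) \<le> (\<Sum>\<epsilon>\<in>signs I. tilt I q \<epsilon> * g \<epsilon> \<omega>)"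
      unfolding E5
    proof (rule divide_right_mono)
      have "real n * (\<Sum>\<epsilon>\<in>signs I. tilt I q \<epsilon> * \<Theta> \<epsilon>) \<le> real n * T"
        using E3 unfolding T_def by (intro mult_left_mono) auto
      then show "(\<Sum>k<n. min (\<zeta> q (X k \<omega>)) B) - real n * T
        \<le> (\<Sum>\<epsilon>\<in>signs I. tilt I q \<epsilon> * (\<Sum>k<n. H \<epsilon> (X k \<omega>))) - real n * (\<Sum>\<epsilon>\<in>signs I. tilt I q \<epsilon> * \<Theta> \<epsilon>)"
        using E4 by linarith
    qed (use B in auto)
    then have "exp (((\<Sum>k<n. min (\<zeta> q (X k \<omega>)) B) - real n * T) / (5 * B) - (\<Sum>i\<in>I. (q i)\<^sup>2))
      \<le> exp ((\<Sum>\<epsilon>\<in>signs I. tilt I q \<epsilon> * g \<epsilon> \<omega>) - (\<Sum>i\<in>I. (q i)\<^sup>2))" by simp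
    also have "\<dots> \<le> W \<omega>" unfolding W_def by (rule tilt_change_of_measure[OF I q])
    finally show "exp (((\<Sum>k<n. min (\<zeta> q (X k \<omega>)) B)
           - real n * ((\<integral>x. \<zeta> q x \<partial>Q)
               + ((\<integral>x. (\<zeta> q x)\<^sup>2 \<partial>Q) + 2 * (\<Sum>i\<in>I. \<integral>x. (b i x)\<^sup>2 \<partial>Q)) / B)) / (5 * B)
          - (\<Sum>i\<in>I. (q i)\<^sup>2)) \<le> W \<omega>" by (simp add: T_def)
  qed
qed

end

text \<open>Bookkeeping for splitting a direction into \<open>N\<close> equal copies.\<close>

lemma sum_product_const:
  fixes f :: "'j \<Rightarrow> real"
  assumes "N > 0"
  shows "(\<Sum>i\<in>J \<times> {..<N}. f (fst i) / real N) = (\<Sum>j\<in>J. f j)"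
proof -
  have "(\<Sum>i\<in>J \<times> {..<N}. f (fst i) / real N) = (\<Sum>j\<in>J. \<Sum>c<N. f j / real N)"
    by (subst sum.cartesian_product) (simp add: case_prod_unfold)
  then show ?thesis using assms by simp
qed

section \<open>From the PAC-Bayes bound to a supremum over an infinite-dimensional set\<close>

context iid_sample
begin

text \<open>A union bound over the net \<open>U\<^sub>0\<close>, with the PAC-Bayes bound handling
  the differences in \<open>V\<close> around each net point. \<open>co\<close> and \<open>e\<close>
  expand a difference in directions, \<open>wt\<close> are relative prior variances and
  \<open>a\<close> is their overall scale: it trades the entropy \<open>r1 / a\<close> against the
  added variance \<open>a * D\<close>. The event must not depend on the expansion length
  \<open>m\<close>, which is why a liminf over \<open>m\<close> enters.\<close>

lemma uniform_deviation:
  fixes y :: "'q::real_normed_vector \<Rightarrow> 'x \<Rightarrow> real" and d :: "'q \<Rightarrow> 'q \<Rightarrow> 'x \<Rightarrow> real"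
    and e :: "'j \<Rightarrow> 'q" and co :: "'q \<Rightarrow> 'j \<Rightarrow> real" and wt :: "'j \<Rightarrow> real" and J :: "nat \<Rightarrow> 'j set"
  assumes fin: "finite U\<^sub>0"
    and cover: "\<And>u. u \<in> U \<Longrightarrow> \<exists>u'\<in>U\<^sub>0. u - u' \<in> V"
    and B: "B > 0" and a: "a > 0" and \<epsilon>: "\<epsilon> > 0" and t: "t \<ge> 0" "real (card U\<^sub>0) \<le> \<epsilon> * exp t"
    and J: "\<And>m. finite (J m)" and wt: "\<And>j. wt j > 0"
    and expand: "\<And>v. v \<in> V \<Longrightarrow> (\<lambda>m. \<Sum>j\<in>J m. co v j *\<^sub>R e j) \<longlonglongrightarrow> v"
    and r1: "\<And>v m. v \<in> V \<Longrightarrow> (\<Sum>j\<in>J m. (co v j)\<^sup>2 / wt j) \<le> r1"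
    and sq: "\<And>u'. u' \<in> U\<^sub>0 \<Longrightarrow> sqint Q (y u')" "\<And>u' v. u' \<in> U\<^sub>0 \<Longrightarrow> sqint Q (d u' v)"
    and lin: "\<And>u'. u' \<in> U\<^sub>0 \<Longrightarrow> AE x in Q. bounded_linear (\<lambda>v. d u' v x)"
    and tangent: "\<And>u'. u' \<in> U\<^sub>0 \<Longrightarrow> AE x in Q. \<forall>u\<in>U. y u x \<le> B \<and> y u x \<le> y u' x + d u' (u - u') x"
    and D: "\<And>u' m. u' \<in> U\<^sub>0 \<Longrightarrow> (\<Sum>j\<in>J m. wt j * (\<integral>x. (d u' (e j) x)\<^sup>2 \<partial>Q)) \<le> D"
    and mean: "\<And>u' v m. u' \<in> U\<^sub>0 \<Longrightarrow> v \<in> V \<Longrightarrow>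
        (\<integral>x. y u' x + d u' (\<Sum>j\<in>J m. co v j *\<^sub>R e j) x \<partial>Q) \<le> \<mu> u'"
    and square: "\<And>u' v m. u' \<in> U\<^sub>0 \<Longrightarrow> v \<in> V \<Longrightarrow>
        (\<integral>x. (y u' x + d u' (\<Sum>j\<in>J m. co v j *\<^sub>R e j) x)\<^sup>2 \<partial>Q) \<le> s2"
  shows "\<exists>A\<in>sets P. measure P A \<ge> 1 - \<epsilon> \<and> (\<forall>\<omega>\<in>A. \<forall>u\<in>U. \<exists>u'\<in>U\<^sub>0. u - u' \<in> V \<and>
      (\<Sum>k<n. y u (X k \<omega>)) \<le> real n * (\<mu> u' + (s2 + 2 * a * D) / B) + 5 * B * (r1 / a + t))"
proof -
  \<comment> \<open>Tilting requires \<open>\<bar>q i\<bar> < 1\<close>, but a coordinate may exceed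
    its prior scale. Splitting each direction into \<open>N'\<close> copies divides \<open>q\<close>
    by \<open>sqrt N'\<close>, while the entropy \<open>\<Sum> q\<^sup>2\<close> and the total
    energy of the copies stay the same.\<close>
  obtain N :: nat where N: "r1 / a < real N" using reals_Archimedean2 by blast
  define N' where "N' = Suc N"
  have N': "N' > 0" "r1 / a < real N'" using N by (auto simp: N'_def)
  define I where "I m = J m \<times> {..<N'}" for m
  have I: "finite (I m)" for m using J by (simp add: I_def)
  define w where "w i = sqrt (a * wt (fst i) / real N') *\<^sub>R e (fst i)" for i :: "'j \<times> nat"
  define b where "b u' i = d u' (w i)" for u' i
  define q where "q v i = co v (fst i) / sqrt (a * wt (fst i) * real N')" for v and i :: "'j \<times> nat"
  define vm where "vm v m = (\<Sum>j\<in>J m. co v j *\<^sub>R e j)" for v m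
  have pos: "a * wt j > 0" for j using a wt by simp
  have qw: "q v i *\<^sub>R w i = (co v (fst i) / real N') *\<^sub>R e (fst i)" for v i
  proof -
    have "sqrt (a * wt (fst i) / real N') / sqrt (a * wt (fst i) * real N') = 1 / real N'"
      using a wt[of "fst i"] N' by (simp add: real_sqrt_divide real_sqrt_mult)
    then have "co v (fst i) / sqrt (a * wt (fst i) * real N') * sqrt (a * wt (fst i) / real N') = co v (fst i) / real N'"
      by (simp only: times_divide_eq_left times_divide_eq_right[symmetric]) simp
    then show ?thesis unfolding q_def w_def by simp
  qed
  have sumqw: "(\<Sum>i\<in>I m. q v i *\<^sub>R w i) = vm v m" for v m
  proof -
    have "(\<Sum>i\<in>I m. q v i *\<^sub>R w i) = (\<Sum>j\<in>J m. \<Sum>c<N'. (co v j / real N') *\<^sub>R e j)"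
      unfolding I_def qw by (subst sum.cartesian_product) (simp add: case_prod_unfold)
    also have "\<dots> = vm v m" unfolding vm_def using N'
      by (intro sum.cong refl) (simp add: sum_constant_scaleR)
    finally show ?thesis .
  qed
  have q2: "(\<Sum>i\<in>I m. (q v i)\<^sup>2) = (\<Sum>j\<in>J m. (co v j)\<^sup>2 / wt j) / a" for v m
  proof -
    have "(q v i)\<^sup>2 = ((co v (fst i))\<^sup>2 / wt (fst i) / a) / real N'" for i
      unfolding q_def using pos[of "fst i"] by (simp add: power_divide real_sqrt_pow2)
    then show ?thesis unfolding I_def
      using sum_product_const[OF N'(1), of "\<lambda>j. (co v j)\<^sup>2 / wt j / a" "J m"]
      by (simp add: sum_divide_distrib)
  qed
  have q1: "\<bar>q v i\<bar> < 1" if "v \<in> V" "i \<in> I m" for v i m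
  proof -
    have "(co v (fst i))\<^sup>2 / wt (fst i) \<le> (\<Sum>j\<in>J m. (co v j)\<^sup>2 / wt j)"
      using that J wt by (intro member_le_sum) (auto simp: I_def less_imp_le)
    also have "\<dots> \<le> r1" by (rule r1[OF that(1)])
    finally have "(co v (fst i))\<^sup>2 / wt (fst i) / a \<le> r1 / a" using a by (intro divide_right_mono) auto
    then have "(co v (fst i))\<^sup>2 / wt (fst i) / a < real N'" using N' by linarith
    then have "(co v (fst i))\<^sup>2 / wt (fst i) / a / real N' < 1"
      using N'(1) by (subst divide_less_eq_1_pos) auto
    moreover have "(q v i)\<^sup>2 = (co v (fst i))\<^sup>2 / wt (fst i) / a / real N'"
      unfolding q_def using pos[of "fst i"] by (simp add: power_divide real_sqrt_pow2)
    ultimately have "(q v i)\<^sup>2 < 1" by linarith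
    then show ?thesis by (simp add: abs_square_less_1)
  qed
  have bsq: "sqint Q (b u' i)" if "u' \<in> U\<^sub>0" for u' i
    unfolding b_def by (rule sq(2)[OF that])
  have b2: "(\<Sum>i\<in>I m. \<integral>x. (b u' i x)\<^sup>2 \<partial>Q) \<le> a * D" if "u' \<in> U\<^sub>0" for u' m
  proof -
    have "(\<integral>x. (b u' i x)\<^sup>2 \<partial>Q) = a * (wt (fst i) * (\<integral>x. (d u' (e (fst i)) x)\<^sup>2 \<partial>Q)) / real N'" for i
    proof -
      have "(\<integral>x. (b u' i x)\<^sup>2 \<partial>Q) = (\<integral>x. a * wt (fst i) / real N' * (d u' (e (fst i)) x)\<^sup>2 \<partial>Q)"
      proof (rule integral_cong_AE)
        show "AE x in Q. (b u' i x)\<^sup>2 = a * wt (fst i) / real N' * (d u' (e (fst i)) x)\<^sup>2"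
          using lin[OF that]
        proof eventually_elim
          case (elim x)
          interpret bounded_linear "\<lambda>v. d u' v x" by (rule elim)
          show ?case unfolding b_def w_def scaleR
            using pos[of "fst i"] by (simp add: power_mult_distrib real_sqrt_pow2)
        qed
      qed (use sqint_measurable[OF sq(2)[OF that]] sqint_measurable[OF bsq[OF that]] in auto)
      then show ?thesis by simp
    qed
    then have "(\<Sum>i\<in>I m. \<integral>x. (b u' i x)\<^sup>2 \<partial>Q) = (\<Sum>j\<in>J m. a * (wt j * (\<integral>x. (d u' (e j) x)\<^sup>2 \<partial>Q)))"
      unfolding I_def
      using sum_product_const[OF N'(1), of "\<lambda>j. a * (wt j * (\<integral>x. (d u' (e j) x)\<^sup>2 \<partial>Q))" "J m"] by simp
    also have "\<dots> \<le> a * D" using D[OF that] a by (simp add: sum_distrib_left[symmetric])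
    finally show ?thesis .
  qed
  define \<zeta> where "\<zeta> u' m v x = y u' x + (\<Sum>i\<in>I m. q v i * b u' i x)" for u' m v x
  have \<zeta>lin: "\<zeta> u' m v x = y u' x + d u' (vm v m) x" if "bounded_linear (\<lambda>v. d u' v x)" for u' m v x
  proof -
    interpret bounded_linear "\<lambda>v. d u' v x" by (rule that)
    show ?thesis unfolding \<zeta>_def b_def sumqw[symmetric] by (simp add: sum scaleR)
  qed
  have \<zeta>sq: "sqint Q (\<zeta> u' m v)" if "u' \<in> U\<^sub>0" for u' m v
    unfolding \<zeta>_def by (intro sqint_add sqint_sum sqint_cmult sq(1) bsq that)
  have \<zeta>int: "(\<integral>x. \<zeta> u' m v x \<partial>Q) \<le> \<mu> u'" "(\<integral>x. (\<zeta> u' m v x)\<^sup>2 \<partial>Q) \<le> s2"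
    if "u' \<in> U\<^sub>0" "v \<in> V" for u' m v
  proof -
    have ae: "AE x in Q. \<zeta> u' m v x = y u' x + d u' (vm v m) x"
      using lin[OF that(1)] by eventually_elim (rule \<zeta>lin)
    note ms = sqint_measurable[OF \<zeta>sq[OF that(1)]] sqint_measurable[OF sq(1)[OF that(1)]]
      sqint_measurable[OF sq(2)[OF that(1)]]
    have "(\<integral>x. \<zeta> u' m v x \<partial>Q) = (\<integral>x. y u' x + d u' (vm v m) x \<partial>Q)"
      using ae ms by (intro integral_cong_AE) auto
    then show "(\<integral>x. \<zeta> u' m v x \<partial>Q) \<le> \<mu> u'" using mean[OF that] by (simp add: vm_def)
    have "(\<integral>x. (\<zeta> u' m v x)\<^sup>2 \<partial>Q) = (\<integral>x. (y u' x + d u' (vm v m) x)\<^sup>2 \<partial>Q)"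
      using ae ms by (intro integral_cong_AE) auto
    then show "(\<integral>x. (\<zeta> u' m v x)\<^sup>2 \<partial>Q) \<le> s2" using square[OF that] by (simp add: vm_def)
  qed
  \<comment> \<open>The majorant may depend on the net point and on \<open>m\<close>, but serves all
    \<open>v\<close> in \<open>V\<close> at once.\<close>
  define good where "good u' m W \<longleftrightarrow>
    W \<in> borel_measurable P \<and> (\<forall>\<omega>. W \<omega> \<ge> 0) \<and> (\<integral>\<^sup>+\<omega>. ennreal (W \<omega>) \<partial>P) \<le> 1 \<and>
    (\<forall>\<omega>. \<forall>v\<in>V. (\<Sum>k<n. min (\<zeta> u' m v (X k \<omega>)) B) \<le> real n * (\<mu> u' + (s2 + 2 * a * D) / B)
        + 5 * B * (r1 / a + ln (W \<omega>)) \<and> W \<omega> > 0)" for u' m W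
  have ex: "\<exists>W. good u' m W" if u': "u' \<in> U\<^sub>0" for u' m
  proof -
    obtain W where W: "W \<in> borel_measurable P" "\<And>\<omega>. W \<omega> \<ge> 0" "(\<integral>\<^sup>+\<omega>. ennreal (W \<omega>) \<partial>P) \<le> 1"
    "\<And>\<omega> q'. (\<And>i. i \<in> I m \<Longrightarrow> \<bar>q' i\<bar> < 1) \<Longrightarrow>
       exp (((\<Sum>k<n. min (y u' (X k \<omega>) + (\<Sum>i\<in>I m. q' i * b u' i (X k \<omega>))) B)
           - real n * ((\<integral>x. y u' x + (\<Sum>i\<in>I m. q' i * b u' i x) \<partial>Q)
               + ((\<integral>x. (y u' x + (\<Sum>i\<in>I m. q' i * b u' i x))\<^sup>2 \<partial>Q)
                  + 2 * (\<Sum>i\<in>I m. \<integral>x. (b u' i x)\<^sup>2 \<partial>Q)) / B)) / (5 * B)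
          - (\<Sum>i\<in>I m. (q' i)\<^sup>2)) \<le> W \<omega>"
      using pac_bayes[OF I B sq(1)[OF u'] bsq[OF u'], of m "\<lambda>i. i" n] by blast
    have "(\<Sum>k<n. min (\<zeta> u' m v (X k \<omega>)) B) \<le> real n * (\<mu> u' + (s2 + 2 * a * D) / B)
        + 5 * B * (r1 / a + ln (W \<omega>)) \<and> W \<omega> > 0" if v: "v \<in> V" for \<omega> v
    proof
      define S where "S = (\<Sum>k<n. min (\<zeta> u' m v (X k \<omega>)) B)"
      define T where "T = (\<integral>x. \<zeta> u' m v x \<partial>Q)
               + ((\<integral>x. (\<zeta> u' m v x)\<^sup>2 \<partial>Q) + 2 * (\<Sum>i\<in>I m. \<integral>x. (b u' i x)\<^sup>2 \<partial>Q)) / B"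
      have *: "exp ((S - real n * T) / (5 * B) - (\<Sum>i\<in>I m. (q v i)\<^sup>2)) \<le> W \<omega>"
        using W(4)[of "q v" \<omega>, OF q1[OF v]] unfolding S_def T_def \<zeta>_def .
      then show Wp: "W \<omega> > 0" using exp_gt_zero by (rule less_le_trans[rotated])
      from * have "(S - real n * T) / (5 * B) - (\<Sum>i\<in>I m. (q v i)\<^sup>2) \<le> ln (W \<omega>)"
        using Wp by (simp add: ln_ge_iff)
      moreover have "(\<Sum>i\<in>I m. (q v i)\<^sup>2) \<le> r1 / a"
        unfolding q2 using r1[OF v] a by (intro divide_right_mono) auto
      ultimately have "(S - real n * T) / (5 * B) \<le> r1 / a + ln (W \<omega>)" by linarith
      then have "S - real n * T \<le> 5 * B * (r1 / a + ln (W \<omega>))"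
        using B by (simp add: divide_le_eq mult.commute)
      moreover have "T \<le> \<mu> u' + (s2 + 2 * a * D) / B"
        unfolding T_def using \<zeta>int[OF u' v, of m] b2[OF u', of m] B
        by (intro add_mono divide_right_mono) auto
      then have "real n * T \<le> real n * (\<mu> u' + (s2 + 2 * a * D) / B)" by (intro mult_left_mono) auto
      ultimately show "S \<le> real n * (\<mu> u' + (s2 + 2 * a * D) / B) + 5 * B * (r1 / a + ln (W \<omega>))"
        by linarith
    qed
    then show ?thesis using W(1-3) unfolding good_def by blast
  qed
  define W where "W m u' = (SOME W. good u' m W)" for m u'
  have "good u' m (W m u')" if "u' \<in> U\<^sub>0" for u' m
    unfolding W_def using ex[OF that] by (rule someI_ex)
  then have W: "\<And>u' m. u' \<in> U\<^sub>0 \<Longrightarrow> W m u' \<in> borel_measurable P"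
    "\<And>u' m \<omega>. u' \<in> U\<^sub>0 \<Longrightarrow> W m u' \<omega> \<ge> 0" "\<And>u' m. u' \<in> U\<^sub>0 \<Longrightarrow> (\<integral>\<^sup>+\<omega>. ennreal (W m u' \<omega>) \<partial>P) \<le> 1"
    "\<And>u' m \<omega> v. u' \<in> U\<^sub>0 \<Longrightarrow> v \<in> V \<Longrightarrow> (\<Sum>k<n. min (\<zeta> u' m v (X k \<omega>)) B)
       \<le> real n * (\<mu> u' + (s2 + 2 * a * D) / B) + 5 * B * (r1 / a + ln (W m u' \<omega>)) \<and> W m u' \<omega> > 0"
    unfolding good_def by blast+
  define S where "S m \<omega> = (\<Sum>u'\<in>U\<^sub>0. ennreal (W m u' \<omega>))" for m \<omega>
  have Sm[measurable]: "S m \<in> borel_measurable P" for m unfolding S_def using W(1) by measurable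
  have Sint: "(\<integral>\<^sup>+\<omega>. S m \<omega> \<partial>P) \<le> of_nat (card U\<^sub>0)" for m
  proof -
    have "(\<integral>\<^sup>+\<omega>. S m \<omega> \<partial>P) = (\<Sum>u'\<in>U\<^sub>0. \<integral>\<^sup>+\<omega>. ennreal (W m u' \<omega>) \<partial>P)"
      unfolding S_def using W(1) by (intro nn_integral_sum) auto
    also have "\<dots> \<le> (\<Sum>u'\<in>U\<^sub>0. 1)" using W(3) by (intro sum_mono) auto
    finally show ?thesis by simp
  qed
  \<comment> \<open>By Fatou's lemma the liminf has mean at most \<open>card U\<^sub>0\<close>, so
    Markov's inequality at level \<open>exp t\<close> costs probability at most
    \<open>card U\<^sub>0 * exp (- t) \<le> \<epsilon>\<close>.\<close>
  define L where "L \<omega> = liminf (\<lambda>m. S m \<omega>)" for \<omega>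
  have [measurable]: "L \<in> borel_measurable P" unfolding L_def by measurable
  have Lint: "(\<integral>\<^sup>+\<omega>. L \<omega> \<partial>P) \<le> of_nat (card U\<^sub>0)"
  proof -
    have "(\<integral>\<^sup>+\<omega>. L \<omega> \<partial>P) \<le> liminf (\<lambda>m. \<integral>\<^sup>+\<omega>. S m \<omega> \<partial>P)"
      unfolding L_def by (rule nn_integral_liminf) simp
    also have "\<dots> \<le> liminf (\<lambda>m. of_nat (card U\<^sub>0))"
      by (intro Liminf_mono) (simp add: Sint)
    finally show ?thesis by (simp add: Liminf_const)
  qed
  define A where "A = {\<omega>\<in>space P. L \<omega> < ennreal (exp t)}"
  have A[measurable]: "A \<in> sets P" unfolding A_def by measurable
  have PA: "measure P A \<ge> 1 - \<epsilon>"
  proof -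
    have "emeasure P {\<omega>\<in>space P. ennreal (exp t) \<le> L \<omega>} = (\<integral>\<^sup>+\<omega>. indicator {\<omega>\<in>space P. ennreal (exp t) \<le> L \<omega>} \<omega> \<partial>P)"
      by simp
    also have "\<dots> \<le> (\<integral>\<^sup>+\<omega>. ennreal (exp (- t)) * L \<omega> \<partial>P)"
    proof (intro nn_integral_mono)
      fix \<omega>
      show "indicator {\<omega>\<in>space P. ennreal (exp t) \<le> L \<omega>} \<omega> \<le> ennreal (exp (- t)) * L \<omega>"
      proof (cases "ennreal (exp t) \<le> L \<omega>")
        case True
        have "1 = ennreal (exp (- t)) * ennreal (exp t)" by (simp add: ennreal_mult[symmetric] exp_add[symmetric])
        also have "\<dots> \<le> ennreal (exp (- t)) * L \<omega>" using True by (intro mult_left_mono) auto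
        finally show ?thesis by (auto simp: indicator_def)
      qed (simp add: indicator_def)
    qed
    also have "\<dots> = ennreal (exp (- t)) * (\<integral>\<^sup>+\<omega>. L \<omega> \<partial>P)" by (rule nn_integral_cmult) simp
    also have "\<dots> \<le> ennreal (exp (- t)) * of_nat (card U\<^sub>0)" using Lint by (intro mult_left_mono) auto
    also have "\<dots> = ennreal (exp (- t) * real (card U\<^sub>0))" by (simp add: ennreal_mult ennreal_of_nat_eq_real_of_nat)
    also have "\<dots> \<le> ennreal \<epsilon>"
    proof (rule ennreal_leI)
      have "exp (- t) * real (card U\<^sub>0) \<le> exp (- t) * (\<epsilon> * exp t)" using t by (intro mult_left_mono) auto
      also have "\<dots> = \<epsilon>" by (simp add: mult.left_commute[of _ \<epsilon>] exp_add[symmetric])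
      finally show "exp (- t) * real (card U\<^sub>0) \<le> \<epsilon>" .
    qed
    finally have "prob {\<omega>\<in>space P. ennreal (exp t) \<le> L \<omega>} \<le> \<epsilon>"
      using \<epsilon> by (simp add: emeasure_eq_measure)
    moreover have "A = space P - {\<omega>\<in>space P. ennreal (exp t) \<le> L \<omega>}" by (auto simp: A_def)
    ultimately show ?thesis using prob_compl[of "{\<omega>\<in>space P. ennreal (exp t) \<le> L \<omega>}"] by simp
  qed
  have sample: "AE \<omega> in P. \<forall>u'\<in>U\<^sub>0. \<forall>k. bounded_linear (\<lambda>v. d u' v (X k \<omega>)) \<and>
      (\<forall>u\<in>U. y u (X k \<omega>) \<le> B \<and> y u (X k \<omega>) \<le> y u' (X k \<omega>) + d u' (u - u') (X k \<omega>))"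
  proof (rule AE_finite_allI[OF fin])
    fix u' assume u': "u' \<in> U\<^sub>0"
    have "AE x in Q. bounded_linear (\<lambda>v. d u' v x) \<and> (\<forall>u\<in>U. y u x \<le> B \<and> y u x \<le> y u' x + d u' (u - u') x)"
      using lin[OF u'] tangent[OF u'] by eventually_elim simp
    then show "AE \<omega> in P. \<forall>k. bounded_linear (\<lambda>v. d u' v (X k \<omega>)) \<and>
      (\<forall>u\<in>U. y u (X k \<omega>) \<le> B \<and> y u (X k \<omega>) \<le> y u' (X k \<omega>) + d u' (u - u') (X k \<omega>))"
      by (rule AE_sample)
  qed
  from sample obtain Z where Z: "Z \<in> null_sets P" "\<And>\<omega>. \<omega> \<in> space P - Z \<Longrightarrow>
      \<forall>u'\<in>U\<^sub>0. \<forall>k. bounded_linear (\<lambda>v. d u' v (X k \<omega>)) \<and>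
      (\<forall>u\<in>U. y u (X k \<omega>) \<le> B \<and> y u (X k \<omega>) \<le> y u' (X k \<omega>) + d u' (u - u') (X k \<omega>))"
    by (elim AE_E3) blast
  show ?thesis
  proof (intro bexI[of _ "A - Z"] conjI ballI)
    show "A - Z \<in> sets P" using Z(1) by auto
    show "measure P (A - Z) \<ge> 1 - \<epsilon>" using PA measure_Diff_null_set[OF A Z(1)] by simp
    fix \<omega> u assume \<omega>: "\<omega> \<in> A - Z" and u: "u \<in> U"
    obtain u' where u': "u' \<in> U\<^sub>0" "u - u' \<in> V" using cover[OF u] by auto
    define v where "v = u - u'"
    have \<omega>g: "\<omega> \<in> space P - Z" using \<omega> by (auto simp: A_def)
    have bl: "bounded_linear (\<lambda>v. d u' v (X k \<omega>))" for k using Z(2)[OF \<omega>g] u'(1) by blast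
    have tg: "y u (X k \<omega>) \<le> B" "y u (X k \<omega>) \<le> y u' (X k \<omega>) + d u' v (X k \<omega>)" for k
      using Z(2)[OF \<omega>g] u'(1) u unfolding v_def by blast+
    define R where "R = real n * (\<mu> u' + (s2 + 2 * a * D) / B) + 5 * B * (r1 / a + t)"
    have lim: "(\<lambda>m. \<Sum>k<n. min (\<zeta> u' m v (X k \<omega>)) B) \<longlonglongrightarrow> (\<Sum>k<n. min (y u' (X k \<omega>) + d u' v (X k \<omega>)) B)"
    proof (intro tendsto_sum tendsto_min tendsto_const)
      fix k
      have "(\<lambda>m. d u' (vm v m) (X k \<omega>)) \<longlonglongrightarrow> d u' v (X k \<omega>)"
        using bounded_linear.tendsto[OF bl expand[OF u'(2)]] unfolding vm_def v_def .
      then show "(\<lambda>m. \<zeta> u' m v (X k \<omega>)) \<longlonglongrightarrow> y u' (X k \<omega>) + d u' v (X k \<omega>)"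
        unfolding \<zeta>lin[OF bl] by (intro tendsto_add tendsto_const)
    qed
    \<comment> \<open>A liminf below \<open>exp t\<close> gives the bound for infinitely many
      \<open>m\<close> only; as the left-hand sides converge in \<open>m\<close>, that is
      enough.\<close>
    have freq: "\<exists>\<^sub>F m in sequentially. (\<Sum>k<n. min (\<zeta> u' m v (X k \<omega>)) B) \<le> R"
    proof -
      have "\<not> (\<forall>\<^sub>F m in sequentially. ennreal (exp t) \<le> S m \<omega>)"
      proof
        assume "\<forall>\<^sub>F m in sequentially. ennreal (exp t) \<le> S m \<omega>"
        then have "ennreal (exp t) \<le> L \<omega>" unfolding L_def by (rule Liminf_bounded)
        then show False using \<omega> by (auto simp: A_def)
      qed
      then have "\<exists>\<^sub>F m in sequentially. S m \<omega> < ennreal (exp t)"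
        by (simp add: frequently_def not_less)
      then show ?thesis
      proof (rule frequently_elim1)
        fix m assume "S m \<omega> < ennreal (exp t)"
        moreover have "ennreal (W m u' \<omega>) \<le> S m \<omega>" unfolding S_def
          using fin u'(1) by (intro member_le_sum) auto
        ultimately have "ennreal (W m u' \<omega>) < ennreal (exp t)" by (rule le_less_trans[rotated])
        then have "W m u' \<omega> < exp t" using W(2)[OF u'(1)] by (simp add: ennreal_less_iff)
        moreover note w4 = W(4)[OF u'(1) u'(2), of m \<omega>]
        ultimately have "ln (W m u' \<omega>) \<le> t"
          by (metis less_imp_le ln_exp ln_less_cancel_iff exp_gt_zero)
        then have "5 * B * (r1 / a + ln (W m u' \<omega>)) \<le> 5 * B * (r1 / a + t)"
          using B by (intro mult_left_mono) auto
        then show "(\<Sum>k<n. min (\<zeta> u' m v (X k \<omega>)) B) \<le> R"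
          unfolding R_def v_def using w4 by linarith
      qed
    qed
    have "(\<Sum>k<n. min (y u' (X k \<omega>) + d u' v (X k \<omega>)) B) \<le> R"
    proof (rule ccontr)
      assume "\<not> ?thesis"
      then have "\<forall>\<^sub>F m in sequentially. R < (\<Sum>k<n. min (\<zeta> u' m v (X k \<omega>)) B)"
        by (intro order_tendstoD(1)[OF lim]) simp
      then show False using freq by (simp add: frequently_def not_le)
    qed
    \<comment> \<open>Here one-sidedness pays: \<open>y u\<close> lies below both the tangent and
      the constant \<open>B\<close>, so below their minimum.\<close>
    moreover have "(\<Sum>k<n. y u (X k \<omega>)) \<le> (\<Sum>k<n. min (y u' (X k \<omega>) + d u' v (X k \<omega>)) B)"
      using tg by (intro sum_mono) simp
    ultimately show "\<exists>u'\<in>U\<^sub>0. u - u' \<in> V \<and>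
      (\<Sum>k<n. y u (X k \<omega>)) \<le> real n * (\<mu> u' + (s2 + 2 * a * D) / B) + 5 * B * (r1 / a + t)"
      using u' unfolding R_def by (intro bexI[of _ u']) auto
  qed
qed

end

subsection \<open>Covering numbers\<close>

lemma sum_half_power_abs: "(\<Sum>j = - int L..int L. (1 / 2 :: real) ^ nat \<bar>j\<bar>) \<le> 3"
proof -
  have "(\<Sum>j = - int L..int L. (1 / 2 :: real) ^ nat \<bar>j\<bar>) = 3 - 2 * (1 / 2) ^ L"
  proof (induction L)
    case (Suc L)
    have "{- int (Suc L)..int (Suc L)} = insert (- int (Suc L)) (insert (int (Suc L)) {- int L..int L})"
      by auto
    then show ?case using Suc by (simp add: nat_add_distrib)
  qed simp
  then show ?thesis by simp
qed

lemma abs_le_square_int: "\<bar>k\<bar> \<le> (k :: int)\<^sup>2"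
proof (cases "k = 0")
  case False
  then have "\<bar>k\<bar> * 1 \<le> \<bar>k\<bar> * \<bar>k\<bar>" by (intro mult_left_mono) auto
  then show ?thesis by (simp add: power2_eq_square)
qed simp

text \<open>Each point satisfies \<open>1 \<le> exp (R - \<Sum> k\<^sup>2)\<close>. Relaxing
  \<open>exp (- k\<^sup>2)\<close> to \<open>(1 / 2) ^ \<bar>k\<bar>\<close>, which is possible for
  integers, and summing over a box lets the count factorize; each factor is at most
  \<open>3 \<le> exp 2\<close>.\<close>

lemma card_lattice_ball:
  assumes T: "finite T" and K: "K \<subseteq> PiE T (\<lambda>_. UNIV :: int set)"
    and sq: "\<And>k. k \<in> K \<Longrightarrow> (\<Sum>t\<in>T. (real_of_int (k t))\<^sup>2) \<le> R"
  shows "finite K \<and> real (card K) \<le> exp (R + 2 * real (card T))"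
proof -
  define L where "L = nat \<lceil>R\<rceil>"
  have kL: "k t \<in> {- int L..int L}" if "k \<in> K" "t \<in> T" for k t
  proof -
    have "real_of_int \<bar>k t\<bar> \<le> real_of_int ((k t)\<^sup>2)" by (simp only: of_int_le_iff abs_le_square_int)
    then have "real_of_int \<bar>k t\<bar> \<le> (real_of_int (k t))\<^sup>2" by simp
    also have "\<dots> \<le> (\<Sum>t\<in>T. (real_of_int (k t))\<^sup>2)"
      using T that(2) by (intro member_le_sum) auto
    also have "\<dots> \<le> R" by (rule sq[OF that(1)])
    finally have "\<bar>k t\<bar> \<le> \<lceil>R\<rceil>" by linarith
    then have "\<bar>k t\<bar> \<le> int L" unfolding L_def by linarith
    then show ?thesis by auto
  qed
  define S where "S = PiE T (\<lambda>_. {- int L..int L})"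
  have KS: "K \<subseteq> S" using K kL unfolding S_def by (auto simp: PiE_iff subset_iff)
  have finS: "finite S" unfolding S_def using T by (intro finite_PiE) auto
  have finK: "finite K" using KS finS by (rule finite_subset)
  have "real (card K) \<le> (\<Sum>k\<in>K. exp R * (\<Prod>t\<in>T. (1 / 2) ^ nat \<bar>k t\<bar>))"
  proof -
    have "1 \<le> exp R * (\<Prod>t\<in>T. (1 / 2 :: real) ^ nat \<bar>k t\<bar>)" if "k \<in> K" for k
    proof -
      have "exp (- R) \<le> exp (\<Sum>t\<in>T. - (real_of_int (k t))\<^sup>2)" using sq[OF that] by (simp add: sum_negf)
      also have "\<dots> = (\<Prod>t\<in>T. exp (- (real_of_int (k t))\<^sup>2))" by (simp add: exp_sum[OF T])
      also have "\<dots> \<le> (\<Prod>t\<in>T. (1 / 2) ^ nat \<bar>k t\<bar>)"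
      proof (intro prod_mono conjI)
        fix t
        have e: "exp (- 1 :: real) \<le> 1 / 2"
        proof -
          have "2 \<le> exp (1 :: real)" using exp_ge_add_one_self[of 1] by simp
          then show ?thesis by (simp add: exp_minus field_simps)
        qed
        have "real (nat \<bar>k t\<bar>) \<le> (real_of_int (k t))\<^sup>2"
        proof -
          have "real_of_int \<bar>k t\<bar> \<le> real_of_int ((k t)\<^sup>2)" by (simp only: of_int_le_iff abs_le_square_int)
          then show ?thesis by simp
        qed
        then have "exp (- (real_of_int (k t))\<^sup>2) \<le> exp (real (nat \<bar>k t\<bar>) * (- 1))" by simp
        also have "\<dots> = exp (- 1) ^ nat \<bar>k t\<bar>" by (rule exp_of_nat_mult)
        also have "\<dots> \<le> (1 / 2) ^ nat \<bar>k t\<bar>" using e by (intro power_mono) auto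
        finally show "exp (- (real_of_int (k t))\<^sup>2) \<le> (1 / 2) ^ nat \<bar>k t\<bar>" .
      qed simp
      finally have "exp R * exp (- R) \<le> exp R * (\<Prod>t\<in>T. (1 / 2) ^ nat \<bar>k t\<bar>)" by (intro mult_left_mono) auto
      then show ?thesis by (simp add: exp_add[symmetric])
    qed
    then have "(\<Sum>k\<in>K. 1) \<le> (\<Sum>k\<in>K. exp R * (\<Prod>t\<in>T. (1 / 2) ^ nat \<bar>k t\<bar>))" by (rule sum_mono)
    then show ?thesis by simp
  qed
  also have "\<dots> \<le> (\<Sum>k\<in>S. exp R * (\<Prod>t\<in>T. (1 / 2) ^ nat \<bar>k t\<bar>))"
    using KS finS by (intro sum_mono2) (auto intro!: mult_nonneg_nonneg prod_nonneg)
  also have "\<dots> = exp R * (\<Prod>t\<in>T. \<Sum>j = - int L..int L. (1 / 2) ^ nat \<bar>j\<bar>)"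
    unfolding S_def by (subst prod_sum_PiE) (use T in \<open>auto simp: sum_distrib_left\<close>)
  also have "\<dots> \<le> exp R * (\<Prod>t\<in>T. 3)"
    by (intro mult_left_mono prod_mono conjI sum_half_power_abs sum_nonneg) auto
  also have "\<dots> \<le> exp R * exp (2 * real (card T))"
  proof -
    have "(3 :: real) \<le> exp 2" using exp_ge_add_one_self[of 2] by simp
    then have "3 ^ card T \<le> exp (2 :: real) ^ card T" by (intro power_mono) auto
    then show ?thesis by (simp add: exp_of_nat_mult[symmetric] mult.commute)
  qed
  finally show ?thesis using finK by (simp add: exp_add)
qed

text \<open>Coordinates are rounded to a grid and one member of \<open>U\<close> is kept per
  occupied cell, so that the net lies in \<open>U\<close> itself. The cardinality bound is free of
  \<open>R\<close> and exponential in the number of coordinates.\<close>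

lemma ellipsoid_net:
  fixes x :: "'u \<Rightarrow> 't \<Rightarrow> real"
  assumes T: "finite T" "T \<noteq> {}" and \<eta>: "\<eta> > 0" and R: "R > 0"
    and U: "\<And>u. u \<in> U \<Longrightarrow> (\<Sum>t\<in>T. (x u t)\<^sup>2) \<le> R\<^sup>2"
  obtains U\<^sub>0 where "U\<^sub>0 \<subseteq> U" "finite U\<^sub>0" "real (card U\<^sub>0) \<le> exp ((2 / \<eta>\<^sup>2 + 4) * real (card T))"
    "\<And>u. u \<in> U \<Longrightarrow> \<exists>u'\<in>U\<^sub>0. (\<Sum>t\<in>T. (x u t - x u' t)\<^sup>2) \<le> \<eta>\<^sup>2 * R\<^sup>2"
proof -
  define D where "D = real (card T)"
  have D: "D > 0" using T by (simp add: D_def card_gt_0_iff)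
  \<comment> \<open>Mesh \<open>1 / s\<close>: \<open>card T\<close> coordinate errors of at most
    \<open>1 / s\<close> add up to at most \<open>\<eta>\<^sup>2 * R\<^sup>2\<close> in squared
    length.\<close>
  define s where "s = sqrt D / (\<eta> * R)"
  have s: "s > 0" "s\<^sup>2 = D / (\<eta>\<^sup>2 * R\<^sup>2)" using D \<eta> R by (auto simp: s_def power_divide power_mult_distrib)
  define k where "k u = (\<lambda>t\<in>T. \<lfloor>x u t * s\<rfloor>)" for u
  define K where "K = k ` U"
  have K: "finite K \<and> real (card K) \<le> exp ((2 / \<eta>\<^sup>2 * D + 2 * D) + 2 * real (card T))"
  proof (rule card_lattice_ball[OF T(1)])
    show "K \<subseteq> PiE T (\<lambda>_. UNIV)" by (auto simp: K_def k_def)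
    fix c assume "c \<in> K"
    then obtain u where u: "u \<in> U" "c = k u" by (auto simp: K_def)
    have "(\<Sum>t\<in>T. (real_of_int (c t))\<^sup>2) \<le> (\<Sum>t\<in>T. 2 * s\<^sup>2 * (x u t)\<^sup>2 + 2)"
    proof (rule sum_mono)
      fix t assume t: "t \<in> T"
      define z where "z = x u t * s"
      define f where "f = z - real_of_int \<lfloor>z\<rfloor>"
      have f: "0 \<le> f" "f \<le> 1" unfolding f_def by linarith+
      have "(real_of_int \<lfloor>z\<rfloor>)\<^sup>2 = (z - f)\<^sup>2" by (simp add: f_def)
      also have "\<dots> \<le> 2 * z\<^sup>2 + 2 * f\<^sup>2"
      proof -
        have "0 \<le> (z + f)\<^sup>2" by simp
        then show ?thesis by (simp add: power2_eq_square algebra_simps)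
      qed
      also have "\<dots> \<le> 2 * z\<^sup>2 + 2" using f by (simp add: power_le_one)
      finally show "(real_of_int (c t))\<^sup>2 \<le> 2 * s\<^sup>2 * (x u t)\<^sup>2 + 2"
        using t u(2) by (simp add: k_def z_def power_mult_distrib mult_ac)
    qed
    also have "\<dots> = 2 * s\<^sup>2 * (\<Sum>t\<in>T. (x u t)\<^sup>2) + 2 * D"
      by (simp add: sum.distrib sum_distrib_left[symmetric] D_def)
    also have "\<dots> \<le> 2 * s\<^sup>2 * R\<^sup>2 + 2 * D"
      using U[OF u(1)] by (intro add_right_mono mult_left_mono) auto
    also have "\<dots> = 2 / \<eta>\<^sup>2 * D + 2 * D" using s(2) R by simp
    finally show "(\<Sum>t\<in>T. (real_of_int (c t))\<^sup>2) \<le> 2 / \<eta>\<^sup>2 * D + 2 * D" .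
  qed
  define rep where "rep c = (SOME u. u \<in> U \<and> k u = c)" for c
  have rep: "rep c \<in> U \<and> k (rep c) = c" if "c \<in> K" for c
    unfolding rep_def by (rule someI_ex) (use that in \<open>auto simp: K_def\<close>)
  show thesis
  proof (rule that[of "rep ` K"])
    show "rep ` K \<subseteq> U" using rep by auto
    show "finite (rep ` K)" using K by simp
    have "real (card (rep ` K)) \<le> real (card K)" using K by (simp add: card_image_le)
    also have "\<dots> \<le> exp ((2 / \<eta>\<^sup>2 * D + 2 * D) + 2 * real (card T))" using K by simp
    also have "(2 / \<eta>\<^sup>2 * D + 2 * D) + 2 * real (card T) = (2 / \<eta>\<^sup>2 + 4) * real (card T)"
      by (simp add: D_def algebra_simps)
    finally show "real (card (rep ` K)) \<le> exp ((2 / \<eta>\<^sup>2 + 4) * real (card T))" .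
    fix u assume u: "u \<in> U"
    define u' where "u' = rep (k u)"
    have "k u \<in> K" using u by (simp add: K_def)
    then have u': "u' \<in> rep ` K" "k u' = k u" using rep by (auto simp: u'_def)
    have "(\<Sum>t\<in>T. (x u t - x u' t)\<^sup>2) \<le> (\<Sum>t\<in>T. 1 / s\<^sup>2)"
    proof (rule sum_mono)
      fix t assume t: "t \<in> T"
      have "\<lfloor>x u t * s\<rfloor> = \<lfloor>x u' t * s\<rfloor>" using fun_cong[OF u'(2), of t] t by (simp add: k_def)
      then have "\<bar>x u t * s - x u' t * s\<bar> \<le> 1" by linarith
      then have "\<bar>x u t * s - x u' t * s\<bar>\<^sup>2 \<le> 1\<^sup>2" by (intro power_mono) auto
      then have "((x u t - x u' t) * s)\<^sup>2 \<le> 1" unfolding left_diff_distrib by simp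
      then have "(x u t - x u' t)\<^sup>2 * s\<^sup>2 \<le> 1" unfolding power_mult_distrib .
      then show "(x u t - x u' t)\<^sup>2 \<le> 1 / s\<^sup>2" using s(1) by (subst pos_le_divide_eq) auto
    qed
    also have "\<dots> = D / s\<^sup>2" by (simp add: D_def)
    also have "\<dots> = \<eta>\<^sup>2 * R\<^sup>2" using s(2) D by simp
    finally show "\<exists>u'\<in>rep ` K. (\<Sum>t\<in>T. (x u t - x u' t)\<^sup>2) \<le> \<eta>\<^sup>2 * R\<^sup>2" using u'(1) by blast
  qed
qed

subsection \<open>Effective dimension\<close>

text \<open>The mean value theorem for \<open>x powr (1 - r)\<close>, used as a discrete integral
  comparison.\<close>

lemma powr_telescope:
  fixes x r :: real assumes "x > 0" "r > 1"
  shows "(r - 1) * (x + 1) powr (- r) \<le> x powr (1 - r) - (x + 1) powr (1 - r)"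
proof -
  have "\<exists>z. x < z \<and> z < x + 1 \<and>
      (x + 1) powr (1 - r) - x powr (1 - r) = (x + 1 - x) * ((1 - r) * z powr (1 - r - 1))"
    by (rule MVT2) (use assms in \<open>auto intro!: has_real_derivative_powr[THEN DERIV_cong]\<close>)
  then obtain z where z: "x < z" "z < x + 1" "(x + 1) powr (1 - r) - x powr (1 - r) = (1 - r) * z powr (- r)"
    by auto
  have "(x + 1) powr (- r) \<le> z powr (- r)" using z assms by (intro powr_mono2') auto
  then have "(r - 1) * (x + 1) powr (- r) \<le> (r - 1) * z powr (- r)" using assms by (intro mult_left_mono) auto
  also have "\<dots> = x powr (1 - r) - (x + 1) powr (1 - r)" using z(3) by (simp add: algebra_simps)
  finally show ?thesis .
qed

lemma sum_powr_tail:
  assumes "r > 1" "N \<ge> 1"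
  shows "(\<Sum>\<nu> = Suc N..m. real \<nu> powr (- r)) \<le> real N powr (1 - r) / (r - 1)"
proof -
  have "(\<Sum>\<nu> = Suc N..m. real \<nu> powr (- r)) \<le> (real N powr (1 - r) - real m powr (1 - r)) / (r - 1)" if "m \<ge> N"
    using that
  proof (induction m rule: dec_induct)
    case (step m)
    have "(\<Sum>\<nu> = Suc N..Suc m. real \<nu> powr (- r)) = (\<Sum>\<nu> = Suc N..m. real \<nu> powr (- r)) + (real m + 1) powr (- r)"
      using step.hyps by (simp add: add.commute)
    also have "\<dots> \<le> (real N powr (1 - r) - real m powr (1 - r)) / (r - 1)
        + (real m powr (1 - r) - (real m + 1) powr (1 - r)) / (r - 1)"
      using step powr_telescope[of "real m" r] assms by (intro add_mono) (auto simp: field_simps)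
    finally show ?case by (simp add: add_divide_distrib[symmetric] add.commute)
  qed simp
  moreover have "(real N powr (1 - r) - real m powr (1 - r)) / (r - 1) \<le> real N powr (1 - r) / (r - 1)"
    using assms by (intro divide_right_mono) auto
  moreover have "(\<Sum>\<nu> = Suc N..m. real \<nu> powr (- r)) \<le> real N powr (1 - r) / (r - 1)" if "m < N"
    using that assms by simp
  ultimately show ?thesis by fastforce
qed

text \<open>The order \<open>l powr (- 1 / r)\<close> is where \<open>l * real \<nu> powr r\<close>
  passes 1: below it every term is at most 1, beyond it the terms decay like
  \<open>real \<nu> powr (- r)\<close>, which is summable since \<open>r > 1\<close>.\<close>

lemma effective_dimension:
  fixes r \<beta> l :: real
  assumes r: "r > 1" and \<beta>: "\<beta> > 0" and l: "0 < l" "l \<le> 1"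
  shows "(\<Sum>\<nu> = 1..m. 1 / (1 + l * \<beta> * real \<nu> powr r)) \<le> (1 + (1 + 1 / (r - 1)) / \<beta>) * l powr (- 1 / r)"
proof -
  define s where "s = l powr (- 1 / r)"
  have s1: "s \<ge> 1"
  proof -
    have "s = inverse (l powr (1 / r))" by (simp add: s_def powr_minus)
    moreover have "l powr (1 / r) \<le> 1" "l powr (1 / r) > 0" using l r by (auto intro: powr_le1)
    ultimately show ?thesis by (simp add: one_le_inverse_iff)
  qed
  have sr: "s powr r = 1 / l"
  proof -
    have "s powr r = l powr (- 1)" unfolding s_def powr_powr using r by simp
    then show ?thesis using l by (simp add: powr_minus divide_inverse)
  qed
  define N where "N = Suc (nat \<lfloor>s\<rfloor>)"
  have N: "s \<le> real N" "real N \<le> s + 1" "N \<ge> 1" using s1 unfolding N_def by linarith+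
  have term1: "1 / (1 + l * \<beta> * real \<nu> powr r) \<le> 1" for \<nu> :: nat
    using l \<beta> by (simp add: divide_le_eq add_pos_nonneg)
  have term2: "1 / (1 + l * \<beta> * real \<nu> powr r) \<le> s powr r / \<beta> * real \<nu> powr (- r)" if "\<nu> \<ge> 1" for \<nu> :: nat
  proof -
    have "1 / (1 + l * \<beta> * real \<nu> powr r) \<le> 1 / (l * \<beta> * real \<nu> powr r)"
      using that l \<beta> by (intro divide_left_mono) (auto intro!: mult_pos_pos add_pos_nonneg)
    also have "\<dots> = s powr r / \<beta> * real \<nu> powr (- r)"
      unfolding sr by (simp add: powr_minus field_simps)
    finally show ?thesis .
  qed
  \<comment> \<open>The index \<open>N\<close>, the first past \<open>s\<close>, is split off
    because the telescoping tail bound starts at \<open>Suc N\<close>.\<close>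
  have "(\<Sum>\<nu> = 1..m. 1 / (1 + l * \<beta> * real \<nu> powr r))
      \<le> (\<Sum>\<nu>\<in>{1..nat \<lfloor>s\<rfloor>} \<union> ({N} \<union> {Suc N..m}). 1 / (1 + l * \<beta> * real \<nu> powr r))"
    using l \<beta> by (intro sum_mono2) (auto simp: N_def intro!: divide_nonneg_nonneg add_nonneg_nonneg)
  also have "\<dots> = (\<Sum>\<nu> = 1..nat \<lfloor>s\<rfloor>. 1 / (1 + l * \<beta> * real \<nu> powr r))
      + (1 / (1 + l * \<beta> * real N powr r) + (\<Sum>\<nu> = Suc N..m. 1 / (1 + l * \<beta> * real \<nu> powr r)))"
    by (subst sum.union_disjoint, (auto simp: N_def)[3])+ simp
  also have "\<dots> \<le> s + (s powr r / \<beta> * s powr (- r) + s powr r / \<beta> * (s powr (1 - r) / (r - 1)))"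
  proof (intro add_mono)
    have "(\<Sum>\<nu> = 1..nat \<lfloor>s\<rfloor>. 1 / (1 + l * \<beta> * real \<nu> powr r)) \<le> (\<Sum>\<nu> = 1..nat \<lfloor>s\<rfloor>. 1)"
      by (intro sum_mono term1)
    also have "\<dots> \<le> s" using s1 by (simp)
    finally show "(\<Sum>\<nu> = 1..nat \<lfloor>s\<rfloor>. 1 / (1 + l * \<beta> * real \<nu> powr r)) \<le> s" .
    have "real N powr (- r) \<le> s powr (- r)" using N s1 r by (intro powr_mono2') auto
    then show "1 / (1 + l * \<beta> * real N powr r) \<le> s powr r / \<beta> * s powr (- r)"
      using term2[OF N(3)] \<beta> by (elim order_trans) (intro mult_left_mono, auto)
    have "(\<Sum>\<nu> = Suc N..m. 1 / (1 + l * \<beta> * real \<nu> powr r)) \<le> (\<Sum>\<nu> = Suc N..m. s powr r / \<beta> * real \<nu> powr (- r))"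
      by (intro sum_mono term2) auto
    also have "\<dots> = s powr r / \<beta> * (\<Sum>\<nu> = Suc N..m. real \<nu> powr (- r))" by (simp add: sum_distrib_left)
    also have "\<dots> \<le> s powr r / \<beta> * (s powr (1 - r) / (r - 1))"
    proof (intro mult_left_mono)
      have "real N powr (1 - r) \<le> s powr (1 - r)" using N s1 r by (intro powr_mono2') auto
      then have "real N powr (1 - r) / (r - 1) \<le> s powr (1 - r) / (r - 1)" using r by (intro divide_right_mono) auto
      then show "(\<Sum>\<nu> = Suc N..m. real \<nu> powr (- r)) \<le> s powr (1 - r) / (r - 1)"
        using sum_powr_tail[OF r N(3), of m] by linarith
    qed (use \<beta> in auto)
    finally show "(\<Sum>\<nu> = Suc N..m. 1 / (1 + l * \<beta> * real \<nu> powr r)) \<le> s powr r / \<beta> * (s powr (1 - r) / (r - 1))" .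
  qed
  also have "\<dots> = s + (1 / \<beta> + s / (\<beta> * (r - 1)))"
  proof -
    have "s powr r * s powr (- r) = 1" "s powr r * s powr (1 - r) = s"
      using s1 by (simp_all add: powr_add[symmetric])
    then have "s powr r / \<beta> * s powr (- r) = 1 / \<beta>" "s powr r / \<beta> * (s powr (1 - r) / (r - 1)) = s / (\<beta> * (r - 1))"
      by (simp_all only: times_divide_eq_left times_divide_eq_right divide_divide_eq_left mult.commute)
    then show ?thesis by (simp only:)
  qed
  also have "\<dots> \<le> s + (s / \<beta> + s / (\<beta> * (r - 1)))" using s1 \<beta> by (simp add: divide_right_mono)
  also have "\<dots> = (1 + (1 + 1 / (r - 1)) / \<beta>) * s" using \<beta> r by (simp add: field_simps)
  finally show ?thesis by (simp add: s_def)
qed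

subsection \<open>Simultaneous diagonalization\<close>

text \<open>Positive semidefinite symmetric bilinear forms as a locale, since two of them live on
  the same space and the penalty may be degenerate.\<close>

locale form =
  fixes V :: "'h::real_vector \<Rightarrow> 'h \<Rightarrow> real"
  assumes sym: "V g g' = V g' g" and add: "V (g + g') k = V g k + V g' k"
    and scale: "V (c *\<^sub>R g) k = c * V g k" and nonneg: "V g g \<ge> 0"
begin

lemma add_right: "V k (g + g') = V k g + V k g'" by (metis sym add)
lemma scale_right: "V k (c *\<^sub>R g) = c * V k g" by (metis sym scale)
lemma zero: "V 0 k = 0" "V k 0 = 0" using scale[of 0 0 k] scale_right[of k 0 0] by simp_all
lemma minus: "V (- g) k = - V g k" "V k (- g) = - V k g"
  using scale[of "-1" g k] scale_right[of k "-1" g] by simp_all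
lemma diff: "V (g - g') k = V g k - V g' k" using add[of g "- g'" k] by (simp add: minus)
lemma diff_right: "V k (g - g') = V k g - V k g'" by (metis sym diff)
lemma sum: "V (\<Sum>i\<in>I. f i) k = (\<Sum>i\<in>I. V (f i) k)"
  by (induction I rule: infinite_finite_induct) (auto simp: zero add)
lemma sum_right: "V k (\<Sum>i\<in>I. f i) = (\<Sum>i\<in>I. V k (f i))"
  by (induction I rule: infinite_finite_induct) (auto simp: zero add_right)

lemma Cauchy_Schwarz: "(V g k)\<^sup>2 \<le> V g g * V k k"
proof -
  have q: "0 \<le> V g g + 2 * t * V g k + t\<^sup>2 * V k k" for t
    using nonneg[of "g + t *\<^sub>R k"] sym[of k g]
    by (simp add: add add_right scale scale_right power2_eq_square algebra_simps)
  show ?thesis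
  proof (cases "V k k = 0")
    case True
    have "V g k = 0"
    proof (rule ccontr)
      assume "V g k \<noteq> 0"
      \<comment> \<open>This \<open>t\<close> makes the quadratic equal to -1.\<close>
      then show False using q[of "- (V g g + 1) / (2 * V g k)"] True by (simp add: field_simps)
    qed
    then show ?thesis using True by simp
  next
    case False
    then have p: "V k k > 0" using nonneg[of k] by linarith
    have "0 \<le> V k k * (V g g + 2 * (- V g k / V k k) * V g k + (- V g k / V k k)\<^sup>2 * V k k)"
      using q[of "- V g k / V k k"] p by (intro mult_nonneg_nonneg) (simp_all only: less_imp_le)
    also have "\<dots> = V g g * V k k - (V g k)\<^sup>2" using False by (simp add: field_simps power2_eq_square)
    finally show ?thesis by simp
  qed
qed

text \<open>The parallelogram law with the square of \<open>g + k\<close> dropped.\<close>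

lemma diff_square_le: "V (g - k) (g - k) \<le> 2 * V g g + 2 * V k k"
  using nonneg[of "g + k"] sym[of k g] by (simp add: add add_right diff diff_right)

end

text \<open>The ambient norm is tied to \<open>V + J\<close>, that is, to smoothing parameter 1, so
  that \<open>M\<^sub>1\<close> and \<open>M\<^sub>2\<close> stay fixed while the actual smoothing
  parameter tends to 0. They serve for continuity and convergence, not for rates.\<close>

locale diagonalized = V: form V + J: form J
  for V J :: "'h::real_normed_vector \<Rightarrow> 'h \<Rightarrow> real" +
  fixes \<phi> :: "nat \<Rightarrow> 'h" and \<rho> :: "nat \<Rightarrow> real" and M\<^sub>1 M\<^sub>2 :: real
  assumes M: "M\<^sub>1 > 0" "M\<^sub>2 > 0"
    and equiv: "M\<^sub>1 * (norm g)\<^sup>2 \<le> V g g + J g g" "V g g + J g g \<le> M\<^sub>2 * (norm g)\<^sup>2"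
    and V_\<phi>: "\<nu> \<ge> 1 \<Longrightarrow> \<mu> \<ge> 1 \<Longrightarrow> V (\<phi> \<nu>) (\<phi> \<mu>) = (if \<nu> = \<mu> then 1 else 0)"
    and J_\<phi>: "\<nu> \<ge> 1 \<Longrightarrow> \<mu> \<ge> 1 \<Longrightarrow> J (\<phi> \<nu>) (\<phi> \<mu>) = (if \<nu> = \<mu> then \<rho> \<nu> else 0)"
    and dense: "closure (span (\<phi> ` {1..})) = UNIV"
    and \<rho>_nonneg: "\<nu> \<ge> 1 \<Longrightarrow> \<rho> \<nu> \<ge> 0"
begin

lemma V_le: "V g g \<le> M\<^sub>2 * (norm g)\<^sup>2" and J_le: "J g g \<le> M\<^sub>2 * (norm g)\<^sup>2"
  using equiv(2)[of g] V.nonneg[of g] J.nonneg[of g] by linarith+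

lemma bounded_linear_forms: "bounded_linear (\<lambda>g. V g k)" "bounded_linear (\<lambda>g. J g k)"
proof -
  have b: "\<bar>F g k\<bar> \<le> norm g * (M\<^sub>2 * norm k)"
    if "\<And>g. F g g \<le> M\<^sub>2 * (norm g)\<^sup>2" "(F g k)\<^sup>2 \<le> F g g * F k k" "\<And>g. F g g \<ge> 0" for F :: "'h \<Rightarrow> 'h \<Rightarrow> real" and g
  proof -
    have "(F g k)\<^sup>2 \<le> (M\<^sub>2 * (norm g)\<^sup>2) * (M\<^sub>2 * (norm k)\<^sup>2)"
      using that M by (elim order_trans) (intro mult_mono, auto)
    also have "\<dots> = (norm g * (M\<^sub>2 * norm k))\<^sup>2" by (simp add: power_mult_distrib power2_eq_square)
    finally have "\<bar>F g k\<bar>\<^sup>2 \<le> (norm g * (M\<^sub>2 * norm k))\<^sup>2" by simp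
    then show ?thesis by (rule power2_le_imp_le) (use M in simp)
  qed
  show "bounded_linear (\<lambda>g. V g k)"
    by (rule bounded_linear_intro[of _ "M\<^sub>2 * norm k"])
      (use b[of V, OF V_le V.Cauchy_Schwarz V.nonneg] in \<open>auto simp: V.add V.scale\<close>)
  show "bounded_linear (\<lambda>g. J g k)"
    by (rule bounded_linear_intro[of _ "M\<^sub>2 * norm k"])
      (use b[of J, OF J_le J.Cauchy_Schwarz J.nonneg] in \<open>auto simp: J.add J.scale\<close>)
qed

text \<open>Both sides are continuous and linear in \<open>g\<close> and agree on the
  eigenfunctions, whose span is dense.\<close>

lemma J_eq: assumes "\<nu> \<ge> 1" shows "J g (\<phi> \<nu>) = \<rho> \<nu> * V g (\<phi> \<nu>)"
proof -
  define f where "f g = J g (\<phi> \<nu>) - \<rho> \<nu> * V g (\<phi> \<nu>)" for g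
  interpret f: bounded_linear f unfolding f_def
    by (intro bounded_linear_sub bounded_linear_forms bounded_linear_const_mult)
  have "f g = 0" if "g \<in> span (\<phi> ` {1..})" for g
    using that
  proof (induction rule: span_induct)
    case base show ?case by (simp add: subspace_def f.add f.scaleR f.zero)
  next
    case (step x) then show ?case using assms by (auto simp: f_def V_\<phi> J_\<phi>)
  qed
  then have "span (\<phi> ` {1..}) \<subseteq> {g. f g = 0}" by auto
  moreover have "closed {g. f g = 0}"
    by (intro closed_Collect_eq continuous_intros linear_continuous_on f.bounded_linear_axioms)
  ultimately have "closure (span (\<phi> ` {1..})) \<subseteq> {g. f g = 0}" by (rule closure_minimal)
  then show ?thesis using dense by (auto simp: f_def)
qed

text \<open>The \<open>V\<close>-orthogonal projection onto the span of the first \<open>m\<close>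
  eigenfunctions. By \<open>J_eq\<close> it is orthogonal for \<open>J\<close> as well, which gives
  Pythagoras in both forms.\<close>

definition proj :: "nat \<Rightarrow> 'h \<Rightarrow> 'h" where
  "proj m g = (\<Sum>\<nu> = 1..m. V g (\<phi> \<nu>) *\<^sub>R \<phi> \<nu>)"

lemma V_proj: "V (proj m g) (proj m g) = (\<Sum>\<nu> = 1..m. (V g (\<phi> \<nu>))\<^sup>2)"
  and V_proj_cross: "V g (proj m g) = (\<Sum>\<nu> = 1..m. (V g (\<phi> \<nu>))\<^sup>2)"
proof -
  show "V g (proj m g) = (\<Sum>\<nu> = 1..m. (V g (\<phi> \<nu>))\<^sup>2)"
    by (simp add: proj_def V.sum_right V.scale_right power2_eq_square)
  have "V (proj m g) (\<phi> \<mu>) = V g (\<phi> \<mu>)" if "\<mu> \<in> {1..m}" for \<mu>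
  proof -
    have "V (proj m g) (\<phi> \<mu>) = (\<Sum>\<nu> = 1..m. if \<nu> = \<mu> then V g (\<phi> \<nu>) else 0)"
      unfolding proj_def V.sum V.scale using that by (intro sum.cong) (auto simp: V_\<phi>)
    then show ?thesis using that by simp
  qed
  then show "V (proj m g) (proj m g) = (\<Sum>\<nu> = 1..m. (V g (\<phi> \<nu>))\<^sup>2)"
    unfolding proj_def[of m g, THEN arg_cong[of _ _ "V (proj m g)"]]
    by (simp add: V.sum_right V.scale_right power2_eq_square)
qed

lemma J_proj: "J (proj m g) (proj m g) = (\<Sum>\<nu> = 1..m. \<rho> \<nu> * (V g (\<phi> \<nu>))\<^sup>2)"
  and J_proj_cross: "J g (proj m g) = (\<Sum>\<nu> = 1..m. \<rho> \<nu> * (V g (\<phi> \<nu>))\<^sup>2)"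
proof -
  show "J g (proj m g) = (\<Sum>\<nu> = 1..m. \<rho> \<nu> * (V g (\<phi> \<nu>))\<^sup>2)"
    by (simp add: proj_def J.sum_right J.scale_right J_eq power2_eq_square mult_ac)
  have "J (proj m g) (\<phi> \<mu>) = \<rho> \<mu> * V g (\<phi> \<mu>)" if "\<mu> \<in> {1..m}" for \<mu>
  proof -
    have "J (proj m g) (\<phi> \<mu>) = (\<Sum>\<nu> = 1..m. if \<nu> = \<mu> then \<rho> \<mu> * V g (\<phi> \<nu>) else 0)"
      unfolding proj_def J.sum J.scale using that by (intro sum.cong) (auto simp: J_\<phi>)
    then show ?thesis using that by simp
  qed
  then show "J (proj m g) (proj m g) = (\<Sum>\<nu> = 1..m. \<rho> \<nu> * (V g (\<phi> \<nu>))\<^sup>2)"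
    unfolding proj_def[of m g, THEN arg_cong[of _ _ "J (proj m g)"]]
    by (simp add: J.sum_right J.scale_right power2_eq_square mult_ac)
qed

lemma V_pythagoras: "V g g = (\<Sum>\<nu> = 1..m. (V g (\<phi> \<nu>))\<^sup>2) + V (g - proj m g) (g - proj m g)"
  using V_proj[of m g] V_proj_cross[of g m] V.sym[of "proj m g" g] by (simp add: V.diff V.diff_right)

lemma J_pythagoras: "J g g = (\<Sum>\<nu> = 1..m. \<rho> \<nu> * (V g (\<phi> \<nu>))\<^sup>2) + J (g - proj m g) (g - proj m g)"
  using J_proj[of m g] J_proj_cross[of g m] J.sym[of "proj m g" g] by (simp add: J.diff J.diff_right)

lemma bessel:
  assumes "l \<ge> 0"
  shows "(\<Sum>\<nu> = 1..m. (1 + l * \<rho> \<nu>) * (V g (\<phi> \<nu>))\<^sup>2) \<le> V g g + l * J g g"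
proof -
  have "(\<Sum>\<nu> = 1..m. (1 + l * \<rho> \<nu>) * (V g (\<phi> \<nu>))\<^sup>2)
     = (\<Sum>\<nu> = 1..m. (V g (\<phi> \<nu>))\<^sup>2) + l * (\<Sum>\<nu> = 1..m. \<rho> \<nu> * (V g (\<phi> \<nu>))\<^sup>2)"
    by (simp add: sum.distrib sum_distrib_left algebra_simps)
  also have "\<dots> \<le> V g g + l * J g g"
    using V_pythagoras[of g m] J_pythagoras[of g m] V.nonneg[of "g - proj m g"] J.nonneg[of "g - proj m g"] assms
    by (intro add_mono mult_left_mono) auto
  finally show ?thesis .
qed

lemma proj_diff: "proj m (g - k) = proj m g - proj m k"
  by (simp add: proj_def V.diff scaleR_left_diff_distrib sum_subtractf)

text \<open>The projection contracts the norm given by \<open>V + J\<close>, hence is bounded in the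
  ambient norm uniformly in \<open>m\<close>.\<close>

lemma norm_proj_le: "norm (proj m g) \<le> sqrt (M\<^sub>2 / M\<^sub>1) * norm g"
proof -
  have "M\<^sub>1 * (norm (proj m g))\<^sup>2 \<le> V (proj m g) (proj m g) + J (proj m g) (proj m g)" by (rule equiv)
  also have "\<dots> \<le> V g g + J g g"
    using V_pythagoras[of g m] J_pythagoras[of g m] V_proj[of m g] J_proj[of m g]
      V.nonneg[of "g - proj m g"] J.nonneg[of "g - proj m g"] by linarith
  also have "\<dots> \<le> M\<^sub>2 * (norm g)\<^sup>2" by (rule equiv)
  finally have "(norm (proj m g))\<^sup>2 \<le> M\<^sub>2 / M\<^sub>1 * (norm g)\<^sup>2" using M by (simp add: field_simps)
  then have "(norm (proj m g))\<^sup>2 \<le> (sqrt (M\<^sub>2 / M\<^sub>1) * norm g)\<^sup>2" using M by (simp add: power_mult_distrib)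
  then show ?thesis by (rule power2_le_imp_le) (use M in simp)
qed

text \<open>The projection is exact for large \<open>m\<close> on the dense span; the uniform bound
  of \<open>norm_proj_le\<close> carries the convergence to every \<open>g\<close>.\<close>

lemma proj_tendsto: "(\<lambda>m. proj m g) \<longlonglongrightarrow> g"
proof -
  have ev: "\<forall>\<^sub>F m in sequentially. proj m s = s" if "s \<in> span (\<phi> ` {1..})" for s
    using that
  proof (induction rule: span_induct_alt)
    case base show ?case by (simp add: proj_def V.zero)
  next
    case (step c x y)
    then obtain \<nu> where \<nu>: "x = \<phi> \<nu>" "\<nu> \<ge> 1" by auto
    have "\<forall>\<^sub>F m in sequentially. m \<ge> \<nu>" by (rule eventually_ge_at_top)
    with step(2) show ?case
    proof eventually_elim
      case (elim m)
      have "(\<Sum>\<mu> = 1..m. V x (\<phi> \<mu>) *\<^sub>R \<phi> \<mu>) = (\<Sum>\<mu> = 1..m. if \<mu> = \<nu> then \<phi> \<nu> else 0)"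
        using \<nu> by (intro sum.cong) (auto simp: V_\<phi>)
      then have px: "proj m x = x" using elim \<nu> by (simp add: proj_def)
      have "proj m (c *\<^sub>R x + y) = c *\<^sub>R proj m x + proj m y"
        by (simp add: proj_def V.add V.scale scaleR_left_distrib sum.distrib scaleR_sum_right)
      then show ?case using px elim by simp
    qed
  qed
  define C where "C = sqrt (M\<^sub>2 / M\<^sub>1) + 1"
  have C: "C > 0" using M by (simp add: C_def add_pos_nonneg add_nonneg_pos)
  show ?thesis
  proof (rule tendstoI)
    fix \<epsilon> :: real assume \<epsilon>: "\<epsilon> > 0"
    have "g \<in> closure (span (\<phi> ` {1..}))" using dense by simp
    then obtain s where s: "s \<in> span (\<phi> ` {1..})" "dist s g < \<epsilon> / C"
      using closure_approachable[of g] \<epsilon> C by (metis divide_pos_pos)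
    from ev[OF s(1)] show "\<forall>\<^sub>F m in sequentially. dist (proj m g) g < \<epsilon>"
    proof eventually_elim
      case (elim m)
      have "norm (proj m g - g) = norm (proj m (g - s) + (s - g))" by (simp add: proj_diff elim)
      also have "\<dots> \<le> norm (proj m (g - s)) + norm (s - g)" by (rule norm_triangle_ineq)
      also have "\<dots> \<le> sqrt (M\<^sub>2 / M\<^sub>1) * norm (g - s) + norm (g - s)"
        using norm_proj_le[of m "g - s"] by (simp add: norm_minus_commute)
      also have "\<dots> = C * dist s g" by (simp add: C_def dist_norm norm_minus_commute algebra_simps)
      also have "\<dots> < \<epsilon>" using s(2) C by (simp add: field_simps)
      finally show ?case by (simp add: dist_norm)
    qed
  qed
qed

text \<open>Letting \<open>m'\<close> tend to infinity turns Bessel's inequality for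
  \<open>V\<close> into Parseval's identity; past \<open>m\<close> the coefficients are dominated by
  those of \<open>J\<close>, whose eigenvalues there are at least \<open>t\<close>.\<close>

lemma V_tail:
  assumes "\<And>\<nu>. \<nu> > m \<Longrightarrow> \<rho> \<nu> \<ge> t" "t > 0"
  shows "V (g - proj m g) (g - proj m g) \<le> J g g / t"
proof -
  have le: "t * (\<Sum>\<nu> = 1..m'. (V g (\<phi> \<nu>))\<^sup>2) \<le> t * (\<Sum>\<nu> = 1..m. (V g (\<phi> \<nu>))\<^sup>2) + J g g" if "m' \<ge> m" for m'
  proof -
    have sp: "(\<Sum>\<nu> = 1..m'. (V g (\<phi> \<nu>))\<^sup>2) = (\<Sum>\<nu> = 1..m. (V g (\<phi> \<nu>))\<^sup>2) + (\<Sum>\<nu> = Suc m..m'. (V g (\<phi> \<nu>))\<^sup>2)"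
    proof -
      have "{1..m'} = {1..m} \<union> {Suc m..m'}" using that by auto
      then show ?thesis by (simp add: sum.union_disjoint)
    qed
    have "t * (\<Sum>\<nu> = Suc m..m'. (V g (\<phi> \<nu>))\<^sup>2) \<le> (\<Sum>\<nu> = Suc m..m'. \<rho> \<nu> * (V g (\<phi> \<nu>))\<^sup>2)"
      unfolding sum_distrib_left using assms by (intro sum_mono mult_right_mono) auto
    also have "\<dots> \<le> (\<Sum>\<nu> = 1..m'. \<rho> \<nu> * (V g (\<phi> \<nu>))\<^sup>2)"
      using \<rho>_nonneg by (intro sum_mono2) auto
    also have "\<dots> \<le> J g g" using J_pythagoras[of g m'] J.nonneg[of "g - proj m' g"] by linarith
    finally show ?thesis unfolding sp by (simp add: algebra_simps)
  qed
  have "(\<lambda>m'. V (g - proj m' g) (g - proj m' g)) \<longlonglongrightarrow> 0"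
  proof (rule tendsto_sandwich)
    show "\<forall>\<^sub>F m' in sequentially. 0 \<le> V (g - proj m' g) (g - proj m' g)" by (simp add: V.nonneg)
    show "\<forall>\<^sub>F m' in sequentially. V (g - proj m' g) (g - proj m' g) \<le> M\<^sub>2 * (norm (g - proj m' g))\<^sup>2"
      by (simp add: V_le)
    have "(\<lambda>m'. M\<^sub>2 * (norm (g - proj m' g))\<^sup>2) \<longlonglongrightarrow> M\<^sub>2 * (norm (g - g))\<^sup>2"
      by (intro tendsto_intros proj_tendsto)
    then show "(\<lambda>m'. M\<^sub>2 * (norm (g - proj m' g))\<^sup>2) \<longlonglongrightarrow> 0" by simp
  qed simp
  then have "(\<lambda>m'. V g g - V (g - proj m' g) (g - proj m' g)) \<longlonglongrightarrow> V g g - 0"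
    by (intro tendsto_diff tendsto_const)
  moreover have "(\<Sum>\<nu> = 1..m'. (V g (\<phi> \<nu>))\<^sup>2) = V g g - V (g - proj m' g) (g - proj m' g)" for m'
    using V_pythagoras[of g m'] by linarith
  ultimately have "(\<lambda>m'. \<Sum>\<nu> = 1..m'. (V g (\<phi> \<nu>))\<^sup>2) \<longlonglongrightarrow> V g g" by simp
  then have "(\<lambda>m'. t * (\<Sum>\<nu> = 1..m'. (V g (\<phi> \<nu>))\<^sup>2)) \<longlonglongrightarrow> t * V g g" by (intro tendsto_intros)
  then have "t * V g g \<le> t * (\<Sum>\<nu> = 1..m. (V g (\<phi> \<nu>))\<^sup>2) + J g g"
    by (rule LIMSEQ_le_const2) (use le in blast)
  then have "t * V (g - proj m g) (g - proj m g) \<le> J g g"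
    unfolding V_pythagoras[of g m] by (simp add: distrib_left)
  then show ?thesis using assms(2) by (simp add: field_simps)
qed

end

subsection \<open>Uniform lower bound for the empirical criterion\<close>

text \<open>Replaces the variance of \<open>L\<^sub>\<theta> \<zeta> + L\<^sub>h g\<close>, to which
  \<open>Var_norm_equiv\<close> shows it equivalent. The gain is that the finite- and
  infinite-dimensional parts are orthogonal, as the expansion in coordinates requires.\<close>

definition sqn :: "('h \<Rightarrow> 'h \<Rightarrow> real) \<Rightarrow> 'a::real_normed_vector \<times> 'h \<Rightarrow> real" where
  "sqn V u = (norm (fst u))\<^sup>2 + V (snd u) (snd u)"

text \<open>The interface between population and sample: \<open>u\<close> is a displacement from the
  true parameter, \<open>y u\<close> stands for the log-likelihood ratio and \<open>d u\<close> for
  its derivative there. Beyond second moments only the one-sided bound \<open>B\<^sub>0\<close>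
  limits the tails.\<close>

locale local_model = iid_sample P Q X + diagonalized V J \<phi> \<rho> M\<^sub>1 M\<^sub>2
  for P :: "'w measure" and Q :: "'x measure" and X :: "nat \<Rightarrow> 'w \<Rightarrow> 'x"
    and V J :: "'h::real_normed_vector \<Rightarrow> 'h \<Rightarrow> real" and \<phi> \<rho> M\<^sub>1 M\<^sub>2 +
  fixes G :: "('a::euclidean_space \<times> 'h) set" and y :: "'a \<times> 'h \<Rightarrow> 'x \<Rightarrow> real"
    and d :: "'a \<times> 'h \<Rightarrow> 'a \<times> 'h \<Rightarrow> 'x \<Rightarrow> real" and c C B\<^sub>0 r \<beta> :: real
  assumes const: "c > 0" "C > 0" "r > 1" "\<beta> > 0"
    and \<rho>_lower: "\<nu> \<ge> 1 \<Longrightarrow> \<rho> \<nu> \<ge> \<beta> * real \<nu> powr r"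
    and y_sqint: "u \<in> G \<Longrightarrow> sqint Q (y u)"
    and d_sqint: "u \<in> G \<Longrightarrow> sqint Q (d u v)"
    and d_linear: "u \<in> G \<Longrightarrow> AE x in Q. bounded_linear (\<lambda>v. d u v x)"
    and tangent: "u' \<in> G \<Longrightarrow> AE x in Q. \<forall>u\<in>G. y u x \<le> B\<^sub>0 \<and> y u x \<le> y u' x + d u' (u - u') x"
    and y_mean: "u \<in> G \<Longrightarrow> (\<integral>x. y u x \<partial>Q) \<le> - c * sqn V u"
    and y_square: "u \<in> G \<Longrightarrow> (\<integral>x. (y u x)\<^sup>2 \<partial>Q) \<le> C * sqn V u"
    and d_mean: "u \<in> G \<Longrightarrow> (\<integral>x. d u v x \<partial>Q) \<le> C * (sqrt (sqn V u) * sqrt (sqn V v))"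
    and d_square: "u \<in> G \<Longrightarrow> (\<integral>x. (d u v x)\<^sup>2 \<partial>Q) \<le> C * sqn V v"
begin

abbreviation Sq :: "'a \<times> 'h \<Rightarrow> real" where
  "Sq \<equiv> sqn V"

lemma Sq_nonneg: "Sq u \<ge> 0"
  by (simp add: sqn_def V.nonneg)

lemma Sq_diff_le: "Sq (u - u') \<le> 2 * Sq u + 2 * Sq u'"
proof -
  have "(norm (fst u - fst u'))\<^sup>2 \<le> 2 * (norm (fst u))\<^sup>2 + 2 * (norm (fst u'))\<^sup>2"
  proof -
    have "(norm (fst u - fst u'))\<^sup>2 \<le> (norm (fst u) + norm (fst u'))\<^sup>2"
      by (intro power_mono norm_triangle_ineq4) auto
    also have "\<dots> \<le> 2 * (norm (fst u))\<^sup>2 + 2 * (norm (fst u'))\<^sup>2"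
      using sum_squares_bound[of "norm (fst u)" "norm (fst u')"] by (simp add: power2_sum)
    finally show ?thesis .
  qed
  then show ?thesis using V.diff_square_le[of "snd u" "snd u'"] by (simp add: sqn_def)
qed

lemma Sq_add_le: "Sq u \<le> 2 * Sq u' + 2 * Sq (u - u')"
proof -
  have "Sq (- (u - u')) = Sq (u - u')" by (simp add: sqn_def V.minus V.diff V.diff_right norm_minus_commute)
  then show ?thesis using Sq_diff_le[of u' "- (u - u')"] by simp
qed

definition dir :: "'a + nat \<Rightarrow> 'a \<times> 'h" where
  "dir = case_sum (\<lambda>i. (i, 0)) (\<lambda>\<nu>. (0, \<phi> \<nu>))"

definition coord :: "'a \<times> 'h \<Rightarrow> 'a + nat \<Rightarrow> real" where
  "coord u = case_sum (\<lambda>i. fst u \<bullet> i) (\<lambda>\<nu>. V (snd u) (\<phi> \<nu>))"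

definition indices :: "nat \<Rightarrow> ('a + nat) set" where
  "indices m = Basis <+> {1..m}"

lemma sum_indices: "(\<Sum>j\<in>indices m. f j) = (\<Sum>i\<in>Basis. f (Inl i)) + (\<Sum>\<nu> = 1..m. f (Inr \<nu>))"
  by (simp add: indices_def sum.Plus)

lemma finite_indices: "finite (indices m)" and card_indices: "card (indices m) = DIM('a) + m"
  by (simp_all add: indices_def card_Plus)

lemma coord_expand: "(\<Sum>j\<in>indices m. coord u j *\<^sub>R dir j) = (fst u, proj m (snd u))"
proof -
  have "(\<Sum>i\<in>Basis. (fst u \<bullet> i) *\<^sub>R (i, 0 :: 'h)) = (fst u, 0)"
    by (rule prod_eqI) (simp_all add: fst_sum snd_sum euclidean_representation)
  moreover have "(\<Sum>\<nu> = 1..m. V (snd u) (\<phi> \<nu>) *\<^sub>R (0 :: 'a, \<phi> \<nu>)) = (0, proj m (snd u))"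
    by (rule prod_eqI) (simp_all add: fst_sum snd_sum proj_def)
  ultimately show ?thesis by (simp add: sum_indices coord_def dir_def)
qed

lemma norm_eq_sum_Basis: "(norm (x :: 'a))\<^sup>2 = (\<Sum>i\<in>Basis. (x \<bullet> i)\<^sup>2)"
  unfolding power2_norm_eq_inner by (subst euclidean_inner) (simp add: power2_eq_square)

lemma Sq_split: "Sq u = (\<Sum>j\<in>indices m. (coord u j)\<^sup>2) + V (snd u - proj m (snd u)) (snd u - proj m (snd u))"
  unfolding sum_indices sqn_def norm_eq_sum_Basis using V_pythagoras[of "snd u" m] by (simp add: coord_def)

lemma Sq_expand_le: "Sq (\<Sum>j\<in>indices m. coord u j *\<^sub>R dir j) \<le> Sq u"
  unfolding coord_expand using V_pythagoras[of "snd u" m] V_proj[of m "snd u"]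
    V.nonneg[of "snd u - proj m (snd u)"] by (simp add: sqn_def)

text \<open>\<open>\<gamma>\<close> is an arbitrarily small share of the squared radius. Four
  sources of error, namely rounding to the net, clipping, entropy, and effective dimension together
  with the size of the net, are allotted \<open>\<gamma> / 5\<close> each; constants tame the first
  three, a large \<open>K\<close> the last.\<close>

lemma uniform_lower_bound:
  fixes lam :: "nat \<Rightarrow> real"
  assumes lam: "\<And>n. lam n > 0" "lam \<longlonglongrightarrow> 0" and \<gamma>: "\<gamma> > 0"
  shows "\<exists>K\<^sub>0>0. \<forall>K\<ge>K\<^sub>0. \<forall>\<epsilon>>0. \<forall>\<^sub>F n in sequentially. \<exists>A\<in>sets P. measure P A \<ge> 1 - \<epsilon> \<and>
     (\<forall>\<omega>\<in>A. \<forall>u\<in>G. Sq u + lam n * J (snd u) (snd u) = K\<^sup>2 * (lam n powr (- 1 / r) / real n + lam n) \<longrightarrow>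
        (\<Sum>k<n. y u (X k \<omega>)) \<le> real n * (- (c / 2) * Sq u
            + \<gamma> * (K\<^sup>2 * (lam n powr (- 1 / r) / real n + lam n))))"
proof -
  \<comment> \<open>Relative accuracy of the net, small against both the curvature constant
    \<open>c\<close> and the slope constant \<open>C\<close>.\<close>
  define \<kappa> where "\<kappa> = min 1 (\<gamma> / (5 * (C + c)))"
  have \<kappa>: "\<kappa> > 0" "\<kappa> \<le> 1" "(C + c) * \<kappa> \<le> \<gamma> / 5"
  proof -
    show "\<kappa> > 0" "\<kappa> \<le> 1" using \<gamma> const by (auto simp: \<kappa>_def)
    have "(C + c) * \<kappa> \<le> (C + c) * (\<gamma> / (5 * (C + c)))" using const by (intro mult_left_mono) (auto simp: \<kappa>_def)
    also have "\<dots> = \<gamma> / 5"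
    proof -
      have "C + c \<noteq> 0" using const by linarith
      then show ?thesis by (simp add: divide_simps)
    qed
    finally show "(C + c) * \<kappa> \<le> \<gamma> / 5" .
  qed
  define \<eta> where "\<eta> = \<kappa> / 2"
  have \<eta>: "\<eta> > 0" "\<eta>\<^sup>2 = \<kappa>\<^sup>2 / 4" using \<kappa> by (auto simp: \<eta>_def power_divide)
  \<comment> \<open>With at least \<open>M * \<Delta>\<close> eigendirections resolved, the
    unresolved tail of a rounding error costs at most \<open>\<kappa>\<^sup>2 / 2\<close> of the
    squared radius.\<close>
  define M where "M = max 1 ((8 / (\<beta> * \<kappa>\<^sup>2)) powr (1 / r))"
  have M: "M \<ge> 1" "4 / (\<beta> * M powr r) \<le> \<kappa>\<^sup>2 / 2"
  proof -
    show "M \<ge> 1" by (simp add: M_def)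
    have "8 / (\<beta> * \<kappa>\<^sup>2) = ((8 / (\<beta> * \<kappa>\<^sup>2)) powr (1 / r)) powr r"
      unfolding powr_powr using const \<kappa> by simp
    also have "\<dots> \<le> M powr r" using const by (intro powr_mono2) (auto simp: M_def)
    finally have "8 \<le> M powr r * (\<beta> * \<kappa>\<^sup>2)" using const \<kappa> by (simp add: divide_le_eq)
    then show "4 / (\<beta> * M powr r) \<le> \<kappa>\<^sup>2 / 2"
      using const \<open>M \<ge> 1\<close> by (simp add: divide_le_eq mult_ac)
  qed
  \<comment> \<open>Besides dominating \<open>B\<^sub>0\<close>, the clipping level makes the second
    moments, at most \<open>4 * C * R\<^sup>2\<close>, fit the budget after division by it.\<close>
  define B where "B = max B\<^sub>0 (20 * C / \<gamma>)"
  have B: "B > 0" "B\<^sub>0 \<le> B" "4 * C / B \<le> \<gamma> / 5"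
  proof -
    have p: "20 * C / \<gamma> > 0" using const \<gamma> by simp
    then show "B > 0" "B\<^sub>0 \<le> B" by (auto simp: B_def)
    have "20 * C / \<gamma> \<le> B" by (simp add: B_def)
    then show "4 * C / B \<le> \<gamma> / 5" using \<open>B > 0\<close> \<gamma> by (simp add: field_simps)
  qed
  \<comment> \<open>The prior variances will be scaled by \<open>\<alpha> / n\<close>, so the
    entropy term is \<open>20 * B / \<alpha>\<close> times \<open>n * R\<^sup>2\<close>.\<close>
  define \<alpha> where "\<alpha> = 100 * B / \<gamma>"
  have \<alpha>: "\<alpha> > 0" "20 * B / \<alpha> = \<gamma> / 5" using B \<gamma> by (auto simp: \<alpha>_def)
  define p where "p = real DIM('a)"
  have p0: "p \<ge> 0" by (simp add: p_def)
  define Ce where "Ce = 1 + (1 + 1 / (r - 1)) / \<beta>"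
  have Ce: "Ce \<ge> 0" using const by (simp add: Ce_def add_nonneg_nonneg)
  define C\<^sub>3 where "C\<^sub>3 = C * (p + Ce)"
  define C\<^sub>4 where "C\<^sub>4 = (2 / \<eta>\<^sup>2 + 4) * (p + M + 1) + 1"
  have C34: "C\<^sub>3 \<ge> 0" "C\<^sub>4 \<ge> 0" using const p0 Ce M \<eta> by (auto simp: C\<^sub>3_def C\<^sub>4_def add_nonneg_nonneg)
  define E where "E = 2 * \<alpha> * C\<^sub>3 / B + 5 * B * C\<^sub>4"
  have E: "E \<ge> 0" using C34 \<alpha> B by (simp add: E_def)
  \<comment> \<open>\<open>E\<close> will multiply \<open>\<Delta> / n\<close>, which is at most
    \<open>R\<^sup>2 / K\<^sup>2\<close>; hence a large \<open>K\<close> suffices.\<close>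
  define K\<^sub>0 where "K\<^sub>0 = max 1 (sqrt (5 * E / \<gamma>))"
  have K\<^sub>0: "K\<^sub>0 > 0" by (simp add: K\<^sub>0_def)
  show ?thesis
  proof (intro exI[of _ K\<^sub>0] conjI allI impI K\<^sub>0)
    fix K \<epsilon> :: real assume K: "K\<^sub>0 \<le> K" and \<epsilon>: "\<epsilon> > 0"
    have Kp: "K > 0" using K K\<^sub>0 by linarith
    have EK: "E / K\<^sup>2 \<le> \<gamma> / 5"
    proof -
      have "sqrt (5 * E / \<gamma>) \<le> K" using K by (simp add: K\<^sub>0_def)
      then have "(sqrt (5 * E / \<gamma>))\<^sup>2 \<le> K\<^sup>2" using E \<gamma> by (intro power_mono) auto
      then have "5 * E / \<gamma> \<le> K\<^sup>2" using E \<gamma> by simp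
      then show ?thesis using \<gamma> Kp by (simp add: field_simps)
    qed
    \<comment> \<open>For large \<open>n\<close> the dimension \<open>\<Delta>\<close> exceeds
      \<open>- ln \<epsilon>\<close>, so a factor \<open>exp \<Delta>\<close> in the union bound
      absorbs the confidence level. The condition on \<open>lam n\<close> below expresses
      \<open>\<Delta> \<ge> Z\<close>.\<close>
    define Z where "Z = max 1 (- ln \<epsilon>)"
    have "\<forall>\<^sub>F n in sequentially. lam n < min 1 (Z powr (- r))"
      using lam(2) by (rule order_tendstoD(2)) (simp add: Z_def)
    moreover have "\<forall>\<^sub>F n in sequentially. n \<ge> (1 :: nat)" by (rule eventually_ge_at_top)
    ultimately show "\<forall>\<^sub>F n in sequentially. \<exists>A\<in>sets P. measure P A \<ge> 1 - \<epsilon> \<and>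
     (\<forall>\<omega>\<in>A. \<forall>u\<in>G. Sq u + lam n * J (snd u) (snd u) = K\<^sup>2 * (lam n powr (- 1 / r) / real n + lam n) \<longrightarrow>
        (\<Sum>k<n. y u (X k \<omega>)) \<le> real n * (- (c / 2) * Sq u
            + \<gamma> * (K\<^sup>2 * (lam n powr (- 1 / r) / real n + lam n))))"
    proof eventually_elim
      case (elim n)
      define l where "l = lam n"
      have l: "0 < l" "l \<le> 1" "l \<le> Z powr (- r)" using lam(1) elim by (auto simp: l_def)
      have n: "real n > 0" using elim by simp
      define \<Delta> where "\<Delta> = l powr (- 1 / r)"
      have \<Delta>: "\<Delta> \<ge> Z" "\<Delta> \<ge> 1" "\<Delta> \<ge> - ln \<epsilon>" "\<Delta> > 0"
      proof -
        have "(Z powr (- r)) powr (- 1 / r) \<le> l powr (- 1 / r)"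
          using l const by (intro powr_mono2') auto
        moreover have "(Z powr (- r)) powr (- 1 / r) = Z" unfolding powr_powr using const by (simp add: Z_def)
        ultimately show "\<Delta> \<ge> Z" by (simp add: \<Delta>_def)
        then show "\<Delta> \<ge> 1" "\<Delta> \<ge> - ln \<epsilon>" "\<Delta> > 0" by (auto simp: Z_def)
      qed
      have \<Delta>r: "\<Delta> powr r = 1 / l"
      proof -
        have "\<Delta> powr r = l powr (- 1)" unfolding \<Delta>_def powr_powr using const by simp
        then show ?thesis using l by (simp add: powr_minus divide_inverse)
      qed
      define R where "R = K * sqrt (\<Delta> / real n + l)"
      have R2: "R\<^sup>2 = K\<^sup>2 * (\<Delta> / real n + l)" using \<Delta> l n by (simp add: R_def power_mult_distrib)
      have Rp: "R > 0" using Kp \<Delta> l n by (simp add: R_def add_pos_pos)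
      define Rq where "Rq u = Sq u + l * J (snd u) (snd u)" for u
      define U where "U = {u\<in>G. Rq u = R\<^sup>2}"
      define m\<^sub>0 where "m\<^sub>0 = nat \<lceil>M * \<Delta>\<rceil>"
      have m\<^sub>0: "M * \<Delta> \<le> real m\<^sub>0" "real m\<^sub>0 \<le> (M + 1) * \<Delta>"
      proof -
        have "0 \<le> M * \<Delta>" using M \<Delta> by simp
        then show "M * \<Delta> \<le> real m\<^sub>0" "real m\<^sub>0 \<le> (M + 1) * \<Delta>"
          unfolding m\<^sub>0_def using \<Delta>(2) by (auto simp: distrib_right) linarith+
      qed
      define t where "t = C\<^sub>4 * \<Delta>"
      define D where "D = C\<^sub>3 * \<Delta>"
      \<comment> \<open>Weights adapted to the penalized norm: squared coordinates divided by them
        sum to at most \<open>Rq\<close>, and over the eigendirections their sum is the effective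
        dimension. The value at \<open>Inr 0\<close>, which is no index, only keeps them
        positive.\<close>
      define wt :: "'a + nat \<Rightarrow> real" where
        "wt = case_sum (\<lambda>_. 1) (\<lambda>\<nu>. if \<nu> \<ge> 1 then 1 / (1 + l * \<rho> \<nu>) else 1)"
      \<comment> \<open>A rounding error is small in variance only; its penalized norm is merely
        comparable to \<open>R\<close>, which is all that the entropy term needs.\<close>
      define Vs where "Vs = {v. Rq v \<le> 4 * R\<^sup>2 \<and> Sq v \<le> \<kappa>\<^sup>2 * R\<^sup>2}"
      have USq: "Sq u \<le> R\<^sup>2" if "u \<in> U" for u
        using that mult_nonneg_nonneg[of l, OF _ J.nonneg[of "snd u"]] l by (auto simp: U_def Rq_def)
      have Rq_diff: "Rq (u - u') \<le> 2 * Rq u + 2 * Rq u'" for u u'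
      proof -
        have "l * J (snd (u - u')) (snd (u - u')) \<le> l * (2 * J (snd u) (snd u) + 2 * J (snd u') (snd u'))"
          using J.diff_square_le[of "snd u" "snd u'"] l by (intro mult_left_mono) auto
        then show ?thesis using Sq_diff_le[of u u'] unfolding Rq_def by (simp add: algebra_simps)
      qed
      have bas: "indices m\<^sub>0 \<noteq> {}" by (auto simp: indices_def)
      have Ucoord: "(\<Sum>j\<in>indices m\<^sub>0. (coord u j)\<^sup>2) \<le> R\<^sup>2" if "u \<in> U" for u
        using USq[OF that] Sq_split[of u m\<^sub>0] V.nonneg[of "snd u - proj m\<^sub>0 (snd u)"] by linarith
      obtain U\<^sub>0 where U\<^sub>0: "U\<^sub>0 \<subseteq> U" "finite U\<^sub>0" "real (card U\<^sub>0) \<le> exp ((2 / \<eta>\<^sup>2 + 4) * real (card (indices m\<^sub>0)))"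
        "\<And>u. u \<in> U \<Longrightarrow> \<exists>u'\<in>U\<^sub>0. (\<Sum>j\<in>indices m\<^sub>0. (coord u j - coord u' j)\<^sup>2) \<le> \<eta>\<^sup>2 * R\<^sup>2"
        by (rule ellipsoid_net[OF finite_indices bas \<eta>(1) Rp, where U = U and x = coord])
          (rule Ucoord, assumption, rule that)
      have tail: "V (g - proj m\<^sub>0 g) (g - proj m\<^sub>0 g) \<le> J g g / (\<beta> * M powr r / l)" for g
      proof (rule V_tail)
        fix \<nu> assume \<nu>: "\<nu> > m\<^sub>0"
        have "M * \<Delta> \<le> real \<nu>" using m\<^sub>0 \<nu> by linarith
        then have "(M * \<Delta>) powr r \<le> real \<nu> powr r" using M \<Delta> const by (intro powr_mono2) auto
        then have "\<beta> * (M powr r * (1 / l)) \<le> \<beta> * real \<nu> powr r"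
          using M \<Delta> const by (intro mult_left_mono) (auto simp: powr_mult \<Delta>r)
        also have "\<dots> \<le> \<rho> \<nu>" using \<nu> by (intro \<rho>_lower) auto
        finally show "\<beta> * M powr r / l \<le> \<rho> \<nu>" by simp
      qed (use const M l in auto)
      have cover: "\<exists>u'\<in>U\<^sub>0. u - u' \<in> Vs" if u: "u \<in> U" for u
      proof -
        obtain u' where u': "u' \<in> U\<^sub>0" "(\<Sum>j\<in>indices m\<^sub>0. (coord u j - coord u' j)\<^sup>2) \<le> \<eta>\<^sup>2 * R\<^sup>2"
          using U\<^sub>0(4)[OF u] by blast
        define v where "v = u - u'"
        have "coord v j = coord u j - coord u' j" for j
          unfolding v_def by (cases j) (auto simp: coord_def inner_diff_left V.diff)
        then have low: "(\<Sum>j\<in>indices m\<^sub>0. (coord v j)\<^sup>2) \<le> \<kappa>\<^sup>2 / 4 * R\<^sup>2" using u'(2) \<eta>(2) by simp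
        \<comment> \<open>Both points lie on the ellipsoid, whence the factor 4.\<close>
        have Rv: "Rq v \<le> 4 * R\<^sup>2"
          using Rq_diff[of u u'] u u'(1) U\<^sub>0(1) unfolding v_def U_def by auto
        have Jv: "l * J (snd v) (snd v) \<le> 4 * R\<^sup>2" using Rv Sq_nonneg[of v] by (simp add: Rq_def)
        have "V (snd v - proj m\<^sub>0 (snd v)) (snd v - proj m\<^sub>0 (snd v)) \<le> J (snd v) (snd v) / (\<beta> * M powr r / l)"
          by (rule tail)
        also have "\<dots> = l * J (snd v) (snd v) / (\<beta> * M powr r)" by simp
        also have "\<dots> \<le> 4 * R\<^sup>2 / (\<beta> * M powr r)" using Jv const by (intro divide_right_mono) auto
        also have "\<dots> = 4 / (\<beta> * M powr r) * R\<^sup>2" by simp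
        also have "\<dots> \<le> \<kappa>\<^sup>2 / 2 * R\<^sup>2" using M by (intro mult_right_mono) auto
        finally have "Sq v \<le> \<kappa>\<^sup>2 / 4 * R\<^sup>2 + \<kappa>\<^sup>2 / 2 * R\<^sup>2" using low Sq_split[of v m\<^sub>0] by linarith
        also have "\<dots> \<le> \<kappa>\<^sup>2 * R\<^sup>2"
          using mult_nonneg_nonneg[of "\<kappa>\<^sup>2" "R\<^sup>2"] by simp
        finally show ?thesis using Rv u'(1) unfolding v_def Vs_def by blast
      qed
      have U\<^sub>0G: "u \<in> G" "Sq u \<le> R\<^sup>2" if "u \<in> U\<^sub>0" for u
      proof -
        have "u \<in> U" using that U\<^sub>0(1) by blast
        then show "u \<in> G" "Sq u \<le> R\<^sup>2" using USq by (simp_all add: U_def)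
      qed
      define \<mu> where "\<mu> u = - c * Sq u + C * \<kappa> * R\<^sup>2" for u
      define s2 where "s2 = 4 * C * R\<^sup>2"
      have vm: "Sq (\<Sum>j\<in>indices m. coord v j *\<^sub>R dir j) \<le> \<kappa>\<^sup>2 * R\<^sup>2" if "v \<in> Vs" for v m
        using Sq_expand_le[where u = v and m = m] that by (auto simp: Vs_def)
      have "\<exists>A\<in>sets P. measure P A \<ge> 1 - \<epsilon> \<and> (\<forall>\<omega>\<in>A. \<forall>u\<in>U. \<exists>u'\<in>U\<^sub>0. u - u' \<in> Vs \<and>
        (\<Sum>k<n. y u (X k \<omega>)) \<le> real n * (\<mu> u' + (s2 + 2 * (\<alpha> / real n) * D) / B) + 5 * B * (4 * R\<^sup>2 / (\<alpha> / real n) + t))"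
      proof (rule uniform_deviation[OF U\<^sub>0(2) cover B(1) _ \<epsilon>, where J = indices and co = coord and e = dir and d = d and wt = wt])
        show "\<alpha> / real n > 0" using \<alpha> n by simp
        show "t \<ge> 0" using C34 \<Delta> by (simp add: t_def)
        have "real (card (indices m\<^sub>0)) = p + real m\<^sub>0" by (simp add: card_indices p_def)
        also have "\<dots> \<le> p * \<Delta> + (M + 1) * \<Delta>" using m\<^sub>0 p0 \<Delta> mult_left_mono[of 1 \<Delta> p] by simp
        finally have "(2 / \<eta>\<^sup>2 + 4) * real (card (indices m\<^sub>0)) \<le> (2 / \<eta>\<^sup>2 + 4) * ((p + M + 1) * \<Delta>)"
          by (intro mult_left_mono) (auto simp: algebra_simps)
        \<comment> \<open>The summand \<open>+ 1\<close> in \<open>C\<^sub>4\<close> leaves a spare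
          \<open>\<Delta>\<close>, which covers \<open>- ln \<epsilon>\<close>.\<close>
        also have "\<dots> = t - \<Delta>" by (simp add: t_def C\<^sub>4_def algebra_simps)
        also have "\<dots> \<le> ln \<epsilon> + t" using \<Delta> by simp
        finally have "exp ((2 / \<eta>\<^sup>2 + 4) * real (card (indices m\<^sub>0))) \<le> exp (ln \<epsilon> + t)" by simp
        then show "real (card U\<^sub>0) \<le> \<epsilon> * exp t" using U\<^sub>0(3) \<epsilon> by (simp add: exp_add)
        show "finite (indices m)" for m by (rule finite_indices)
        have lr: "1 + l * \<rho> \<nu> > 0" if "\<nu> \<ge> 1" for \<nu>
          using l \<rho>_nonneg[OF that] by (intro add_pos_nonneg) auto
        show "0 < wt j" for j using lr by (cases j) (auto simp: wt_def)
        show "(\<lambda>m. \<Sum>j\<in>indices m. coord v j *\<^sub>R dir j) \<longlonglongrightarrow> v" for v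
        proof -
          have "(\<lambda>m. (fst v, proj m (snd v))) \<longlonglongrightarrow> (fst v, snd v)"
            by (intro tendsto_intros proj_tendsto)
          then show ?thesis by (simp add: coord_expand)
        qed
        show "(\<Sum>j\<in>indices m. (coord v j)\<^sup>2 / wt j) \<le> 4 * R\<^sup>2" if "v \<in> Vs" for v m
        proof -
          have "(\<Sum>j\<in>indices m. (coord v j)\<^sup>2 / wt j)
              = (norm (fst v))\<^sup>2 + (\<Sum>\<nu> = 1..m. (1 + l * \<rho> \<nu>) * (V (snd v) (\<phi> \<nu>))\<^sup>2)"
            unfolding sum_indices norm_eq_sum_Basis by (simp add: coord_def wt_def mult.commute)
          also have "\<dots> \<le> Rq v" using bessel[of l "snd v" m] l by (simp add: Rq_def sqn_def)
          also have "\<dots> \<le> 4 * R\<^sup>2" using that by (simp add: Vs_def)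
          finally show ?thesis .
        qed
        show "sqint Q (y u')" if "u' \<in> U\<^sub>0" for u' by (rule y_sqint[OF U\<^sub>0G(1)[OF that]])
        show "sqint Q (d u' v)" if "u' \<in> U\<^sub>0" for u' v by (rule d_sqint[OF U\<^sub>0G(1)[OF that]])
        show "AE x in Q. bounded_linear (\<lambda>v. d u' v x)" if "u' \<in> U\<^sub>0" for u' by (rule d_linear[OF U\<^sub>0G(1)[OF that]])
        show "AE x in Q. \<forall>u\<in>U. y u x \<le> B \<and> y u x \<le> y u' x + d u' (u - u') x" if "u' \<in> U\<^sub>0" for u'
          using tangent[OF U\<^sub>0G(1)[OF that]] by eventually_elim (use B(2) in \<open>force simp: U_def\<close>)
        show "(\<Sum>j\<in>indices m. wt j * (\<integral>x. (d u' (dir j) x)\<^sup>2 \<partial>Q)) \<le> D" if "u' \<in> U\<^sub>0" for u' m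
        proof -
          have dir1: "Sq (dir j) = 1" if "j \<in> indices m" for j
            using that by (auto simp: indices_def dir_def sqn_def V.zero V_\<phi>)
          have "(\<Sum>j\<in>indices m. wt j * (\<integral>x. (d u' (dir j) x)\<^sup>2 \<partial>Q)) \<le> (\<Sum>j\<in>indices m. wt j * C)"
          proof (intro sum_mono mult_left_mono)
            fix j assume "j \<in> indices m"
            then show "(\<integral>x. (d u' (dir j) x)\<^sup>2 \<partial>Q) \<le> C"
              using d_square[OF U\<^sub>0G(1)[OF that], of "dir j"] dir1 by simp
            show "0 \<le> wt j" using lr by (cases j) (auto simp: wt_def less_imp_le)
          qed
          also have "\<dots> = C * (p + (\<Sum>\<nu> = 1..m. 1 / (1 + l * \<rho> \<nu>)))"
            by (simp add: sum_indices wt_def p_def distrib_left sum_distrib_left)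
          also have "\<dots> \<le> C * (p * \<Delta> + Ce * \<Delta>)"
          proof (intro mult_left_mono add_mono)
            show "p \<le> p * \<Delta>" using p0 \<Delta> mult_left_mono[of 1 \<Delta> p] by simp
            have "(\<Sum>\<nu> = 1..m. 1 / (1 + l * \<rho> \<nu>)) \<le> (\<Sum>\<nu> = 1..m. 1 / (1 + l * \<beta> * real \<nu> powr r))"
            proof (intro sum_mono divide_left_mono)
              fix \<nu> assume "\<nu> \<in> {1..m}"
              then have \<nu>: "\<nu> \<ge> 1" by simp
              have "l * (\<beta> * real \<nu> powr r) \<le> l * \<rho> \<nu>" using \<rho>_lower[OF \<nu>] l by (intro mult_left_mono) auto
              then show "1 + l * \<beta> * real \<nu> powr r \<le> 1 + l * \<rho> \<nu>" by (simp add: mult.assoc)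
              show "0 < (1 + l * \<rho> \<nu>) * (1 + l * \<beta> * real \<nu> powr r)"
                by (rule mult_pos_pos[OF lr[OF \<nu>]]) (use l const in \<open>auto intro!: add_pos_nonneg\<close>)
            qed simp
            also have "\<dots> \<le> Ce * \<Delta>" unfolding Ce_def \<Delta>_def by (rule effective_dimension) (use const l in auto)
            finally show "(\<Sum>\<nu> = 1..m. 1 / (1 + l * \<rho> \<nu>)) \<le> Ce * \<Delta>" .
          qed (use const in auto)
          also have "\<dots> = D" by (simp add: D_def C\<^sub>3_def algebra_simps)
          finally show ?thesis .
        qed
        show "(\<integral>x. y u' x + d u' (\<Sum>j\<in>indices m. coord v j *\<^sub>R dir j) x \<partial>Q) \<le> \<mu> u'"
          if "u' \<in> U\<^sub>0" "v \<in> Vs" for u' v m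
        proof -
          define w where "w = (\<Sum>j\<in>indices m. coord v j *\<^sub>R dir j)"
          have "(\<integral>x. y u' x + d u' w x \<partial>Q) = (\<integral>x. y u' x \<partial>Q) + (\<integral>x. d u' w x \<partial>Q)"
            using Q.sqint_integrable[OF y_sqint] Q.sqint_integrable[OF d_sqint] U\<^sub>0G(1)[OF that(1)]
            by (intro Bochner_Integration.integral_add) auto
          also have "\<dots> \<le> - c * Sq u' + C * (sqrt (Sq u') * sqrt (Sq w))"
            using y_mean[OF U\<^sub>0G(1)[OF that(1)]] d_mean[OF U\<^sub>0G(1)[OF that(1)], of w] by linarith
          also have "\<dots> \<le> - c * Sq u' + C * (R * (\<kappa> * R))"
          proof (intro add_left_mono mult_left_mono mult_mono)
            show "sqrt (Sq u') \<le> R" using U\<^sub>0G(2)[OF that(1)] Rp by (intro real_le_lsqrt) (auto simp: Sq_nonneg)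
            have "Sq w \<le> (\<kappa> * R)\<^sup>2" using vm[OF that(2)] by (simp add: w_def power_mult_distrib)
            then show "sqrt (Sq w) \<le> \<kappa> * R" using Rp \<kappa> by (intro real_le_lsqrt) (auto simp: Sq_nonneg)
          qed (use const Rp \<kappa> Sq_nonneg in auto)
          also have "\<dots> = \<mu> u'" by (simp add: \<mu>_def power2_eq_square)
          finally show ?thesis by (simp add: w_def)
        qed
        show "(\<integral>x. (y u' x + d u' (\<Sum>j\<in>indices m. coord v j *\<^sub>R dir j) x)\<^sup>2 \<partial>Q) \<le> s2"
          if "u' \<in> U\<^sub>0" "v \<in> Vs" for u' v m
        proof -
          define w where "w = (\<Sum>j\<in>indices m. coord v j *\<^sub>R dir j)"
          note sy = y_sqint[OF U\<^sub>0G(1)[OF that(1)]] and sd = d_sqint[OF U\<^sub>0G(1)[OF that(1)], of w]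
          note sy' = sqint_integrable_square[OF sy] and sd' = sqint_integrable_square[OF sd]
          have "(\<integral>x. (y u' x + d u' w x)\<^sup>2 \<partial>Q) \<le> (\<integral>x. 2 * (y u' x)\<^sup>2 + 2 * (d u' w x)\<^sup>2 \<partial>Q)"
          proof (rule integral_mono)
            show "integrable Q (\<lambda>x. (y u' x + d u' w x)\<^sup>2)" by (rule sqint_integrable_square[OF sqint_add[OF sy sd]])
            show "integrable Q (\<lambda>x. 2 * (y u' x)\<^sup>2 + 2 * (d u' w x)\<^sup>2)" using sy' sd' by auto
            show "(y u' x + d u' w x)\<^sup>2 \<le> 2 * (y u' x)\<^sup>2 + 2 * (d u' w x)\<^sup>2" for x
              using sum_squares_bound[of "y u' x" "d u' w x"] by (simp add: power2_sum)
          qed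
          also have "\<dots> = 2 * (\<integral>x. (y u' x)\<^sup>2 \<partial>Q) + 2 * (\<integral>x. (d u' w x)\<^sup>2 \<partial>Q)" using sy' sd' by simp
          also have "\<dots> \<le> 2 * (C * R\<^sup>2) + 2 * (C * R\<^sup>2)"
          proof (intro add_mono mult_left_mono)
            show "(\<integral>x. (y u' x)\<^sup>2 \<partial>Q) \<le> C * R\<^sup>2"
              using y_square[OF U\<^sub>0G(1)[OF that(1)]] U\<^sub>0G(2)[OF that(1)] const by (elim order_trans) simp
            have "Sq w \<le> \<kappa>\<^sup>2 * R\<^sup>2" using vm[OF that(2)] by (simp add: w_def)
            also have "\<dots> \<le> 1 * R\<^sup>2" using \<kappa> by (intro mult_right_mono power_le_one) auto
            finally show "(\<integral>x. (d u' w x)\<^sup>2 \<partial>Q) \<le> C * R\<^sup>2"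
              using d_square[OF U\<^sub>0G(1)[OF that(1)], of w] const by (elim order_trans) simp
          qed auto
          finally show ?thesis by (simp add: w_def s2_def)
        qed
      qed
      then obtain A where A: "A \<in> sets P" "measure P A \<ge> 1 - \<epsilon>"
        "\<And>\<omega> u. \<omega> \<in> A \<Longrightarrow> u \<in> U \<Longrightarrow> \<exists>u'\<in>U\<^sub>0. u - u' \<in> Vs \<and>
        (\<Sum>k<n. y u (X k \<omega>)) \<le> real n * (\<mu> u' + (s2 + 2 * (\<alpha> / real n) * D) / B) + 5 * B * (4 * R\<^sup>2 / (\<alpha> / real n) + t)"
        by blast
      have "(\<Sum>k<n. y u (X k \<omega>)) \<le> real n * (- (c / 2) * Sq u + \<gamma> * R\<^sup>2)" if \<omega>u: "\<omega> \<in> A" "u \<in> U" for \<omega> u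
      proof -
        obtain u' where u': "u' \<in> U\<^sub>0" "u - u' \<in> Vs"
          "(\<Sum>k<n. y u (X k \<omega>)) \<le> real n * (\<mu> u' + (s2 + 2 * (\<alpha> / real n) * D) / B) + 5 * B * (4 * R\<^sup>2 / (\<alpha> / real n) + t)"
          using A(3)[OF \<omega>u] by blast
        \<comment> \<open>Passing from the net point to \<open>u\<close> halves the curvature
          constant.\<close>
        have "Sq u \<le> 2 * Sq u' + 2 * (\<kappa>\<^sup>2 * R\<^sup>2)" using Sq_add_le[of u u'] u'(2) by (simp add: Vs_def)
        then have "c / 2 * Sq u \<le> c / 2 * (2 * Sq u' + 2 * (\<kappa>\<^sup>2 * R\<^sup>2))" using const by (intro mult_left_mono) auto
        then have "\<mu> u' \<le> - (c / 2) * Sq u + (c * \<kappa>\<^sup>2 + C * \<kappa>) * R\<^sup>2" by (simp add: \<mu>_def algebra_simps)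
        also have "(c * \<kappa>\<^sup>2 + C * \<kappa>) * R\<^sup>2 \<le> \<gamma> / 5 * R\<^sup>2"
        proof (rule mult_right_mono)
          have "c * \<kappa>\<^sup>2 \<le> c * \<kappa>" using \<kappa> const by (simp add: power2_eq_square mult_left_le)
          then show "c * \<kappa>\<^sup>2 + C * \<kappa> \<le> \<gamma> / 5" using \<kappa>(3) by (simp add: algebra_simps)
        qed simp
        finally have 1: "\<mu> u' \<le> - (c / 2) * Sq u + \<gamma> / 5 * R\<^sup>2" by simp
        have \<Delta>n: "\<Delta> / real n \<le> R\<^sup>2 / K\<^sup>2" using R2 Kp l by simp
        have "(s2 + 2 * (\<alpha> / real n) * D) / B + 5 * B * (4 * R\<^sup>2 / \<alpha>) + 5 * B * (C\<^sub>4 * (\<Delta> / real n))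
           = (4 * C / B) * R\<^sup>2 + (20 * B / \<alpha>) * R\<^sup>2 + E * (\<Delta> / real n)"
          by (simp add: s2_def D_def E_def algebra_simps add_divide_distrib)
        also have "\<dots> \<le> \<gamma> / 5 * R\<^sup>2 + \<gamma> / 5 * R\<^sup>2 + \<gamma> / 5 * R\<^sup>2"
        proof (intro add_mono)
          show "4 * C / B * R\<^sup>2 \<le> \<gamma> / 5 * R\<^sup>2" using B by (intro mult_right_mono) auto
          show "20 * B / \<alpha> * R\<^sup>2 \<le> \<gamma> / 5 * R\<^sup>2" unfolding \<alpha>(2) ..
          have "E * (\<Delta> / real n) \<le> E * (R\<^sup>2 / K\<^sup>2)" using \<Delta>n E by (intro mult_left_mono)
          also have "\<dots> = E / K\<^sup>2 * R\<^sup>2" by simp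
          also have "\<dots> \<le> \<gamma> / 5 * R\<^sup>2" using EK by (intro mult_right_mono) auto
          finally show "E * (\<Delta> / real n) \<le> \<gamma> / 5 * R\<^sup>2" .
        qed
        finally have 2: "(s2 + 2 * (\<alpha> / real n) * D) / B + 5 * B * (4 * R\<^sup>2 / \<alpha>) + 5 * B * (C\<^sub>4 * (\<Delta> / real n))
           \<le> 3 / 5 * \<gamma> * R\<^sup>2" by simp
        have "real n * (\<mu> u' + (s2 + 2 * (\<alpha> / real n) * D) / B) + 5 * B * (4 * R\<^sup>2 / (\<alpha> / real n) + t)
          = real n * (\<mu> u' + ((s2 + 2 * (\<alpha> / real n) * D) / B + 5 * B * (4 * R\<^sup>2 / \<alpha>) + 5 * B * (C\<^sub>4 * (\<Delta> / real n))))"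
        proof -
          have "5 * B * (4 * R\<^sup>2 / (\<alpha> / real n) + t) = real n * (5 * B * (4 * R\<^sup>2 / \<alpha>) + 5 * B * (C\<^sub>4 * (\<Delta> / real n)))"
            using n \<alpha> by (simp add: t_def field_simps)
          then show ?thesis by (simp only: distrib_left add.assoc)
        qed
        also have "\<dots> \<le> real n * (- (c / 2) * Sq u + \<gamma> * R\<^sup>2)"
        proof (rule mult_left_mono)
          have "w + b \<le> s + \<gamma> * R\<^sup>2" if "w \<le> s + \<gamma> / 5 * R\<^sup>2" "b \<le> 3 / 5 * \<gamma> * R\<^sup>2" for w b s
          proof -
            have "0 \<le> \<gamma> * R\<^sup>2" using \<gamma> by simp
            moreover have "b \<le> 3 / 5 * (\<gamma> * R\<^sup>2)" "w \<le> s + 1 / 5 * (\<gamma> * R\<^sup>2)" using that by simp_all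
            ultimately show ?thesis by linarith
          qed
          from this[OF 1 2] show "\<mu> u' + ((s2 + 2 * (\<alpha> / real n) * D) / B + 5 * B * (4 * R\<^sup>2 / \<alpha>) + 5 * B * (C\<^sub>4 * (\<Delta> / real n)))
            \<le> - (c / 2) * Sq u + \<gamma> * R\<^sup>2" .
        qed simp
        finally show ?thesis using u'(3) by linarith
      qed
      then show ?case
        using A(1,2) unfolding U_def Rq_def l_def[symmetric] \<Delta>_def[symmetric] R2 by blast
    qed
  qed
qed

end

subsection \<open>The Kullback-Leibler loss\<close>

text \<open>The neighbourhood in \<open>loc\<close> depends on the point without uniformity, so no
  subdivision of the interval is at hand. Instead, if \<open>n 1 < n 0\<close>, the function minus
  its chord has a positive maximum because \<open>n' 0 = 0\<close>. At its last maximizer the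
  tangent is parallel to the chord, and staying above it just to the right yields a later
  maximizer.\<close>

lemma locally_above_tangent_imp_le:
  fixes n n' :: "real \<Rightarrow> real"
  assumes der: "\<And>s. 0 \<le> s \<Longrightarrow> s \<le> 1 \<Longrightarrow> (n has_real_derivative n' s) (at s)"
    and n'0: "n' 0 = 0"
    and loc: "\<And>s. 0 \<le> s \<Longrightarrow> s < 1 \<Longrightarrow> \<exists>\<delta>>0. \<forall>h. 0 < h \<and> h < \<delta> \<and> s + h \<le> 1 \<longrightarrow> n s + h * n' s \<le> n (s + h)"
  shows "n 0 \<le> n 1"
proof (rule ccontr)
  assume "\<not> n 0 \<le> n 1"
  then have a: "n 1 - n 0 < 0" by simp
  define a where "a = n 1 - n 0"
  define k where "k s = n s - n 0 - s * a" for s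
  have k01: "k 0 = 0" "k 1 = 0" by (auto simp: k_def a_def)
  have kd: "(k has_real_derivative (n' s - a)) (at s)" if "0 \<le> s" "s \<le> 1" for s
    unfolding k_def by (auto intro!: derivative_eq_intros der that)
  have cont: "continuous_on {0..1} k"
    using kd by (intro continuous_at_imp_continuous_on ballI DERIV_isCont) auto
  obtain x where x: "x \<in> {0..1}" "\<And>s. s \<in> {0..1} \<Longrightarrow> k s \<le> k x"
    using continuous_attains_sup[OF _ _ cont] by auto
  have kx: "k x > 0"
  proof -
    obtain \<delta> where \<delta>: "\<delta> > 0" "\<And>h. 0 < h \<Longrightarrow> h < \<delta> \<Longrightarrow> k 0 < k (0 + h)"
      using DERIV_pos_inc_right[OF kd[of 0]] n'0 a by (auto simp: a_def)
    define h where "h = min (\<delta> / 2) 1"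
    have "0 < h" "h < \<delta>" "h \<le> 1" using \<delta>(1) by (auto simp: h_def)
    then have "0 < k h" "k h \<le> k x" using \<delta>(2)[of h] x(2)[of h] k01 by auto
    then show ?thesis by linarith
  qed
  define S where "S = {s\<in>{0..1}. k s = k x}"
  have Seq: "S = {0..1} \<inter> k -` {k x}" by (auto simp: S_def)
  then have "closed S" using continuous_closed_preimage[OF cont, of "{k x}"] by simp
  then have "compact S" using Seq by (simp add: compact_eq_bounded_closed bounded_Int)
  then obtain z where z: "z \<in> S" "\<And>s. s \<in> S \<Longrightarrow> s \<le> z"
    using compact_attains_sup[of S] x(1) by (auto simp: S_def)
  have zi: "0 < z" "z < 1" "k z = k x" using z(1) kx k01 by (auto simp: S_def order.order_iff_strict)
  have kz: "n' z - a = 0"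
  proof (rule DERIV_local_max[OF kd])
    show "0 < min z (1 - z)" using zi by simp
    show "\<forall>s. \<bar>z - s\<bar> < min z (1 - z) \<longrightarrow> k s \<le> k z"
      unfolding zi(3) by (intro allI impI x(2)) (auto simp: abs_less_iff)
  qed (use zi in auto)
  obtain \<delta> where \<delta>: "\<delta> > 0" "\<And>h. 0 < h \<Longrightarrow> h < \<delta> \<Longrightarrow> z + h \<le> 1 \<Longrightarrow> n z + h * n' z \<le> n (z + h)"
    using loc[of z] zi by auto
  define h where "h = min (\<delta> / 2) (1 - z)"
  have h: "0 < h" "h < \<delta>" "z + h \<le> 1" using \<delta>(1) zi by (auto simp: h_def)
  have "n' z = a" using kz by simp
  then have "k x \<le> k (z + h)" using \<delta>(2)[OF h] zi(3) by (simp add: k_def algebra_simps)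
  then have "z + h \<in> S" using x(2)[of "z + h"] h zi by (auto simp: S_def)
  then show False using z(2) h(1) by fastforce
qed

text \<open>Taylor's formula with Lagrange remainder; the bound \<open>- b\<close> matters for
  negative \<open>w\<close> only.\<close>

lemma exp_ge_quadratic:
  fixes w b :: real assumes "- b \<le> w" "b \<ge> 0"
  shows "exp (- b) / 2 * w\<^sup>2 \<le> exp w - 1 - w"
proof -
  obtain t where t: "\<bar>t\<bar> \<le> \<bar>w\<bar>" "exp w = (\<Sum>m<2. w ^ m / fact m) + exp t / fact 2 * w ^ 2"
    using Maclaurin_exp_le[of w 2] by auto
  have eq: "exp w - 1 - w = exp t / 2 * w\<^sup>2"
    using t(2) by (simp add: eval_nat_numeral)
  show ?thesis
  proof (cases "w \<le> 0")
    case True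
    then have "- b \<le> t" using t(1) assms by linarith
    then show ?thesis unfolding eq by (intro mult_right_mono divide_right_mono) auto
  next
    case False
    have "exp (- b) / 2 * w\<^sup>2 \<le> 1 / 2 * w\<^sup>2" using assms by (intro mult_right_mono divide_right_mono) auto
    also have "\<dots> \<le> exp w - 1 - w"
      using exp_lower_Taylor_quadratic[of w] False by (simp add: power2_eq_square)
    finally show ?thesis .
  qed
qed

lemma abs_exp_diff_le:
  fixes a b B :: real assumes "a \<le> B" "b \<le> B"
  shows "\<bar>exp a - exp b\<bar> \<le> exp B * \<bar>a - b\<bar>"
proof -
  have *: "\<bar>exp a - exp b\<bar> \<le> exp B * \<bar>a - b\<bar>" if "b \<le> a" "a \<le> B" for a b
  proof -
    have "exp a * (1 - (a - b)) \<le> exp a * exp (- (a - b))"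
      by (intro mult_left_mono) (use exp_ge_add_one_self[of "- (a - b)"] in linarith, simp)
    then have "exp a * (1 - (a - b)) \<le> exp b" by (simp add: exp_add[symmetric])
    then have "exp a - exp b \<le> exp a * (a - b)" by (simp add: algebra_simps)
    also have "\<dots> \<le> exp B * (a - b)" using that by (intro mult_right_mono) auto
    finally show ?thesis using that by simp
  qed
  show ?thesis
  proof (cases "b \<le> a")
    case True then show ?thesis using *[of b a] assms by simp
  next
    case False then show ?thesis using *[of a b] assms by (simp add: abs_minus_commute)
  qed
qed

locale density_base =
  fixes M :: "'x measure" and \<eta> :: "'q \<Rightarrow> 'x \<Rightarrow> real" and \<tau>\<^sub>0 :: 'q
  assumes exp_integrable: "integrable M (\<lambda>x. exp (\<eta> \<tau> x))"
    and eta_L20: "\<eta> \<tau> \<in> L20_space M \<eta> \<tau>\<^sub>0"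
    and prob_Q: "prob_space (density M (\<lambda>x. ennreal (dens M \<eta> \<tau>\<^sub>0 x)))"
begin

definition Q :: "'x measure" where "Q = density M (\<lambda>x. ennreal (dens M \<eta> \<tau>\<^sub>0 x))"

definition logZ :: "'q \<Rightarrow> real" where "logZ \<tau> = ln (\<integral>x. exp (\<eta> \<tau> x) \<partial>M)"

text \<open>The log-likelihood ratio against the true parameter; its exponential is the density of
  the law of \<tau> with respect to \<open>Q\<close>, see \<open>dens_eq\<close>.\<close>

definition llr :: "'q \<Rightarrow> 'x \<Rightarrow> real" where "llr \<tau> x = (\<eta> \<tau> x - logZ \<tau>) - (\<eta> \<tau>\<^sub>0 x - logZ \<tau>\<^sub>0)"

text \<open>The mean under \<tau>, written over \<open>Q\<close> so that all parameters share one
  measure; \<open>mean_eq\<close> links it to \<open>mean\<close>.\<close>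

definition expect :: "'q \<Rightarrow> ('x \<Rightarrow> real) \<Rightarrow> real" where "expect \<tau> \<phi> = (\<integral>x. \<phi> x * exp (llr \<tau> x) \<partial>Q)"

sublocale Q: prob_space Q
  unfolding Q_def by (rule prob_Q)

lemma eta_measurable [measurable]: "\<eta> \<tau> \<in> borel_measurable M"
  using eta_L20[of \<tau>] by (simp add: L20_space_def L2_space_def)

lemma dens_measurable [measurable]: "dens M \<eta> \<tau> \<in> borel_measurable M"
  unfolding dens_def by measurable

lemma sets_Q [measurable_cong]: "sets Q = sets M" and space_Q: "space Q = space M"
  by (simp_all add: Q_def)

lemma Z_pos: "(\<integral>x. exp (\<eta> \<tau> x) \<partial>M) > 0"
proof -
  have "(\<integral>x. exp (\<eta> \<tau> x) \<partial>M) \<noteq> 0"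
  proof
    assume "(\<integral>x. exp (\<eta> \<tau> x) \<partial>M) = 0"
    then have "AE x in M. exp (\<eta> \<tau> x) = 0"
      using integral_nonneg_eq_0_iff_AE[OF exp_integrable[of \<tau>]] by simp
    then have "AE x in M. False" by simp
    then have "AE x in Q. False" unfolding Q_def by (subst AE_density) auto
    then show False using Q.AE_False by simp
  qed
  moreover have "(\<integral>x. exp (\<eta> \<tau> x) \<partial>M) \<ge> 0" by simp
  ultimately show ?thesis by linarith
qed

lemma dens_pos: "dens M \<eta> \<tau> x > 0"
  using Z_pos[of \<tau>] by (simp add: dens_def)

lemma ln_dens: "ln (dens M \<eta> \<tau> x) = \<eta> \<tau> x - logZ \<tau>"
  using Z_pos[of \<tau>] by (simp add: dens_def logZ_def ln_div)

lemma dens_eq: "dens M \<eta> \<tau> x = dens M \<eta> \<tau>\<^sub>0 x * exp (llr \<tau> x)"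
proof -
  have "dens M \<eta> \<sigma> x = exp (\<eta> \<sigma> x - logZ \<sigma>)" for \<sigma>
    using ln_dens[of \<sigma> x] dens_pos[of \<sigma> x] by (metis exp_ln)
  then show ?thesis by (simp add: llr_def exp_add[symmetric])
qed

text \<open>The true density is strictly positive everywhere, so \<open>Q\<close> and
  \<open>M\<close> have the same null sets.\<close>

lemma AE_Q: "(AE x in Q. R x) \<longleftrightarrow> (AE x in M. R x)"
  unfolding Q_def by (subst AE_density) (auto simp: dens_pos)

lemma llr_measurable [measurable]: "llr \<tau> \<in> borel_measurable M"
  unfolding llr_def by measurable

lemma integral_Q:
  assumes [measurable]: "\<phi> \<in> borel_measurable M"
  shows "(\<integral>x. \<phi> x \<partial>Q) = (\<integral>x. dens M \<eta> \<tau>\<^sub>0 x * \<phi> x \<partial>M)"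
    and "integrable Q \<phi> \<longleftrightarrow> integrable M (\<lambda>x. dens M \<eta> \<tau>\<^sub>0 x * \<phi> x)"
proof -
  have "AE x in M. 0 \<le> dens M \<eta> \<tau>\<^sub>0 x" using less_imp_le[OF dens_pos] by simp
  then show "(\<integral>x. \<phi> x \<partial>Q) = (\<integral>x. dens M \<eta> \<tau>\<^sub>0 x * \<phi> x \<partial>M)"
    and "integrable Q \<phi> \<longleftrightarrow> integrable M (\<lambda>x. dens M \<eta> \<tau>\<^sub>0 x * \<phi> x)"
    unfolding Q_def by (simp_all add: integral_real_density integrable_real_density)
qed

lemma mean_eq:
  assumes [measurable]: "\<phi> \<in> borel_measurable M"
  shows "mean M \<eta> \<tau> \<phi> = expect \<tau> \<phi>"
proof -
  have "mean M \<eta> \<tau> \<phi> = (\<integral>x. dens M \<eta> \<tau>\<^sub>0 x * (\<phi> x * exp (llr \<tau> x)) \<partial>M)"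
    unfolding mean_def by (intro Bochner_Integration.integral_cong refl) (subst dens_eq, simp add: mult_ac)
  then show ?thesis unfolding expect_def by (subst integral_Q) auto
qed

lemma llr_0: "llr \<tau>\<^sub>0 x = 0" by (simp add: llr_def)

lemma expect_0: "expect \<tau>\<^sub>0 \<phi> = (\<integral>x. \<phi> x \<partial>Q)" by (simp add: expect_def llr_0)

lemma Var_eq:
  assumes [measurable]: "\<phi> \<in> borel_measurable M"
  shows "Var M \<eta> \<tau> \<phi> = expect \<tau> (\<lambda>x. (\<phi> x)\<^sup>2) - (expect \<tau> \<phi>)\<^sup>2"
  unfolding Var_def Cov_def by (simp add: mean_eq power2_eq_square)

lemma L20_iff: "\<phi> \<in> L20_space M \<eta> \<tau>\<^sub>0 \<longleftrightarrow> sqint Q \<phi> \<and> (\<integral>x. \<phi> x \<partial>Q) = 0"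
proof -
  have "\<phi> \<in> L20_space M \<eta> \<tau>\<^sub>0 \<longleftrightarrow> \<phi> \<in> borel_measurable M \<and> integrable M (\<lambda>x. (\<phi> x)\<^sup>2 * dens M \<eta> \<tau>\<^sub>0 x) \<and> mean M \<eta> \<tau>\<^sub>0 \<phi> = 0"
    by (auto simp: L20_space_def L2_space_def)
  also have "\<dots> \<longleftrightarrow> sqint Q \<phi> \<and> (\<integral>x. \<phi> x \<partial>Q) = 0"
    by (auto simp: sqint_def mean_eq expect_0 integral_Q(2) mult.commute)
  finally show ?thesis .
qed

lemma eta_sqint: "sqint Q (\<eta> \<tau>)" and eta_mean: "(\<integral>x. \<eta> \<tau> x \<partial>Q) = 0"
  using eta_L20[of \<tau>] by (auto simp: L20_iff)

lemma llr_sqint: "sqint Q (llr \<tau>)"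
  unfolding llr_def by (intro sqint_diff eta_sqint Q.sqint_const)

lemma Var_0:
  assumes "sqint Q \<phi>" "(\<integral>x. \<phi> x \<partial>Q) = 0"
  shows "Var M \<eta> \<tau>\<^sub>0 \<phi> = (\<integral>x. (\<phi> x)\<^sup>2 \<partial>Q)"
  using assms sqint_measurable[OF assms(1)] by (subst Var_eq) (auto simp: expect_0)

lemma L2_norm_eq:
  assumes "sqint Q \<phi>" shows "L2_norm M \<eta> \<tau>\<^sub>0 \<phi> = sqrt (\<integral>x. (\<phi> x)\<^sup>2 \<partial>Q)"
  using sqint_measurable[OF assms] unfolding L2_norm_def by (subst mean_eq) (auto simp: expect_0)

text \<open>Representatives are centred under the true density, so the Kullback-Leibler loss is a
  difference of log-partition functions.\<close>

lemma llr_mean: "(\<integral>x. llr \<tau> x \<partial>Q) = - (logZ \<tau> - logZ \<tau>\<^sub>0)"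
  unfolding llr_def using Q.sqint_integrable[OF eta_sqint] eta_mean by (simp add: Q.prob_space)

lemma exp_llr_integral: "integrable Q (\<lambda>x. exp (llr \<tau> x))" "(\<integral>x. exp (llr \<tau> x) \<partial>Q) = 1"
proof -
  have eq: "(\<lambda>x. dens M \<eta> \<tau>\<^sub>0 x * exp (llr \<tau> x)) = (\<lambda>x. exp (\<eta> \<tau> x) / (\<integral>t. exp (\<eta> \<tau> t) \<partial>M))"
    unfolding dens_eq[symmetric] by (simp add: dens_def)
  show "integrable Q (\<lambda>x. exp (llr \<tau> x))"
    by (subst integral_Q(2)) (auto simp: eq exp_integrable)
  show "(\<integral>x. exp (llr \<tau> x) \<partial>Q) = 1"
    using Z_pos[of \<tau>] by (subst integral_Q(1)) (auto simp: eq)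
qed

end

text \<open>Two derivatives of \<open>\<eta>\<close> coexist: \<open>D\<close> at fixed points of
  the sample space, needed at the observations, and an abstract one in the L2 sense. Log-concavity
  comes with a null set for each pair of parameters; \<open>separable\<close> later merges these
  into one.\<close>

locale density_model = density_base M \<eta> \<tau>\<^sub>0
  for M :: "'x measure" and \<eta> :: "'q::real_normed_vector \<Rightarrow> 'x \<Rightarrow> real" and \<tau>\<^sub>0 :: 'q +
  fixes N :: "'q set" and D :: "'q \<Rightarrow> 'q \<Rightarrow> 'x \<Rightarrow> real" and n2 :: "'q \<Rightarrow> real" and c\<^sub>1 c\<^sub>2 C\<^sub>3 C\<^sub>4 c\<^sub>n :: real
  assumes N: "open N" "convex N" "\<tau>\<^sub>0 \<in> N"
    and log_concave: "0 \<le> t \<Longrightarrow> t \<le> 1 \<Longrightarrow> AE x in M.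
        (1 - t) * ln (dens M \<eta> \<tau> x) + t * ln (dens M \<eta> \<sigma> x) \<le> ln (dens M \<eta> ((1 - t) *\<^sub>R \<tau> + t *\<^sub>R \<sigma>) x)"
    and eta_derivative: "AE x in M. \<forall>\<tau>\<in>N. ((\<lambda>\<sigma>. \<eta> \<sigma> x) has_derivative (\<lambda>v. D \<tau> v x)) (at \<tau>)"
    and D_L20: "\<tau> \<in> N \<Longrightarrow> D \<tau> v \<in> L20_space M \<eta> \<tau>\<^sub>0"
    and L2_differentiable: "\<exists>D1. \<forall>\<tau>\<in>N. L20_bounded_linear M \<eta> \<tau>\<^sub>0 (D1 \<tau>) \<and>
        (\<forall>\<epsilon>>0. \<forall>\<^sub>F k in nhds 0. L2_norm M \<eta> \<tau>\<^sub>0 (\<lambda>x. \<eta> (\<tau> + k) x - \<eta> \<tau> x - D1 \<tau> k x) \<le> \<epsilon> * norm k)"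
    and const: "c\<^sub>1 > 0" "c\<^sub>2 > 0" "C\<^sub>3 > 0" "C\<^sub>4 > 0" "c\<^sub>n > 0"
    and D_var: "\<tau> \<in> N \<Longrightarrow> c\<^sub>1 * n2 v \<le> Var M \<eta> \<tau>\<^sub>0 (D \<tau> v)" "\<tau> \<in> N \<Longrightarrow> Var M \<eta> \<tau>\<^sub>0 (D \<tau> v) \<le> c\<^sub>2 * n2 v"
    and var_equiv: "\<tau> \<in> N \<Longrightarrow> f \<in> L20_space M \<eta> \<tau>\<^sub>0 \<Longrightarrow>
        C\<^sub>3 * Var M \<eta> \<tau>\<^sub>0 f \<le> Var M \<eta> \<tau> f \<and> Var M \<eta> \<tau> f \<le> C\<^sub>4 * Var M \<eta> \<tau>\<^sub>0 f"
    and nontrivial: "\<exists>f\<in>L20_space M \<eta> \<tau>\<^sub>0. Var M \<eta> \<tau>\<^sub>0 f > 0"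
    and n2_nonneg: "n2 v \<ge> 0" and n2_scale: "n2 (c *\<^sub>R v) = c\<^sup>2 * n2 v" and n2_le: "n2 v \<le> c\<^sub>n * (norm v)\<^sup>2"
    and separable: "\<exists>S :: 'q set. countable S \<and> closure S = UNIV"
begin

definition score :: "'q \<Rightarrow> 'q \<Rightarrow> 'x \<Rightarrow> real" where "score \<tau> v x = D \<tau> v x - expect \<tau> (D \<tau> v)"

lemma D_sqint: "\<tau> \<in> N \<Longrightarrow> sqint Q (D \<tau> v)" and D_mean: "\<tau> \<in> N \<Longrightarrow> (\<integral>x. D \<tau> v x \<partial>Q) = 0"
  using D_L20[of \<tau> v] by (auto simp: L20_iff)

lemma D_square:
  assumes "\<tau> \<in> N"
  shows "c\<^sub>1 * n2 v \<le> (\<integral>x. (D \<tau> v x)\<^sup>2 \<partial>Q)" "(\<integral>x. (D \<tau> v x)\<^sup>2 \<partial>Q) \<le> c\<^sub>2 * n2 v"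
  using D_var[OF assms, of v] Var_0[OF D_sqint[OF assms] D_mean[OF assms], of v] by simp_all

text \<open>Testing the equivalence of the variances on indicators bounds the density ratio: the
  equivalence keeps the mass of a fixed set away from 0 and 1, so that no subset of it, and none of
  its complement, can carry almost all of the mass.\<close>

lemma density_ratio_bounded: "\<exists>B\<ge>0. \<forall>\<tau>\<in>N. AE x in Q. \<bar>llr \<tau> x\<bar> \<le> B"
proof -
  obtain f where f: "f \<in> L20_space M \<eta> \<tau>\<^sub>0" "Var M \<eta> \<tau>\<^sub>0 f > 0" using nontrivial by blast
  have fs: "sqint Q f" "(\<integral>x. f x \<partial>Q) = 0" using f(1) by (auto simp: L20_iff)
  have fm[measurable]: "f \<in> borel_measurable M" using sqint_measurable[OF fs(1)] by simp
  have f2: "(\<integral>x. (f x)\<^sup>2 \<partial>Q) > 0" using f(2) Var_0[OF fs] by simp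
  have nz: False if "AE x in Q. f x = 0"
  proof -
    have "(\<integral>x. (f x)\<^sup>2 \<partial>Q) = (\<integral>x. 0 \<partial>Q)" using that by (intro integral_cong_AE) auto
    then show False using f2 by simp
  qed
  \<comment> \<open>A centred function that is not null is positive on a set of mass strictly
    between 0 and 1.\<close>
  define T where "T = {x\<in>space M. f x > 0}"
  have T[measurable]: "T \<in> sets M" unfolding T_def by measurable
  define p where "p S = measure Q S" for S
  have p0: "p T \<noteq> 0"
  proof
    assume "p T = 0"
    then have "emeasure Q T = 0" by (simp add: p_def Q.emeasure_eq_measure)
    then have "AE x in Q. x \<notin> T" by (intro AE_not_in) (auto simp: null_sets_def)
    then have le: "AE x in Q. 0 \<le> - f x" using AE_space by eventually_elim (auto simp: T_def space_Q)
    have "AE x in Q. - f x = 0"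
      using integral_nonneg_eq_0_iff_AE[OF _ le] Q.sqint_integrable[OF fs(1)] fs(2) by simp
    then show False using nz by simp
  qed
  have p1: "p T \<noteq> 1"
  proof
    assume "p T = 1"
    then have "AE x in Q. x \<in> T" using Q.AE_prob_1[of T] by (simp add: p_def)
    then have le: "AE x in Q. 0 \<le> f x" by eventually_elim (auto simp: T_def)
    have "AE x in Q. f x = 0"
      using integral_nonneg_eq_0_iff_AE[OF _ le] Q.sqint_integrable[OF fs(1)] fs(2) by simp
    then show False using nz by simp
  qed
  have pT: "0 < p T" "p T < 1" using p0 p1 Q.prob_le_1[of T] measure_nonneg[of Q T] by (auto simp: p_def less_le)
  \<comment> \<open>A lower bound, valid at every parameter of \<open>N\<close>, for the variance of
    the indicator of \<open>T\<close>.\<close>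
  define k where "k = C\<^sub>3 * (p T * (1 - p T))"
  have k: "k > 0" using pT const by (simp add: k_def)
  define K where "K = C\<^sub>4 / k"
  have K: "K > 0" using k const by (simp add: K_def)
  have main: "AE x in Q. exp (llr \<tau> x) \<le> K \<and> k \<le> exp (llr \<tau> x)" if \<tau>: "\<tau> \<in> N" for \<tau>
  proof -
    define q where "q S = (\<integral>x. indicator S x * exp (llr \<tau> x) \<partial>Q)" for S :: "'x set"
    have int: "integrable Q (\<lambda>x. indicator S x * exp (llr \<tau> x))" if "S \<in> sets M" for S :: "'x set"
      using integrable_mult_indicator[of S Q "\<lambda>x. exp (llr \<tau> x)"] exp_llr_integral(1)[of \<tau>] that by simp
    have q0: "0 \<le> q S" for S unfolding q_def by simp
    have qmono: "q S \<le> q S'" if "S \<subseteq> S'" "S \<in> sets M" "S' \<in> sets M" for S S'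
      unfolding q_def using that int by (intro integral_mono) (auto simp: indicator_def)
    have qdisj: "q (S \<inter> T) + q (S - T) = q S" if [measurable]: "S \<in> sets M" for S
    proof -
      have "q (S \<inter> T) + q (S - T) = (\<integral>x. indicator (S \<inter> T) x * exp (llr \<tau> x) + indicator (S - T) x * exp (llr \<tau> x) \<partial>Q)"
        unfolding q_def by (rule Bochner_Integration.integral_add[symmetric]) (auto intro: int)
      also have "\<dots> = q S" unfolding q_def
        by (intro Bochner_Integration.integral_cong) (auto simp: indicator_def)
      finally show ?thesis .
    qed
    have pdisj: "p (S \<inter> T) + p (S - T) = p S" if [measurable]: "S \<in> sets M" for S
      unfolding p_def using Q.finite_measure_Diff'[of S T] by (simp add: sets_Q)
    have qspace: "q (space M) = 1"
    proof -
      have "q (space M) = (\<integral>x. exp (llr \<tau> x) \<partial>Q)" unfolding q_def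
        by (intro Bochner_Integration.integral_cong) (auto simp: space_Q)
      then show ?thesis by (simp add: exp_llr_integral)
    qed
    have q1: "q S \<le> 1" if "S \<in> sets M" for S
      using qmono[of S "space M"] sets.sets_into_space[OF that] that by (simp add: qspace)
    \<comment> \<open>The variance of an indicator is \<open>p * (1 - p)\<close> under the true law
      and \<open>q * (1 - q)\<close> under the law of \<tau>, so equivalence of variances compares
      masses of sets.\<close>
    have vS: "C\<^sub>3 * (p S * (1 - p S)) \<le> q S * (1 - q S) \<and> q S * (1 - q S) \<le> C\<^sub>4 * (p S * (1 - p S))"
      if S[measurable]: "S \<in> sets M" for S
    proof -
      define g where "g x = indicator S x - p S" for x
      have [measurable]: "g \<in> borel_measurable M" unfolding g_def by measurable
      have indS: "integrable Q (indicator S :: _ \<Rightarrow> real)"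
        using S by (simp add: sets_Q Q.emeasure_eq_measure)
      have pS: "(\<integral>x. indicator S x \<partial>Q) = p S" using S by (simp add: p_def sets_Q)
      have gm: "(\<integral>x. g x \<partial>Q) = 0"
        unfolding g_def using indS by (subst Bochner_Integration.integral_diff) (auto simp: p_def Q.prob_space)
      have g2: "(g x)\<^sup>2 = (1 - 2 * p S) * indicator S x + (p S)\<^sup>2" for x
        by (auto simp: g_def indicator_def power2_eq_square algebra_simps)
      have gs: "sqint Q g" unfolding sqint_def g2 using indS by (auto simp: g_def)
      have V0: "Var M \<eta> \<tau>\<^sub>0 g = p S * (1 - p S)"
        unfolding Var_0[OF gs gm] g2 using indS
        by (subst Bochner_Integration.integral_add) (auto simp: p_def Q.prob_space power2_eq_square algebra_simps)
      have e1: "expect \<tau> g = q S - p S"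
      proof -
        have "expect \<tau> g = (\<integral>x. indicator S x * exp (llr \<tau> x) - p S * exp (llr \<tau> x) \<partial>Q)"
          unfolding expect_def g_def by (simp add: left_diff_distrib)
        then show ?thesis using int[OF S] exp_llr_integral[of \<tau>] by (simp add: q_def)
      qed
      have e2: "expect \<tau> (\<lambda>x. (g x)\<^sup>2) = (1 - 2 * p S) * q S + (p S)\<^sup>2"
      proof -
        have "expect \<tau> (\<lambda>x. (g x)\<^sup>2) = (\<integral>x. (1 - 2 * p S) * (indicator S x * exp (llr \<tau> x)) + (p S)\<^sup>2 * exp (llr \<tau> x) \<partial>Q)"
          unfolding expect_def g2 by (simp add: distrib_right mult.assoc)
        then show ?thesis using int[OF S] exp_llr_integral[of \<tau>] by (simp add: q_def)
      qed
      have V1: "Var M \<eta> \<tau> g = q S * (1 - q S)"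
        by (subst Var_eq, simp, unfold e1 e2) (simp add: power2_eq_square algebra_simps)
      have "g \<in> L20_space M \<eta> \<tau>\<^sub>0" using gs gm by (simp add: L20_iff)
      from var_equiv[OF \<tau> this] show ?thesis by (simp add: V0 V1)
    qed
    have kT: "k \<le> q T * (1 - q T)" using vS[OF T] by (simp add: k_def)
    have qT: "k \<le> q T" "k \<le> 1 - q T"
      using kT mult_left_le[of "1 - q T" "q T"] mult_left_le[of "q T" "1 - q T"] q0[of T] q1[OF T]
      by (auto simp: mult.commute)
    \<comment> \<open>To cancel the factor \<open>1 - q S'\<close>, it must stay away from 0. It
      does for subsets of \<open>T\<close> and of its complement, hence the splitting of
      \<open>S\<close>.\<close>
    have upper: "q S \<le> K * p S" if [measurable]: "S \<in> sets M" for S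
    proof -
      have *: "q S' \<le> K * p S'" if [measurable]: "S' \<in> sets M" and le: "q S' \<le> 1 - k" for S'
      proof -
        have "k * q S' \<le> q S' * (1 - q S')" using le q0[of S'] mult_left_mono[of k "1 - q S'" "q S'"] by (simp add: mult.commute)
        also have "\<dots> \<le> C\<^sub>4 * (p S' * (1 - p S'))" using vS[of S'] by simp
        also have "\<dots> \<le> C\<^sub>4 * p S'" using const Q.prob_le_1[of S'] measure_nonneg[of Q S']
          by (intro mult_left_mono) (auto simp: p_def mult_left_le)
        finally show ?thesis using k by (simp add: K_def field_simps)
      qed
      have "q (S \<inter> T) \<le> 1 - k" using qmono[of "S \<inter> T" T] qT by simp
      moreover have "q (S - T) \<le> 1 - k"
      proof -
        have "q (space M \<inter> T) + q (space M - T) = 1" using qdisj[of "space M"] qspace by simp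
        moreover have "space M \<inter> T = T" using sets.sets_into_space[OF T] by auto
        moreover have "q (S - T) \<le> q (space M - T)"
          using sets.sets_into_space[of S M] by (intro qmono) auto
        ultimately show ?thesis using qT by simp
      qed
      ultimately have "q (S \<inter> T) + q (S - T) \<le> K * p (S \<inter> T) + K * p (S - T)"
        by (intro add_mono *) auto
      then show ?thesis using qdisj[of S] pdisj[of S] by (simp add: distrib_left[symmetric])
    qed
    have lower: "k * p S \<le> q S" if [measurable]: "S \<in> sets M" for S
    proof -
      have *: "k * p S' \<le> q S'" if [measurable]: "S' \<in> sets M" and le: "p T * (1 - p T) \<le> 1 - p S'" for S'
      proof -
        have "k * p S' = C\<^sub>3 * (p S' * (p T * (1 - p T)))" by (simp add: k_def)
        also have "\<dots> \<le> C\<^sub>3 * (p S' * (1 - p S'))"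
          using const le by (intro mult_left_mono) (auto simp: p_def)
        also have "\<dots> \<le> q S' * (1 - q S')" using vS[of S'] by simp
        also have "\<dots> \<le> q S'" using q0[of S'] q1[of S'] by (intro mult_left_le) auto
        finally show ?thesis .
      qed
      have "p (S \<inter> T) \<le> p T" unfolding p_def by (intro Q.finite_measure_mono) (auto simp: sets_Q)
      moreover have "p T * (1 - p T) \<le> 1 - p T" using pT by (intro mult_left_le_one_le) auto
      ultimately have "p T * (1 - p T) \<le> 1 - p (S \<inter> T)" by linarith
      moreover have "p T * (1 - p T) \<le> 1 - p (S - T)"
      proof -
        have "p (space M \<inter> T) + p (space M - T) = 1" using pdisj[of "space M"] Q.prob_space by (simp add: p_def space_Q)
        moreover have "space M \<inter> T = T" using sets.sets_into_space[OF T] by auto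
        moreover have "p (S - T) \<le> p (space M - T)"
          unfolding p_def using sets.sets_into_space[of S M] by (intro Q.finite_measure_mono) (auto simp: sets_Q)
        moreover have "p T * (1 - p T) \<le> p T" using pT by (intro mult_left_le) auto
        ultimately show ?thesis by simp
      qed
      ultimately have "k * p (S \<inter> T) + k * p (S - T) \<le> q (S \<inter> T) + q (S - T)"
        by (intro add_mono *) auto
      then show ?thesis using qdisj[of S] pdisj[of S] by (simp add: distrib_left[symmetric])
    qed
    have pint: "integrable Q (\<lambda>x. indicator S x :: real)" "(\<integral>x. indicator S x \<partial>Q) = p S" if "S \<in> sets M" for S
      using that by (simp_all add: sets_Q Q.emeasure_eq_measure p_def)
    \<comment> \<open>On the level set where the bound fails the integrand is positive, yet its
      integral is at most 0; so that set is null.\<close>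
    have "AE x in Q. exp (llr \<tau> x) \<le> K"
    proof -
      define S where "S = {x\<in>space M. exp (llr \<tau> x) > K}"
      have S[measurable]: "S \<in> sets M" unfolding S_def by measurable
      define g where "g x = indicator S x * exp (llr \<tau> x) - K * indicator S x" for x
      have gi: "integrable Q g" unfolding g_def using int[OF S] pint(1)[OF S] by auto
      have g0: "0 \<le> g x" for x by (auto simp: g_def S_def indicator_def)
      have "(\<integral>x. g x \<partial>Q) = q S - K * p S" unfolding g_def using int[OF S] pint[OF S] by (simp add: q_def)
      also have "\<dots> \<le> 0" using upper[OF S] by simp
      finally have "(\<integral>x. g x \<partial>Q) = 0" using Bochner_Integration.integral_nonneg[of Q g, OF g0] by linarith
      then have "AE x in Q. g x = 0" using integral_nonneg_eq_0_iff_AE[OF gi] g0 by simp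
      then show ?thesis using AE_space by eventually_elim (auto simp: g_def S_def indicator_def space_Q split: if_splits)
    qed
    moreover have "AE x in Q. k \<le> exp (llr \<tau> x)"
    proof -
      define S where "S = {x\<in>space M. exp (llr \<tau> x) < k}"
      have S[measurable]: "S \<in> sets M" unfolding S_def by measurable
      define g where "g x = k * indicator S x - indicator S x * exp (llr \<tau> x)" for x
      have gi: "integrable Q g" unfolding g_def using int[OF S] pint(1)[OF S] by auto
      have g0: "0 \<le> g x" for x by (auto simp: g_def S_def indicator_def)
      have "(\<integral>x. g x \<partial>Q) = k * p S - q S" unfolding g_def using int[OF S] pint[OF S] by (simp add: q_def)
      also have "\<dots> \<le> 0" using lower[OF S] by simp
      finally have "(\<integral>x. g x \<partial>Q) = 0" using Bochner_Integration.integral_nonneg[of Q g, OF g0] by linarith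
      then have "AE x in Q. g x = 0" using integral_nonneg_eq_0_iff_AE[OF gi] g0 by simp
      then show ?thesis using AE_space by eventually_elim (auto simp: g_def S_def indicator_def space_Q split: if_splits)
    qed
    ultimately show ?thesis by eventually_elim simp
  qed
  show ?thesis
  proof (intro exI[of _ "max \<bar>ln K\<bar> \<bar>ln k\<bar>"] conjI ballI)
    fix \<tau> assume "\<tau> \<in> N"
    from main[OF this] show "AE x in Q. \<bar>llr \<tau> x\<bar> \<le> max \<bar>ln K\<bar> \<bar>ln k\<bar>"
    proof eventually_elim
      case (elim x)
      have "llr \<tau> x \<le> ln K" using elim K by (simp add: ln_ge_iff)
      moreover have "ln k \<le> llr \<tau> x" using ln_mono[of k "exp (llr \<tau> x)"] elim k by simp
      ultimately
      show ?case by linarith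
    qed
  qed simp
qed

end

section \<open>Lipschitz bounds and differentiability of the log-partition function\<close>

context density_model
begin

definition bnd :: real where
  "bnd = (SOME B. B \<ge> 0 \<and> (\<forall>\<tau>\<in>N. AE x in Q. \<bar>llr \<tau> x\<bar> \<le> B))"

lemma bnd_nonneg: "bnd \<ge> 0" and llr_bounded: "\<tau> \<in> N \<Longrightarrow> AE x in Q. \<bar>llr \<tau> x\<bar> \<le> bnd"
  using someI_ex[of "\<lambda>B. B \<ge> 0 \<and> (\<forall>\<tau>\<in>N. AE x in Q. \<bar>llr \<tau> x\<bar> \<le> B)"] density_ratio_bounded
  unfolding bnd_def by auto

lemma integrable_weighted:
  assumes "\<tau> \<in> N" "integrable Q \<phi>"
  shows "integrable Q (\<lambda>x. \<phi> x * exp (llr \<tau> x))"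
proof (rule Bochner_Integration.integrable_bound)
  show "integrable Q (\<lambda>x. exp bnd * \<phi> x)" using assms by simp
  show "(\<lambda>x. \<phi> x * exp (llr \<tau> x)) \<in> borel_measurable Q" using assms by auto
  show "AE x in Q. norm (\<phi> x * exp (llr \<tau> x)) \<le> norm (exp bnd * \<phi> x)"
    using llr_bounded[OF assms(1)]
  proof eventually_elim
    case (elim x)
    then have "\<bar>\<phi> x\<bar> * exp (llr \<tau> x) \<le> \<bar>\<phi> x\<bar> * exp bnd" by (intro mult_left_mono) auto
    then show ?case by (simp add: abs_mult mult.commute)
  qed
qed

lemma expect_le:
  assumes "\<tau> \<in> N" "integrable Q \<phi>" "AE x in Q. 0 \<le> \<phi> x"
  shows "expect \<tau> \<phi> \<le> exp bnd * (\<integral>x. \<phi> x \<partial>Q)"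
    and "exp (- bnd) * (\<integral>x. \<phi> x \<partial>Q) \<le> expect \<tau> \<phi>"
    and "exp (- bnd) * expect \<tau> \<phi> \<le> (\<integral>x. \<phi> x \<partial>Q)"
proof -
  have "expect \<tau> \<phi> \<le> (\<integral>x. exp bnd * \<phi> x \<partial>Q)"
    unfolding expect_def
  proof (rule integral_mono_AE)
    show "AE x in Q. \<phi> x * exp (llr \<tau> x) \<le> exp bnd * \<phi> x"
      using llr_bounded[OF assms(1)] assms(3)
      by eventually_elim (subst mult.commute, intro mult_right_mono, auto)
  qed (use integrable_weighted assms in auto)
  then show 1: "expect \<tau> \<phi> \<le> exp bnd * (\<integral>x. \<phi> x \<partial>Q)" by simp
  have "(\<integral>x. exp (- bnd) * \<phi> x \<partial>Q) \<le> expect \<tau> \<phi>"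
    unfolding expect_def
  proof (rule integral_mono_AE)
    show "AE x in Q. exp (- bnd) * \<phi> x \<le> \<phi> x * exp (llr \<tau> x)"
      using llr_bounded[OF assms(1)] assms(3)
      by eventually_elim (subst mult.commute, intro mult_left_mono, auto)
  qed (use integrable_weighted assms in auto)
  then show "exp (- bnd) * (\<integral>x. \<phi> x \<partial>Q) \<le> expect \<tau> \<phi>" by simp
  have "exp (- bnd) * expect \<tau> \<phi> \<le> exp (- bnd) * (exp bnd * (\<integral>x. \<phi> x \<partial>Q))"
    using 1 by (intro mult_left_mono) auto
  then show "exp (- bnd) * expect \<tau> \<phi> \<le> (\<integral>x. \<phi> x \<partial>Q)"
    by (simp add: mult.assoc[symmetric] exp_add[symmetric])
qed

lemma abs_expect_le:
  assumes "\<tau> \<in> N" "sqint Q \<phi>"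
  shows "\<bar>expect \<tau> \<phi>\<bar> \<le> exp bnd * sqrt (\<integral>x. (\<phi> x)\<^sup>2 \<partial>Q)"
proof -
  have "\<bar>expect \<tau> \<phi>\<bar> \<le> (\<integral>x. \<bar>\<phi> x * exp (llr \<tau> x)\<bar> \<partial>Q)"
    unfolding expect_def using integral_abs_bound .
  also have "\<dots> = expect \<tau> (\<lambda>x. \<bar>\<phi> x\<bar>)" unfolding expect_def by (simp add: abs_mult)
  also have "\<dots> \<le> exp bnd * (\<integral>x. \<bar>\<phi> x\<bar> \<partial>Q)"
    using assms Q.sqint_integrable by (intro expect_le(1)) auto
  also have "\<dots> \<le> exp bnd * sqrt (\<integral>x. (\<phi> x)\<^sup>2 \<partial>Q)"
  proof (intro mult_left_mono)
    have "sqint Q (\<lambda>x. \<bar>\<phi> x\<bar>)" using assms(2) by (auto simp: sqint_def)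
    from Q.square_integral_le[OF this] show "(\<integral>x. \<bar>\<phi> x\<bar> \<partial>Q) \<le> sqrt (\<integral>x. (\<phi> x)\<^sup>2 \<partial>Q)"
      by (intro real_le_rsqrt) simp
  qed simp
  finally show ?thesis .
qed

text \<open>Gibbs' inequality: integrate \<open>1 + w \<le> exp w\<close> against the density of
  \<tau>.\<close>

lemma expect_llr_le:
  assumes "\<tau> \<in> N"
  shows "expect \<tau> (\<lambda>x. llr \<sigma> x - llr \<tau> x) \<le> 0"
proof -
  have i: "integrable Q (\<lambda>x. (llr \<sigma> x - llr \<tau> x) * exp (llr \<tau> x))"
    using Q.sqint_integrable[OF llr_sqint] by (intro integrable_weighted assms) auto
  have "(\<integral>x. (llr \<sigma> x - llr \<tau> x) * exp (llr \<tau> x) + exp (llr \<tau> x) \<partial>Q) \<le> (\<integral>x. exp (llr \<sigma> x) \<partial>Q)"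
  proof (rule integral_mono)
    show "integrable Q (\<lambda>x. (llr \<sigma> x - llr \<tau> x) * exp (llr \<tau> x) + exp (llr \<tau> x))"
      using i exp_llr_integral(1) by auto
    fix x
    have "(1 + (llr \<sigma> x - llr \<tau> x)) * exp (llr \<tau> x) \<le> exp (llr \<sigma> x - llr \<tau> x) * exp (llr \<tau> x)"
      by (intro mult_right_mono exp_ge_add_one_self) auto
    then show "(llr \<sigma> x - llr \<tau> x) * exp (llr \<tau> x) + exp (llr \<tau> x) \<le> exp (llr \<sigma> x)"
      by (simp add: exp_add[symmetric] distrib_right)
  qed (rule exp_llr_integral)
  then show ?thesis unfolding expect_def using i exp_llr_integral by simp
qed

text \<open>Gibbs' inequality in terms of the log-partition function. It replaces differentiation
  under the integral sign: used at both ends of a segment, it sandwiches an increment of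
  \<open>logZ\<close>.\<close>

lemma expect_eta_le:
  assumes "\<tau> \<in> N"
  shows "expect \<tau> (\<lambda>x. \<eta> \<sigma> x - \<eta> \<tau> x) \<le> logZ \<sigma> - logZ \<tau>"
proof -
  have "expect \<tau> (\<lambda>x. llr \<sigma> x - llr \<tau> x)
      = (\<integral>x. (\<eta> \<sigma> x - \<eta> \<tau> x) * exp (llr \<tau> x) - (logZ \<sigma> - logZ \<tau>) * exp (llr \<tau> x) \<partial>Q)"
    unfolding expect_def by (intro Bochner_Integration.integral_cong) (auto simp: llr_def algebra_simps)
  also have "\<dots> = expect \<tau> (\<lambda>x. \<eta> \<sigma> x - \<eta> \<tau> x) - (logZ \<sigma> - logZ \<tau>)"
    unfolding expect_def
    using integrable_weighted[OF assms, of "\<lambda>x. \<eta> \<sigma> x - \<eta> \<tau> x"] Q.sqint_integrable[OF eta_sqint] exp_llr_integral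
    by (subst Bochner_Integration.integral_diff) auto
  finally show ?thesis using expect_llr_le[OF assms, of \<sigma>] by simp
qed

text \<open>The derivative in the L2 sense and the pointwise derivative of \<open>\<eta>\<close> agree almost everywhere,
  as limits of the same difference quotients.\<close>

lemma L2_derivative:
  assumes \<tau>: "\<tau> \<in> N" and \<epsilon>: "\<epsilon> > 0"
  shows "\<exists>\<delta>>0. \<forall>h. \<bar>h\<bar> < \<delta> \<longrightarrow>
    (\<integral>x. (\<eta> (\<tau> + h *\<^sub>R v) x - \<eta> \<tau> x - h * D \<tau> v x)\<^sup>2 \<partial>Q) \<le> \<epsilon> * h\<^sup>2"
proof -
  obtain D1 where "L20_bounded_linear M \<eta> \<tau>\<^sub>0 (D1 \<tau>)"
    "\<And>\<epsilon>. \<epsilon> > 0 \<Longrightarrow> \<forall>\<^sub>F k in nhds 0. L2_norm M \<eta> \<tau>\<^sub>0 (\<lambda>x. \<eta> (\<tau> + k) x - \<eta> \<tau> x - D1 \<tau> k x) \<le> \<epsilon> * norm k"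
    using L2_differentiable \<tau> by blast
  then have D1: "\<And>v. sqint Q (D1 \<tau> v)" "\<And>h v. AE x in Q. D1 \<tau> (h *\<^sub>R v) x = h * D1 \<tau> v x"
    "\<And>\<epsilon>. \<epsilon> > 0 \<Longrightarrow> \<forall>\<^sub>F k in nhds 0. L2_norm M \<eta> \<tau>\<^sub>0 (\<lambda>x. \<eta> (\<tau> + k) x - \<eta> \<tau> x - D1 \<tau> k x) \<le> \<epsilon> * norm k"
    unfolding L20_bounded_linear_def L20_iff AE_Q by blast+
  note [measurable] = sqint_measurable[OF D1(1)] sqint_measurable[OF D_sqint[OF \<tau>]]
  \<comment> \<open>The Frechet estimate along multiples of a fixed direction; the 1 added in the
    denominators covers \<open>v = 0\<close>.\<close>
  have quot: "\<exists>\<delta>>0. \<forall>h. \<bar>h\<bar> < \<delta> \<longrightarrow>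
    (\<integral>x. (\<eta> (\<tau> + h *\<^sub>R v) x - \<eta> \<tau> x - h * D1 \<tau> v x)\<^sup>2 \<partial>Q) \<le> \<epsilon> * h\<^sup>2" if \<epsilon>: "\<epsilon> > 0" for \<epsilon>
  proof -
    define e where "e = sqrt \<epsilon> / (norm v + 1)"
    have nv: "norm v + 1 > 0" by (simp add: add_nonneg_pos)
    have e: "e > 0" using \<epsilon> nv by (simp add: e_def)
    obtain d where d: "d > 0" "\<And>k. norm k < d \<Longrightarrow>
        L2_norm M \<eta> \<tau>\<^sub>0 (\<lambda>x. \<eta> (\<tau> + k) x - \<eta> \<tau> x - D1 \<tau> k x) \<le> e * norm k"
      using D1(3)[OF e] unfolding eventually_nhds_metric by (auto simp: dist_norm)
    show ?thesis
    proof (intro exI[of _ "d / (norm v + 1)"] conjI allI impI)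
      show "d / (norm v + 1) > 0" using d nv by simp
      fix h :: real assume "\<bar>h\<bar> < d / (norm v + 1)"
      then have "\<bar>h\<bar> * (norm v + 1) < d" using nv by (simp add: pos_less_divide_eq)
      moreover have "norm (h *\<^sub>R v) \<le> \<bar>h\<bar> * (norm v + 1)" by (simp add: distrib_left)
      ultimately have "norm (h *\<^sub>R v) < d" by linarith
      define g where "g x = \<eta> (\<tau> + h *\<^sub>R v) x - \<eta> \<tau> x - D1 \<tau> (h *\<^sub>R v) x" for x
      have gs: "sqint Q g" unfolding g_def by (intro sqint_diff eta_sqint D1)
      have "L2_norm M \<eta> \<tau>\<^sub>0 g \<le> e * norm (h *\<^sub>R v)" using d(2)[OF \<open>norm (h *\<^sub>R v) < d\<close>] by (simp add: g_def[abs_def])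
      also have "\<dots> = sqrt \<epsilon> * \<bar>h\<bar> * (norm v / (norm v + 1))" by (simp add: e_def)
      also have "\<dots> \<le> sqrt \<epsilon> * \<bar>h\<bar> * 1"
        using \<epsilon> nv by (intro mult_left_mono) auto
      finally have "sqrt (\<integral>x. (g x)\<^sup>2 \<partial>Q) \<le> sqrt \<epsilon> * \<bar>h\<bar>" by (simp add: L2_norm_eq[OF gs])
      then have "(sqrt (\<integral>x. (g x)\<^sup>2 \<partial>Q))\<^sup>2 \<le> (sqrt \<epsilon> * \<bar>h\<bar>)\<^sup>2" by (intro power_mono) auto
      then have "(\<integral>x. (g x)\<^sup>2 \<partial>Q) \<le> \<epsilon> * h\<^sup>2" using \<epsilon> by (simp add: power_mult_distrib)
      moreover have "(\<integral>x. (g x)\<^sup>2 \<partial>Q) = (\<integral>x. (\<eta> (\<tau> + h *\<^sub>R v) x - \<eta> \<tau> x - h * D1 \<tau> v x)\<^sup>2 \<partial>Q)"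
        unfolding g_def using D1(2)[of h v] by (intro integral_cong_AE) auto
      ultimately show "(\<integral>x. (\<eta> (\<tau> + h *\<^sub>R v) x - \<eta> \<tau> x - h * D1 \<tau> v x)\<^sup>2 \<partial>Q) \<le> \<epsilon> * h\<^sup>2" by simp
    qed
  qed
  \<comment> \<open>Difference quotients along \<open>hs\<close> tend to the L2 derivative in L1,
    hence almost everywhere on a subsequence; pointwise they tend to
    \<open>D \<tau> v\<close>.\<close>
  define hs where "hs n = 1 / real (Suc n)" for n
  have hs: "hs n > 0" for n by (simp add: hs_def)
  have hs0: "hs \<longlonglongrightarrow> 0" unfolding hs_def using LIMSEQ_inverse_real_of_nat by (simp add: inverse_eq_divide)
  define g where "g n x = (\<eta> (\<tau> + hs n *\<^sub>R v) x - \<eta> \<tau> x) / hs n - D1 \<tau> v x" for n x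
  have gs: "sqint Q (g n)" for n
  proof -
    have "sqint Q (\<lambda>x. (1 / hs n) * (\<eta> (\<tau> + hs n *\<^sub>R v) x - \<eta> \<tau> x) - D1 \<tau> v x)"
      by (intro sqint_diff sqint_cmult eta_sqint D1)
    then show ?thesis by (simp add: g_def[abs_def])
  qed
  have g2: "(\<integral>x. (\<eta> (\<tau> + hs n *\<^sub>R v) x - \<eta> \<tau> x - hs n * D1 \<tau> v x)\<^sup>2 \<partial>Q) = (hs n)\<^sup>2 * (\<integral>x. (g n x)\<^sup>2 \<partial>Q)" for n
  proof -
    have "\<eta> (\<tau> + hs n *\<^sub>R v) x - \<eta> \<tau> x - hs n * D1 \<tau> v x = hs n * g n x" for x
      using hs[of n] by (simp add: g_def field_simps)
    then show ?thesis by (simp add: power_mult_distrib)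
  qed
  have "(\<lambda>n. \<integral>x. norm (g n x) \<partial>Q) \<longlonglongrightarrow> 0"
  proof (rule LIMSEQ_I)
    fix r :: real assume r: "r > 0"
    obtain \<delta> where \<delta>: "\<delta> > 0" "\<And>h. \<bar>h\<bar> < \<delta> \<Longrightarrow>
      (\<integral>x. (\<eta> (\<tau> + h *\<^sub>R v) x - \<eta> \<tau> x - h * D1 \<tau> v x)\<^sup>2 \<partial>Q) \<le> (r / 2)\<^sup>2 * h\<^sup>2"
      using quot[of "(r / 2)\<^sup>2"] r by auto
    obtain n0 where n0: "\<And>n. n \<ge> n0 \<Longrightarrow> \<bar>hs n\<bar> < \<delta>" using LIMSEQ_D[OF hs0 \<delta>(1)] by auto
    show "\<exists>no. \<forall>n\<ge>no. norm ((\<integral>x. norm (g n x) \<partial>Q) - 0) < r"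
    proof (intro exI[of _ n0] allI impI)
      fix n assume n: "n0 \<le> n"
      have "(hs n)\<^sup>2 * (\<integral>x. (g n x)\<^sup>2 \<partial>Q) \<le> (hs n)\<^sup>2 * (r / 2)\<^sup>2"
        using \<delta>(2)[OF n0[OF n]] unfolding g2 by (simp add: mult.commute)
      then have "(\<integral>x. (g n x)\<^sup>2 \<partial>Q) \<le> (r / 2)\<^sup>2" using hs[of n] by simp
      moreover have "sqint Q (\<lambda>x. norm (g n x))" using gs[of n] by (auto simp: sqint_def)
      then have "(\<integral>x. norm (g n x) \<partial>Q)\<^sup>2 \<le> (\<integral>x. (g n x)\<^sup>2 \<partial>Q)" using Q.square_integral_le by fastforce
      ultimately have "(\<integral>x. norm (g n x) \<partial>Q)\<^sup>2 \<le> (r / 2)\<^sup>2" by linarith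
      then have "(\<integral>x. norm (g n x) \<partial>Q) \<le> r / 2" by (rule power2_le_imp_le) (use r in simp)
      then show "norm ((\<integral>x. norm (g n x) \<partial>Q) - 0) < r" using r by simp
    qed
  qed
  then obtain s where s: "strict_mono s" "AE x in Q. (\<lambda>n. g (s n) x) \<longlonglongrightarrow> 0"
    using tendsto_L1_AE_subseq[of Q g] Q.sqint_integrable[OF gs] by blast
  have "AE x in Q. \<forall>\<tau>\<in>N. ((\<lambda>\<sigma>. \<eta> \<sigma> x) has_derivative (\<lambda>v. D \<tau> v x)) (at \<tau>)"
    unfolding AE_Q by (rule eta_derivative)
  with s(2) have "AE x in Q. D \<tau> v x = D1 \<tau> v x"
  proof eventually_elim
    case (elim x)
    have der: "((\<lambda>\<sigma>. \<eta> \<sigma> x) has_derivative (\<lambda>v. D \<tau> v x)) (at \<tau>)" using elim(2) \<tau> by blast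
    interpret bounded_linear "\<lambda>v. D \<tau> v x" using der by (rule has_derivative_bounded_linear)
    have "((\<lambda>t. \<eta> (\<tau> + t *\<^sub>R v) x) has_derivative (\<lambda>t. D \<tau> (t *\<^sub>R v) x)) (at 0)"
      by (rule has_derivative_compose[of "\<lambda>t. \<tau> + t *\<^sub>R v", where g = "\<lambda>\<sigma>. \<eta> \<sigma> x"])
        (auto intro!: derivative_eq_intros simp: der)
    then have "((\<lambda>t. \<eta> (\<tau> + t *\<^sub>R v) x) has_real_derivative D \<tau> v x) (at 0)"
      by (simp add: has_field_derivative_def scaleR mult_commute_abs)
    then have "((\<lambda>t. (\<eta> (\<tau> + t *\<^sub>R v) x - \<eta> \<tau> x) / t) \<longlongrightarrow> D \<tau> v x) (at 0)"
      by (simp add: has_field_derivative_iff)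
    moreover have "filterlim (\<lambda>n. hs (s n)) (at 0) sequentially"
      unfolding filterlim_at using LIMSEQ_subseq_LIMSEQ[OF hs0 s(1)] hs by (auto simp: o_def less_imp_neq[symmetric] eventually_sequentially) 
    ultimately have "(\<lambda>n. (\<eta> (\<tau> + hs (s n) *\<^sub>R v) x - \<eta> \<tau> x) / hs (s n)) \<longlonglongrightarrow> D \<tau> v x"
      by (rule filterlim_compose)
    then have "(\<lambda>n. g (s n) x) \<longlonglongrightarrow> D \<tau> v x - D1 \<tau> v x" unfolding g_def by (intro tendsto_intros)
    then show ?case using LIMSEQ_unique[OF _ elim(1)] by fastforce
  qed
  then have "(\<integral>x. (\<eta> (\<tau> + h *\<^sub>R v) x - \<eta> \<tau> x - h * D \<tau> v x)\<^sup>2 \<partial>Q)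
     = (\<integral>x. (\<eta> (\<tau> + h *\<^sub>R v) x - \<eta> \<tau> x - h * D1 \<tau> v x)\<^sup>2 \<partial>Q)" for h
    by (intro integral_cong_AE) auto
  then show ?thesis using quot[OF \<epsilon>] by simp
qed

lemma segment_in_N:
  assumes "\<tau> \<in> N" "\<sigma> \<in> N" "0 \<le> s" "s \<le> 1"
  shows "\<tau> + s *\<^sub>R (\<sigma> - \<tau>) \<in> N"
proof -
  have "(1 - s) *\<^sub>R \<tau> + s *\<^sub>R \<sigma> \<in> N" using assms N(2) by (intro convexD) auto
  then show ?thesis by (simp add: algebra_simps)
qed

text \<open>Pairing with a fixed function reduces an L2-valued derivative to a real one, to which
  the mean value theorem applies.\<close>

lemma has_real_derivative_pairing:
  assumes \<tau>: "\<tau> + s *\<^sub>R v \<in> N" and \<phi>: "sqint Q \<phi>"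
  shows "((\<lambda>s. \<integral>x. \<phi> x * \<eta> (\<tau> + s *\<^sub>R v) x \<partial>Q) has_real_derivative (\<integral>x. \<phi> x * D (\<tau> + s *\<^sub>R v) v x \<partial>Q)) (at s)"
proof -
  define \<sigma> where "\<sigma> = \<tau> + s *\<^sub>R v"
  define a where "a = (\<integral>x. (\<phi> x)\<^sup>2 \<partial>Q)"
  have a0: "a \<ge> 0" by (simp add: a_def)
  have \<sigma>N: "\<sigma> \<in> N" using \<tau> by (simp add: \<sigma>_def)
  define F where "F s = (\<integral>x. \<phi> x * \<eta> (\<tau> + s *\<^sub>R v) x \<partial>Q)" for s
  have "((\<lambda>h. (F (s + h) - F s) / h) \<longlongrightarrow> (\<integral>x. \<phi> x * D \<sigma> v x \<partial>Q)) (at 0)"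
  proof (rule LIM_I)
    fix r :: real assume r: "r > 0"
    define e where "e = (r / (2 * (sqrt a + 1)))\<^sup>2"
    have sa: "sqrt a + 1 > 0" using a0 by (simp add: add_nonneg_pos)
    have e: "e > 0" using r sa by (simp add: e_def)
    obtain \<delta> where \<delta>: "\<delta> > 0" "\<And>h. \<bar>h\<bar> < \<delta> \<Longrightarrow>
      (\<integral>x. (\<eta> (\<sigma> + h *\<^sub>R v) x - \<eta> \<sigma> x - h * D \<sigma> v x)\<^sup>2 \<partial>Q) \<le> e * h\<^sup>2"
      using L2_derivative[OF \<sigma>N e] by blast
    show "\<exists>d>0. \<forall>h. h \<noteq> 0 \<and> norm (h - 0) < d \<longrightarrow> norm ((F (s + h) - F s) / h - (\<integral>x. \<phi> x * D \<sigma> v x \<partial>Q)) < r"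
    proof (intro exI[of _ \<delta>] conjI allI impI \<delta>(1))
      fix h :: real assume h: "h \<noteq> 0 \<and> norm (h - 0) < \<delta>"
      define g where "g x = \<eta> (\<sigma> + h *\<^sub>R v) x - \<eta> \<sigma> x - h * D \<sigma> v x" for x
      have gs: "sqint Q g" unfolding g_def by (intro sqint_diff sqint_cmult eta_sqint D_sqint \<sigma>N)
      have "F (s + h) - F s - h * (\<integral>x. \<phi> x * D \<sigma> v x \<partial>Q)
         = (\<integral>x. \<phi> x * \<eta> (\<sigma> + h *\<^sub>R v) x - \<phi> x * \<eta> \<sigma> x - h * (\<phi> x * D \<sigma> v x) \<partial>Q)"
        unfolding F_def using sqint_mult[OF \<phi> eta_sqint] sqint_mult[OF \<phi> D_sqint[OF \<sigma>N]]
        by (simp add: \<sigma>_def algebra_simps)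
      also have "\<dots> = (\<integral>x. \<phi> x * g x \<partial>Q)"
        by (intro Bochner_Integration.integral_cong refl) (simp add: g_def algebra_simps)
      finally have "\<bar>F (s + h) - F s - h * (\<integral>x. \<phi> x * D \<sigma> v x \<partial>Q)\<bar> \<le> sqrt a * sqrt (\<integral>x. (g x)\<^sup>2 \<partial>Q)"
        using abs_integral_mult_le[OF \<phi> gs] by (simp add: a_def)
      also have "\<dots> \<le> sqrt a * sqrt (e * h\<^sup>2)"
        using \<delta>(2)[of h] h a0 by (intro mult_left_mono real_sqrt_le_mono) (auto simp: g_def)
      also have "\<dots> = sqrt a * (r / (2 * (sqrt a + 1))) * \<bar>h\<bar>"
        using r sa by (simp add: e_def real_sqrt_mult)
      also have "\<dots> < r * \<bar>h\<bar>"
      proof (rule mult_strict_right_mono)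
        have "sqrt a * r < r * (2 * (sqrt a + 1))" using r a0 by (simp add: algebra_simps add_nonneg_pos)
        then show "sqrt a * (r / (2 * (sqrt a + 1))) < r" using sa by (simp add: divide_less_eq)
      qed (use h in simp)
      finally have "\<bar>F (s + h) - F s - h * (\<integral>x. \<phi> x * D \<sigma> v x \<partial>Q)\<bar> / \<bar>h\<bar> < r"
        using h by (simp add: divide_less_eq)
      then show "norm ((F (s + h) - F s) / h - (\<integral>x. \<phi> x * D \<sigma> v x \<partial>Q)) < r"
        using h by (simp add: abs_divide[symmetric] diff_divide_distrib)
    qed
  qed
  then show ?thesis unfolding DERIV_def F_def \<sigma>_def .
qed

text \<open>Pair the increment of \<open>\<eta>\<close> with itself: the mean value theorem and
  Cauchy-Schwarz bound its squared norm \<open>a\<close> by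
  \<open>sqrt a * sqrt (c\<^sub>2 * n2 v)\<close>, and one factor cancels.\<close>

lemma eta_Lipschitz:
  assumes "\<tau> \<in> N" "\<sigma> \<in> N"
  shows "(\<integral>x. (\<eta> \<sigma> x - \<eta> \<tau> x)\<^sup>2 \<partial>Q) \<le> c\<^sub>2 * n2 (\<sigma> - \<tau>)"
proof -
  define v where "v = \<sigma> - \<tau>"
  define \<phi> where "\<phi> x = \<eta> \<sigma> x - \<eta> \<tau> x" for x
  have \<phi>: "sqint Q \<phi>" unfolding \<phi>_def by (intro sqint_diff eta_sqint)
  define a where "a = (\<integral>x. (\<phi> x)\<^sup>2 \<partial>Q)"
  define F where "F s = (\<integral>x. \<phi> x * \<eta> (\<tau> + s *\<^sub>R v) x \<partial>Q)" for s
  have "\<exists>z::real. 0 < z \<and> z < 1 \<and> F 1 - F 0 = (1 - 0) * (\<integral>x. \<phi> x * D (\<tau> + z *\<^sub>R v) v x \<partial>Q)"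
    unfolding F_def v_def
    by (rule MVT2) (use has_real_derivative_pairing[OF segment_in_N[OF assms] \<phi>] in auto)
  then obtain z where z: "0 < z" "z < 1" "F 1 - F 0 = (\<integral>x. \<phi> x * D (\<tau> + z *\<^sub>R v) v x \<partial>Q)" by auto
  have zN: "\<tau> + z *\<^sub>R v \<in> N" unfolding v_def using z assms by (intro segment_in_N) auto
  have "F 1 - F 0 = (\<integral>x. \<phi> x * \<eta> \<sigma> x - \<phi> x * \<eta> \<tau> x \<partial>Q)"
    unfolding F_def using sqint_mult[OF \<phi> eta_sqint] by (simp add: v_def)
  also have "\<dots> = a" unfolding a_def
    by (intro Bochner_Integration.integral_cong refl) (simp add: \<phi>_def power2_eq_square algebra_simps)
  finally have "a = \<bar>\<integral>x. \<phi> x * D (\<tau> + z *\<^sub>R v) v x \<partial>Q\<bar>" using z by (simp add: a_def)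
  also have "\<dots> \<le> sqrt a * sqrt (\<integral>x. (D (\<tau> + z *\<^sub>R v) v x)\<^sup>2 \<partial>Q)"
    unfolding a_def by (rule abs_integral_mult_le[OF \<phi> D_sqint[OF zN]])
  also have "\<dots> \<le> sqrt a * sqrt (c\<^sub>2 * n2 v)"
    using D_square(2)[OF zN] by (intro mult_left_mono real_sqrt_le_mono) (auto simp: a_def)
  finally have le: "a \<le> sqrt a * sqrt (c\<^sub>2 * n2 v)" .
  have a0: "a \<ge> 0" by (simp add: a_def)
  have "a \<le> c\<^sub>2 * n2 v"
  proof (cases "a = 0")
    case True then show ?thesis using const n2_nonneg by simp
  next
    case False
    then have "sqrt a > 0" using a0 by simp
    moreover have "sqrt a * sqrt a \<le> sqrt a * sqrt (c\<^sub>2 * n2 v)" using le a0 by simp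
    ultimately have "sqrt a \<le> sqrt (c\<^sub>2 * n2 v)" by (rule mult_left_le_imp_le[rotated])
    then show ?thesis by (simp only: real_sqrt_le_iff)
  qed
  then show ?thesis by (simp add: a_def \<phi>_def v_def)
qed

lemma n2_minus: "n2 (\<tau> - \<sigma>) = n2 (\<sigma> - \<tau>)"
  using n2_scale[of "-1" "\<sigma> - \<tau>"] by simp

lemma logZ_Lipschitz:
  assumes "\<tau> \<in> N" "\<sigma> \<in> N"
  shows "\<bar>logZ \<sigma> - logZ \<tau>\<bar> \<le> exp bnd * sqrt (c\<^sub>2 * n2 (\<sigma> - \<tau>))"
proof -
  have *: "logZ \<sigma> - logZ \<tau> \<le> exp bnd * sqrt (c\<^sub>2 * n2 (\<sigma> - \<tau>))" if "\<tau> \<in> N" "\<sigma> \<in> N" for \<tau> \<sigma>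
  proof -
    have "logZ \<sigma> - logZ \<tau> \<le> \<bar>expect \<sigma> (\<lambda>x. \<eta> \<tau> x - \<eta> \<sigma> x)\<bar>" using expect_eta_le[OF that(2), of \<tau>] by linarith
    also have "\<dots> \<le> exp bnd * sqrt (\<integral>x. (\<eta> \<tau> x - \<eta> \<sigma> x)\<^sup>2 \<partial>Q)"
      by (intro abs_expect_le that sqint_diff eta_sqint)
    also have "\<dots> \<le> exp bnd * sqrt (c\<^sub>2 * n2 (\<sigma> - \<tau>))"
      using eta_Lipschitz[OF that] by (intro mult_left_mono real_sqrt_le_mono) (auto simp: power2_commute)
    finally show ?thesis .
  qed
  show ?thesis using *[OF assms] *[OF assms(2,1)] n2_minus[of \<tau> \<sigma>] by (simp add: abs_le_iff)
qed

text \<open>The first summand bounds the increment of \<open>\<eta>\<close>, the second that of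
  \<open>logZ\<close>; their squares add because \<open>\<eta>\<close> is centred under the true
  law.\<close>

definition c\<^sub>L :: real where "c\<^sub>L = c\<^sub>2 * (1 + (exp bnd)\<^sup>2)"

lemma llr_Lipschitz:
  assumes "\<tau> \<in> N" "\<sigma> \<in> N"
  shows "(\<integral>x. (llr \<sigma> x - llr \<tau> x)\<^sup>2 \<partial>Q) = (\<integral>x. (\<eta> \<sigma> x - \<eta> \<tau> x)\<^sup>2 \<partial>Q) + (logZ \<sigma> - logZ \<tau>)\<^sup>2"
    and "(\<integral>x. (llr \<sigma> x - llr \<tau> x)\<^sup>2 \<partial>Q) \<le> c\<^sub>L * n2 (\<sigma> - \<tau>)"
proof -
  define b where "b = logZ \<sigma> - logZ \<tau>"
  define g where "g x = \<eta> \<sigma> x - \<eta> \<tau> x" for x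
  have g: "sqint Q g" unfolding g_def by (intro sqint_diff eta_sqint)
  have gm: "(\<integral>x. g x \<partial>Q) = 0" unfolding g_def using Q.sqint_integrable[OF eta_sqint] by (simp add: eta_mean)
  have "(\<lambda>x. (llr \<sigma> x - llr \<tau> x)\<^sup>2) = (\<lambda>x. (g x)\<^sup>2 - 2 * b * g x + b\<^sup>2)"
    by (auto simp: llr_def g_def b_def power2_eq_square algebra_simps)
  then show eq: "(\<integral>x. (llr \<sigma> x - llr \<tau> x)\<^sup>2 \<partial>Q) = (\<integral>x. (\<eta> \<sigma> x - \<eta> \<tau> x)\<^sup>2 \<partial>Q) + (logZ \<sigma> - logZ \<tau>)\<^sup>2"
    using sqint_integrable_square[OF g] Q.sqint_integrable[OF g] gm
    by (simp add: Q.prob_space g_def[symmetric] b_def[symmetric])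
  have "\<bar>b\<bar>\<^sup>2 \<le> (exp bnd * sqrt (c\<^sub>2 * n2 (\<sigma> - \<tau>)))\<^sup>2"
    using logZ_Lipschitz[OF assms] by (intro power_mono) (auto simp: b_def)
  also have "\<dots> = (exp bnd)\<^sup>2 * (c\<^sub>2 * n2 (\<sigma> - \<tau>))" using const n2_nonneg by (simp add: power_mult_distrib)
  finally show "(\<integral>x. (llr \<sigma> x - llr \<tau> x)\<^sup>2 \<partial>Q) \<le> c\<^sub>L * n2 (\<sigma> - \<tau>)"
    unfolding eq using eta_Lipschitz[OF assms] by (simp add: c\<^sub>L_def b_def algebra_simps)
qed

lemma c\<^sub>L: "c\<^sub>L > 0" "c\<^sub>2 \<le> c\<^sub>L"
  using const by (auto simp: c\<^sub>L_def add_pos_nonneg)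

text \<open>On the bounded range of the log-likelihood ratios \<open>exp\<close> is Lipschitz, so
  the densities differ in L2 by at most a multiple of the parameter distance.\<close>

lemma expect_diff_le:
  assumes "\<tau> \<in> N" "\<sigma> \<in> N" "sqint Q \<phi>"
  shows "\<bar>expect \<sigma> \<phi> - expect \<tau> \<phi>\<bar> \<le> exp bnd * (sqrt (\<integral>x. (\<phi> x)\<^sup>2 \<partial>Q) * sqrt (c\<^sub>L * n2 (\<sigma> - \<tau>)))"
proof -
  define w where "w x = exp (llr \<sigma> x) - exp (llr \<tau> x)" for x
  have wle: "AE x in Q. \<bar>w x\<bar> \<le> exp bnd * \<bar>llr \<sigma> x - llr \<tau> x\<bar>"
    using llr_bounded[OF assms(1)] llr_bounded[OF assms(2)]
    by eventually_elim (auto simp: w_def intro!: abs_exp_diff_le)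
  have ls: "sqint Q (\<lambda>x. llr \<sigma> x - llr \<tau> x)" by (intro sqint_diff llr_sqint)
  have ws: "sqint Q w" by (rule sqint_bound[OF ls _ wle]) (simp add: w_def)
  have "(\<integral>x. (w x)\<^sup>2 \<partial>Q) \<le> (\<integral>x. (exp bnd)\<^sup>2 * (llr \<sigma> x - llr \<tau> x)\<^sup>2 \<partial>Q)"
  proof (rule integral_mono_AE)
    show "AE x in Q. (w x)\<^sup>2 \<le> (exp bnd)\<^sup>2 * (llr \<sigma> x - llr \<tau> x)\<^sup>2"
      using wle
    proof eventually_elim
      case (elim x)
      then have "\<bar>w x\<bar>\<^sup>2 \<le> (exp bnd * \<bar>llr \<sigma> x - llr \<tau> x\<bar>)\<^sup>2" by (intro power_mono) auto
      then show ?case by (simp add: power_mult_distrib)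
    qed
  qed (use sqint_integrable_square[OF ws] sqint_integrable_square[OF ls] in auto)
  also have "\<dots> \<le> (exp bnd)\<^sup>2 * (c\<^sub>L * n2 (\<sigma> - \<tau>))"
    using llr_Lipschitz(2)[OF assms(1,2)] by simp
  finally have w2: "sqrt (\<integral>x. (w x)\<^sup>2 \<partial>Q) \<le> exp bnd * sqrt (c\<^sub>L * n2 (\<sigma> - \<tau>))"
    using real_sqrt_le_mono by (fastforce simp: real_sqrt_mult)
  have "expect \<sigma> \<phi> - expect \<tau> \<phi> = (\<integral>x. \<phi> x * exp (llr \<sigma> x) - \<phi> x * exp (llr \<tau> x) \<partial>Q)"
    unfolding expect_def using integrable_weighted[OF _ Q.sqint_integrable[OF assms(3)]] assms by simp
  also have "\<dots> = (\<integral>x. \<phi> x * w x \<partial>Q)" by (simp add: w_def right_diff_distrib)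
  finally have "\<bar>expect \<sigma> \<phi> - expect \<tau> \<phi>\<bar> \<le> sqrt (\<integral>x. (\<phi> x)\<^sup>2 \<partial>Q) * sqrt (\<integral>x. (w x)\<^sup>2 \<partial>Q)"
    using abs_integral_mult_le[OF assms(3) ws] by simp
  also have "\<dots> \<le> sqrt (\<integral>x. (\<phi> x)\<^sup>2 \<partial>Q) * (exp bnd * sqrt (c\<^sub>L * n2 (\<sigma> - \<tau>)))"
    using w2 by (intro mult_left_mono) auto
  finally show ?thesis by (simp add: mult_ac)
qed

lemma expect_add:
  assumes "\<tau> \<in> N" "integrable Q \<phi>" "integrable Q \<psi>"
  shows "expect \<tau> (\<lambda>x. \<phi> x + \<psi> x) = expect \<tau> \<phi> + expect \<tau> \<psi>"
  unfolding expect_def distrib_right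
  using integrable_weighted[OF assms(1)] assms by (subst Bochner_Integration.integral_add) auto

lemma expect_cmult: "expect \<tau> (\<lambda>x. c * \<phi> x) = c * expect \<tau> \<phi>"
  by (simp add: expect_def mult.assoc)

lemma expect_const: "expect \<tau> (\<lambda>_. c) = c"
  by (simp add: expect_def exp_llr_integral)

text \<open>Gibbs' inequality at both endpoints puts the increment of \<open>logZ\<close> between
  the means of the increment of \<open>\<eta>\<close> under the base and under the shifted
  parameter; these two means differ by order \<open>h\<^sup>2\<close>.\<close>

lemma logZ_derivative:
  assumes \<tau>: "\<tau> + s *\<^sub>R v \<in> N"
  shows "((\<lambda>s. logZ (\<tau> + s *\<^sub>R v)) has_real_derivative expect (\<tau> + s *\<^sub>R v) (D (\<tau> + s *\<^sub>R v) v)) (at s)"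
proof -
  define \<sigma> where "\<sigma> = \<tau> + s *\<^sub>R v"
  have \<sigma>N: "\<sigma> \<in> N" using \<tau> by (simp add: \<sigma>_def)
  define E where "E = expect \<sigma> (D \<sigma> v)"
  have "((\<lambda>h. (logZ (\<tau> + (s + h) *\<^sub>R v) - logZ \<sigma>) / h) \<longlongrightarrow> E) (at 0)"
  proof (rule LIM_I)
    fix r :: real assume r: "r > 0"
    define e where "e = (r / (4 * exp bnd))\<^sup>2"
    have e: "e > 0" "exp bnd * sqrt e = r / 4" using r by (auto simp: e_def)
    obtain \<delta> where \<delta>: "\<delta> > 0" "\<And>h. \<bar>h\<bar> < \<delta> \<Longrightarrow>
      (\<integral>x. (\<eta> (\<sigma> + h *\<^sub>R v) x - \<eta> \<sigma> x - h * D \<sigma> v x)\<^sup>2 \<partial>Q) \<le> e * h\<^sup>2"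
      using L2_derivative[OF \<sigma>N e(1)] by blast
    obtain \<delta>' where \<delta>': "\<delta>' > 0" "\<And>k. norm k < \<delta>' \<Longrightarrow> \<sigma> + k \<in> N"
    proof -
      obtain d where "d > 0" "ball \<sigma> d \<subseteq> N" using N(1) \<sigma>N open_contains_ball by blast
      then show ?thesis by (intro that[of d]) (auto simp: dist_norm subset_iff)
    qed
    define C where "C = exp bnd * c\<^sub>L * n2 v"
    have C: "C \<ge> 0" using c\<^sub>L n2_nonneg by (simp add: C_def)
    \<comment> \<open>The three bounds serve, in this order, the L2 derivative, membership of the
      shifted parameter in \<open>N\<close>, and the second-order term.\<close>
    define d where "d = min \<delta> (min (\<delta>' / (norm v + 1)) (r / (4 * (C + 1))))"
    have nv: "norm v + 1 > 0" by (simp add: add_nonneg_pos)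
    have d: "d > 0" using \<delta> \<delta>' nv r C by (simp add: d_def)
    show "\<exists>d>0. \<forall>h. h \<noteq> 0 \<and> norm (h - 0) < d \<longrightarrow> norm ((logZ (\<tau> + (s + h) *\<^sub>R v) - logZ \<sigma>) / h - E) < r"
    proof (intro exI[of _ d] conjI allI impI d)
      fix h :: real assume h: "h \<noteq> 0 \<and> norm (h - 0) < d"
      then have h1: "\<bar>h\<bar> < \<delta>" "\<bar>h\<bar> < \<delta>' / (norm v + 1)" "\<bar>h\<bar> < r / (4 * (C + 1))" "h \<noteq> 0" by (auto simp: d_def)
      have "\<bar>h\<bar> * (norm v + 1) < \<delta>'" using h1(2) nv by (simp add: pos_less_divide_eq)
      moreover have "norm (h *\<^sub>R v) \<le> \<bar>h\<bar> * (norm v + 1)" by (simp add: distrib_left)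
      ultimately have \<sigma>hN: "\<sigma> + h *\<^sub>R v \<in> N" by (intro \<delta>'(2)) linarith
      define g where "g x = \<eta> (\<sigma> + h *\<^sub>R v) x - \<eta> \<sigma> x" for x
      define \<Delta> where "\<Delta> = logZ (\<sigma> + h *\<^sub>R v) - logZ \<sigma>"
      have gs: "sqint Q g" unfolding g_def by (intro sqint_diff eta_sqint)
      have lo: "expect \<sigma> g \<le> \<Delta>" unfolding g_def \<Delta>_def by (rule expect_eta_le[OF \<sigma>N])
      have up: "\<Delta> \<le> expect (\<sigma> + h *\<^sub>R v) g"
      proof -
        have "expect (\<sigma> + h *\<^sub>R v) (\<lambda>x. (-1) * g x) \<le> - \<Delta>"
          using expect_eta_le[OF \<sigma>hN, of \<sigma>] by (simp add: g_def \<Delta>_def)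
        then show ?thesis unfolding expect_cmult by simp
      qed
      have b1: "\<bar>expect \<sigma> g - h * E\<bar> \<le> r / 4 * \<bar>h\<bar>"
      proof -
        have rs: "sqint Q (\<lambda>x. g x + (- h) * D \<sigma> v x)" by (intro sqint_add sqint_cmult gs D_sqint \<sigma>N)
        have "expect \<sigma> g - h * E = expect \<sigma> (\<lambda>x. g x + (- h) * D \<sigma> v x)"
          using Q.sqint_integrable[OF gs] Q.sqint_integrable[OF D_sqint[OF \<sigma>N]]
          by (subst expect_add[OF \<sigma>N]) (simp_all add: E_def expect_cmult[of _ "- h", simplified])
        also have "\<bar>\<dots>\<bar> \<le> exp bnd * sqrt (\<integral>x. (g x + (- h) * D \<sigma> v x)\<^sup>2 \<partial>Q)"
          by (rule abs_expect_le[OF \<sigma>N rs])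
        also have "\<dots> \<le> exp bnd * sqrt (e * h\<^sup>2)"
          using \<delta>(2)[OF h1(1)] by (intro mult_left_mono real_sqrt_le_mono) (auto simp: g_def)
        also have "\<dots> = (exp bnd * sqrt e) * \<bar>h\<bar>" by (simp add: real_sqrt_mult)
        finally show ?thesis unfolding e(2) .
      qed
      have b2: "\<bar>expect (\<sigma> + h *\<^sub>R v) g - expect \<sigma> g\<bar> \<le> C * h\<^sup>2"
      proof -
        have "(\<integral>x. (g x)\<^sup>2 \<partial>Q) \<le> c\<^sub>2 * n2 (h *\<^sub>R v)" using eta_Lipschitz[OF \<sigma>N \<sigma>hN] by (simp add: g_def)
        also have "\<dots> \<le> c\<^sub>L * n2 (h *\<^sub>R v)" using c\<^sub>L n2_nonneg by (intro mult_right_mono) auto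
        finally have g2: "sqrt (\<integral>x. (g x)\<^sup>2 \<partial>Q) \<le> sqrt (c\<^sub>L * n2 (h *\<^sub>R v))" by simp
        have "\<bar>expect (\<sigma> + h *\<^sub>R v) g - expect \<sigma> g\<bar> \<le> exp bnd * (sqrt (\<integral>x. (g x)\<^sup>2 \<partial>Q) * sqrt (c\<^sub>L * n2 (h *\<^sub>R v)))"
          using expect_diff_le[OF \<sigma>N \<sigma>hN gs] by simp
        also have "\<dots> \<le> exp bnd * (sqrt (c\<^sub>L * n2 (h *\<^sub>R v)) * sqrt (c\<^sub>L * n2 (h *\<^sub>R v)))"
          using g2 c\<^sub>L n2_nonneg by (intro mult_left_mono mult_right_mono) auto
        also have "\<dots> = exp bnd * (c\<^sub>L * n2 (h *\<^sub>R v))" using c\<^sub>L n2_nonneg by simp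
        also have "\<dots> = C * h\<^sup>2" by (simp add: C_def n2_scale)
        finally show ?thesis .
      qed
      have b3: "C * h\<^sup>2 \<le> r / 4 * \<bar>h\<bar>"
      proof -
        have "C * \<bar>h\<bar> \<le> (C + 1) * \<bar>h\<bar>" by (intro mult_right_mono) auto
        also have "\<dots> \<le> r / 4" using h1(3) C by (simp add: pos_less_divide_eq less_imp_le mult.commute field_simps)
        finally have "C * \<bar>h\<bar> * \<bar>h\<bar> \<le> r / 4 * \<bar>h\<bar>" by (intro mult_right_mono) auto
        then show ?thesis by (simp add: power2_eq_square mult.assoc)
      qed
      have "\<bar>\<Delta> - h * E\<bar> \<le> r / 4 * \<bar>h\<bar> + r / 4 * \<bar>h\<bar>" using lo up b1 b2 b3 by linarith
      also have "\<dots> = r / 2 * \<bar>h\<bar>" by simp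
      also have "\<dots> < r * \<bar>h\<bar>" using r h1 by simp
      finally have "\<bar>\<Delta> - h * E\<bar> / \<bar>h\<bar> < r" using h1 by (simp add: divide_less_eq)
      then show "norm ((logZ (\<tau> + (s + h) *\<^sub>R v) - logZ \<sigma>) / h - E) < r"
      proof -
        have "\<tau> + (s + h) *\<^sub>R v = \<sigma> + h *\<^sub>R v" by (simp add: \<sigma>_def scaleR_left_distrib)
        then have "(logZ (\<tau> + (s + h) *\<^sub>R v) - logZ \<sigma>) / h - E = (\<Delta> - h * E) / h"
          using h1(4) by (simp add: \<Delta>_def diff_divide_distrib)
        then show ?thesis using \<open>\<bar>\<Delta> - h * E\<bar> / \<bar>h\<bar> < r\<close> by (simp add: abs_divide)
      qed
    qed
  qed
  then show ?thesis unfolding DERIV_def E_def \<sigma>_def .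
qed

end

section \<open>Tangent inequality, Bregman divergence and quadratic growth of the loss\<close>

context density_model
begin

lemma logZ_continuous:
  assumes "\<tau> \<in> N" shows "isCont logZ \<tau>"
proof -
  define K where "K = exp bnd * sqrt (c\<^sub>2 * c\<^sub>n)"
  have le: "\<bar>logZ \<sigma> - logZ \<tau>\<bar> \<le> K * norm (\<sigma> - \<tau>)" if "\<sigma> \<in> N" for \<sigma>
  proof -
    have "\<bar>logZ \<sigma> - logZ \<tau>\<bar> \<le> exp bnd * sqrt (c\<^sub>2 * n2 (\<sigma> - \<tau>))" by (rule logZ_Lipschitz[OF assms that])
    also have "\<dots> \<le> exp bnd * sqrt (c\<^sub>2 * (c\<^sub>n * (norm (\<sigma> - \<tau>))\<^sup>2))"
      using n2_le const by (intro mult_left_mono real_sqrt_le_mono) auto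
    also have "\<dots> = K * norm (\<sigma> - \<tau>)" by (simp add: K_def real_sqrt_mult)
    finally show ?thesis .
  qed
  have "((\<lambda>\<sigma>. logZ \<sigma> - logZ \<tau>) \<longlongrightarrow> 0) (at \<tau>)"
  proof (rule Lim_null_comparison)
    show "\<forall>\<^sub>F \<sigma> in at \<tau>. norm (logZ \<sigma> - logZ \<tau>) \<le> K * norm (\<sigma> - \<tau>)"
      using eventually_at_in_open'[OF N(1) assms] by eventually_elim (use le in simp)
    have "((\<lambda>\<sigma>. K * norm (\<sigma> - \<tau>)) \<longlongrightarrow> K * norm (\<tau> - \<tau>)) (at \<tau>)" by (intro tendsto_intros)
    then show "((\<lambda>\<sigma>. K * norm (\<sigma> - \<tau>)) \<longlongrightarrow> 0) (at \<tau>)" by simp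
  qed
  then show ?thesis unfolding isCont_def by (rule LIM_zero_cancel)
qed

lemma D_linear: "AE x in Q. \<forall>\<tau>\<in>N. bounded_linear (\<lambda>v. D \<tau> v x)"
  unfolding AE_Q using eta_derivative by eventually_elim (blast intro: has_derivative_bounded_linear)

lemma expect_D_linear:
  assumes "\<tau> \<in> N" shows "bounded_linear (\<lambda>v. expect \<tau> (D \<tau> v))"
proof (rule bounded_linear_intro[of _ "exp bnd * sqrt (c\<^sub>2 * c\<^sub>n)"])
  note [measurable] = sqint_measurable[OF D_sqint[OF assms]]
  note i = Q.sqint_integrable[OF D_sqint[OF assms]]
  fix u v
  have "AE x in Q. D \<tau> (u + v) x = D \<tau> u x + D \<tau> v x"
    using D_linear by eventually_elim (use assms in \<open>auto dest!: bounded_linear.linear linear_add\<close>)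
  then have "expect \<tau> (D \<tau> (u + v)) = expect \<tau> (\<lambda>x. D \<tau> u x + D \<tau> v x)"
    unfolding expect_def by (intro integral_cong_AE) auto
  then show "expect \<tau> (D \<tau> (u + v)) = expect \<tau> (D \<tau> u) + expect \<tau> (D \<tau> v)"
    using expect_add[OF assms i i] by simp
  fix c
  have "AE x in Q. D \<tau> (c *\<^sub>R v) x = c * D \<tau> v x"
    using D_linear by eventually_elim (use assms in \<open>auto dest!: bounded_linear.linear linear_cmul\<close>)
  then have "expect \<tau> (D \<tau> (c *\<^sub>R v)) = expect \<tau> (\<lambda>x. c * D \<tau> v x)"
    unfolding expect_def by (intro integral_cong_AE) auto
  then show "expect \<tau> (D \<tau> (c *\<^sub>R v)) = c *\<^sub>R expect \<tau> (D \<tau> v)" by (simp add: expect_cmult)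
  have "\<bar>expect \<tau> (D \<tau> v)\<bar> \<le> exp bnd * sqrt (\<integral>x. (D \<tau> v x)\<^sup>2 \<partial>Q)"
    by (rule abs_expect_le[OF assms D_sqint[OF assms]])
  also have "\<dots> \<le> exp bnd * sqrt (c\<^sub>2 * (c\<^sub>n * (norm v)\<^sup>2))"
  proof (intro mult_left_mono real_sqrt_le_mono)
    have "(\<integral>x. (D \<tau> v x)\<^sup>2 \<partial>Q) \<le> c\<^sub>2 * n2 v" by (rule D_square(2)[OF assms])
    also have "\<dots> \<le> c\<^sub>2 * (c\<^sub>n * (norm v)\<^sup>2)" using n2_le const by (intro mult_left_mono) auto
    finally show "(\<integral>x. (D \<tau> v x)\<^sup>2 \<partial>Q) \<le> c\<^sub>2 * (c\<^sub>n * (norm v)\<^sup>2)" .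
  qed simp
  also have "\<dots> = norm v * (exp bnd * sqrt (c\<^sub>2 * c\<^sub>n))" by (simp add: real_sqrt_mult)
  finally show "norm (expect \<tau> (D \<tau> v)) \<le> norm v * (exp bnd * sqrt (c\<^sub>2 * c\<^sub>n))" by simp
qed

lemma score_linear:
  assumes "\<tau> \<in> N" shows "AE x in Q. bounded_linear (\<lambda>v. score \<tau> v x)"
  using D_linear
  by eventually_elim (use assms expect_D_linear in \<open>auto simp: score_def intro!: bounded_linear_sub\<close>)

lemma score_sqint: "\<tau> \<in> N \<Longrightarrow> sqint Q (score \<tau> v)"
  unfolding score_def by (intro sqint_diff D_sqint Q.sqint_const)

text \<open>Log-concavity along the segment bounds the increment by difference quotients at \<tau>,
  which converge to the score. Steps \<open>1 / (k + 1)\<close> keep the exceptional sets countable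
  in number.\<close>

lemma tangent_pair:
  assumes \<tau>: "\<tau> \<in> N" and \<sigma>: "\<sigma> \<in> N"
  shows "AE x in Q. llr \<sigma> x - llr \<tau> x \<le> score \<tau> (\<sigma> - \<tau>) x"
proof -
  define v where "v = \<sigma> - \<tau>"
  define t where "t k = 1 / real (Suc k)" for k
  have t: "0 < t k" "t k \<le> 1" for k by (auto simp: t_def)
  have t0: "t \<longlonglongrightarrow> 0" unfolding t_def using LIMSEQ_inverse_real_of_nat by (simp add: inverse_eq_divide)
  have conv: "AE x in Q. \<forall>k. t k * (llr \<sigma> x - llr \<tau> x) \<le> llr (\<tau> + t k *\<^sub>R v) x - llr \<tau> x"
  proof -
    have "AE x in Q. t k * (llr \<sigma> x - llr \<tau> x) \<le> llr (\<tau> + t k *\<^sub>R v) x - llr \<tau> x" for k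
    proof -
      have "AE x in Q. (1 - t k) * ln (dens M \<eta> \<tau> x) + t k * ln (dens M \<eta> \<sigma> x) \<le> ln (dens M \<eta> ((1 - t k) *\<^sub>R \<tau> + t k *\<^sub>R \<sigma>) x)"
        unfolding AE_Q using t[of k] by (intro log_concave) auto
      then show ?thesis
      proof eventually_elim
        case (elim x)
        have "(1 - t k) *\<^sub>R \<tau> + t k *\<^sub>R \<sigma> = \<tau> + t k *\<^sub>R v" by (simp add: v_def algebra_simps)
        then show ?case using elim unfolding ln_dens llr_def by (simp add: algebra_simps)
      qed
    qed
    then show ?thesis by (simp add: AE_all_countable)
  qed
  have der: "AE x in Q. \<forall>\<tau>\<in>N. ((\<lambda>\<sigma>. \<eta> \<sigma> x) has_derivative (\<lambda>v. D \<tau> v x)) (at \<tau>)"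
    unfolding AE_Q by (rule eta_derivative)
  from conv der show ?thesis
  proof eventually_elim
    case (elim x)
    have dx: "((\<lambda>\<sigma>. \<eta> \<sigma> x) has_derivative (\<lambda>v. D \<tau> v x)) (at \<tau>)" using elim(2) \<tau> by blast
    interpret bounded_linear "\<lambda>v. D \<tau> v x" using dx by (rule has_derivative_bounded_linear)
    have "((\<lambda>s. \<eta> (\<tau> + s *\<^sub>R v) x) has_derivative (\<lambda>s. D \<tau> (s *\<^sub>R v) x)) (at 0)"
      by (rule has_derivative_compose[of "\<lambda>s. \<tau> + s *\<^sub>R v", where g = "\<lambda>\<sigma>. \<eta> \<sigma> x"])
        (auto intro!: derivative_eq_intros simp: dx)
    then have d1: "((\<lambda>s. \<eta> (\<tau> + s *\<^sub>R v) x) has_real_derivative D \<tau> v x) (at 0)"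
      by (simp add: has_field_derivative_def scaleR mult_commute_abs)
    have d2: "((\<lambda>s. logZ (\<tau> + s *\<^sub>R v)) has_real_derivative expect \<tau> (D \<tau> v)) (at 0)"
      using logZ_derivative[of \<tau> 0 v] \<tau> by simp
    have "((\<lambda>s. llr (\<tau> + s *\<^sub>R v) x) has_real_derivative score \<tau> v x) (at 0)"
      unfolding llr_def score_def by (auto intro!: derivative_eq_intros d1 d2)
    then have "((\<lambda>h. (llr (\<tau> + h *\<^sub>R v) x - llr \<tau> x) / h) \<longlongrightarrow> score \<tau> v x) (at 0)"
      by (simp add: DERIV_def)
    moreover have "filterlim t (at 0) sequentially"
      unfolding filterlim_at using t0 t by (auto simp: less_imp_neq[symmetric] eventually_sequentially)
    ultimately have lim: "(\<lambda>k. (llr (\<tau> + t k *\<^sub>R v) x - llr \<tau> x) / t k) \<longlonglongrightarrow> score \<tau> v x"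
      by (rule filterlim_compose)
    have "llr \<sigma> x - llr \<tau> x \<le> score \<tau> v x"
    proof (rule LIMSEQ_le_const[OF lim], intro exI[of _ 0] allI impI)
      fix k
      show "llr \<sigma> x - llr \<tau> x \<le> (llr (\<tau> + t k *\<^sub>R v) x - llr \<tau> x) / t k"
        using elim(1) t[of k] by (simp add: pos_le_divide_eq mult.commute)
    qed
    then show ?case by (simp add: v_def)
  qed
qed

text \<open>One null set must serve all \<sigma>, since the estimator ranges over an uncountable
  set. The inequality is obtained on a countable dense set and extended by continuity in \<sigma> at
  fixed \<open>x\<close>.\<close>

lemma llr_tangent:
  assumes \<tau>: "\<tau> \<in> N"
  shows "AE x in Q. \<forall>\<sigma>\<in>N. llr \<sigma> x \<le> bnd \<and> llr \<sigma> x \<le> llr \<tau> x + score \<tau> (\<sigma> - \<tau>) x"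
proof -
  obtain S :: "'q set" where S: "countable S" "closure S = UNIV" using separable by blast
  have "AE x in Q. llr \<sigma> x \<le> bnd \<and> llr \<sigma> x \<le> llr \<tau> x + score \<tau> (\<sigma> - \<tau>) x" if "\<sigma> \<in> S \<inter> N" for \<sigma>
    using tangent_pair[OF \<tau>, of \<sigma>] llr_bounded[of \<sigma>] that by (auto elim!: eventually_elim2)
  then have all: "AE x in Q. \<forall>\<sigma>\<in>S \<inter> N. llr \<sigma> x \<le> bnd \<and> llr \<sigma> x \<le> llr \<tau> x + score \<tau> (\<sigma> - \<tau>) x"
    using S(1) by (subst AE_ball_countable) auto
  have der: "AE x in Q. \<forall>\<tau>\<in>N. ((\<lambda>\<sigma>. \<eta> \<sigma> x) has_derivative (\<lambda>v. D \<tau> v x)) (at \<tau>)"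
    unfolding AE_Q by (rule eta_derivative)
  from all der score_linear[OF \<tau>] show ?thesis
  proof eventually_elim
    case (elim x)
    show ?case
    proof
      fix \<sigma> assume \<sigma>: "\<sigma> \<in> N"
      obtain s where s: "\<And>k. s k \<in> S" "s \<longlonglongrightarrow> \<sigma>"
        using S(2) closure_sequential[of \<sigma> S] by auto
      have ev: "\<forall>\<^sub>F k in sequentially. s k \<in> N"
        using s(2) N(1) \<sigma> by (rule topological_tendstoD)
      have "isCont (\<lambda>\<sigma>. \<eta> \<sigma> x) \<sigma>"
        using elim(2) \<sigma> by (auto intro: has_derivative_continuous)
      then have "isCont (\<lambda>\<sigma>. llr \<sigma> x) \<sigma>"
        unfolding llr_def using logZ_continuous[OF \<sigma>] by (intro continuous_intros)
      then have l1: "(\<lambda>k. llr (s k) x) \<longlonglongrightarrow> llr \<sigma> x" by (rule isCont_tendsto_compose[OF _ s(2)])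
      have l2: "(\<lambda>k. llr \<tau> x + score \<tau> (s k - \<tau>) x) \<longlonglongrightarrow> llr \<tau> x + score \<tau> (\<sigma> - \<tau>) x"
        using s(2) by (intro tendsto_intros bounded_linear.tendsto[OF elim(3)])
      have "llr \<sigma> x \<le> bnd"
        by (rule tendsto_upperbound[OF l1]) (use ev elim(1) s(1) in \<open>auto elim!: eventually_mono\<close>)
      moreover have "llr \<sigma> x \<le> llr \<tau> x + score \<tau> (\<sigma> - \<tau>) x"
        by (rule tendsto_le[OF _ l2 l1]) (use ev elim(1) s(1) in \<open>auto elim!: eventually_mono\<close>)
      ultimately show "llr \<sigma> x \<le> bnd \<and> llr \<sigma> x \<le> llr \<tau> x + score \<tau> (\<sigma> - \<tau>) x" ..
    qed
  qed
qed

text \<open>The integrand of the Bregman divergence is nonnegative by log-concavity, so its integral under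
  \<open>\<tau>\<^sub>0\<close> dominates the one under \<open>\<tau>\<close>, which is a Kullback-Leibler divergence.\<close>

lemma logZ_Bregman:
  assumes \<tau>: "\<tau> \<in> N" and \<sigma>: "\<sigma> \<in> N"
  shows "exp (- 4 * bnd) / 2 * (\<integral>x. (\<eta> \<sigma> x - \<eta> \<tau> x)\<^sup>2 \<partial>Q)
    \<le> logZ \<sigma> - logZ \<tau> - expect \<tau> (D \<tau> (\<sigma> - \<tau>))"
proof -
  define v where "v = \<sigma> - \<tau>"
  define w where "w x = llr \<sigma> x - llr \<tau> x" for x
  define r where "r x = score \<tau> v x + (-1) * w x" for x
  have ws: "sqint Q w" unfolding w_def by (intro sqint_diff llr_sqint)
  have [measurable]: "w \<in> borel_measurable Q" using ws by (rule sqint_measurable)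
  have w2i: "integrable Q (\<lambda>x. (w x)\<^sup>2)" using ws by (rule sqint_integrable_square)
  have wi: "integrable Q w" using ws by (rule Q.sqint_integrable)
  have si: "integrable Q (score \<tau> v)" by (rule Q.sqint_integrable[OF score_sqint[OF \<tau>]])
  have ri: "integrable Q r" unfolding r_def using wi si by auto
  have r0: "AE x in Q. 0 \<le> r x"
    using tangent_pair[OF \<tau> \<sigma>] by eventually_elim (simp add: r_def w_def v_def)
  have "expect \<tau> (score \<tau> v) = expect \<tau> (\<lambda>x. D \<tau> v x + - expect \<tau> (D \<tau> v))"
    by (simp add: score_def[abs_def])
  also have "\<dots> = 0"
    by (subst expect_add[OF \<tau> Q.sqint_integrable[OF D_sqint[OF \<tau>]]]) (auto simp: expect_const)
  finally have es: "expect \<tau> (score \<tau> v) = 0" .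
  \<comment> \<open>The score is centred under \<tau>, so the mean of \<open>r\<close> under \<tau>
    is a Kullback-Leibler divergence; its mean under the true law is the Bregman divergence of
    \<open>logZ\<close>, see \<open>Er\<close>.\<close>
  have er: "expect \<tau> r = - expect \<tau> w"
    unfolding r_def using wi si by (subst expect_add[OF \<tau>]) (simp_all add: es expect_cmult[of _ "-1", simplified])
  have Er: "(\<integral>x. r x \<partial>Q) = logZ \<sigma> - logZ \<tau> - expect \<tau> (D \<tau> v)"
  proof -
    have "(\<integral>x. score \<tau> v x \<partial>Q) = - expect \<tau> (D \<tau> v)"
      unfolding score_def using Q.sqint_integrable[OF D_sqint[OF \<tau>]] D_mean[OF \<tau>] by (simp add: Q.prob_space)
    moreover have "(\<integral>x. w x \<partial>Q) = - (logZ \<sigma> - logZ \<tau>)"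
      unfolding w_def using Q.sqint_integrable[OF llr_sqint] by (simp add: llr_mean)
    ultimately show ?thesis unfolding r_def using wi si by simp
  qed
  \<comment> \<open>\<open>exp (- (2 * bnd))\<close> is the Taylor constant on the range of
    \<open>w\<close>; each of the two changes between \<open>Q\<close> and the law of \<tau> costs a
    further \<open>exp (- bnd)\<close>.\<close>
  have "exp (- (2 * bnd)) / 2 * (exp (- bnd) * (\<integral>x. (w x)\<^sup>2 \<partial>Q)) \<le> - expect \<tau> w"
  proof -
    have "exp (- (2 * bnd)) / 2 * (exp (- bnd) * (\<integral>x. (w x)\<^sup>2 \<partial>Q)) \<le> exp (- (2 * bnd)) / 2 * expect \<tau> (\<lambda>x. (w x)\<^sup>2)"
      using expect_le(2)[OF \<tau> w2i] by (intro mult_left_mono) auto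
    also have "\<dots> = (\<integral>x. exp (- (2 * bnd)) / 2 * (w x)\<^sup>2 * exp (llr \<tau> x) \<partial>Q)"
      by (simp add: expect_def mult.assoc)
    also have "\<dots> \<le> (\<integral>x. exp (llr \<sigma> x) - exp (llr \<tau> x) - w x * exp (llr \<tau> x) \<partial>Q)"
    proof (rule integral_mono_AE)
      show "integrable Q (\<lambda>x. exp (- (2 * bnd)) / 2 * (w x)\<^sup>2 * exp (llr \<tau> x))"
        using w2i by (intro integrable_weighted[OF \<tau>]) auto
      show "integrable Q (\<lambda>x. exp (llr \<sigma> x) - exp (llr \<tau> x) - w x * exp (llr \<tau> x))"
        using exp_llr_integral integrable_weighted[OF \<tau> wi] by auto
      show "AE x in Q. exp (- (2 * bnd)) / 2 * (w x)\<^sup>2 * exp (llr \<tau> x)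
          \<le> exp (llr \<sigma> x) - exp (llr \<tau> x) - w x * exp (llr \<tau> x)"
        using llr_bounded[OF \<tau>] llr_bounded[OF \<sigma>]
      proof eventually_elim
        case (elim x)
        then have "- (2 * bnd) \<le> w x" by (auto simp: w_def)
        then have "exp (- (2 * bnd)) / 2 * (w x)\<^sup>2 * exp (llr \<tau> x) \<le> (exp (w x) - 1 - w x) * exp (llr \<tau> x)"
          using bnd_nonneg by (intro mult_right_mono exp_ge_quadratic) auto
        also have "\<dots> = exp (llr \<sigma> x) - exp (llr \<tau> x) - w x * exp (llr \<tau> x)"
          by (simp add: left_diff_distrib w_def exp_add[symmetric])
        finally show ?case .
      qed
    qed
    also have "\<dots> = - expect \<tau> w"
      unfolding expect_def using exp_llr_integral integrable_weighted[OF \<tau> wi] by simp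
    finally show ?thesis .
  qed
  then have "exp (- bnd) * (exp (- (2 * bnd)) / 2 * (exp (- bnd) * (\<integral>x. (w x)\<^sup>2 \<partial>Q))) \<le> exp (- bnd) * expect \<tau> r"
    unfolding er by (intro mult_left_mono) auto
  also have "\<dots> \<le> (\<integral>x. r x \<partial>Q)" by (rule expect_le(3)[OF \<tau> ri r0])
  also have "exp (- bnd) * (exp (- (2 * bnd)) / 2 * (exp (- bnd) * (\<integral>x. (w x)\<^sup>2 \<partial>Q))) = exp (- 4 * bnd) / 2 * (\<integral>x. (w x)\<^sup>2 \<partial>Q)"
  proof -
    have "exp (- 4 * bnd) = exp (- bnd) * (exp (- (2 * bnd)) * exp (- bnd))" by (simp add: exp_add[symmetric])
    then show ?thesis by simp
  qed
  finally have "exp (- 4 * bnd) / 2 * (\<integral>x. (w x)\<^sup>2 \<partial>Q) \<le> logZ \<sigma> - logZ \<tau> - expect \<tau> (D \<tau> v)" unfolding Er .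
  moreover have "exp (- 4 * bnd) / 2 * (\<integral>x. (\<eta> \<sigma> x - \<eta> \<tau> x)\<^sup>2 \<partial>Q) \<le> exp (- 4 * bnd) / 2 * (\<integral>x. (w x)\<^sup>2 \<partial>Q)"
    using llr_Lipschitz(1)[OF \<tau> \<sigma>] by (intro mult_left_mono) (auto simp: w_def)
  ultimately show ?thesis unfolding v_def by (rule order_trans[rotated])
qed

text \<open>The factor \<open>exp (- 4 * bnd) / 2\<close> of \<open>logZ_Bregman\<close> times the
  \<open>c\<^sub>1 / 4\<close> that remains of the derivative bound in \<open>llr_mean_le\<close>
  once the linearization error is absorbed.\<close>

definition c\<^sub>K :: real where "c\<^sub>K = exp (- 4 * bnd) * c\<^sub>1 / 8"

lemma c\<^sub>K: "c\<^sub>K > 0" using const by (simp add: c\<^sub>K_def)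

text \<open>The lower variance bound concerns derivatives, which may turn along the segment, so it
  does not directly bound the increment of \<open>\<eta>\<close> from below. It does give quadratic
  growth of \<open>logZ\<close> near each point of the segment, which
  \<open>locally_above_tangent_imp_le\<close> makes global.\<close>

lemma llr_mean_le:
  assumes u: "\<tau>\<^sub>0 + u \<in> N"
  shows "(\<integral>x. llr (\<tau>\<^sub>0 + u) x \<partial>Q) \<le> - c\<^sub>K * n2 u"
proof (cases "n2 u = 0")
  case True
  have "expect \<tau>\<^sub>0 (\<lambda>x. llr (\<tau>\<^sub>0 + u) x - llr \<tau>\<^sub>0 x) \<le> 0" by (rule expect_llr_le[OF N(3)])
  then show ?thesis using True by (simp add: expect_0 llr_0)
next
  case False
  then have pos: "n2 u > 0" using n2_nonneg[of u] by simp
  have seg: "\<tau>\<^sub>0 + s *\<^sub>R u \<in> N" if "0 \<le> s" "s \<le> 1" for s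
    using segment_in_N[OF N(3) u that] by simp
  define n where "n s = logZ (\<tau>\<^sub>0 + s *\<^sub>R u) - c\<^sub>K * n2 u * s\<^sup>2" for s
  define n' where "n' s = expect (\<tau>\<^sub>0 + s *\<^sub>R u) (D (\<tau>\<^sub>0 + s *\<^sub>R u) u) - 2 * (c\<^sub>K * n2 u) * s" for s
  have "n 0 \<le> n 1"
  proof (rule locally_above_tangent_imp_le)
    show "(n has_real_derivative n' s) (at s)" if "0 \<le> s" "s \<le> 1" for s
      unfolding n_def n'_def by (auto intro!: derivative_eq_intros logZ_derivative seg that)
    show "n' 0 = 0" using D_mean[OF N(3), of u] by (simp add: n'_def expect_0)
    fix s :: real assume s: "0 \<le> s" "s < 1"
    define \<tau> where "\<tau> = \<tau>\<^sub>0 + s *\<^sub>R u"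
    have \<tau>: "\<tau> \<in> N" unfolding \<tau>_def using s by (intro seg) auto
    \<comment> \<open>The squared remainder enters twice, so it uses up half of
      \<open>c\<^sub>1 * n2 u\<close>.\<close>
    define e where "e = c\<^sub>1 * n2 u / 4"
    have e: "e > 0" using const pos by (simp add: e_def)
    obtain \<delta> where \<delta>: "\<delta> > 0" "\<And>h. \<bar>h\<bar> < \<delta> \<Longrightarrow>
      (\<integral>x. (\<eta> (\<tau> + h *\<^sub>R u) x - \<eta> \<tau> x - h * D \<tau> u x)\<^sup>2 \<partial>Q) \<le> e * h\<^sup>2"
      using L2_derivative[OF \<tau> e] by blast
    show "\<exists>\<delta>>0. \<forall>h. 0 < h \<and> h < \<delta> \<and> s + h \<le> 1 \<longrightarrow> n s + h * n' s \<le> n (s + h)"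
    proof (intro exI[of _ \<delta>] conjI allI impI \<delta>(1))
      fix h assume h: "0 < h \<and> h < \<delta> \<and> s + h \<le> 1"
      define \<sigma> where "\<sigma> = \<tau> + h *\<^sub>R u"
      have \<sigma>_eq: "\<sigma> = \<tau>\<^sub>0 + (s + h) *\<^sub>R u" by (simp add: \<sigma>_def \<tau>_def algebra_simps)
      have \<sigma>: "\<sigma> \<in> N" unfolding \<sigma>_eq using s h by (intro seg) auto
      define g where "g x = \<eta> \<sigma> x - \<eta> \<tau> x" for x
      have gs: "sqint Q g" unfolding g_def by (intro sqint_diff eta_sqint)
      have rs: "sqint Q (\<lambda>x. g x - h * D \<tau> u x)" by (intro sqint_diff sqint_cmult gs D_sqint \<tau>)
      have "h\<^sup>2 * (c\<^sub>1 * n2 u) \<le> h\<^sup>2 * (\<integral>x. (D \<tau> u x)\<^sup>2 \<partial>Q)"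
        using D_square(1)[OF \<tau>] by (intro mult_left_mono) auto
      also have "\<dots> = (\<integral>x. (h * D \<tau> u x)\<^sup>2 \<partial>Q)" by (simp add: power_mult_distrib)
      also have "\<dots> \<le> (\<integral>x. 2 * (g x)\<^sup>2 + 2 * (g x - h * D \<tau> u x)\<^sup>2 \<partial>Q)"
      proof (rule integral_mono)
        show "integrable Q (\<lambda>x. (h * D \<tau> u x)\<^sup>2)"
          by (rule sqint_integrable_square[OF sqint_cmult[OF D_sqint[OF \<tau>]]])
        show "integrable Q (\<lambda>x. 2 * (g x)\<^sup>2 + 2 * (g x - h * D \<tau> u x)\<^sup>2)"
          using sqint_integrable_square[OF gs] sqint_integrable_square[OF rs] by auto
        fix x
        have "0 \<le> (2 * g x - h * D \<tau> u x)\<^sup>2" by simp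
        then show "(h * D \<tau> u x)\<^sup>2 \<le> 2 * (g x)\<^sup>2 + 2 * (g x - h * D \<tau> u x)\<^sup>2"
          by (simp add: power2_eq_square algebra_simps)
      qed
      also have "\<dots> = 2 * (\<integral>x. (g x)\<^sup>2 \<partial>Q) + 2 * (\<integral>x. (g x - h * D \<tau> u x)\<^sup>2 \<partial>Q)"
        using sqint_integrable_square[OF gs] sqint_integrable_square[OF rs] by simp
      also have "\<dots> \<le> 2 * (\<integral>x. (g x)\<^sup>2 \<partial>Q) + 2 * (e * h\<^sup>2)"
        using \<delta>(2)[of h] h by (simp add: g_def \<sigma>_def)
      finally have "c\<^sub>1 * n2 u / 4 * h\<^sup>2 \<le> (\<integral>x. (g x)\<^sup>2 \<partial>Q)" by (simp add: e_def algebra_simps)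
      then have "exp (- 4 * bnd) / 2 * (c\<^sub>1 * n2 u / 4 * h\<^sup>2) \<le> exp (- 4 * bnd) / 2 * (\<integral>x. (g x)\<^sup>2 \<partial>Q)"
        by (intro mult_left_mono) auto
      also have "\<dots> \<le> logZ \<sigma> - logZ \<tau> - expect \<tau> (D \<tau> (\<sigma> - \<tau>))"
        unfolding g_def by (rule logZ_Bregman[OF \<tau> \<sigma>])
      also have "expect \<tau> (D \<tau> (\<sigma> - \<tau>)) = h * expect \<tau> (D \<tau> u)"
        using linear_cmul[OF bounded_linear.linear[OF expect_D_linear[OF \<tau>]], of h u] by (simp add: \<sigma>_def)
      finally have main: "c\<^sub>K * n2 u * h\<^sup>2 \<le> logZ \<sigma> - logZ \<tau> - h * expect \<tau> (D \<tau> u)" by (simp add: c\<^sub>K_def)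
      have "(s + h)\<^sup>2 = s\<^sup>2 + 2 * s * h + h\<^sup>2" by (simp add: power2_sum)
      then have "n (s + h) - n s - h * n' s = logZ \<sigma> - logZ \<tau> - h * expect \<tau> (D \<tau> u) - c\<^sub>K * n2 u * h\<^sup>2"
        unfolding n_def n'_def \<sigma>_eq[symmetric] \<tau>_def[symmetric] by (simp add: algebra_simps)
      then show "n s + h * n' s \<le> n (s + h)" using main by linarith
    qed
  qed
  then have "c\<^sub>K * n2 u \<le> logZ (\<tau>\<^sub>0 + u) - logZ \<tau>\<^sub>0" by (simp add: n_def)
  then show ?thesis by (simp add: llr_mean)
qed

lemma llr_square_le: "\<tau>\<^sub>0 + u \<in> N \<Longrightarrow> (\<integral>x. (llr (\<tau>\<^sub>0 + u) x)\<^sup>2 \<partial>Q) \<le> c\<^sub>L * n2 u"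
  using llr_Lipschitz(2)[OF N(3), of "\<tau>\<^sub>0 + u"] by (simp add: llr_0)

text \<open>The score is centred under its own parameter, not under the true one. Its mean under
  \<open>Q\<close> is a difference of means under two parameters, hence of first order in
  \<open>u\<close>.\<close>

lemma score_mean_le:
  assumes u: "\<tau>\<^sub>0 + u \<in> N"
  shows "(\<integral>x. score (\<tau>\<^sub>0 + u) v x \<partial>Q) \<le> exp bnd * c\<^sub>L * (sqrt (n2 u) * sqrt (n2 v))"
proof -
  define \<tau> where "\<tau> = \<tau>\<^sub>0 + u"
  have \<tau>: "\<tau> \<in> N" using u by (simp add: \<tau>_def)
  have "(\<integral>x. score \<tau> v x \<partial>Q) = expect \<tau>\<^sub>0 (D \<tau> v) - expect \<tau> (D \<tau> v)"
    unfolding score_def expect_0 using Q.sqint_integrable[OF D_sqint[OF \<tau>]] by (simp add: Q.prob_space)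
  also have "\<dots> \<le> exp bnd * (sqrt (\<integral>x. (D \<tau> v x)\<^sup>2 \<partial>Q) * sqrt (c\<^sub>L * n2 u))"
    using expect_diff_le[OF N(3) \<tau> D_sqint[OF \<tau>], of v] by (simp add: \<tau>_def abs_le_iff)
  also have "\<dots> \<le> exp bnd * (sqrt (c\<^sub>L * n2 v) * sqrt (c\<^sub>L * n2 u))"
  proof (intro mult_left_mono mult_right_mono real_sqrt_le_mono)
    have "(\<integral>x. (D \<tau> v x)\<^sup>2 \<partial>Q) \<le> c\<^sub>2 * n2 v" by (rule D_square(2)[OF \<tau>])
    also have "\<dots> \<le> c\<^sub>L * n2 v" using c\<^sub>L n2_nonneg by (intro mult_right_mono) auto
    finally show "(\<integral>x. (D \<tau> v x)\<^sup>2 \<partial>Q) \<le> c\<^sub>L * n2 v" .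
  qed (use c\<^sub>L n2_nonneg in auto)
  also have "\<dots> = exp bnd * c\<^sub>L * (sqrt (n2 u) * sqrt (n2 v))" using c\<^sub>L by (simp add: real_sqrt_mult)
  finally show ?thesis by (simp add: \<tau>_def)
qed

lemma score_square_le:
  assumes \<tau>: "\<tau> \<in> N"
  shows "(\<integral>x. (score \<tau> v x)\<^sup>2 \<partial>Q) \<le> c\<^sub>L * n2 v"
proof -
  define b where "b = expect \<tau> (D \<tau> v)"
  note ds = D_sqint[OF \<tau>, of v]
  have "(\<lambda>x. (score \<tau> v x)\<^sup>2) = (\<lambda>x. (D \<tau> v x)\<^sup>2 - 2 * b * D \<tau> v x + b\<^sup>2)"
    by (auto simp: score_def b_def power2_eq_square algebra_simps)
  then have "(\<integral>x. (score \<tau> v x)\<^sup>2 \<partial>Q) = (\<integral>x. (D \<tau> v x)\<^sup>2 \<partial>Q) + b\<^sup>2"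
    using sqint_integrable_square[OF ds] Q.sqint_integrable[OF ds] D_mean[OF \<tau>] by (simp add: Q.prob_space)
  also have "b\<^sup>2 \<le> (exp bnd)\<^sup>2 * (\<integral>x. (D \<tau> v x)\<^sup>2 \<partial>Q)"
  proof -
    have "\<bar>b\<bar>\<^sup>2 \<le> (exp bnd * sqrt (\<integral>x. (D \<tau> v x)\<^sup>2 \<partial>Q))\<^sup>2"
      unfolding b_def by (intro power_mono abs_expect_le[OF \<tau> ds]) auto
    then show ?thesis by (simp add: power_mult_distrib)
  qed
  also have "(\<integral>x. (D \<tau> v x)\<^sup>2 \<partial>Q) + (exp bnd)\<^sup>2 * (\<integral>x. (D \<tau> v x)\<^sup>2 \<partial>Q)
      = (1 + (exp bnd)\<^sup>2) * (\<integral>x. (D \<tau> v x)\<^sup>2 \<partial>Q)" by (simp add: algebra_simps)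
  also have "\<dots> \<le> (1 + (exp bnd)\<^sup>2) * (c\<^sub>2 * n2 v)"
    using D_square(2)[OF \<tau>] by (intro mult_left_mono) auto
  finally show ?thesis by (simp add: c\<^sub>L_def mult_ac)
qed

end

subsection \<open>Rate of the penalized estimator\<close>

text \<open>Allows an implication between events to fail on a null set and at \<open>n = 0\<close>,
  where there is no observation.\<close>

lemma whp_AE_mono:
  assumes "prob_space P" "whp P E" "AE \<omega> in P. \<forall>n\<ge>1. E n \<omega> \<longrightarrow> E' n \<omega>"
  shows "whp P E'"
  unfolding whp_def
proof (intro allI impI)
  interpret prob_space P by fact
  fix \<epsilon> :: real assume "\<epsilon> > 0"
  obtain Z where Z: "Z \<in> null_sets P" "\<And>\<omega>. \<omega> \<in> space P - Z \<Longrightarrow> \<forall>n\<ge>1. E n \<omega> \<longrightarrow> E' n \<omega>"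
    using assms(3) by (elim AE_E3) blast
  have "\<forall>\<^sub>F n in sequentially. \<exists>A\<in>sets P. measure P A \<ge> 1 - \<epsilon> \<and> (\<forall>\<omega>\<in>A. E n \<omega>)"
    using assms(2) \<open>\<epsilon> > 0\<close> unfolding whp_def by blast
  with eventually_ge_at_top[of "1 :: nat"]
  show "\<forall>\<^sub>F n in sequentially. \<exists>A\<in>sets P. measure P A \<ge> 1 - \<epsilon> \<and> (\<forall>\<omega>\<in>A. E' n \<omega>)"
  proof eventually_elim
    case (elim n)
    then obtain A where A: "A \<in> sets P" "measure P A \<ge> 1 - \<epsilon>" "\<forall>\<omega>\<in>A. E n \<omega>" by blast
    show ?case
    proof (intro bexI[of _ "A - Z"] conjI ballI)
      show "A - Z \<in> sets P" using A(1) Z(1) by auto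
      show "measure P (A - Z) \<ge> 1 - \<epsilon>" using A(2) measure_Diff_null_set[OF A(1) Z(1)] by simp
      fix \<omega> assume "\<omega> \<in> A - Z"
      then show "E' n \<omega>" using A(1,3) Z(2)[of \<omega>] elim(1) sets.sets_into_space by blast
    qed
  qed
qed

text \<open>The basic inequality is demanded on the whole segment from the true parameter to the
  estimator. An estimator too far away would make the segment cross the boundary of the ellipsoid,
  where \<open>uniform_lower_bound\<close> contradicts the inequality.\<close>

lemma (in local_model) penalized_rate:
  fixes lam :: "nat \<Rightarrow> real" and est :: "nat \<Rightarrow> 'w \<Rightarrow> 'a \<times> 'h" and h\<^sub>0 :: 'h
  assumes lam: "\<And>n. lam n > 0" "lam \<longlonglongrightarrow> 0"
    and star: "\<And>u s. u \<in> G \<Longrightarrow> 0 \<le> s \<Longrightarrow> s \<le> 1 \<Longrightarrow> s *\<^sub>R u \<in> G"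
    and est: "whp P (\<lambda>n \<omega>. est n \<omega> \<in> G \<and> (\<forall>s\<in>{0..1}.
        lam n / 2 * (J (h\<^sub>0 + s *\<^sub>R snd (est n \<omega>)) (h\<^sub>0 + s *\<^sub>R snd (est n \<omega>)) - J h\<^sub>0 h\<^sub>0)
        \<le> (\<Sum>k<n. y (s *\<^sub>R est n \<omega>) (X k \<omega>)) / real n))"
  shows "big_Op P (\<lambda>n \<omega>. norm (fst (est n \<omega>)))
    (\<lambda>n. real n powr (- 1 / 2) * lam n powr (- 1 / (2 * r)) + lam n powr (1 / 2))"
proof -
  \<comment> \<open>\<open>c / 2\<close> is the curvature left by
    \<open>uniform_lower_bound\<close>, \<open>1 / 4\<close> the share of the penalty left after the
    cross term with \<open>h\<^sub>0\<close>; \<open>c'\<close> is a common weight for both parts of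
    the squared radius.\<close>
  define c' where "c' = min (c / 2) (1 / 4)"
  have c': "c' > 0" using const by (simp add: c'_def)
  define J0 where "J0 = J h\<^sub>0 h\<^sub>0"
  have J0: "J0 \<ge> 0" by (simp add: J0_def J.nonneg)
  obtain K\<^sub>0 where K\<^sub>0: "K\<^sub>0 > 0" "\<And>K \<epsilon>. K \<ge> K\<^sub>0 \<Longrightarrow> \<epsilon> > 0 \<Longrightarrow> \<forall>\<^sub>F n in sequentially. \<exists>A\<in>sets P. measure P A \<ge> 1 - \<epsilon> \<and>
     (\<forall>\<omega>\<in>A. \<forall>u\<in>G. Sq u + lam n * J (snd u) (snd u) = K\<^sup>2 * (lam n powr (- 1 / r) / real n + lam n) \<longrightarrow>
        (\<Sum>k<n. y u (X k \<omega>)) \<le> real n * (- (c / 2) * Sq u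
            + c' / 2 * (K\<^sup>2 * (lam n powr (- 1 / r) / real n + lam n))))"
    using uniform_lower_bound[of lam "c' / 2", OF lam] c' by auto
  \<comment> \<open>Large enough for \<open>c' / 2 * K\<^sup>2\<close> to exceed the bias
    \<open>J0\<close>.\<close>
  define K where "K = max K\<^sub>0 (sqrt (2 * J0 / c') + 1)"
  have K: "K \<ge> K\<^sub>0" "K > 0" "2 * J0 / c' < K\<^sup>2"
  proof -
    show "K \<ge> K\<^sub>0" "K > 0" using K\<^sub>0 by (auto simp: K_def)
    have "0 \<le> sqrt (2 * J0 / c')" using J0 c' by simp
    moreover have "sqrt (2 * J0 / c') < K" by (simp add: K_def)
    ultimately have "(sqrt (2 * J0 / c'))\<^sup>2 < K\<^sup>2" by (intro power_strict_mono) auto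
    then show "2 * J0 / c' < K\<^sup>2" using J0 c' by simp
  qed
  show ?thesis
    unfolding big_Op_def
  proof (intro allI impI exI[of _ K])
    fix \<epsilon> :: real assume \<epsilon>: "\<epsilon> > 0"
    have "\<forall>\<^sub>F n in sequentially. \<exists>A\<in>sets P. measure P A \<ge> 1 - \<epsilon> / 2 \<and> (\<forall>\<omega>\<in>A. est n \<omega> \<in> G \<and> (\<forall>s\<in>{0..1}.
        lam n / 2 * (J (h\<^sub>0 + s *\<^sub>R snd (est n \<omega>)) (h\<^sub>0 + s *\<^sub>R snd (est n \<omega>)) - J h\<^sub>0 h\<^sub>0)
        \<le> (\<Sum>k<n. y (s *\<^sub>R est n \<omega>) (X k \<omega>)) / real n))"
      using est \<epsilon> unfolding whp_def by auto
    moreover have "\<forall>\<^sub>F n in sequentially. \<exists>A\<in>sets P. measure P A \<ge> 1 - \<epsilon> / 2 \<and>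
     (\<forall>\<omega>\<in>A. \<forall>u\<in>G. Sq u + lam n * J (snd u) (snd u) = K\<^sup>2 * (lam n powr (- 1 / r) / real n + lam n) \<longrightarrow>
        (\<Sum>k<n. y u (X k \<omega>)) \<le> real n * (- (c / 2) * Sq u
            + c' / 2 * (K\<^sup>2 * (lam n powr (- 1 / r) / real n + lam n))))"
      using K\<^sub>0(2)[OF K(1), of "\<epsilon> / 2"] \<epsilon> by simp
    moreover have "\<forall>\<^sub>F n in sequentially. n \<ge> (1 :: nat)" by (rule eventually_ge_at_top)
    ultimately show "\<forall>\<^sub>F n in sequentially. \<exists>A\<in>sets P. measure P A \<ge> 1 - \<epsilon> \<and>
      (\<forall>\<omega>\<in>A. \<bar>norm (fst (est n \<omega>))\<bar> \<le> K * (real n powr (- 1 / 2) * lam n powr (- 1 / (2 * r)) + lam n powr (1 / 2)))"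
    proof eventually_elim
      case (elim n)
      define l where "l = lam n"
      have l: "l > 0" using lam by (simp add: l_def)
      have n: "real n > 0" using elim(3) by simp
      define \<delta> where "\<delta> = l powr (- 1 / r) / real n + l"
      have \<delta>: "\<delta> > 0" "l \<le> \<delta>" using l n by (auto simp: \<delta>_def add_nonneg_pos)
      obtain A\<^sub>1 where A\<^sub>1: "A\<^sub>1 \<in> sets P" "measure P A\<^sub>1 \<ge> 1 - \<epsilon> / 2" "\<And>\<omega>. \<omega> \<in> A\<^sub>1 \<Longrightarrow> est n \<omega> \<in> G"
        "\<And>\<omega> s. \<omega> \<in> A\<^sub>1 \<Longrightarrow> 0 \<le> s \<Longrightarrow> s \<le> 1 \<Longrightarrow>
          l / 2 * (J (h\<^sub>0 + s *\<^sub>R snd (est n \<omega>)) (h\<^sub>0 + s *\<^sub>R snd (est n \<omega>)) - J0)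
          \<le> (\<Sum>k<n. y (s *\<^sub>R est n \<omega>) (X k \<omega>)) / real n"
        using elim(1) unfolding l_def J0_def by fastforce
      obtain A\<^sub>2 where A\<^sub>2: "A\<^sub>2 \<in> sets P" "measure P A\<^sub>2 \<ge> 1 - \<epsilon> / 2"
        "\<And>\<omega> u. \<omega> \<in> A\<^sub>2 \<Longrightarrow> u \<in> G \<Longrightarrow> Sq u + l * J (snd u) (snd u) = K\<^sup>2 * \<delta> \<Longrightarrow>
          (\<Sum>k<n. y u (X k \<omega>)) \<le> real n * (- (c / 2) * Sq u + c' / 2 * (K\<^sup>2 * \<delta>))"
        using elim(2) unfolding l_def[symmetric] \<delta>_def[symmetric] by blast
      have key: "Sq (est n \<omega>) \<le> K\<^sup>2 * \<delta>" if \<omega>: "\<omega> \<in> A\<^sub>1" "\<omega> \<in> A\<^sub>2" for \<omega>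
      proof (rule ccontr)
        assume neg: "\<not> Sq (est n \<omega>) \<le> K\<^sup>2 * \<delta>"
        define u where "u = est n \<omega>"
        define a where "a = Sq u + l * J (snd u) (snd u)"
        have Kd: "K\<^sup>2 * \<delta> > 0" using K \<delta> by simp
        have "0 \<le> l * J (snd u) (snd u)" using l J.nonneg by simp
        then have a: "a > K\<^sup>2 * \<delta>" using neg by (simp add: a_def u_def)
        \<comment> \<open>Moves back along the segment to the boundary; both parts of the squared
          radius are homogeneous of degree 2.\<close>
        define s where "s = sqrt (K\<^sup>2 * \<delta> / a)"
        have s: "0 \<le> s" "s \<le> 1" "s\<^sup>2 * a = K\<^sup>2 * \<delta>" using a Kd by (auto simp: s_def)
        define v where "v = s *\<^sub>R u"
        have v: "v \<in> G" unfolding v_def u_def using s A\<^sub>1(3)[OF \<omega>(1)] by (intro star) auto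
        have "Sq v = s\<^sup>2 * Sq u"
          using s(1) by (simp add: v_def sqn_def V.scale V.scale_right power_mult_distrib distrib_left power2_eq_square mult_ac)
        moreover have "J (snd v) (snd v) = s\<^sup>2 * J (snd u) (snd u)"
          by (simp add: v_def J.scale J.scale_right power2_eq_square mult_ac)
        ultimately have vR: "Sq v + l * J (snd v) (snd v) = K\<^sup>2 * \<delta>"
          using s(3) by (simp add: a_def algebra_simps)
        have "l / 2 * (J (h\<^sub>0 + snd v) (h\<^sub>0 + snd v) - J0) \<le> (\<Sum>k<n. y v (X k \<omega>)) / real n"
          using A\<^sub>1(4)[OF \<omega>(1) s(1,2)] by (simp add: v_def u_def)
        also have "\<dots> \<le> - (c / 2) * Sq v + c' / 2 * (K\<^sup>2 * \<delta>)"
          using A\<^sub>2(3)[OF \<omega>(2) v vR] n by (simp add: divide_le_eq mult.commute)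
        finally have 1: "l / 2 * (J (h\<^sub>0 + snd v) (h\<^sub>0 + snd v) - J0) \<le> - (c / 2) * Sq v + c' / 2 * (K\<^sup>2 * \<delta>)" .
        \<comment> \<open>Nonnegativity of \<open>J\<close> at
          \<open>2 *\<^sub>R h\<^sub>0 + snd v\<close> bounds the cross term from below by
          \<open>- 2 * J0 - J (snd v) (snd v) / 2\<close>.\<close>
        have 2: "J (snd v) (snd v) / 2 - 2 * J0 \<le> J (h\<^sub>0 + snd v) (h\<^sub>0 + snd v) - J0"
          using J.nonneg[of "2 *\<^sub>R h\<^sub>0 + snd v"] J.sym[of "snd v" h\<^sub>0]
          by (simp add: J0_def J.add J.add_right J.scale J.scale_right)
        have "l / 2 * (J (snd v) (snd v) / 2 - 2 * J0) \<le> l / 2 * (J (h\<^sub>0 + snd v) (h\<^sub>0 + snd v) - J0)"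
          using 2 l by (intro mult_left_mono) auto
        then have 3: "c / 2 * Sq v + 1 / 4 * (l * J (snd v) (snd v)) \<le> c' / 2 * (K\<^sup>2 * \<delta>) + l * J0"
          using 1 by (simp add: algebra_simps)
        have "c' * (K\<^sup>2 * \<delta>) = c' * Sq v + c' * (l * J (snd v) (snd v))" by (simp add: vR[symmetric] distrib_left)
        also have "\<dots> \<le> c / 2 * Sq v + 1 / 4 * (l * J (snd v) (snd v))"
          using Sq_nonneg[of v] l J.nonneg[of "snd v"] by (intro add_mono mult_right_mono) (auto simp: c'_def)
        also have "\<dots> \<le> c' / 2 * (K\<^sup>2 * \<delta>) + \<delta> * J0"
          using 3 mult_right_mono[OF \<delta>(2) J0] by linarith
        finally have "c' / 2 * K\<^sup>2 * \<delta> \<le> J0 * \<delta>" by (simp add: algebra_simps)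
        then have "c' / 2 * K\<^sup>2 \<le> J0" using \<delta>(1) by (rule mult_right_le_imp_le)
        then have "K\<^sup>2 \<le> 2 * J0 / c'" using c' by (simp add: pos_le_divide_eq mult.commute)
        then show False using K(3) by simp
      qed
      show ?case
      proof (intro bexI[of _ "A\<^sub>1 \<inter> A\<^sub>2"] conjI ballI)
        show "A\<^sub>1 \<inter> A\<^sub>2 \<in> sets P" using A\<^sub>1 A\<^sub>2 by auto
        have "prob (A\<^sub>1 \<union> A\<^sub>2) = prob A\<^sub>1 + prob A\<^sub>2 - prob (A\<^sub>1 \<inter> A\<^sub>2)"
          using measure_Un3[of A\<^sub>1 P A\<^sub>2] A\<^sub>1(1) A\<^sub>2(1) by (simp add: fmeasurable_eq_sets)
        then show "prob (A\<^sub>1 \<inter> A\<^sub>2) \<ge> 1 - \<epsilon>"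
          using A\<^sub>1(2) A\<^sub>2(2) prob_le_1[of "A\<^sub>1 \<union> A\<^sub>2"] by linarith
        fix \<omega> assume "\<omega> \<in> A\<^sub>1 \<inter> A\<^sub>2"
        then have "(norm (fst (est n \<omega>)))\<^sup>2 \<le> K\<^sup>2 * \<delta>"
          using key[of \<omega>] V.nonneg[of "snd (est n \<omega>)"] by (simp add: sqn_def)
        then have "norm (fst (est n \<omega>)) \<le> sqrt (K\<^sup>2 * \<delta>)" by (rule real_le_rsqrt)
        also have "\<dots> = K * sqrt \<delta>" using K by (simp add: real_sqrt_mult)
        also have "\<dots> \<le> K * (real n powr (- 1 / 2) * l powr (- 1 / (2 * r)) + l powr (1 / 2))"
        proof (intro mult_left_mono)
          have "sqrt \<delta> \<le> sqrt (l powr (- 1 / r) / real n) + sqrt l"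
            unfolding \<delta>_def using l n by (intro sqrt_add_le_add_sqrt) auto
          also have "sqrt (l powr (- 1 / r) / real n) = real n powr (- 1 / 2) * l powr (- 1 / (2 * r))"
          proof -
            have "sqrt (l powr (- 1 / r)) = (l powr (- 1 / r)) powr (1 / 2)" by (simp add: powr_half_sqrt)
            also have "\<dots> = l powr (- 1 / (2 * r))" unfolding powr_powr by (simp add: mult.commute)
            finally have "sqrt (l powr (- 1 / r)) = l powr (- 1 / (2 * r))" .
            moreover have "real n powr (- 1 / 2) = 1 / sqrt (real n)"
              using powr_minus_divide[of "real n" "1 / 2"] n by (simp only: minus_divide_left powr_half_sqrt less_imp_le)
            ultimately show ?thesis unfolding real_sqrt_divide by (simp only: times_divide_eq_left mult_1_left)
          qed
          also have "sqrt l = l powr (1 / 2)" using l by (simp add: powr_half_sqrt)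
          finally show "sqrt \<delta> \<le> real n powr (- 1 / 2) * l powr (- 1 / (2 * r)) + l powr (1 / 2)" .
        qed (use K in simp)
        finally show "\<bar>norm (fst (est n \<omega>))\<bar> \<le> K * (real n powr (- 1 / 2) * lam n powr (- 1 / (2 * r)) + lam n powr (1 / 2))"
          by (simp add: l_def)
      qed
    qed
  qed
qed

text \<open>Take finite rational combinations of \<open>S\<close>, coded as lists. Their closure is
  stable under addition and, by approximating a real factor with rational ones, under scaling; so it
  is a closed subspace containing \<open>S\<close>.\<close>

lemma countable_dense_in_closure_span:
  fixes S :: "'a::real_normed_vector set"
  assumes "countable S"
  shows "\<exists>T. countable T \<and> closure (span S) \<subseteq> closure T"
proof -
  define f where "f l = (\<Sum>(q, s)\<leftarrow>l. of_rat q *\<^sub>R s)" for l :: "(rat \<times> 'a) list"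
  define T where "T = f ` lists (UNIV \<times> S)"
  have "countable T" unfolding T_def using assms by (intro countable_image countable_lists countable_SIGMA) auto
  moreover have "subspace (closure T)"
    unfolding subspace_def
  proof (intro conjI ballI allI)
    have "f [] \<in> T" unfolding T_def by (intro imageI) simp
    then show "0 \<in> closure T" using closure_subset by (force simp: f_def)
    fix x y assume "x \<in> closure T" "y \<in> closure T"
    then obtain a b where ab: "\<And>n. a n \<in> T" "a \<longlonglongrightarrow> x" "\<And>n. b n \<in> T" "b \<longlonglongrightarrow> y"
      by (auto simp: closure_sequential)
    have "a n + b n \<in> T" for n
    proof -
      obtain k l where "k \<in> lists (UNIV \<times> S)" "l \<in> lists (UNIV \<times> S)" "a n = f k" "b n = f l"
        using ab(1)[of n] ab(3)[of n] by (auto simp: T_def)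
      then show ?thesis unfolding T_def by (intro image_eqI[of _ _ "k @ l"]) (auto simp: f_def)
    qed
    then show "x + y \<in> closure T"
      unfolding closure_sequential
      by (intro exI[of _ "\<lambda>n. a n + b n"] conjI allI tendsto_add[OF ab(2,4)])
  next
    fix c :: real and x assume "x \<in> closure T"
    have "c *\<^sub>R z \<in> closure T" if z: "z \<in> T" for z
    proof -
      have "\<exists>p :: rat. c < of_rat p \<and> of_rat p < c + 1 / real (Suc n)" for n by (rule of_rat_dense) simp
      then obtain p :: "nat \<Rightarrow> rat" where p: "\<And>n. c < of_rat (p n)" "\<And>n. of_rat (p n) < c + 1 / real (Suc n)"
        by metis
      define q where "q n = (of_rat (p n) :: real)" for n
      have "(\<lambda>n. 1 / real (Suc n)) \<longlonglongrightarrow> 0" using LIMSEQ_inverse_real_of_nat by (simp add: inverse_eq_divide)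
      then have "(\<lambda>n. c + 1 / real (Suc n)) \<longlonglongrightarrow> c + 0" by (intro tendsto_add tendsto_const)
      then have q: "q \<longlonglongrightarrow> c"
        by (intro tendsto_sandwich[of "\<lambda>_. c" q _ "\<lambda>n. c + 1 / real (Suc n)"])
          (use p in \<open>auto simp: q_def less_imp_le\<close>)
      have "q n *\<^sub>R z \<in> T" for n
      proof -
        obtain l where l: "l \<in> lists (UNIV \<times> S)" "z = f l" using z by (auto simp: T_def)
        have "of_rat (p n) *\<^sub>R f l = f (map (\<lambda>(q, s). (p n * q, s)) l)"
          by (induction l) (auto simp: f_def scaleR_right_distrib of_rat_mult)
        moreover have "map (\<lambda>(q, s). (p n * q, s)) l \<in> lists (UNIV \<times> S)" using l(1) by auto
        ultimately show ?thesis unfolding q_def l(2) T_def by blast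
      qed
      moreover have "(\<lambda>n. q n *\<^sub>R z) \<longlonglongrightarrow> c *\<^sub>R z" using q by (intro tendsto_intros)
      ultimately show ?thesis
        unfolding closure_sequential by (intro exI[of _ "\<lambda>n. q n *\<^sub>R z"]) simp
    qed
    moreover obtain a where a: "\<And>n. a n \<in> T" "a \<longlonglongrightarrow> x"
      using \<open>x \<in> closure T\<close> by (auto simp: closure_sequential)
    moreover have "(\<lambda>n. c *\<^sub>R a n) \<longlonglongrightarrow> c *\<^sub>R x" using a(2) by (intro tendsto_intros)
    ultimately show "c *\<^sub>R x \<in> closure T"
      using closed_sequentially[OF closed_closure, of "\<lambda>n. c *\<^sub>R a n" T] by blast
  qed
  moreover have "S \<subseteq> closure T"
  proof
    fix s assume "s \<in> S"
    then have "f [(1, s)] \<in> T" unfolding T_def by (intro imageI) auto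
    then show "s \<in> closure T" using closure_subset by (force simp: f_def)
  qed
  ultimately have "span S \<subseteq> closure T" by (intro span_minimal)
  then have "closure (span S) \<subseteq> closure T" by (intro closure_minimal) auto
  then show ?thesis using \<open>countable T\<close> by blast
qed

section \<open>Reduction of the operators and derivatives to the abstract setting\<close>

context density_base
begin

lemma L20_bounded_linear_iff:
  "L20_bounded_linear M \<eta> \<tau>\<^sub>0 T \<longleftrightarrow> (\<forall>u. sqint Q (T u) \<and> (\<integral>x. T u x \<partial>Q) = 0) \<and>
     (\<forall>u v. AE x in Q. T (u + v) x = T u x + T v x) \<and> (\<forall>c u. AE x in Q. T (c *\<^sub>R u) x = c * T u x) \<and>
     (\<exists>K. \<forall>u. L2_norm M \<eta> \<tau>\<^sub>0 (T u) \<le> K * norm u)"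
  by (simp add: L20_bounded_linear_def L20_iff AE_Q)

text \<open>Representatives are linear only almost everywhere, a difference that integrals do not
  see.\<close>

lemma L20_form:
  assumes "L20_bounded_linear M \<eta> \<tau>\<^sub>0 T"
  shows "form (\<lambda>u v. \<integral>x. T u x * T v x \<partial>Q)"
proof
  have s: "sqint Q (T u)" for u using assms by (simp add: L20_bounded_linear_iff)
  note [measurable] = sqint_measurable[OF s]
  fix u v w c
  show "(\<integral>x. T u x * T v x \<partial>Q) = (\<integral>x. T v x * T u x \<partial>Q)" by (simp add: mult.commute)
  have "AE x in Q. T (u + v) x = T u x + T v x" using assms by (simp add: L20_bounded_linear_iff)
  then have "(\<integral>x. T (u + v) x * T w x \<partial>Q) = (\<integral>x. T u x * T w x + T v x * T w x \<partial>Q)"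
    by (intro integral_cong_AE) (auto simp: distrib_right)
  then show "(\<integral>x. T (u + v) x * T w x \<partial>Q) = (\<integral>x. T u x * T w x \<partial>Q) + (\<integral>x. T v x * T w x \<partial>Q)"
    using sqint_mult[OF s s] by simp
  have "AE x in Q. T (c *\<^sub>R u) x = c * T u x" using assms by (simp add: L20_bounded_linear_iff)
  then have "(\<integral>x. T (c *\<^sub>R u) x * T w x \<partial>Q) = (\<integral>x. c * (T u x * T w x) \<partial>Q)"
    by (intro integral_cong_AE) auto
  then show "(\<integral>x. T (c *\<^sub>R u) x * T w x \<partial>Q) = c * (\<integral>x. T u x * T w x \<partial>Q)" by simp
  show "(\<integral>x. T u x * T u x \<partial>Q) \<ge> 0" by simp
qed

lemma Var_cmult_AE:
  assumes "sqint Q \<phi>" "\<psi> \<in> borel_measurable M" "AE x in Q. \<psi> x = c * \<phi> x"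
  shows "Var M \<eta> \<tau>\<^sub>0 \<psi> = c\<^sup>2 * Var M \<eta> \<tau>\<^sub>0 \<phi>"
proof -
  note [measurable] = assms(2) sqint_measurable[OF assms(1), simplified]
  have "(\<integral>x. \<psi> x \<partial>Q) = (\<integral>x. c * \<phi> x \<partial>Q)" "(\<integral>x. (\<psi> x)\<^sup>2 \<partial>Q) = (\<integral>x. (c * \<phi> x)\<^sup>2 \<partial>Q)"
    using assms(3) by (intro integral_cong_AE; auto)+
  then show ?thesis
    by (simp add: Var_eq expect_0 power_mult_distrib right_diff_distrib)
qed

text \<open>The gap \<open>c\<^sub>\<delta>\<close> keeps the unit sphere under
  \<open>L\<^sub>\<theta>\<close> away from the range of \<open>L\<^sub>h\<close>, so by homogeneity
  the variance of the sum dominates \<open>(norm \<zeta>)\<^sup>2\<close>. The part from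
  \<open>L\<^sub>h\<close> is then recovered by subtracting the part from
  \<open>L\<^sub>\<theta>\<close>, whose size boundedness controls.\<close>

lemma Var_norm_equiv:
  fixes L\<^sub>\<theta> :: "'a::real_normed_vector \<Rightarrow> 'x \<Rightarrow> real" and L\<^sub>h :: "'h::real_normed_vector \<Rightarrow> 'x \<Rightarrow> real"
  assumes L\<theta>: "L20_bounded_linear M \<eta> \<tau>\<^sub>0 L\<^sub>\<theta>" and Lh: "L20_bounded_linear M \<eta> \<tau>\<^sub>0 L\<^sub>h"
    and c: "c\<^sub>\<delta> > 0" "\<And>\<zeta> g. norm \<zeta> = 1 \<Longrightarrow> Var M \<eta> \<tau>\<^sub>0 (\<lambda>x. L\<^sub>\<theta> \<zeta> x - L\<^sub>h g x) > c\<^sub>\<delta>"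
  shows "\<exists>a>0. \<exists>b>0. \<forall>\<zeta> g.
      a * ((norm \<zeta>)\<^sup>2 + (\<integral>x. L\<^sub>h g x * L\<^sub>h g x \<partial>Q)) \<le> Var M \<eta> \<tau>\<^sub>0 (\<lambda>x. L\<^sub>\<theta> \<zeta> x + L\<^sub>h g x) \<and>
      Var M \<eta> \<tau>\<^sub>0 (\<lambda>x. L\<^sub>\<theta> \<zeta> x + L\<^sub>h g x) \<le> b * ((norm \<zeta>)\<^sup>2 + (\<integral>x. L\<^sub>h g x * L\<^sub>h g x \<partial>Q))"
proof -
  have s: "sqint Q (L\<^sub>\<theta> \<zeta>)" "sqint Q (L\<^sub>h g)" "(\<integral>x. L\<^sub>\<theta> \<zeta> x \<partial>Q) = 0" "(\<integral>x. L\<^sub>h g x \<partial>Q) = 0" for \<zeta> g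
    using L\<theta> Lh by (auto simp: L20_bounded_linear_iff)
  have [measurable]: "L\<^sub>\<theta> \<zeta> \<in> borel_measurable M" "L\<^sub>h g \<in> borel_measurable M" for \<zeta> g
    using sqint_measurable[OF s(1)] sqint_measurable[OF s(2)] by simp_all
  obtain K' where K': "\<And>\<zeta>. L2_norm M \<eta> \<tau>\<^sub>0 (L\<^sub>\<theta> \<zeta>) \<le> K' * norm \<zeta>"
    using L\<theta> by (auto simp: L20_bounded_linear_iff)
  define A where "A \<zeta> = (\<integral>x. (L\<^sub>\<theta> \<zeta> x)\<^sup>2 \<partial>Q)" for \<zeta>
  define V where "V g = (\<integral>x. (L\<^sub>h g x)\<^sup>2 \<partial>Q)" for g
  define W where "W \<zeta> g = Var M \<eta> \<tau>\<^sub>0 (\<lambda>x. L\<^sub>\<theta> \<zeta> x + L\<^sub>h g x)" for \<zeta> g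
  have V0: "V g \<ge> 0" for g by (simp add: V_def)
  have W_eq: "W \<zeta> g = (\<integral>x. (L\<^sub>\<theta> \<zeta> x + L\<^sub>h g x)\<^sup>2 \<partial>Q)" for \<zeta> g
    unfolding W_def
    by (rule Var_0[OF sqint_add[OF s(1,2)]]) (simp add: Q.sqint_integrable s)
  have W0: "W \<zeta> g \<ge> 0" for \<zeta> g by (simp add: W_eq)
  have A_le: "A \<zeta> \<le> K'\<^sup>2 * (norm \<zeta>)\<^sup>2" for \<zeta>
  proof -
    have "sqrt (A \<zeta>) \<le> K' * norm \<zeta>" using K'[of \<zeta>] L2_norm_eq[OF s(1)] by (simp add: A_def)
    then have "(sqrt (A \<zeta>))\<^sup>2 \<le> (K' * norm \<zeta>)\<^sup>2" by (intro power_mono) (auto simp: A_def)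
    then show ?thesis by (simp add: A_def power_mult_distrib)
  qed
  note i1 = sqint_integrable_square[OF s(1)] and i2 = sqint_integrable_square[OF s(2)]
    and i3 = sqint_integrable_square[OF sqint_add[OF s(1,2)]]
  have up: "W \<zeta> g \<le> 2 * A \<zeta> + 2 * V g" for \<zeta> g
  proof -
    have "W \<zeta> g \<le> (\<integral>x. 2 * (L\<^sub>\<theta> \<zeta> x)\<^sup>2 + 2 * (L\<^sub>h g x)\<^sup>2 \<partial>Q)"
      unfolding W_eq
    proof (rule integral_mono[OF i3])
      show "integrable Q (\<lambda>x. 2 * (L\<^sub>\<theta> \<zeta> x)\<^sup>2 + 2 * (L\<^sub>h g x)\<^sup>2)" using i1 i2 by auto
      show "(L\<^sub>\<theta> \<zeta> x + L\<^sub>h g x)\<^sup>2 \<le> 2 * (L\<^sub>\<theta> \<zeta> x)\<^sup>2 + 2 * (L\<^sub>h g x)\<^sup>2" for x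
        using sum_squares_bound[of "L\<^sub>\<theta> \<zeta> x" "L\<^sub>h g x"] by (simp add: power2_sum)
    qed
    then show ?thesis using i1 i2 by (simp add: A_def V_def)
  qed
  have lo: "V g \<le> 2 * W \<zeta> g + 2 * A \<zeta>" for \<zeta> g
  proof -
    have "V g \<le> (\<integral>x. 2 * (L\<^sub>\<theta> \<zeta> x + L\<^sub>h g x)\<^sup>2 + 2 * (L\<^sub>\<theta> \<zeta> x)\<^sup>2 \<partial>Q)"
      unfolding V_def
    proof (rule integral_mono[OF i2])
      show "integrable Q (\<lambda>x. 2 * (L\<^sub>\<theta> \<zeta> x + L\<^sub>h g x)\<^sup>2 + 2 * (L\<^sub>\<theta> \<zeta> x)\<^sup>2)" using i1 i3 by auto
      fix x
      have "0 \<le> (2 * L\<^sub>\<theta> \<zeta> x + L\<^sub>h g x)\<^sup>2" by simp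
      then show "(L\<^sub>h g x)\<^sup>2 \<le> 2 * (L\<^sub>\<theta> \<zeta> x + L\<^sub>h g x)\<^sup>2 + 2 * (L\<^sub>\<theta> \<zeta> x)\<^sup>2"
        by (simp add: power2_eq_square algebra_simps)
    qed
    then show ?thesis using i1 i3 by (simp add: A_def W_eq)
  qed
  have \<zeta>W: "c\<^sub>\<delta> * (norm \<zeta>)\<^sup>2 \<le> W \<zeta> g" for \<zeta> g
  proof (cases "\<zeta> = 0")
    case True then show ?thesis using W0 by simp
  next
    case False
    define z where "z = (1 / norm \<zeta>) *\<^sub>R \<zeta>"
    \<comment> \<open>The minus sign matches the difference in the hypothesis on
      \<open>c\<^sub>\<delta>\<close>.\<close>
    define k where "k = (- 1 / norm \<zeta>) *\<^sub>R g"
    have nz: "norm z = 1" using False by (simp add: z_def)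
    have "AE x in Q. L\<^sub>\<theta> z x = (1 / norm \<zeta>) * L\<^sub>\<theta> \<zeta> x" "AE x in Q. L\<^sub>h k x = (- 1 / norm \<zeta>) * L\<^sub>h g x"
      unfolding z_def k_def using L\<theta> Lh unfolding L20_bounded_linear_iff by blast+
    then have "AE x in Q. L\<^sub>\<theta> \<zeta> x + L\<^sub>h g x = norm \<zeta> * (L\<^sub>\<theta> z x - L\<^sub>h k x)"
      by eventually_elim (use False in \<open>simp add: field_simps\<close>)
    then have "W \<zeta> g = (norm \<zeta>)\<^sup>2 * Var M \<eta> \<tau>\<^sub>0 (\<lambda>x. L\<^sub>\<theta> z x - L\<^sub>h k x)"
      unfolding W_def by (intro Var_cmult_AE sqint_diff s) auto
    also have "\<dots> \<ge> (norm \<zeta>)\<^sup>2 * c\<^sub>\<delta>" using c(2)[OF nz, of k] by (intro mult_left_mono) auto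
    finally show ?thesis by (simp add: mult.commute)
  qed
  \<comment> \<open>\<open>1 / c\<^sub>\<delta>\<close> pays for \<zeta>, and
    \<open>2 + 2 * K'\<^sup>2 / c\<^sub>\<delta>\<close> for the part from
    \<open>L\<^sub>h\<close>.\<close>
  define q where "q = 1 / c\<^sub>\<delta> + 2 + 2 * K'\<^sup>2 / c\<^sub>\<delta>"
  have q: "q > 0" using c by (simp add: q_def add_pos_nonneg add_nonneg_pos)
  have low: "(norm \<zeta>)\<^sup>2 + V g \<le> q * W \<zeta> g" for \<zeta> g
  proof -
    have z: "(norm \<zeta>)\<^sup>2 \<le> W \<zeta> g / c\<^sub>\<delta>" using \<zeta>W[of \<zeta> g] c by (simp add: pos_le_divide_eq mult.commute)
    have "V g \<le> 2 * W \<zeta> g + 2 * (K'\<^sup>2 * (W \<zeta> g / c\<^sub>\<delta>))"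
      using lo[of g \<zeta>] A_le[of \<zeta>] mult_left_mono[OF z, of "K'\<^sup>2"] by simp
    then have "(norm \<zeta>)\<^sup>2 + V g \<le> W \<zeta> g / c\<^sub>\<delta> + (2 * W \<zeta> g + 2 * (K'\<^sup>2 * (W \<zeta> g / c\<^sub>\<delta>)))"
      using z by linarith
    also have "\<dots> = q * W \<zeta> g" using c by (simp add: q_def field_simps)
    finally show ?thesis .
  qed
  have high: "W \<zeta> g \<le> (2 * K'\<^sup>2 + 2) * ((norm \<zeta>)\<^sup>2 + V g)" for \<zeta> g
  proof -
    have "W \<zeta> g \<le> 2 * (K'\<^sup>2 * (norm \<zeta>)\<^sup>2) + 2 * V g" using up[of \<zeta> g] A_le[of \<zeta>] by linarith
    also have "\<dots> \<le> (2 * K'\<^sup>2 + 2) * ((norm \<zeta>)\<^sup>2 + V g)"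
      using V0[of g] mult_nonneg_nonneg[of "K'\<^sup>2" "V g"] by (simp add: algebra_simps)
    finally show ?thesis .
  qed
  have qK: "0 < 1 / q" "0 < 2 * K'\<^sup>2 + 2" using q by (auto simp: add_nonneg_pos)
  have "1 / q * ((norm \<zeta>)\<^sup>2 + (\<integral>x. L\<^sub>h g x * L\<^sub>h g x \<partial>Q)) \<le> Var M \<eta> \<tau>\<^sub>0 (\<lambda>x. L\<^sub>\<theta> \<zeta> x + L\<^sub>h g x) \<and>
    Var M \<eta> \<tau>\<^sub>0 (\<lambda>x. L\<^sub>\<theta> \<zeta> x + L\<^sub>h g x) \<le> (2 * K'\<^sup>2 + 2) * ((norm \<zeta>)\<^sup>2 + (\<integral>x. L\<^sub>h g x * L\<^sub>h g x \<partial>Q))" for \<zeta> g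
  proof
    have "1 / q * ((norm \<zeta>)\<^sup>2 + V g) \<le> W \<zeta> g" using low[of \<zeta> g] q by (simp add: divide_le_eq mult.commute)
    then show "1 / q * ((norm \<zeta>)\<^sup>2 + (\<integral>x. L\<^sub>h g x * L\<^sub>h g x \<partial>Q)) \<le> Var M \<eta> \<tau>\<^sub>0 (\<lambda>x. L\<^sub>\<theta> \<zeta> x + L\<^sub>h g x)"
      by (simp add: V_def W_def power2_eq_square)
    show "Var M \<eta> \<tau>\<^sub>0 (\<lambda>x. L\<^sub>\<theta> \<zeta> x + L\<^sub>h g x) \<le> (2 * K'\<^sup>2 + 2) * ((norm \<zeta>)\<^sup>2 + (\<integral>x. L\<^sub>h g x * L\<^sub>h g x \<partial>Q))"
      using high[of \<zeta> g] by (simp add: V_def W_def power2_eq_square)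
  qed
  then show ?thesis using qK by blast
qed

end

text \<open>The partial derivatives are defined by \<open>frechet_derivative\<close>, which says
  nothing without differentiability. Joint differentiability identifies them with the restrictions
  of the total derivative to the two factors.\<close>

lemma D_tot_has_derivative:
  assumes "(\<lambda>\<sigma>. \<eta> \<sigma> x) differentiable (at \<tau>)"
  shows "((\<lambda>\<sigma>. \<eta> \<sigma> x) has_derivative (\<lambda>v. D_tot \<eta> \<tau> v x)) (at \<tau>)"
proof -
  obtain F where F: "((\<lambda>\<sigma>. \<eta> \<sigma> x) has_derivative F) (at \<tau>)" using assms unfolding differentiable_def by blast
  interpret F: bounded_linear F using F by (rule has_derivative_bounded_linear)
  obtain \<theta> h where \<tau>: "\<tau> = (\<theta>, h)" by (cases \<tau>)
  have "((\<lambda>\<theta>. \<eta> (\<theta>, h) x) has_derivative (\<lambda>\<zeta>. F (\<zeta>, 0))) (at \<theta>)"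
    by (rule has_derivative_compose[of "\<lambda>\<theta>. (\<theta>, h)", where g = "\<lambda>\<sigma>. \<eta> \<sigma> x"])
      (use F \<tau> in \<open>auto intro!: derivative_eq_intros\<close>)
  then have 1: "frechet_derivative (\<lambda>\<theta>. \<eta> (\<theta>, h) x) (at \<theta>) = (\<lambda>\<zeta>. F (\<zeta>, 0))"
    by (rule frechet_derivative_at[symmetric])
  have "((\<lambda>h. \<eta> (\<theta>, h) x) has_derivative (\<lambda>g. F (0, g))) (at h)"
    by (rule has_derivative_compose[of "\<lambda>h. (\<theta>, h)", where g = "\<lambda>\<sigma>. \<eta> \<sigma> x"])
      (use F \<tau> in \<open>auto intro!: derivative_eq_intros\<close>)
  then have 2: "frechet_derivative (\<lambda>h. \<eta> (\<theta>, h) x) (at h) = (\<lambda>g. F (0, g))"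
    by (rule frechet_derivative_at[symmetric])
  have "D_tot \<eta> \<tau> v x = F v" for v
    using F.add[of "(fst v, 0)" "(0, snd v)"]
    by (simp add: D_tot_def D_theta_def D_h_def D_fst_def D_snd_def \<tau> 1 2)
  then show ?thesis using F by simp
qed

theorem corollary1:
  fixes M :: "'x measure"
    and \<eta> :: "(real ^ 'p) \<times> ('h::{real_inner, complete_space}) \<Rightarrow> 'x \<Rightarrow> real"
    and \<theta>\<^sub>0 :: "real ^ 'p" and h\<^sub>0 :: 'h
    and J :: "'h \<Rightarrow> 'h \<Rightarrow> real"
    and L\<^sub>\<theta> :: "real ^ 'p \<Rightarrow> 'x \<Rightarrow> real" and L\<^sub>h :: "'h \<Rightarrow> 'x \<Rightarrow> real"
    and N\<^sub>\<theta> :: "(real ^ 'p) set" and N\<^sub>h :: "'h set"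
    and P :: "'w measure" and X :: "nat \<Rightarrow> 'w \<Rightarrow> 'x"
    and lam :: "nat \<Rightarrow> real"
    and \<theta>hat :: "nat \<Rightarrow> 'w \<Rightarrow> real ^ 'p" and hhat :: "nat \<Rightarrow> 'w \<Rightarrow> 'h"
    and c\<^sub>\<delta> C\<^sub>1 C\<^sub>2 C\<^sub>3 C\<^sub>4 C\<^sub>d r \<beta>\<^sub>1 \<beta>\<^sub>2 :: real
    and \<phi> :: "nat \<Rightarrow> 'h" and \<rho> \<kappa> :: "nat \<Rightarrow> real"
  assumes
    \<comment> \<open>model\<close>
    dens_fin: "\<And>\<tau>. integrable M (\<lambda>x. exp (\<eta> \<tau> x))"
    and eta_L20: "\<And>\<tau>. \<eta> \<tau> \<in> L20_space M \<eta> (\<theta>\<^sub>0, h\<^sub>0)"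
    \<comment> \<open>iid sample from the true density\<close>
    and prob: "prob_space P"
    and indep: "prob_space.indep_vars P (\<lambda>_. M) X UNIV"
    and ident: "\<And>i. distributed P M (X i) (\<lambda>x. ennreal (dens M \<eta> (\<theta>\<^sub>0, h\<^sub>0) x))"
    \<comment> \<open>neighbourhoods of the true parameter\<close>
    and nbhd_\<theta>: "open N\<^sub>\<theta>" "\<theta>\<^sub>0 \<in> N\<^sub>\<theta>"
    and nbhd_h: "open N\<^sub>h" "h\<^sub>0 \<in> N\<^sub>h"
    \<comment> \<open>the derivatives of the likelihood at the observations make sense\<close>
    and eta_diff: "AE x in M. \<forall>\<tau>\<in>N\<^sub>\<theta> \<times> N\<^sub>h. (\<lambda>\<sigma>. \<eta> \<sigma> x) differentiable (at \<tau>)"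
    \<comment> \<open>convexity\<close>
    and crit_convex: "AE \<omega> in P. \<forall>n\<ge>1. convex_on UNIV (crit M \<eta> n (\<lambda>i. X i \<omega>))"
    \<comment> \<open>smoothing parameters\<close>
    and lam_pos: "\<And>n. lam n > 0"
    \<comment> \<open>estimator and minimizer of the quadratic criterion\<close>
    and estimator: "whp P (\<lambda>n \<omega>. unique_local_min (pen_crit M \<eta> J (lam n) n (\<lambda>i. X i \<omega>))
                      (N\<^sub>\<theta> \<times> N\<^sub>h) (\<theta>hat n \<omega>, hhat n \<omega>))"
    and quad_minimizer: "whp P (\<lambda>n \<omega>. \<exists>\<tau>\<in>N\<^sub>\<theta> \<times> N\<^sub>h.
           is_arg_min (quad_crit M \<eta> (\<theta>\<^sub>0, h\<^sub>0) J (lam n) n (\<lambda>i. X i \<omega>)) (\<lambda>_. True) \<tau>)"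
    \<comment> \<open>Assumption 1\<close>
    and A1_bilinear: "bilinear J"
    and A1_sym: "\<And>g g'. J g g' = J g' g"
    and A1_nonneg: "\<And>g. J g g \<ge> 0"
    and A1_null: "\<exists>B. finite B \<and> {g. J g g = 0} = span B"
    \<comment> \<open>Assumption 2\<close>
    and A2_L\<theta>: "L20_bounded_linear M \<eta> (\<theta>\<^sub>0, h\<^sub>0) L\<^sub>\<theta>"
    and A2_Lh: "L20_bounded_linear M \<eta> (\<theta>\<^sub>0, h\<^sub>0) L\<^sub>h"
    and A2_null_\<theta>: "\<And>\<zeta>. (AE x in M. L\<^sub>\<theta> \<zeta> x = 0) \<Longrightarrow> \<zeta> = 0"
    and A2_null_h: "\<And>g. (AE x in M. L\<^sub>h g x = 0) \<Longrightarrow> g = 0"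
    and A2_i: "\<And>l. l > 0 \<Longrightarrow> \<exists>M\<^sub>1>0. \<exists>M\<^sub>2>0. \<forall>g.
           M\<^sub>1 * (norm g)\<^sup>2 \<le> Var M \<eta> (\<theta>\<^sub>0, h\<^sub>0) (L\<^sub>h g) + l * J g g \<and>
           Var M \<eta> (\<theta>\<^sub>0, h\<^sub>0) (L\<^sub>h g) + l * J g g \<le> M\<^sub>2 * (norm g)\<^sup>2"
    and A2_ii: "c\<^sub>\<delta> > 0"
      "\<And>\<zeta> g. norm \<zeta> = 1 \<Longrightarrow> Var M \<eta> (\<theta>\<^sub>0, h\<^sub>0) (\<lambda>x. L\<^sub>\<theta> \<zeta> x - L\<^sub>h g x) > c\<^sub>\<delta>"
    \<comment> \<open>Assumption 3\<close>
    and A3_inj: "\<And>\<tau> \<sigma>. \<tau> \<in> N\<^sub>\<theta> \<times> N\<^sub>h \<Longrightarrow> \<sigma> \<in> N\<^sub>\<theta> \<times> N\<^sub>h \<Longrightarrow> (AE x in M. \<eta> \<tau> x = \<eta> \<sigma> x) \<Longrightarrow> \<tau> = \<sigma>"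
    and A3_C3: "L20_C3_on M \<eta> (\<theta>\<^sub>0, h\<^sub>0) (N\<^sub>\<theta> \<times> N\<^sub>h)"
    and A3_root: "\<And>n \<tau>. n \<ge> 1 \<Longrightarrow> \<tau> \<in> N\<^sub>\<theta> \<times> N\<^sub>h \<Longrightarrow>
           ((\<forall>\<zeta>. (\<integral>\<omega>. D_fst (crit M \<eta> n (\<lambda>i. X i \<omega>)) \<tau> \<zeta> \<partial>P) = 0) \<and>
            (\<forall>g. (\<integral>\<omega>. D_snd (crit M \<eta> n (\<lambda>i. X i \<omega>)) \<tau> g \<partial>P) = 0))
           \<longleftrightarrow> \<tau> = (\<theta>\<^sub>0, h\<^sub>0)"
    \<comment> \<open>Assumption 4\<close>
    and A4_D\<theta>: "\<And>\<tau>. \<tau> \<in> N\<^sub>\<theta> \<times> N\<^sub>h \<Longrightarrow> L20_bounded_linear M \<eta> (\<theta>\<^sub>0, h\<^sub>0) (D_theta \<eta> \<tau>)"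
    and A4_Dh: "\<And>\<tau>. \<tau> \<in> N\<^sub>\<theta> \<times> N\<^sub>h \<Longrightarrow> L20_bounded_linear M \<eta> (\<theta>\<^sub>0, h\<^sub>0) (D_h \<eta> \<tau>)"
    and A4_const: "C\<^sub>1 > 0" "C\<^sub>2 > 0"
    and A4: "\<And>\<tau> \<zeta> g. \<tau> \<in> N\<^sub>\<theta> \<times> N\<^sub>h \<Longrightarrow>
           C\<^sub>1 * Var M \<eta> (\<theta>\<^sub>0, h\<^sub>0) (\<lambda>x. L\<^sub>\<theta> \<zeta> x + L\<^sub>h g x)
             \<le> Var M \<eta> (\<theta>\<^sub>0, h\<^sub>0) (\<lambda>x. D_theta \<eta> \<tau> \<zeta> x + D_h \<eta> \<tau> g x) \<and>
           Var M \<eta> (\<theta>\<^sub>0, h\<^sub>0) (\<lambda>x. D_theta \<eta> \<tau> \<zeta> x + D_h \<eta> \<tau> g x)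
             \<le> C\<^sub>2 * Var M \<eta> (\<theta>\<^sub>0, h\<^sub>0) (\<lambda>x. L\<^sub>\<theta> \<zeta> x + L\<^sub>h g x)"
    \<comment> \<open>Assumption 5\<close>
    and A5_const: "0 < C\<^sub>d" "C\<^sub>d < 2 * C\<^sub>1"
    and A5: "\<And>\<tau>\<^sub>1 \<tau>\<^sub>2 \<zeta> g. \<tau>\<^sub>1 \<in> N\<^sub>\<theta> \<times> N\<^sub>h \<Longrightarrow> \<tau>\<^sub>2 \<in> N\<^sub>\<theta> \<times> N\<^sub>h \<Longrightarrow> (\<zeta>, g) \<in> N\<^sub>\<theta> \<times> N\<^sub>h \<Longrightarrow>
           Var M \<eta> (\<theta>\<^sub>0, h\<^sub>0) (\<lambda>x. (D_theta \<eta> \<tau>\<^sub>1 \<zeta> x - D_theta \<eta> \<tau>\<^sub>2 \<zeta> x)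
                                   + (D_h \<eta> \<tau>\<^sub>1 g x - D_h \<eta> \<tau>\<^sub>2 g x))
             \<le> C\<^sub>d * Var M \<eta> (\<theta>\<^sub>0, h\<^sub>0) (\<lambda>x. L\<^sub>\<theta> \<zeta> x + L\<^sub>h g x)"
    \<comment> \<open>Assumption 6\<close>
    and A6_convex: "convex (N\<^sub>\<theta> \<times> N\<^sub>h)"
    and A6_const: "C\<^sub>3 > 0" "C\<^sub>4 > 0"
    and A6: "\<And>\<tau> f. \<tau> \<in> N\<^sub>\<theta> \<times> N\<^sub>h \<Longrightarrow> f \<in> L20_space M \<eta> (\<theta>\<^sub>0, h\<^sub>0) \<Longrightarrow>
           C\<^sub>3 * Var M \<eta> (\<theta>\<^sub>0, h\<^sub>0) f \<le> Var M \<eta> \<tau> f \<and>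
           Var M \<eta> \<tau> f \<le> C\<^sub>4 * Var M \<eta> (\<theta>\<^sub>0, h\<^sub>0) f"
    \<comment> \<open>Assumption 7\<close>
    and A7_cc: "\<And>\<epsilon>. \<epsilon> > 0 \<Longrightarrow> \<exists>S. finite S \<and> (\<forall>l\<in>S. bounded_linear (l :: 'h \<Rightarrow> real)) \<and>
           (\<forall>g. (\<forall>l\<in>S. l g = 0) \<longrightarrow> Var M \<eta> (\<theta>\<^sub>0, h\<^sub>0) (L\<^sub>h g) \<le> \<epsilon> * J g g)"
    and A7_V: "\<And>\<nu> \<mu>. \<nu> \<ge> 1 \<Longrightarrow> \<mu> \<ge> 1 \<Longrightarrow>
           Cov M \<eta> (\<theta>\<^sub>0, h\<^sub>0) (L\<^sub>h (\<phi> \<nu>)) (L\<^sub>h (\<phi> \<mu>)) = (if \<nu> = \<mu> then 1 else 0)"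
    and A7_J: "\<And>\<nu> \<mu>. \<nu> \<ge> 1 \<Longrightarrow> \<mu> \<ge> 1 \<Longrightarrow> J (\<phi> \<nu>) (\<phi> \<mu>) = (if \<nu> = \<mu> then \<rho> \<nu> else 0)"
    and A7_complete: "closure (span (\<phi> ` {1..})) = UNIV"
    and A7_rho: "\<And>\<nu>. \<nu> \<ge> 1 \<Longrightarrow> 0 \<le> \<rho> \<nu>" "filterlim \<rho> at_top sequentially"
    \<comment> \<open>Assumption 8\<close>
    and A8_r: "r > 1"
    and A8_beta: "0 < \<beta>\<^sub>1"
    and A8: "\<And>\<nu>. \<nu> \<ge> 1 \<Longrightarrow> \<rho> \<nu> = \<kappa> \<nu> * real \<nu> powr r \<and> \<beta>\<^sub>1 < \<kappa> \<nu> \<and> \<kappa> \<nu> < \<beta>\<^sub>2"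
    \<comment> \<open>asymptotic regime\<close>
    and lam_0: "lam \<longlonglongrightarrow> 0"
    and n_lam: "filterlim (\<lambda>n. real n * lam n powr (1 / r)) at_top sequentially"
  shows "(\<exists>c\<^sub>1>0. \<exists>c\<^sub>2>0. \<forall>n \<omega>.
            c\<^sub>1 * norm (\<theta>hat n \<omega> - \<theta>\<^sub>0) \<le> norm_Rp M \<eta> (\<theta>\<^sub>0, h\<^sub>0) L\<^sub>\<theta> (\<theta>hat n \<omega> - \<theta>\<^sub>0) \<and>
            norm_Rp M \<eta> (\<theta>\<^sub>0, h\<^sub>0) L\<^sub>\<theta> (\<theta>hat n \<omega> - \<theta>\<^sub>0) \<le> c\<^sub>2 * norm (\<theta>hat n \<omega> - \<theta>\<^sub>0))
       \<and> big_Op P (\<lambda>n \<omega>. norm_Rp M \<eta> (\<theta>\<^sub>0, h\<^sub>0) L\<^sub>\<theta> (\<theta>hat n \<omega> - \<theta>\<^sub>0))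
           (\<lambda>n. real n powr (- 1 / 2) * lam n powr (- 1 / (2 * r)) + lam n powr (1 / 2))
       \<and> big_Op P (\<lambda>n \<omega>. norm (\<theta>hat n \<omega> - \<theta>\<^sub>0))
           (\<lambda>n. real n powr (- 1 / 2) * lam n powr (- 1 / (2 * r)) + lam n powr (1 / 2))"
proof -

  \<comment> \<open>The true law, the quadratic forms and their diagonalization\<close>
  define \<tau>\<^sub>0 where "\<tau>\<^sub>0 = (\<theta>\<^sub>0, h\<^sub>0)"
  define N where "N = N\<^sub>\<theta> \<times> N\<^sub>h"
  note defs = \<tau>\<^sub>0_def N_def
  interpret P: prob_space P by (rule prob)
  have dQ: "distr P M (X i) = density M (\<lambda>x. ennreal (dens M \<eta> \<tau>\<^sub>0 x))" for i
    unfolding \<tau>\<^sub>0_def by (rule distributed_distr_eq_density[OF ident])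
  have X_meas: "X i \<in> P \<rightarrow>\<^sub>M M" for i by (rule distributed_measurable[OF ident])
  interpret base: density_base M \<eta> \<tau>\<^sub>0
  proof (rule density_base.intro)
    show "integrable M (\<lambda>x. exp (\<eta> \<tau> x))" for \<tau> by (rule dens_fin)
    show "\<eta> \<tau> \<in> L20_space M \<eta> \<tau>\<^sub>0" for \<tau> unfolding \<tau>\<^sub>0_def by (rule eta_L20)
    show "prob_space (density M (\<lambda>x. ennreal (dens M \<eta> \<tau>\<^sub>0 x)))"
      unfolding dQ[of 0, symmetric] by (rule P.prob_space_distr[OF X_meas])
  qed
  note L\<theta> = A2_L\<theta>[folded defs] and Lh = A2_Lh[folded defs]
  have Lhs: "sqint base.Q (L\<^sub>h g)" "(\<integral>x. L\<^sub>h g x \<partial>base.Q) = 0" for g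
    using Lh by (auto simp: base.L20_bounded_linear_iff)
  have L\<theta>s: "sqint base.Q (L\<^sub>\<theta> \<zeta>)" for \<zeta> using L\<theta> by (auto simp: base.L20_bounded_linear_iff)
  have [measurable]: "L\<^sub>h g \<in> borel_measurable M" "L\<^sub>\<theta> \<zeta> \<in> borel_measurable M" for g \<zeta>
    using sqint_measurable[OF Lhs(1)] sqint_measurable[OF L\<theta>s] by simp_all
  define V where "V = (\<lambda>g g'. \<integral>x. L\<^sub>h g x * L\<^sub>h g' x \<partial>base.Q)"
  have Cov_V: "Cov M \<eta> \<tau>\<^sub>0 (L\<^sub>h g) (L\<^sub>h g') = V g g'" for g g'
    unfolding Cov_def V_def by (simp add: base.mean_eq base.expect_0 Lhs)
  have Var_V: "Var M \<eta> \<tau>\<^sub>0 (L\<^sub>h g) = V g g" for g by (simp add: Var_def Cov_V)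
  have formV: "form V" unfolding V_def by (rule base.L20_form[OF Lh])
  have formJ: "form J"
    by (rule form.intro)
      (use bilinear_ladd[OF A1_bilinear] bilinear_lmul[OF A1_bilinear] A1_sym A1_nonneg in simp_all)
  \<comment> \<open>Taken at smoothing parameter 1, so that the constants are free of
    \<open>n\<close>.\<close>
  obtain M\<^sub>1 M\<^sub>2 where M12: "M\<^sub>1 > 0" "M\<^sub>2 > 0"
    "\<And>g. M\<^sub>1 * (norm g)\<^sup>2 \<le> V g g + J g g" "\<And>g. V g g + J g g \<le> M\<^sub>2 * (norm g)\<^sup>2"
    using A2_i[of 1, folded defs] by (auto simp: Var_V)
  interpret diag: diagonalized V J \<phi> \<rho> M\<^sub>1 M\<^sub>2
    by (intro diagonalized.intro formV formJ diagonalized_axioms.intro)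
      (use M12 A7_V[folded defs] A7_J A7_complete A7_rho(1) in \<open>auto simp: Cov_V\<close>)
  obtain a b where ab: "a > 0" "b > 0"
    "\<And>\<zeta> g. a * ((norm \<zeta>)\<^sup>2 + V g g) \<le> Var M \<eta> \<tau>\<^sub>0 (\<lambda>x. L\<^sub>\<theta> \<zeta> x + L\<^sub>h g x)"
    "\<And>\<zeta> g. Var M \<eta> \<tau>\<^sub>0 (\<lambda>x. L\<^sub>\<theta> \<zeta> x + L\<^sub>h g x) \<le> b * ((norm \<zeta>)\<^sup>2 + V g g)"
    using base.Var_norm_equiv[OF L\<theta> Lh A2_ii(1) A2_ii(2)[folded defs]] unfolding V_def by blast

  \<comment> \<open>The population model\<close>
  have convex_at: "AE \<omega> in P. convex_on UNIV (crit M \<eta> 1 (\<lambda>i. X i \<omega>))"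
    using crit_convex by eventually_elim simp
  have crit_eq: "crit M \<eta> n xs \<tau> = - (\<Sum>k<n. \<eta> \<tau> (xs k)) / real n + base.logZ \<tau>" for n xs \<tau>
    by (simp add: crit_def base.logZ_def)
  interpret dm: density_model M \<eta> \<tau>\<^sub>0 N "D_tot \<eta>" "sqn V" "C\<^sub>1 * a" "C\<^sub>2 * b" C\<^sub>3 C\<^sub>4 "1 + M\<^sub>2"
  proof
    show "open N" "\<tau>\<^sub>0 \<in> N" using nbhd_\<theta> nbhd_h by (auto simp: N_def \<tau>\<^sub>0_def open_Times)
    show "convex N" using A6_convex by (simp add: N_def)
    show "AE x in M. (1 - t) * ln (dens M \<eta> \<tau> x) + t * ln (dens M \<eta> \<sigma> x)
        \<le> ln (dens M \<eta> ((1 - t) *\<^sub>R \<tau> + t *\<^sub>R \<sigma>) x)" if "0 \<le> t" "t \<le> 1" for t \<tau> \<sigma>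
    proof -
      define R where "R x \<longleftrightarrow> (1 - t) * (\<eta> \<tau> x - base.logZ \<tau>) + t * (\<eta> \<sigma> x - base.logZ \<sigma>)
        \<le> \<eta> ((1 - t) *\<^sub>R \<tau> + t *\<^sub>R \<sigma>) x - base.logZ ((1 - t) *\<^sub>R \<tau> + t *\<^sub>R \<sigma>)" for x
      \<comment> \<open>For one observation, convexity of the criterion is log-concavity of the
        density at that observation; as \<open>X 0\<close> has the true law, this transfers to
        almost every \<open>x\<close>.\<close>
      have "AE \<omega> in P. R (X 0 \<omega>)"
        using convex_at
      proof eventually_elim
        case (elim \<omega>)
        have "crit M \<eta> 1 (\<lambda>i. X i \<omega>) ((1 - t) *\<^sub>R \<tau> + t *\<^sub>R \<sigma>)
          \<le> (1 - t) * crit M \<eta> 1 (\<lambda>i. X i \<omega>) \<tau> + t * crit M \<eta> 1 (\<lambda>i. X i \<omega>) \<sigma>"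
          using convex_onD[OF elim, of t \<tau> \<sigma>] that by simp
        then show ?case by (simp add: R_def crit_eq algebra_simps)
      qed
      moreover have "{x\<in>space M. R x} \<in> sets M" unfolding R_def by measurable
      ultimately have "AE x in distr P M (X 0). R x" by (subst AE_distr_iff[OF X_meas])
      then have "AE x in base.Q. R x" unfolding dQ base.Q_def .
      then show ?thesis by (simp add: base.AE_Q R_def base.ln_dens)
    qed
    show "AE x in M. \<forall>\<tau>\<in>N. ((\<lambda>\<sigma>. \<eta> \<sigma> x) has_derivative (\<lambda>v. D_tot \<eta> \<tau> v x)) (at \<tau>)"
      using eta_diff[folded defs] by eventually_elim (blast intro: D_tot_has_derivative)
    show "D_tot \<eta> \<tau> v \<in> L20_space M \<eta> \<tau>\<^sub>0" if "\<tau> \<in> N" for \<tau> v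
    proof -
      have s: "sqint base.Q (D_theta \<eta> \<tau> (fst v))" "sqint base.Q (D_h \<eta> \<tau> (snd v))"
        "(\<integral>x. D_theta \<eta> \<tau> (fst v) x \<partial>base.Q) = 0" "(\<integral>x. D_h \<eta> \<tau> (snd v) x \<partial>base.Q) = 0"
        using A4_D\<theta>[folded defs, OF that] A4_Dh[folded defs, OF that]
        by (auto simp: base.L20_bounded_linear_iff)
      have "sqint base.Q (\<lambda>x. D_theta \<eta> \<tau> (fst v) x + D_h \<eta> \<tau> (snd v) x)" by (rule sqint_add[OF s(1,2)])
      moreover have "(\<integral>x. D_theta \<eta> \<tau> (fst v) x + D_h \<eta> \<tau> (snd v) x \<partial>base.Q) = 0"
        using s base.Q.sqint_integrable[OF s(1)] base.Q.sqint_integrable[OF s(2)] by simp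
      ultimately show ?thesis by (simp add: base.L20_iff D_tot_def[abs_def])
    qed
    show "\<exists>D1. \<forall>\<tau>\<in>N. L20_bounded_linear M \<eta> \<tau>\<^sub>0 (D1 \<tau>) \<and>
        (\<forall>\<epsilon>>0. \<forall>\<^sub>F k in nhds 0. L2_norm M \<eta> \<tau>\<^sub>0 (\<lambda>x. \<eta> (\<tau> + k) x - \<eta> \<tau> x - D1 \<tau> k x) \<le> \<epsilon> * norm k)"
      using A3_C3[folded defs] unfolding L20_C3_on_def
      by (elim exE) (intro exI ballI, drule (1) bspec, elim conjE, intro conjI)
    show "C\<^sub>1 * a > 0" "C\<^sub>2 * b > 0" "1 + M\<^sub>2 > 0" "C\<^sub>3 > 0" "C\<^sub>4 > 0"
      using A4_const A6_const ab M12 by auto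
    show "C\<^sub>1 * a * sqn V v \<le> Var M \<eta> \<tau>\<^sub>0 (D_tot \<eta> \<tau> v)" if "\<tau> \<in> N" for \<tau> v
    proof -
      have "C\<^sub>1 * (a * sqn V v) \<le> C\<^sub>1 * Var M \<eta> \<tau>\<^sub>0 (\<lambda>x. L\<^sub>\<theta> (fst v) x + L\<^sub>h (snd v) x)"
        unfolding sqn_def using ab(3) A4_const by (intro mult_left_mono) auto
      also have "\<dots> \<le> Var M \<eta> \<tau>\<^sub>0 (D_tot \<eta> \<tau> v)"
        using A4[folded defs, OF that, of "fst v" "snd v"] by (simp add: D_tot_def[abs_def])
      finally show ?thesis by (simp add: mult.assoc)
    qed
    show "Var M \<eta> \<tau>\<^sub>0 (D_tot \<eta> \<tau> v) \<le> C\<^sub>2 * b * sqn V v" if "\<tau> \<in> N" for \<tau> v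
    proof -
      have "Var M \<eta> \<tau>\<^sub>0 (D_tot \<eta> \<tau> v) \<le> C\<^sub>2 * Var M \<eta> \<tau>\<^sub>0 (\<lambda>x. L\<^sub>\<theta> (fst v) x + L\<^sub>h (snd v) x)"
        using A4[folded defs, OF that, of "fst v" "snd v"] by (simp add: D_tot_def[abs_def])
      also have "\<dots> \<le> C\<^sub>2 * (b * sqn V v)"
        unfolding sqn_def using ab(4) A4_const by (intro mult_left_mono) auto
      finally show ?thesis by (simp add: mult.assoc)
    qed
    show "C\<^sub>3 * Var M \<eta> \<tau>\<^sub>0 f \<le> Var M \<eta> \<tau> f \<and> Var M \<eta> \<tau> f \<le> C\<^sub>4 * Var M \<eta> \<tau>\<^sub>0 f"
      if "\<tau> \<in> N" "f \<in> L20_space M \<eta> \<tau>\<^sub>0" for \<tau> f using A6[folded defs, OF that] .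
    \<comment> \<open>The image of the first eigenfunction is centred and has variance 1.\<close>
    show "\<exists>f\<in>L20_space M \<eta> \<tau>\<^sub>0. Var M \<eta> \<tau>\<^sub>0 f > 0"
      using Lhs[of "\<phi> 1"] by (intro bexI[of _ "L\<^sub>h (\<phi> 1)"]) (auto simp: Var_V diag.V_\<phi> base.L20_iff)
    show "sqn V v \<ge> 0" for v :: "(real ^ 'p) \<times> 'h" by (simp add: sqn_def diag.V.nonneg)
    show "sqn V (c *\<^sub>R v) = c\<^sup>2 * sqn V v" for c and v :: "(real ^ 'p) \<times> 'h"
      by (simp add: sqn_def diag.V.scale diag.V.scale_right power_mult_distrib power2_eq_square algebra_simps)
    show "sqn V v \<le> (1 + M\<^sub>2) * (norm v)\<^sup>2" for v :: "(real ^ 'p) \<times> 'h"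
    proof -
      have eq: "(norm v)\<^sup>2 = (norm (fst v))\<^sup>2 + (norm (snd v))\<^sup>2" by (simp add: norm_prod_def)
      have "0 \<le> M\<^sub>2 * (norm (fst v))\<^sup>2" "0 \<le> (norm (snd v))\<^sup>2" using M12 by auto
      then show ?thesis using diag.V_le[of "snd v"]
        unfolding sqn_def eq distrib_left distrib_right mult_1_left by linarith
    qed
    \<comment> \<open>Completeness of the eigenfunctions makes the Hilbert space separable.\<close>
    show "\<exists>S :: ((real ^ 'p) \<times> 'h) set. countable S \<and> closure S = UNIV"
    proof -
      obtain S\<^sub>1 :: "(real ^ 'p) set" where S\<^sub>1: "countable S\<^sub>1" "closure S\<^sub>1 = UNIV"
        using countable_dense_in_closure_span[of "Basis :: (real ^ 'p) set"] by (auto simp: countable_finite)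
      obtain S\<^sub>2 :: "'h set" where S\<^sub>2: "countable S\<^sub>2" "closure S\<^sub>2 = UNIV"
        using countable_dense_in_closure_span[of "\<phi> ` {1..}"] A7_complete by auto
      show ?thesis
        by (intro exI[of _ "S\<^sub>1 \<times> S\<^sub>2"]) (use S\<^sub>1 S\<^sub>2 in \<open>auto simp: closure_Times\<close>)
    qed
  qed

  \<comment> \<open>The sample in displacement coordinates\<close>
  have Q_eq: "base.Q = density M (\<lambda>x. ennreal (dens M \<eta> \<tau>\<^sub>0 x))" by (rule base.Q_def)
  have iid: "iid_sample P base.Q X"
  proof
    show "P.indep_vars (\<lambda>_. base.Q) X UNIV"
      using P.indep_vars_compose2[OF indep, of "\<lambda>_ x. x" "\<lambda>_. base.Q"]
      by (simp add: measurable_cong_sets[OF refl base.sets_Q])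
    show "distr P base.Q (X i) = base.Q" for i
      using dQ[of i] distr_cong[OF refl base.sets_Q, of P "X i" "X i"] by (simp add: Q_eq)
  qed
  define G where "G = {u. \<tau>\<^sub>0 + u \<in> N}"
  \<comment> \<open>One constant for all upper bounds; it dominates \<open>dm.c\<^sub>L\<close>
    because \<open>dm.bnd\<close> is nonnegative.\<close>
  define C where "C = exp dm.bnd * dm.c\<^sub>L"
  have C: "C > 0" "dm.c\<^sub>L \<le> C" using dm.c\<^sub>L dm.bnd_nonneg by (auto simp: C_def)
  interpret lm: local_model P base.Q X V J \<phi> \<rho> M\<^sub>1 M\<^sub>2 G "\<lambda>u. base.llr (\<tau>\<^sub>0 + u)" "\<lambda>u. dm.score (\<tau>\<^sub>0 + u)"
    dm.c\<^sub>K C dm.bnd r \<beta>\<^sub>1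
  proof (intro local_model.intro local_model_axioms.intro iid diag.diagonalized_axioms)
    show "dm.c\<^sub>K > 0" "C > 0" "r > 1" "\<beta>\<^sub>1 > 0" using dm.c\<^sub>K C A8_r A8_beta by auto
    show "\<beta>\<^sub>1 * real \<nu> powr r \<le> \<rho> \<nu>" if "\<nu> \<ge> 1" for \<nu>
      using A8[OF that] by (auto intro!: mult_right_mono)
    fix u v assume "u \<in> G"
    then have u: "\<tau>\<^sub>0 + u \<in> N" by (simp add: G_def)
    have n2: "sqn V w \<ge> 0" for w :: "(real ^ 'p) \<times> 'h" by (rule dm.n2_nonneg)
    show "sqint base.Q (base.llr (\<tau>\<^sub>0 + u))" by (rule base.llr_sqint)
    show "sqint base.Q (dm.score (\<tau>\<^sub>0 + u) v)" by (rule dm.score_sqint[OF u])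
    show "AE x in base.Q. bounded_linear (\<lambda>v. dm.score (\<tau>\<^sub>0 + u) v x)" by (rule dm.score_linear[OF u])
    show "AE x in base.Q. \<forall>u'\<in>G. base.llr (\<tau>\<^sub>0 + u') x \<le> dm.bnd \<and>
        base.llr (\<tau>\<^sub>0 + u') x \<le> base.llr (\<tau>\<^sub>0 + u) x + dm.score (\<tau>\<^sub>0 + u) (u' - u) x"
      using dm.llr_tangent[OF u]
    proof eventually_elim
      case (elim x)
      show ?case
      proof
        fix u' assume "u' \<in> G"
        then show "base.llr (\<tau>\<^sub>0 + u') x \<le> dm.bnd \<and>
          base.llr (\<tau>\<^sub>0 + u') x \<le> base.llr (\<tau>\<^sub>0 + u) x + dm.score (\<tau>\<^sub>0 + u) (u' - u) x"
          using bspec[OF elim, of "\<tau>\<^sub>0 + u'"] by (simp add: G_def)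
      qed
    qed
    show "(\<integral>x. base.llr (\<tau>\<^sub>0 + u) x \<partial>base.Q) \<le> - dm.c\<^sub>K * sqn V u" by (rule dm.llr_mean_le[OF u])
    show "(\<integral>x. (base.llr (\<tau>\<^sub>0 + u) x)\<^sup>2 \<partial>base.Q) \<le> C * sqn V u"
      using dm.llr_square_le[OF u] mult_right_mono[OF C(2) n2] by (rule order_trans)
    show "(\<integral>x. dm.score (\<tau>\<^sub>0 + u) v x \<partial>base.Q) \<le> C * (sqrt (sqn V u) * sqrt (sqn V v))"
      unfolding C_def by (rule dm.score_mean_le[OF u])
    show "(\<integral>x. (dm.score (\<tau>\<^sub>0 + u) v x)\<^sup>2 \<partial>base.Q) \<le> C * sqn V v"
      using dm.score_square_le[OF u] mult_right_mono[OF C(2) n2] by (rule order_trans)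
  qed

  \<comment> \<open>The basic inequality along the segment to the estimator\<close>
  define est where "est n \<omega> = (\<theta>hat n \<omega> - \<theta>\<^sub>0, hhat n \<omega> - h\<^sub>0)" for n \<omega>
  have est: "\<tau>\<^sub>0 + est n \<omega> = (\<theta>hat n \<omega>, hhat n \<omega>)" for n \<omega> by (simp add: est_def \<tau>\<^sub>0_def)
  have "whp P (\<lambda>n \<omega>. est n \<omega> \<in> G \<and> (\<forall>s\<in>{0..1}.
      lam n / 2 * (J (h\<^sub>0 + s *\<^sub>R snd (est n \<omega>)) (h\<^sub>0 + s *\<^sub>R snd (est n \<omega>)) - J h\<^sub>0 h\<^sub>0)
      \<le> (\<Sum>k<n. base.llr (\<tau>\<^sub>0 + s *\<^sub>R est n \<omega>) (X k \<omega>)) / real n))"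
  proof (rule whp_AE_mono[OF prob estimator[folded defs]])
    show "AE \<omega> in P. \<forall>n\<ge>1.
      unique_local_min (pen_crit M \<eta> J (lam n) n (\<lambda>i. X i \<omega>)) N (\<theta>hat n \<omega>, hhat n \<omega>) \<longrightarrow>
      est n \<omega> \<in> G \<and> (\<forall>s\<in>{0..1}.
      lam n / 2 * (J (h\<^sub>0 + s *\<^sub>R snd (est n \<omega>)) (h\<^sub>0 + s *\<^sub>R snd (est n \<omega>)) - J h\<^sub>0 h\<^sub>0)
      \<le> (\<Sum>k<n. base.llr (\<tau>\<^sub>0 + s *\<^sub>R est n \<omega>) (X k \<omega>)) / real n)"
      using crit_convex
    proof eventually_elim
      case (elim \<omega>)
      show ?case
      proof (intro allI impI)
        fix n :: nat assume n: "n \<ge> 1"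
          and min: "unique_local_min (pen_crit M \<eta> J (lam n) n (\<lambda>i. X i \<omega>)) N (\<theta>hat n \<omega>, hhat n \<omega>)"
        define F where "F = pen_crit M \<eta> J (lam n) n (\<lambda>i. X i \<omega>)"
        have convF: "convex_on UNIV F"
        proof -
          have "convex_on UNIV (\<lambda>\<tau> :: (real ^ 'p) \<times> 'h. J (snd \<tau>) (snd \<tau>))"
          proof (rule convex_onI)
            fix t :: real and \<sigma> \<tau> :: "(real ^ 'p) \<times> 'h" assume t: "0 < t" "t < 1"
            have "0 \<le> t * (1 - t) * J (snd \<sigma> - snd \<tau>) (snd \<sigma> - snd \<tau>)"
              using t diag.J.nonneg by simp
            then show "J (snd ((1 - t) *\<^sub>R \<sigma> + t *\<^sub>R \<tau>)) (snd ((1 - t) *\<^sub>R \<sigma> + t *\<^sub>R \<tau>))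
                \<le> (1 - t) * J (snd \<sigma>) (snd \<sigma>) + t * J (snd \<tau>) (snd \<tau>)"
              using diag.J.sym[of "snd \<tau>" "snd \<sigma>"]
              by (simp add: diag.J.add diag.J.add_right diag.J.scale diag.J.scale_right
                  diag.J.diff diag.J.diff_right algebra_simps)
          qed simp
          then have "convex_on UNIV (\<lambda>\<tau> :: (real ^ 'p) \<times> 'h. lam n / 2 * J (snd \<tau>) (snd \<tau>))"
            using lam_pos[of n] by (intro convex_on_cmul) auto
          then show ?thesis unfolding F_def pen_crit_def
            using elim n by (intro convex_on_add) auto
        qed
        have inN: "(\<theta>hat n \<omega>, hhat n \<omega>) \<in> N" and "local_min F (\<theta>hat n \<omega>, hhat n \<omega>)"
          using min unfolding unique_local_min_def F_def by blast+
        then obtain e where e: "e > 0" "\<And>\<sigma>. dist \<sigma> (\<theta>hat n \<omega>, hhat n \<omega>) < e \<Longrightarrow> F (\<theta>hat n \<omega>, hhat n \<omega>) \<le> F \<sigma>"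
          unfolding local_min_def eventually_nhds_metric by blast
        \<comment> \<open>Minimality is assumed only locally; convexity of the penalized criterion
          makes it global, hence comparable with the true parameter.\<close>
        have glob: "F (\<theta>hat n \<omega>, hhat n \<omega>) \<le> F \<sigma>" for \<sigma>
          using convex_local_global_minimum[OF e(1) convF, of "(\<theta>hat n \<omega>, hhat n \<omega>)"] e(2)
          by (cases \<sigma>) (auto simp: dist_commute)
        show "est n \<omega> \<in> G \<and> (\<forall>s\<in>{0..1}.
          lam n / 2 * (J (h\<^sub>0 + s *\<^sub>R snd (est n \<omega>)) (h\<^sub>0 + s *\<^sub>R snd (est n \<omega>)) - J h\<^sub>0 h\<^sub>0)
          \<le> (\<Sum>k<n. base.llr (\<tau>\<^sub>0 + s *\<^sub>R est n \<omega>) (X k \<omega>)) / real n)"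
        proof (intro conjI ballI)
          show "est n \<omega> \<in> G" using inN by (simp add: G_def est)
          fix s :: real assume s: "s \<in> {0..1}"
          define \<sigma> where "\<sigma> = \<tau>\<^sub>0 + s *\<^sub>R est n \<omega>"
          have "\<sigma> = (1 - s) *\<^sub>R \<tau>\<^sub>0 + s *\<^sub>R (\<theta>hat n \<omega>, hhat n \<omega>)"
            unfolding est[symmetric] \<sigma>_def by (simp add: algebra_simps)
          \<comment> \<open>Convexity passes the comparison with \<open>\<tau>\<^sub>0\<close> from
            the estimator to every point of the segment.\<close>
          then have "F \<sigma> \<le> (1 - s) * F \<tau>\<^sub>0 + s * F (\<theta>hat n \<omega>, hhat n \<omega>)"
            using convex_onD[OF convF, of s \<tau>\<^sub>0 "(\<theta>hat n \<omega>, hhat n \<omega>)"] s by simp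
          also have "\<dots> \<le> (1 - s) * F \<tau>\<^sub>0 + s * F \<tau>\<^sub>0"
            using glob[of \<tau>\<^sub>0] s by (intro add_left_mono mult_left_mono) auto
          finally have le: "F \<sigma> \<le> F \<tau>\<^sub>0" by (simp add: algebra_simps)
          have "(\<Sum>k<n. base.llr \<sigma> (X k \<omega>)) = (\<Sum>k<n. \<eta> \<sigma> (X k \<omega>)) - real n * base.logZ \<sigma>
              - ((\<Sum>k<n. \<eta> \<tau>\<^sub>0 (X k \<omega>)) - real n * base.logZ \<tau>\<^sub>0)"
            by (simp add: base.llr_def sum_subtractf)
          then have "crit M \<eta> n (\<lambda>i. X i \<omega>) \<sigma> - crit M \<eta> n (\<lambda>i. X i \<omega>) \<tau>\<^sub>0
             = - (\<Sum>k<n. base.llr \<sigma> (X k \<omega>)) / real n"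
            using n by (simp add: crit_eq diff_divide_distrib)
          moreover have "snd \<sigma> = h\<^sub>0 + s *\<^sub>R snd (est n \<omega>)" "snd \<tau>\<^sub>0 = h\<^sub>0" by (simp_all add: \<sigma>_def \<tau>\<^sub>0_def)
          ultimately show "lam n / 2 * (J (h\<^sub>0 + s *\<^sub>R snd (est n \<omega>)) (h\<^sub>0 + s *\<^sub>R snd (est n \<omega>)) - J h\<^sub>0 h\<^sub>0)
            \<le> (\<Sum>k<n. base.llr (\<tau>\<^sub>0 + s *\<^sub>R est n \<omega>) (X k \<omega>)) / real n"
            using le unfolding F_def pen_crit_def \<sigma>_def[symmetric] by (simp add: right_diff_distrib)
        qed
      qed
    qed
  qed
  then have "big_Op P (\<lambda>n \<omega>. norm (fst (est n \<omega>)))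
      (\<lambda>n. real n powr (- 1 / 2) * lam n powr (- 1 / (2 * r)) + lam n powr (1 / 2))"
  proof (rule lm.penalized_rate[OF lam_pos lam_0, rotated])
    show "s *\<^sub>R u \<in> G" if "u \<in> G" "0 \<le> s" "s \<le> 1" for u s
      using dm.segment_in_N[of \<tau>\<^sub>0 "\<tau>\<^sub>0 + u" s] dm.N that by (simp add: G_def)
  qed
  then have rate: "big_Op P (\<lambda>n \<omega>. norm (\<theta>hat n \<omega> - \<theta>\<^sub>0))
      (\<lambda>n. real n powr (- 1 / 2) * lam n powr (- 1 / (2 * r)) + lam n powr (1 / 2))"
    by (simp add: est_def)

  \<comment> \<open>Equivalence of the two norms of the parametric part\<close>
  have norm_equiv: "sqrt a * norm \<zeta> \<le> norm_Rp M \<eta> \<tau>\<^sub>0 L\<^sub>\<theta> \<zeta>" "norm_Rp M \<eta> \<tau>\<^sub>0 L\<^sub>\<theta> \<zeta> \<le> sqrt b * norm \<zeta>" for \<zeta>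
  proof -
    \<comment> \<open>A representative of \<open>L\<^sub>h 0\<close> need not be the zero function;
      homogeneity with factor 0 shows that it vanishes almost everywhere.\<close>
    have "AE x in base.Q. L\<^sub>h (0 *\<^sub>R 0) x = 0 * L\<^sub>h 0 x" using Lh unfolding base.L20_bounded_linear_iff by blast
    then have "AE x in base.Q. L\<^sub>\<theta> \<zeta> x + L\<^sub>h 0 x = 1 * L\<^sub>\<theta> \<zeta> x" by simp
    then have eq: "Var M \<eta> \<tau>\<^sub>0 (\<lambda>x. L\<^sub>\<theta> \<zeta> x + L\<^sub>h 0 x) = Var M \<eta> \<tau>\<^sub>0 (L\<^sub>\<theta> \<zeta>)"
      using base.Var_cmult_AE[OF L\<theta>s, of "\<lambda>x. L\<^sub>\<theta> \<zeta> x + L\<^sub>h 0 x" 1] by simp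
    have "a * (norm \<zeta>)\<^sup>2 \<le> Var M \<eta> \<tau>\<^sub>0 (L\<^sub>\<theta> \<zeta>)" "Var M \<eta> \<tau>\<^sub>0 (L\<^sub>\<theta> \<zeta>) \<le> b * (norm \<zeta>)\<^sup>2"
      using ab(3,4)[of \<zeta> 0] by (simp_all add: eq diag.V.zero)
    then have "sqrt (a * (norm \<zeta>)\<^sup>2) \<le> norm_Rp M \<eta> \<tau>\<^sub>0 L\<^sub>\<theta> \<zeta>" "norm_Rp M \<eta> \<tau>\<^sub>0 L\<^sub>\<theta> \<zeta> \<le> sqrt (b * (norm \<zeta>)\<^sup>2)"
      unfolding norm_Rp_def by (simp_all only: real_sqrt_le_iff)
    then show "sqrt a * norm \<zeta> \<le> norm_Rp M \<eta> \<tau>\<^sub>0 L\<^sub>\<theta> \<zeta>" "norm_Rp M \<eta> \<tau>\<^sub>0 L\<^sub>\<theta> \<zeta> \<le> sqrt b * norm \<zeta>"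
      by (simp_all add: real_sqrt_mult)
  qed
  have "big_Op P (\<lambda>n \<omega>. norm_Rp M \<eta> \<tau>\<^sub>0 L\<^sub>\<theta> (\<theta>hat n \<omega> - \<theta>\<^sub>0))
      (\<lambda>n. real n powr (- 1 / 2) * lam n powr (- 1 / (2 * r)) + lam n powr (1 / 2))"
    unfolding big_Op_def
  proof (intro allI impI)
    fix \<epsilon> :: real assume "\<epsilon> > 0"
    then obtain K where "\<forall>\<^sub>F n in sequentially. \<exists>A\<in>sets P. measure P A \<ge> 1 - \<epsilon> \<and> (\<forall>\<omega>\<in>A.
      \<bar>norm (\<theta>hat n \<omega> - \<theta>\<^sub>0)\<bar> \<le> K * (real n powr (- 1 / 2) * lam n powr (- 1 / (2 * r)) + lam n powr (1 / 2)))"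
      using rate unfolding big_Op_def by blast
    then show "\<exists>K. \<forall>\<^sub>F n in sequentially. \<exists>A\<in>sets P. measure P A \<ge> 1 - \<epsilon> \<and> (\<forall>\<omega>\<in>A.
      \<bar>norm_Rp M \<eta> \<tau>\<^sub>0 L\<^sub>\<theta> (\<theta>hat n \<omega> - \<theta>\<^sub>0)\<bar>
        \<le> K * (real n powr (- 1 / 2) * lam n powr (- 1 / (2 * r)) + lam n powr (1 / 2)))"
    proof (intro exI[of _ "sqrt b * K"], elim eventually_mono)
      fix n
      define q where "q = real n powr (- 1 / 2) * lam n powr (- 1 / (2 * r)) + lam n powr (1 / 2)"
      have "\<bar>norm_Rp M \<eta> \<tau>\<^sub>0 L\<^sub>\<theta> (\<theta>hat n \<omega> - \<theta>\<^sub>0)\<bar> \<le> sqrt b * K * q"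
        if "\<bar>norm (\<theta>hat n \<omega> - \<theta>\<^sub>0)\<bar> \<le> K * q" for \<omega>
      proof -
        have "0 \<le> sqrt a * norm (\<theta>hat n \<omega> - \<theta>\<^sub>0)" using ab by simp
        then have "\<bar>norm_Rp M \<eta> \<tau>\<^sub>0 L\<^sub>\<theta> (\<theta>hat n \<omega> - \<theta>\<^sub>0)\<bar> \<le> sqrt b * norm (\<theta>hat n \<omega> - \<theta>\<^sub>0)"
          using norm_equiv[of "\<theta>hat n \<omega> - \<theta>\<^sub>0"] by linarith
        also have "\<dots> \<le> sqrt b * (K * q)" using that ab by (intro mult_left_mono) auto
        finally show ?thesis by (simp add: mult.assoc)
      qed
      then show "\<exists>A\<in>sets P. measure P A \<ge> 1 - \<epsilon> \<and> (\<forall>\<omega>\<in>A. \<bar>norm (\<theta>hat n \<omega> - \<theta>\<^sub>0)\<bar>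
          \<le> K * (real n powr (- 1 / 2) * lam n powr (- 1 / (2 * r)) + lam n powr (1 / 2))) \<Longrightarrow>
        \<exists>A\<in>sets P. measure P A \<ge> 1 - \<epsilon> \<and> (\<forall>\<omega>\<in>A. \<bar>norm_Rp M \<eta> \<tau>\<^sub>0 L\<^sub>\<theta> (\<theta>hat n \<omega> - \<theta>\<^sub>0)\<bar>
          \<le> sqrt b * K * (real n powr (- 1 / 2) * lam n powr (- 1 / (2 * r)) + lam n powr (1 / 2)))"
        unfolding q_def by blast
    qed
  qed
  moreover have "\<exists>c\<^sub>1>0. \<exists>c\<^sub>2>0. \<forall>n \<omega>.
      c\<^sub>1 * norm (\<theta>hat n \<omega> - \<theta>\<^sub>0) \<le> norm_Rp M \<eta> \<tau>\<^sub>0 L\<^sub>\<theta> (\<theta>hat n \<omega> - \<theta>\<^sub>0) \<and>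
      norm_Rp M \<eta> \<tau>\<^sub>0 L\<^sub>\<theta> (\<theta>hat n \<omega> - \<theta>\<^sub>0) \<le> c\<^sub>2 * norm (\<theta>hat n \<omega> - \<theta>\<^sub>0)"
  proof -
    have "sqrt a > 0" "sqrt b > 0" using ab by auto
    then show ?thesis using norm_equiv by blast
  qed
  ultimately show ?thesis using rate unfolding \<tau>\<^sub>0_def by blast
qed

end
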